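(* Let $1 < p < q \le 2$ or $2 \le p < q < \infty$, and let $r > \max(\frac1p,\frac12)$. Then, with constants independent of $n\ge2$, $$r_n(U^r_p,L_q) \asymp \Big(\frac{(\log n)^{d-1}}{n}\Big)^{r-1/p+1/q}.$$
   Context: Fix $d\in\mathbb N$. $\mathbb T=[0,1]$ with end points identified; functions on $\mathbb T^d$ are functions on $\mathbb R^d$ that are $1$-periodic in each variable. $L_p=L_p(\mathbb T^d)$ with norm $\|\cdot\|_p$. $A_n\asymp B_n$ means $C B_n\le A_n\le C'B_n$ with constants $C,C'>0$ independent of $n$. Sobolev space: for $r>0$ let $F_r(x)=1+2\sum_{k=1}^\infty k^{-r}\cos(2\pi kx-r\pi/2)$ and $F_r(\mathbf x)=\prod_{j=1}^d F_r(x_j)$. For $1\le p\le\infty$, $W^r_p$ is the set of $f\in L_p$ of the form $f=F_r*\varphi=\int_{\mathbb T^d}F_r(\mathbf x-\mathbf y)\varphi(\mathbf y)\,d\mathbf y$ with $\|\varphi\|_p<\infty$, and $\|f\|_{W^r_p}:=\|\varphi\|_p$. $U^r_p$ is the unit ball of $W^r_p$. When $r>1/p$, elements of $W^r_p$ are identified with continuous functions. Sampling width: for a set $\mathbf X_n=\{\mathbf x^j\}_{j=1}^n$ of $n$ points in $\mathbb T^d$ and a family $\Phi_n=\{\varphi_j\}_{j=1}^n$ of $n$ functions put $L_n(\mathbf X_n,\Phi_n,f)=\sum_{j=1}^nf(\mathbf x^j)\varphi_j$. For a class $F$ of functions, $r_n(F,L_q):=\inf_{\mathbf X_n,\Phi_n}\sup_{f\in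 F}\|f-L_n(\mathbf X_n,\Phi_n,f)\|_q$. *)

theory Defs
  imports "HOL-Analysis.Analysis"
begin

text \<open>
  A function on the torus is a function on \<open>real ^ 'd\<close> that is 1-periodic in each variable;
  the measure of the torus is Lebesgue measure on the unit cube. Functions are complex valued.
\<close>

definition periodic :: "(real ^ 'd \<Rightarrow> complex) \<Rightarrow> bool" where
  "periodic f \<longleftrightarrow> (\<forall>x i. f (x + axis i 1) = f x)"

text \<open>
  The norm takes the value \<open>\<infinity>\<close> on measurable functions outside \<open>L\<^sub>p\<close>. It is only meaningful for
  measurable functions, since \<open>nn_integral\<close> of a non-measurable function is a lower integral.
\<close>

definition Lp_norm :: "real \<Rightarrow> (real ^ 'd \<Rightarrow> complex) \<Rightarrow> ennreal" where
  "Lp_norm p f =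
     (let I = (\<integral>\<^sup>+x\<in>cbox 0 1. ennreal (norm (f x) powr p) \<partial>lborel)
      in if I = \<infinity> then \<infinity> else ennreal (enn2real I powr (1 / p)))"

text \<open>
  Elements of \<open>L\<^sub>p\<close> are represented by functions, not by classes modulo null sets. Every
  class has a Borel representative, so Borel measurability loses nothing.
\<close>

definition torus_measurable :: "(real ^ 'd \<Rightarrow> complex) set" where
  "torus_measurable = {f. f \<in> borel_measurable borel \<and> periodic f}"

definition Lp_space :: "real \<Rightarrow> (real ^ 'd \<Rightarrow> complex) set" where
  "Lp_space p = {f \<in> torus_measurable. Lp_norm p f < \<infinity>}"

text \<open>
  For \<open>r > 0\<close> the series converges (conditionally if \<open>r \<le> 1\<close>) at every non-integer \<open>x\<close>. It can
  diverge at integers, where the value is irrelevant: the kernel is only used under an integral.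
\<close>

definition kernel1 :: "real \<Rightarrow> real \<Rightarrow> real" where
  "kernel1 r x =
     1 + 2 * (\<Sum>k. real (Suc k) powr (- r) * cos (2 * pi * real (Suc k) * x - r * pi / 2))"

definition kernel :: "real \<Rightarrow> real ^ 'd \<Rightarrow> real" where
  "kernel r x = (\<Prod>j\<in>UNIV. kernel1 r (x $ j))"

definition torus_conv ::
    "(real ^ 'd \<Rightarrow> real) \<Rightarrow> (real ^ 'd \<Rightarrow> complex) \<Rightarrow> real ^ 'd \<Rightarrow> complex" where
  "torus_conv F \<phi> x = (LINT y:cbox 0 1|lborel. complex_of_real (F (x - y)) * \<phi> y)"

definition sobolev_reps ::
    "real \<Rightarrow> real \<Rightarrow> (real ^ 'd \<Rightarrow> complex) \<Rightarrow> (real ^ 'd \<Rightarrow> complex) set" where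
  "sobolev_reps r p f = {\<phi> \<in> Lp_space p. AE x in lborel. f x = torus_conv (kernel r) \<phi> x}"

definition sobolev_space :: "real \<Rightarrow> real \<Rightarrow> (real ^ 'd \<Rightarrow> complex) set" where
  "sobolev_space r p = {f \<in> Lp_space p. sobolev_reps r p f \<noteq> {}}"

text \<open>
  No Fourier coefficient of \<open>kernel r\<close> vanishes, so the function \<open>\<phi>\<close> representing \<open>f\<close> is unique up to
  null sets, and the infimum below is over a single value.
\<close>

definition sobolev_norm :: "real \<Rightarrow> real \<Rightarrow> (real ^ 'd \<Rightarrow> complex) \<Rightarrow> ennreal" where
  "sobolev_norm r p f = (INF \<phi> \<in> sobolev_reps r p f. Lp_norm p \<phi>)"

text \<open>
  Point values are needed for sampling. For \<open>r > 1 / p\<close> every class modulo null sets in the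
  Sobolev space contains exactly one continuous function, which is the representative taken here.
\<close>

definition sobolev_ball :: "real \<Rightarrow> real \<Rightarrow> (real ^ 'd \<Rightarrow> complex) set" where
  "sobolev_ball r p =
     {f \<in> sobolev_space r p. continuous_on UNIV f \<and> sobolev_norm r p f \<le> 1}"

text \<open>
  Points of the torus are represented by their unique representatives in the half-open cube,
  so that injectivity means distinctness on the torus.
\<close>

definition sample_points :: "nat \<Rightarrow> (nat \<Rightarrow> real ^ 'd) set" where
  "sample_points n = {X. inj_on X {1..n} \<and> (\<forall>j\<in>{1..n}. \<forall>i. 0 \<le> X j $ i \<and> X j $ i < 1)}"

definition sampling_op ::
    "nat \<Rightarrow> (nat \<Rightarrow> real ^ 'd) \<Rightarrow> (nat \<Rightarrow> real ^ 'd \<Rightarrow> complex) \<Rightarrow>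
     (real ^ 'd \<Rightarrow> complex) \<Rightarrow> real ^ 'd \<Rightarrow> complex" where
  "sampling_op n X \<Phi> f t = (\<Sum>j=1..n. f (X j) * \<Phi> j t)"

definition sampling_width :: "nat \<Rightarrow> (real ^ 'd \<Rightarrow> complex) set \<Rightarrow> real \<Rightarrow> ennreal" where
  "sampling_width n F q =
     (INF (X, \<Phi>) \<in> sample_points n \<times> {\<Phi>. \<forall>j\<in>{1..n}. \<Phi> j \<in> torus_measurable}.
        SUP f \<in> F. Lp_norm q (\<lambda>t. f t - sampling_op n X \<Phi> f t))"

end

theory Submission
  imports Defs
begin

text \<open>
  Put \<open>\<beta> = r - 1 / p + 1 / q\<close>. At level \<open>m\<close> a sparse grid and a dyadic layer of frequencies have about
  \<open>m ^ (d - 1) * 2 ^ m\<close> elements, and both halves of the theorem say that the best error at this level is of the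
  order \<open>2 powr (- \<beta> * m)\<close>. If \<open>n\<close> is the number of elements, then \<open>2 powr (- m)\<close> is of the order
  \<open>ln n ^ (d - 1) / n\<close> (\<open>sparse_grid_budget\<close>, \<open>layer_budget\<close>), which gives the asserted rate.

  The analytic tool is an inequality of Hardy-Littlewood-Sobolev type. A kernel
  \<open>\<Sum>s. 2 powr (- (\<sigma> + \<tau> - 1) * s) * k s\<close>, whose parts \<open>k s\<close> have bounded integrals in each variable and are
  bounded by \<open>2 ^ s\<close>, behaves like a power of the distance and maps \<open>L\<^sub>p\<close> to \<open>L\<^sub>q\<close> for \<open>\<sigma> = 1 / p\<close> and
  \<open>\<tau> = 1 - 1 / q\<close> (\<open>HLS_bound_dyadic_sum\<close>). Written as a bound for a bilinear form with a nonnegative kernel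
  it passes to tensor products of kernels by integrating out one pair of variables after the other
  (\<open>HLS_bound_PiM\<close>). Estimating the roughly \<open>m ^ (d - 1)\<close> tensor blocks of one level separately would
  lose a power of \<open>m\<close>; here all the blocks are summed inside the product kernel, and nothing is lost.

  Upper bound. Interpolation by de la Vallee Poussin kernels at \<open>2 ^ (s + 2)\<close> equidistant points of the circle splits
  into details of the levels up to \<open>s\<close>, and Smolyak's operator keeps the tensor products of details
  whose levels add up to less than \<open>m\<close>. Applied to the kernel of the Sobolev class, the details
  that are left out form a kernel dominated by \<open>2 powr (- \<beta> * m)\<close> times a tensor product of kernels as
  above. The condition \<open>r > 1 / p\<close> controls the aliasing of high frequencies. So the error on
  the ball is \<open>O(2 powr (- \<beta> * m))\<close> in \<open>L\<^sub>q\<close> (\<open>smolyak_error\<close>). Since point values are used, the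
  functions of the ball are first shown to be uniform limits of trigonometric polynomials
  (\<open>sobolev_ball_representation\<close>).

  Lower bound. Given \<open>n\<close> nodes, let a layer contain at least \<open>2 * n\<close> frequencies, and consider the
  matrix of Fourier coefficients of the errors made at the exponentials of the layer. Polynomials on
  the layer that vanish at all nodes are their own errors, so on a space of codimension at most \<open>n\<close>
  the matrix acts as the identity, and its squared Frobenius norm is at least half the number of
  frequencies (\<open>defect_matrix_Frobenius\<close>). One dyadic box therefore carries the mass \<open>2 ^ m / 2\<close>. A
  bump with the frequencies of this box, centred at a point found by averaging, is paired through the
  matrix with a polynomial on the layer. Holder's inequality turns the size of the matrix into a lower bound
  for the error (\<open>recovery_error_ge\<close>). The norm of the polynomial on the layer is taken from its
  \<open>L\<^sub>2\<close> norm by a Nikolskii inequality without logarithmic loss (\<open>Nikolskii_layer\<close>), again a consequence of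
  the kernel inequality. That inequality needs an exponent at least 2 on the side of that polynomial. This is
  where \<open>p\<close> and \<open>q\<close> have to lie on the same side of 2.
\<close>

section \<open>A kernel inequality of Hardy-Littlewood-Sobolev type\<close>

text \<open>
  For \<open>a > 0\<close> this is the continuous extension of \<open>x powr a\<close> to \<open>[0, \<infinity>]\<close>. With it the integral
  inequalities below hold for all measurable functions, integrable or not.
\<close>

definition epow :: "ennreal \<Rightarrow> real \<Rightarrow> ennreal" where
  "epow x a = (if x = \<infinity> then \<infinity> else ennreal (enn2real x powr a))"

lemma epow_ennreal [simp]: "0 \<le> x \<Longrightarrow> epow (ennreal x) a = ennreal (x powr a)"
  by (simp add: epow_def)

lemma epow_0 [simp]: "epow 0 a = 0"
  by (simp add: epow_def)

lemma epow_top [simp]: "epow \<infinity> a = \<infinity>"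
  by (simp add: epow_def)

lemma epow_top' [simp]: "epow top a = top"
  by (simp add: epow_def)

lemma epow_eq_0_iff [simp]: "epow x a = 0 \<longleftrightarrow> x = 0"
  by (cases x) (auto simp: epow_def)

lemma epow_measurable [measurable]:
  assumes [measurable]: "f \<in> borel_measurable M"
  shows "(\<lambda>x. epow (f x) a) \<in> borel_measurable M"
  unfolding epow_def by measurable

text \<open>
  With \<open>X = h / 2 ^ s\<close> this is \<open>2 ^ s * X powr \<kappa>\<close>, where \<open>\<kappa> < 1\<close> if \<open>X \<ge> 1\<close> and \<open>\<kappa> > 1\<close> if \<open>X < 1\<close>. It serves
  two purposes. Compared with \<open>h\<close> it decays geometrically as \<open>2 ^ s\<close> moves away from \<open>h\<close> in either
  direction, so that the sum over \<open>s\<close> is \<open>O(h)\<close>; and \<open>X powr \<sigma>\<close> is the power \<open>\<sigma> + \<epsilon>\<close> or \<open>\<sigma> - \<epsilon>\<close> of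
  \<open>level_part \<sigma> \<epsilon> s h / 2 ^ s\<close>, so that nothing but a small change of the exponent is paid for this.
\<close>

definition level_part :: "real \<Rightarrow> real \<Rightarrow> nat \<Rightarrow> real \<Rightarrow> real" where
  "level_part \<sigma> \<epsilon> s h =
     2 ^ s * (if 2 ^ s \<le> h then (h / 2 ^ s) powr (\<sigma> / (\<sigma> + \<epsilon>)) else (h / 2 ^ s) powr (\<sigma> / (\<sigma> - \<epsilon>)))"

lemma level_part_nonneg [simp]: "0 \<le> level_part \<sigma> \<epsilon> s h"
  by (simp add: level_part_def)

lemma level_part_measurable [measurable]:
  assumes [measurable]: "f \<in> borel_measurable M"
  shows "(\<lambda>x. level_part \<sigma> \<epsilon> s (f x)) \<in> borel_measurable M"
  unfolding level_part_def by measurable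

text \<open>
  Both branches are geometric sequences with ratio \<open>2 powr (- \<delta>)\<close> when counted from the index at
  which \<open>2 ^ s\<close> passes \<open>x\<close>.
\<close>

lemma geometric_sum_two_sided:
  fixes x \<delta> :: real
  assumes x: "0 < x" and \<delta>: "0 < \<delta>"
  shows "(\<Sum>s<n. if 2 ^ s \<le> x then (2 ^ s / x) powr \<delta> else (x / 2 ^ s) powr \<delta>) \<le> 2 / (1 - 2 powr (- \<delta>))"
proof -
  define q where "q = 2 powr (- \<delta>)"
  have q: "0 < q" "q < 1" using \<delta> by (auto simp: q_def powr_less_one)
  have qpow: "q ^ k = (2 ^ k) powr (- \<delta>)" for k
    by (simp add: q_def powr_realpow[symmetric] powr_powr mult.commute)
  have geo: "(\<Sum>k\<in>K. q ^ k) \<le> 1 / (1 - q)" if "finite K" for K :: "nat set"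
  proof -
    have "(\<Sum>k\<in>K. q ^ k) \<le> (\<Sum>k. q ^ k)"
      using q that by (intro sum_le_suminf summable_geometric) auto
    also have "\<dots> = 1 / (1 - q)" using q by (intro suminf_geometric) auto
    finally show ?thesis .
  qed
  let ?A = "{s\<in>{..<n}. 2 ^ s \<le> x}" and ?B = "{s\<in>{..<n}. \<not> 2 ^ s \<le> x}"
  have A: "(\<Sum>s\<in>?A. (2 ^ s / x) powr \<delta>) \<le> 1 / (1 - q)"
  proof (cases "?A = {}")
    case True
    then have "(\<Sum>s\<in>?A. (2 ^ s / x) powr \<delta>) = 0" by (simp only: sum.empty)
    then show ?thesis using q by simp
  next
    case False
    define m where "m = Max ?A"
    have m: "m \<in> ?A" "\<And>s. s \<in> ?A \<Longrightarrow> s \<le> m"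
      using False unfolding m_def by (intro Max_in; simp) (rule Max_ge, auto)
    have "(\<Sum>s\<in>?A. (2 ^ s / x) powr \<delta>) \<le> (\<Sum>s\<in>?A. q ^ (m - s))"
    proof (rule sum_mono)
      fix s assume s: "s \<in> ?A"
      have "2 ^ s / x \<le> 2 ^ s / 2 ^ m" using m(1) x by (intro divide_left_mono) auto
      also have "\<dots> = 1 / 2 ^ (m - s)" using m(2)[OF s] by (simp add: power_diff)
      finally have "(2 ^ s / x) powr \<delta> \<le> (1 / 2 ^ (m - s)) powr \<delta>"
        using x \<delta> by (intro powr_mono2) auto
      also have "\<dots> = q ^ (m - s)" by (simp add: qpow powr_minus_divide powr_divide)
      finally show "(2 ^ s / x) powr \<delta> \<le> q ^ (m - s)" .
    qed
    also have "\<dots> = (\<Sum>k\<in>(\<lambda>s. m - s) ` ?A. q ^ k)"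
      using m(2) by (subst sum.reindex) (auto intro!: inj_onI dest: m(2) simp: diff_diff_cancel, metis (no_types, lifting) diff_diff_cancel lessThan_iff mem_Collect_eq)
    also have "\<dots> \<le> 1 / (1 - q)" by (rule geo) auto
    finally show ?thesis .
  qed
  have B: "(\<Sum>s\<in>?B. (x / 2 ^ s) powr \<delta>) \<le> 1 / (1 - q)"
  proof (cases "?B = {}")
    case True
    then have "(\<Sum>s\<in>?B. (x / 2 ^ s) powr \<delta>) = 0" by (simp only: sum.empty)
    then show ?thesis using q by simp
  next
    case False
    define m where "m = Min ?B"
    have m: "m \<in> ?B" "\<And>s. s \<in> ?B \<Longrightarrow> m \<le> s"
      using False unfolding m_def by (intro Min_in; simp) (rule Min_le, auto)
    have "(\<Sum>s\<in>?B. (x / 2 ^ s) powr \<delta>) \<le> (\<Sum>s\<in>?B. q ^ (s - m))"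
    proof (rule sum_mono)
      fix s assume s: "s \<in> ?B"
      have "x / 2 ^ s \<le> 2 ^ m / 2 ^ s" using m(1) x by (intro divide_right_mono) auto
      also have "\<dots> = 1 / 2 ^ (s - m)" using m(2)[OF s] by (simp add: power_diff)
      finally have "(x / 2 ^ s) powr \<delta> \<le> (1 / 2 ^ (s - m)) powr \<delta>"
        using x \<delta> by (intro powr_mono2) auto
      also have "\<dots> = q ^ (s - m)" by (simp add: qpow powr_minus_divide powr_divide)
      finally show "(x / 2 ^ s) powr \<delta> \<le> q ^ (s - m)" .
    qed
    also have "\<dots> = (\<Sum>k\<in>(\<lambda>s. s - m) ` ?B. q ^ k)"
      using m(2) by (subst sum.reindex) (auto intro!: inj_onI, metis (no_types, lifting) le_add_diff_inverse2 lessThan_iff mem_Collect_eq not_le)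
    also have "\<dots> \<le> 1 / (1 - q)" by (rule geo) auto
    finally show ?thesis .
  qed
  have "(\<Sum>s<n. if 2 ^ s \<le> x then (2 ^ s / x) powr \<delta> else (x / 2 ^ s) powr \<delta>)
      = (\<Sum>s\<in>?A. (2 ^ s / x) powr \<delta>) + (\<Sum>s\<in>?B. (x / 2 ^ s) powr \<delta>)"
    by (subst sum.If_cases) (auto simp: Int_def)
  then show ?thesis using A B by (simp add: q_def)
qed

lemma sum_level_part_le:
  assumes \<epsilon>: "0 < \<epsilon>" "\<epsilon> < \<sigma>" and h: "0 \<le> h"
  shows "(\<Sum>s<n. level_part \<sigma> \<epsilon> s h) \<le> 2 / (1 - 2 powr (- (\<epsilon> / (\<sigma> + \<epsilon>)))) * h"
proof (cases "h = 0")
  case True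
  have "\<not> (2::real) ^ s \<le> 0" for s by (simp add: not_le)
  with True show ?thesis by (simp add: level_part_def)
next
  case False
  with h have h0: "0 < h" by simp
  define \<delta> where "\<delta> = \<epsilon> / (\<sigma> + \<epsilon>)"
  have \<delta>: "0 < \<delta>" using \<epsilon> by (simp add: \<delta>_def)
  have "level_part \<sigma> \<epsilon> s h \<le> h * (if 2 ^ s \<le> h then (2 ^ s / h) powr \<delta> else (h / 2 ^ s) powr \<delta>)" for s
  proof (cases "2 ^ s \<le> h")
    case True
    have e: "\<sigma> / (\<sigma> + \<epsilon>) = 1 - \<delta>" using \<epsilon> by (simp add: \<delta>_def field_simps)
    have "(h / 2 ^ s) powr (1 - \<delta>) = h / 2 ^ s * (2 ^ s / h) powr \<delta>"
      using h0 by (simp add: powr_diff powr_divide)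
    then show ?thesis using True by (simp add: level_part_def e)
  next
    case False
    have "(h / 2 ^ s) powr (\<sigma> / (\<sigma> - \<epsilon>)) \<le> (h / 2 ^ s) powr (1 + \<delta>)"
    proof (rule powr_mono')
      have "\<epsilon> / (\<sigma> + \<epsilon>) \<le> \<epsilon> / (\<sigma> - \<epsilon>)" using \<epsilon> by (intro divide_left_mono) auto
      moreover have "\<sigma> / (\<sigma> - \<epsilon>) = 1 + \<epsilon> / (\<sigma> - \<epsilon>)" using \<epsilon> by (simp add: field_simps)
      ultimately show "1 + \<delta> \<le> \<sigma> / (\<sigma> - \<epsilon>)" by (simp add: \<delta>_def)
    qed (use h0 False in auto)
    also have "\<dots> = h / 2 ^ s * (h / 2 ^ s) powr \<delta>"
      using h0 by (simp add: powr_add)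
    finally show ?thesis using False by (simp add: level_part_def field_simps)
  qed
  then have "(\<Sum>s<n. level_part \<sigma> \<epsilon> s h) \<le> h * (\<Sum>s<n. if 2 ^ s \<le> h then (2 ^ s / h) powr \<delta> else (h / 2 ^ s) powr \<delta>)"
    unfolding sum_distrib_left by (rule sum_mono)
  also have "\<dots> \<le> h * (2 / (1 - 2 powr (- \<delta>)))"
    by (intro mult_left_mono geometric_sum_two_sided h h0 \<delta>)
  finally show ?thesis by (simp add: \<delta>_def mult.commute)
qed

text \<open>
  A number at least 1 is not increased by an exponent at most 1, and a number at most 1 has all its
  powers at most 1. If both numbers are at most 1, both are replaced by the larger one, and the total
  exponent is at least 1.
\<close>

lemma powr_mult_le_sum:
  fixes A B \<alpha> \<beta> :: real
  assumes "0 \<le> A" "0 \<le> B" "0 < \<alpha>" "\<alpha> \<le> 1" "0 < \<beta>" "\<beta> \<le> 1" "1 \<le> \<alpha> + \<beta>"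
  shows "A powr \<alpha> * B powr \<beta> \<le> A + B + A * B"
proof -
  have up: "x powr \<gamma> \<le> x" if "1 \<le> x" "\<gamma> \<le> 1" for x \<gamma> :: real
    using powr_mono[of \<gamma> 1 x] that by simp
  have le1: "x powr \<gamma> \<le> 1" if "0 \<le> x" "x \<le> 1" "0 < \<gamma>" for x \<gamma> :: real
    using that by (simp add: powr_le1)
  consider "1 \<le> A" "1 \<le> B" | "1 \<le> A" "B \<le> 1" | "A \<le> 1" "1 \<le> B" | "A \<le> 1" "B \<le> 1" by linarith
  then show ?thesis
  proof cases
    case 1
    then have "A powr \<alpha> * B powr \<beta> \<le> A * B" using assms by (intro mult_mono up) auto
    then show ?thesis using assms by linarith
  next
    case 2
    then have "A powr \<alpha> * B powr \<beta> \<le> A * 1" using assms by (intro mult_mono up le1) auto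
    then show ?thesis using assms mult_nonneg_nonneg[of A B] by linarith
  next
    case 3
    then have "A powr \<alpha> * B powr \<beta> \<le> 1 * B" using assms by (intro mult_mono up le1) auto
    then show ?thesis using assms mult_nonneg_nonneg[of A B] by linarith
  next
    case 4
    define m where "m = max A B"
    have m: "0 \<le> m" "m \<le> 1" "A \<le> m" "B \<le> m" using 4 assms by (auto simp: m_def)
    have "A powr \<alpha> * B powr \<beta> \<le> m powr \<alpha> * m powr \<beta>"
      using assms m by (intro mult_mono powr_mono2) auto
    also have "\<dots> = m powr (\<alpha> + \<beta>)" by (simp add: powr_add)
    also have "\<dots> \<le> m powr 1" using m assms by (intro powr_mono') auto
    also have "\<dots> \<le> A + B" using m assms by (auto simp: m_def)
    finally show ?thesis using assms mult_nonneg_nonneg[of A B] by linarith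
  qed
qed

text \<open>
  This is where a product of powers is traded for level parts. The three summands on the right are
  made for the three bounds known for a kernel: integrated in \<open>x\<close>, integrated in \<open>y\<close>, and pointwise. The
  parameter \<open>t\<close> makes the first summand small enough for a kernel whose integral in \<open>x\<close> is as large as
  \<open>2 ^ t\<close>; the price is the factor \<open>2 powr ((\<sigma> + \<epsilon>) * t)\<close>.
\<close>

lemma level_part_product:
  assumes \<epsilon>: "0 < \<epsilon>" "\<epsilon> < \<sigma>" "\<epsilon> < \<tau>" "\<sigma> + \<epsilon> \<le> 1" "\<tau> + \<epsilon> \<le> 1" "1 \<le> \<sigma> + \<tau> - 2 * \<epsilon>"
    and hg: "0 \<le> h" "0 \<le> g"
  shows "2 powr (- (\<sigma> + \<tau> - 1) * real s) * (h powr \<sigma> * g powr \<tau>)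
     \<le> 2 powr ((\<sigma> + \<epsilon>) * real t) * (level_part \<sigma> \<epsilon> s h / 2 ^ t + level_part \<tau> \<epsilon> s g
          + level_part \<sigma> \<epsilon> s h * level_part \<tau> \<epsilon> s g / 2 ^ (s + t))"
proof -
  have scaled: "\<exists>\<alpha>. (\<alpha> = \<sigma> + \<epsilon> \<or> \<alpha> = \<sigma> - \<epsilon>) \<and> (h / 2 ^ s) powr \<sigma> = (level_part \<sigma> \<epsilon> s h / 2 ^ s) powr \<alpha>"
    if "0 < \<epsilon>" "\<epsilon> < \<sigma>" "0 \<le> h" for \<sigma> h :: real
  proof (cases "2 ^ s \<le> h")
    case True
    then show ?thesis using that
      by (intro exI[of _ "\<sigma> + \<epsilon>"]) (simp add: level_part_def powr_powr)
  next
    case False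
    then show ?thesis using that
      by (intro exI[of _ "\<sigma> - \<epsilon>"]) (simp add: level_part_def powr_powr)
  qed
  define U where "U = level_part \<sigma> \<epsilon> s h / 2 ^ s"
  define W where "W = level_part \<tau> \<epsilon> s g / 2 ^ s"
  have UW: "0 \<le> U" "0 \<le> W" by (auto simp: U_def W_def)
  obtain \<alpha> where \<alpha>: "\<alpha> = \<sigma> + \<epsilon> \<or> \<alpha> = \<sigma> - \<epsilon>" "(h / 2 ^ s) powr \<sigma> = U powr \<alpha>"
    using scaled[of \<sigma> h] \<epsilon> hg unfolding U_def by blast
  obtain \<beta> where \<beta>: "\<beta> = \<tau> + \<epsilon> \<or> \<beta> = \<tau> - \<epsilon>" "(g / 2 ^ s) powr \<tau> = W powr \<beta>"
    using scaled[of \<tau> g] \<epsilon> hg unfolding W_def by blast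
  have "2 powr (- (\<sigma> + \<tau> - 1) * real s) = 2 ^ s / ((2 ^ s) powr \<sigma> * (2 ^ s) powr \<tau>)"
    by (simp add: powr_realpow[symmetric] powr_powr powr_add[symmetric] powr_diff[symmetric] field_simps)
  then have "2 powr (- (\<sigma> + \<tau> - 1) * real s) * (h powr \<sigma> * g powr \<tau>)
      = 2 ^ s * ((h / 2 ^ s) powr \<sigma> * (g / 2 ^ s) powr \<tau>)"
    using hg by (simp add: powr_divide)
  also have "\<dots> = 2 ^ s * (U powr \<alpha> * W powr \<beta>)" by (simp add: \<alpha> \<beta>)
  also have "U powr \<alpha> = (2 ^ t) powr \<alpha> * (U / 2 ^ t) powr \<alpha>"
    using UW by (simp add: powr_divide)
  also have "2 ^ s * ((2 ^ t) powr \<alpha> * (U / 2 ^ t) powr \<alpha> * W powr \<beta>)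
      = 2 ^ s * ((2 ^ t) powr \<alpha> * ((U / 2 ^ t) powr \<alpha> * W powr \<beta>))" by simp
  also have "\<dots> \<le> 2 ^ s * (2 powr ((\<sigma> + \<epsilon>) * real t) * (U / 2 ^ t + W + U / 2 ^ t * W))"
  proof (intro mult_left_mono mult_mono)
    have "(2 ^ t) powr \<alpha> = 2 powr (\<alpha> * real t)"
      by (simp add: powr_realpow[symmetric] powr_powr mult.commute)
    also have "\<dots> \<le> 2 powr ((\<sigma> + \<epsilon>) * real t)"
      using \<alpha>(1) \<epsilon> by (intro powr_mono mult_right_mono) auto
    finally show "(2 ^ t) powr \<alpha> \<le> 2 powr ((\<sigma> + \<epsilon>) * real t)" .
    show "(U / 2 ^ t) powr \<alpha> * W powr \<beta> \<le> U / 2 ^ t + W + U / 2 ^ t * W"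
      using \<alpha>(1) \<beta>(1) \<epsilon> UW by (intro powr_mult_le_sum) auto
  qed (use UW in auto)
  also have "\<dots> = 2 powr ((\<sigma> + \<epsilon>) * real t) * (level_part \<sigma> \<epsilon> s h / 2 ^ t + level_part \<tau> \<epsilon> s g
          + level_part \<sigma> \<epsilon> s h * level_part \<tau> \<epsilon> s g / 2 ^ (s + t))"
    by (simp add: U_def W_def power_add field_simps)
  finally show ?thesis .
qed

text \<open>
  After \<open>level_part_product\<close> each summand is integrated with the kernel bound that suits it. Each
  level part enters linearly, so only their integrals \<open>U\<close> and \<open>W\<close> are left.
\<close>

lemma level_part_kernel_bound:
  fixes N :: "'a measure" and h g :: "'a \<Rightarrow> real" and k :: "'a \<Rightarrow> 'a \<Rightarrow> real"
  assumes N: "sigma_finite_measure N"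
    and \<epsilon>: "0 < \<epsilon>" "\<epsilon> < \<sigma>" "\<epsilon> < \<tau>" "\<sigma> + \<epsilon> \<le> 1" "\<tau> + \<epsilon> \<le> 1" "1 \<le> \<sigma> + \<tau> - 2 * \<epsilon>"
    and A: "0 \<le> A"
    and k: "(\<lambda>(x, y). k x y) \<in> borel_measurable (N \<Otimes>\<^sub>M N)" "\<And>x y. 0 \<le> k x y"
    and kx: "\<And>y. (\<integral>\<^sup>+x. ennreal (k x y) \<partial>N) \<le> ennreal (A * 2 ^ t)"
    and ky: "\<And>x. (\<integral>\<^sup>+y. ennreal (k x y) \<partial>N) \<le> ennreal A"
    and ks: "\<And>x y. k x y \<le> A * 2 ^ (s + t)"
    and h [measurable]: "h \<in> borel_measurable N" and h0: "\<And>y. 0 \<le> h y"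
    and g [measurable]: "g \<in> borel_measurable N" and g0: "\<And>y. 0 \<le> g y"
  defines "U \<equiv> \<integral>\<^sup>+y. ennreal (level_part \<sigma> \<epsilon> s (h y)) \<partial>N"
    and "W \<equiv> \<integral>\<^sup>+x. ennreal (level_part \<tau> \<epsilon> s (g x)) \<partial>N"
  shows "(\<integral>\<^sup>+x. \<integral>\<^sup>+y. ennreal (2 powr (- (\<sigma> + \<tau> - 1) * real s) * k x y * (h y powr \<sigma> * g x powr \<tau>)) \<partial>N \<partial>N)
     \<le> ennreal (2 powr ((\<sigma> + \<epsilon>) * real t) * A) * (U + W + U * W)"
proof -
  interpret sigma_finite_measure N by fact
  interpret pair_sigma_finite N N by (intro pair_sigma_finite.intro N)
  have k' [measurable]: "(\<lambda>p. k (fst p) (snd p)) \<in> borel_measurable (N \<Otimes>\<^sub>M N)"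
    using k(1) by (simp add: case_prod_beta)
  have kx' [measurable]: "k x \<in> borel_measurable N" if "x \<in> space N" for x
    using measurable_compose[OF measurable_Pair1'[OF that] k(1)] by simp
  let ?u = "\<lambda>y. level_part \<sigma> \<epsilon> s (h y)" and ?w = "\<lambda>x. level_part \<tau> \<epsilon> s (g x)"
  let ?T = "2 powr ((\<sigma> + \<epsilon>) * real t)"
  have pt: "ennreal (2 powr (- (\<sigma> + \<tau> - 1) * real s) * k x y * (h y powr \<sigma> * g x powr \<tau>))
     \<le> ennreal ?T * (ennreal (k x y) * (ennreal (?u y) * ennreal (1 / 2 ^ t)) + ennreal (k x y) * ennreal (?w x)
          + ennreal A * (ennreal (?u y) * ennreal (?w x)))" for x y
  proof -
    have "2 powr (- (\<sigma> + \<tau> - 1) * real s) * k x y * (h y powr \<sigma> * g x powr \<tau>)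
      = k x y * (2 powr (- (\<sigma> + \<tau> - 1) * real s) * (h y powr \<sigma> * g x powr \<tau>))" by simp
    also have "\<dots> \<le> k x y * (?T * (?u y / 2 ^ t + ?w x + ?u y * ?w x / 2 ^ (s + t)))"
      using \<epsilon> h0 g0 k(2) by (intro mult_left_mono level_part_product) auto
    also have "\<dots> = ?T * (k x y * (?u y * (1 / 2 ^ t)) + k x y * ?w x + k x y / 2 ^ (s + t) * (?u y * ?w x))"
      by (simp add: field_simps)
    also have "\<dots> \<le> ?T * (k x y * (?u y * (1 / 2 ^ t)) + k x y * ?w x + A * (?u y * ?w x))"
      using ks[of x y] by (intro mult_left_mono add_left_mono mult_right_mono) (auto simp: field_simps)
    finally have "ennreal (2 powr (- (\<sigma> + \<tau> - 1) * real s) * k x y * (h y powr \<sigma> * g x powr \<tau>))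
       \<le> ennreal (?T * (k x y * (?u y * (1 / 2 ^ t)) + k x y * ?w x + A * (?u y * ?w x)))"
      by (rule ennreal_leI)
    also have "\<dots> = ennreal ?T * (ennreal (k x y) * (ennreal (?u y) * ennreal (1 / 2 ^ t)) + ennreal (k x y) * ennreal (?w x)
          + ennreal A * (ennreal (?u y) * ennreal (?w x)))"
    proof -
      define c :: real where "c = 1 / 2 ^ t"
      have "0 \<le> c" by (simp add: c_def)
      then show ?thesis
        unfolding c_def[symmetric] using k(2) A by (simp add: ennreal_mult ennreal_plus)
    qed
    finally show ?thesis .
  qed
  have "(\<integral>\<^sup>+x. \<integral>\<^sup>+y. ennreal (2 powr (- (\<sigma> + \<tau> - 1) * real s) * k x y * (h y powr \<sigma> * g x powr \<tau>)) \<partial>N \<partial>N)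
     \<le> (\<integral>\<^sup>+x. \<integral>\<^sup>+y. ennreal ?T * (ennreal (k x y) * (ennreal (?u y) * ennreal (1 / 2 ^ t)) + ennreal (k x y) * ennreal (?w x)
          + ennreal A * (ennreal (?u y) * ennreal (?w x))) \<partial>N \<partial>N)"
    by (intro nn_integral_mono pt)
  also have "\<dots> = (\<integral>\<^sup>+x. ennreal ?T * ((\<integral>\<^sup>+y. ennreal (k x y) * (ennreal (?u y) * ennreal (1 / 2 ^ t)) \<partial>N)
        + (\<integral>\<^sup>+y. ennreal (k x y) \<partial>N) * ennreal (?w x) + ennreal A * (U * ennreal (?w x))) \<partial>N)"
    by (intro nn_integral_cong) (simp add: nn_integral_cmult nn_integral_add nn_integral_multc U_def)
  also have "\<dots> = ennreal ?T * ((\<integral>\<^sup>+x. \<integral>\<^sup>+y. ennreal (k x y) * (ennreal (?u y) * ennreal (1 / 2 ^ t)) \<partial>N \<partial>N)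
        + (\<integral>\<^sup>+x. (\<integral>\<^sup>+y. ennreal (k x y) \<partial>N) * ennreal (?w x) \<partial>N) + ennreal A * (U * W))"
    by (simp add: nn_integral_cmult nn_integral_add W_def)
  also have "\<dots> \<le> ennreal ?T * (ennreal A * U + ennreal A * W + ennreal A * (U * W))"
  proof (intro mult_left_mono add_mono order_refl)
    have "(\<integral>\<^sup>+x. \<integral>\<^sup>+y. ennreal (k x y) * (ennreal (?u y) * ennreal (1 / 2 ^ t)) \<partial>N \<partial>N)
        = (\<integral>\<^sup>+y. \<integral>\<^sup>+x. ennreal (k x y) * (ennreal (?u y) * ennreal (1 / 2 ^ t)) \<partial>N \<partial>N)"
      by (rule Fubini'[symmetric]) (simp add: case_prod_beta)
    also have "\<dots> = (\<integral>\<^sup>+y. (\<integral>\<^sup>+x. ennreal (k x y) \<partial>N) * (ennreal (?u y) * ennreal (1 / 2 ^ t)) \<partial>N)"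
    proof (intro nn_integral_cong nn_integral_multc)
      fix y assume "y \<in> space N"
      from measurable_compose[OF measurable_Pair2'[OF this] k(1)]
      show "(\<lambda>x. ennreal (k x y)) \<in> borel_measurable N" by simp
    qed
    also have "\<dots> \<le> (\<integral>\<^sup>+y. ennreal (A * 2 ^ t) * (ennreal (?u y) * ennreal (1 / 2 ^ t)) \<partial>N)"
      by (intro nn_integral_mono mult_right_mono kx) auto
    also have "\<dots> = (\<integral>\<^sup>+y. ennreal A * ennreal (?u y) \<partial>N)"
      using A by (intro nn_integral_cong) (simp add: ennreal_mult[symmetric])
    also have "\<dots> = ennreal A * U" by (simp add: nn_integral_cmult U_def)
    finally show "(\<integral>\<^sup>+x. \<integral>\<^sup>+y. ennreal (k x y) * (ennreal (?u y) * ennreal (1 / 2 ^ t)) \<partial>N \<partial>N) \<le> ennreal A * U" .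
    have "(\<integral>\<^sup>+x. (\<integral>\<^sup>+y. ennreal (k x y) \<partial>N) * ennreal (?w x) \<partial>N) \<le> (\<integral>\<^sup>+x. ennreal A * ennreal (?w x) \<partial>N)"
      by (intro nn_integral_mono mult_right_mono ky) auto
    also have "\<dots> = ennreal A * W" by (simp add: nn_integral_cmult W_def)
    finally show "(\<integral>\<^sup>+x. (\<integral>\<^sup>+y. ennreal (k x y) \<partial>N) * ennreal (?w x) \<partial>N) \<le> ennreal A * W" .
  qed auto
  also have "\<dots> = ennreal (?T * A) * (U + W + U * W)"
    using A by (simp add: ennreal_mult distrib_left mult.assoc)
  finally show ?thesis .
qed

text \<open>
  For \<open>K x y = \<bar>x - y\<bar> powr (\<sigma> + \<tau> - 2)\<close> on the line this is the Hardy-Littlewood-Sobolev inequality,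
  with the two functions written as powers \<open>H powr \<sigma>\<close> and \<open>G powr \<tau>\<close> of integrable functions. In this form
  the inequality is stable under tensor products.
\<close>

definition HLS_bound :: "'a measure \<Rightarrow> ('a \<Rightarrow> 'a \<Rightarrow> ennreal) \<Rightarrow> real \<Rightarrow> real \<Rightarrow> ennreal \<Rightarrow> bool" where
  "HLS_bound N K \<sigma> \<tau> C \<longleftrightarrow> (\<forall>H G. H \<in> borel_measurable N \<longrightarrow> G \<in> borel_measurable N \<longrightarrow>
     (\<integral>\<^sup>+x. \<integral>\<^sup>+y. K x y * epow (H y) \<sigma> * epow (G x) \<tau> \<partial>N \<partial>N)
       \<le> C * epow (\<integral>\<^sup>+y. H y \<partial>N) \<sigma> * epow (\<integral>\<^sup>+x. G x \<partial>N) \<tau>)"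

text \<open>
  Both sides are homogeneous of degree \<open>\<sigma>\<close> in \<open>H\<close> and of degree \<open>\<tau>\<close> in \<open>G\<close>. Integrals equal to \<open>0\<close> or \<open>\<infinity>\<close>
  cannot be normalized, but then one side is trivial.
\<close>

lemma HLS_bound_of_normalized:
  assumes K [measurable]: "(\<lambda>(x, y). K x y) \<in> borel_measurable (N \<Otimes>\<^sub>M N)"
    and N: "sigma_finite_measure N"
    and C: "0 < C"
    and norm: "\<And>h g. \<lbrakk>h \<in> borel_measurable N; g \<in> borel_measurable N; \<And>y. 0 \<le> h y; \<And>y. 0 \<le> g y;
        (\<integral>\<^sup>+y. ennreal (h y) \<partial>N) = 1; (\<integral>\<^sup>+y. ennreal (g y) \<partial>N) = 1\<rbrakk> \<Longrightarrow>
       (\<integral>\<^sup>+x. \<integral>\<^sup>+y. K x y * ennreal (h y powr \<sigma>) * ennreal (g x powr \<tau>) \<partial>N \<partial>N) \<le> ennreal C"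
  shows "HLS_bound N K \<sigma> \<tau> (ennreal C)"
  unfolding HLS_bound_def
proof (intro allI impI)
  interpret sigma_finite_measure N by fact
  interpret pair_sigma_finite N N by (intro pair_sigma_finite.intro N)
  fix H G :: "'a \<Rightarrow> ennreal"
  assume [measurable]: "H \<in> borel_measurable N" "G \<in> borel_measurable N"
  define I J where "I = (\<integral>\<^sup>+y. H y \<partial>N)" and "J = (\<integral>\<^sup>+y. G y \<partial>N)"
  have K' [measurable]: "K x \<in> borel_measurable N" if "x \<in> space N" for x
    using measurable_compose[OF measurable_Pair1'[OF that] K] by simp
  show "(\<integral>\<^sup>+x. \<integral>\<^sup>+y. K x y * epow (H y) \<sigma> * epow (G x) \<tau> \<partial>N \<partial>N) \<le> ennreal C * epow (\<integral>\<^sup>+y. H y \<partial>N) \<sigma> * epow (\<integral>\<^sup>+x. G x \<partial>N) \<tau>"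
    unfolding I_def[symmetric] J_def[symmetric]
  proof (cases "I = 0 \<or> J = 0")
    case True
    have "(\<integral>\<^sup>+x. \<integral>\<^sup>+y. K x y * epow (H y) \<sigma> * epow (G x) \<tau> \<partial>N \<partial>N) = 0"
    proof (cases "I = 0")
      case True
      then have ae: "AE y in N. H y = 0" by (simp add: I_def nn_integral_0_iff_AE)
      have "(\<integral>\<^sup>+y. K x y * epow (H y) \<sigma> * epow (G x) \<tau> \<partial>N) = (\<integral>\<^sup>+y. 0 \<partial>N)" for x
        using ae by (intro nn_integral_cong_AE) auto
      then show ?thesis by simp
    next
      case False
      with True have "J = 0" by auto
      then have ae: "AE y in N. G y = 0" by (simp add: J_def nn_integral_0_iff_AE)
      have "(\<integral>\<^sup>+x. \<integral>\<^sup>+y. K x y * epow (H y) \<sigma> * epow (G x) \<tau> \<partial>N \<partial>N) = (\<integral>\<^sup>+x. 0 \<partial>N)"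
        using ae by (intro nn_integral_cong_AE) auto
      then show ?thesis by simp
    qed
    then show "(\<integral>\<^sup>+x. \<integral>\<^sup>+y. K x y * epow (H y) \<sigma> * epow (G x) \<tau> \<partial>N \<partial>N) \<le> ennreal C * epow I \<sigma> * epow J \<tau>" by simp
  next
    case False
    show "(\<integral>\<^sup>+x. \<integral>\<^sup>+y. K x y * epow (H y) \<sigma> * epow (G x) \<tau> \<partial>N \<partial>N) \<le> ennreal C * epow I \<sigma> * epow J \<tau>"
    proof (cases "I = \<infinity> \<or> J = \<infinity>")
      case True
      with False C have "ennreal C * epow I \<sigma> * epow J \<tau> = \<infinity>"
        by (auto simp: ennreal_mult_eq_top_iff)
      then show ?thesis by simp
    next
      case fin: False
      obtain i where i: "I = ennreal i" "0 < i"
        using False fin by (cases I) auto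
      obtain j where j: "J = ennreal j" "0 < j"
        using False fin by (cases J) auto
      define h where "h = (\<lambda>y. enn2real (H y) / i)"
      define g where "g = (\<lambda>y. enn2real (G y) / j)"
      have [measurable]: "h \<in> borel_measurable N" "g \<in> borel_measurable N" unfolding h_def g_def by measurable
      have hg0: "0 \<le> h y" "0 \<le> g y" for y using i j by (auto simp: h_def g_def)
      have aeH: "AE y in N. H y \<noteq> \<infinity>" using fin by (intro nn_integral_PInf_AE) (auto simp: I_def)
      have aeG: "AE y in N. G y \<noteq> \<infinity>" using fin by (intro nn_integral_PInf_AE) (auto simp: J_def)
      have H: "AE y in N. H y = ennreal i * ennreal (h y)"
        using aeH by eventually_elim (use i in \<open>auto simp: h_def ennreal_mult[symmetric] less_top\<close>)
      have G: "AE y in N. G y = ennreal j * ennreal (g y)"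
        using aeG by eventually_elim (use j in \<open>auto simp: g_def ennreal_mult[symmetric] less_top\<close>)
      have "ennreal i * (\<integral>\<^sup>+y. ennreal (h y) \<partial>N) = ennreal i"
        using i(1) H unfolding I_def by (subst nn_integral_cmult[symmetric]) (auto simp: nn_integral_cong_AE)
      then have h1: "(\<integral>\<^sup>+y. ennreal (h y) \<partial>N) = 1"
        using i(2) ennreal_mult_cancel_left[of "ennreal i" _ 1] by auto
      have "ennreal j * (\<integral>\<^sup>+y. ennreal (g y) \<partial>N) = ennreal j"
        using j(1) G unfolding J_def by (subst nn_integral_cmult[symmetric]) (auto simp: nn_integral_cong_AE)
      then have g1: "(\<integral>\<^sup>+y. ennreal (g y) \<partial>N) = 1"
        using j(2) ennreal_mult_cancel_left[of "ennreal j" _ 1] by auto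
      have H': "AE y in N. epow (H y) \<sigma> = ennreal (i powr \<sigma>) * ennreal (h y powr \<sigma>)"
        using H by eventually_elim (use i hg0 in \<open>simp add: ennreal_mult[symmetric] powr_mult\<close>)
      have G': "AE y in N. epow (G y) \<tau> = ennreal (j powr \<tau>) * ennreal (g y powr \<tau>)"
        using G by eventually_elim (use j hg0 in \<open>simp add: ennreal_mult[symmetric] powr_mult\<close>)
      have "(\<integral>\<^sup>+x. \<integral>\<^sup>+y. K x y * epow (H y) \<sigma> * epow (G x) \<tau> \<partial>N \<partial>N)
         = (\<integral>\<^sup>+x. \<integral>\<^sup>+y. (ennreal (i powr \<sigma>) * ennreal (j powr \<tau>)) * (K x y * ennreal (h y powr \<sigma>) * ennreal (g x powr \<tau>)) \<partial>N \<partial>N)"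
      proof (rule nn_integral_cong_AE, use G' in eventually_elim, rule nn_integral_cong_AE, use H' in eventually_elim)
        fix x y
        assume "epow (G x) \<tau> = ennreal (j powr \<tau>) * ennreal (g x powr \<tau>)"
          and "epow (H y) \<sigma> = ennreal (i powr \<sigma>) * ennreal (h y powr \<sigma>)"
        then show "K x y * epow (H y) \<sigma> * epow (G x) \<tau>
           = (ennreal (i powr \<sigma>) * ennreal (j powr \<tau>)) * (K x y * ennreal (h y powr \<sigma>) * ennreal (g x powr \<tau>))"
          by (simp add: mult_ac)
      qed
      also have "\<dots> = (\<integral>\<^sup>+x. (ennreal (i powr \<sigma>) * ennreal (j powr \<tau>)) * (\<integral>\<^sup>+y. K x y * ennreal (h y powr \<sigma>) * ennreal (g x powr \<tau>) \<partial>N) \<partial>N)"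
        by (intro nn_integral_cong nn_integral_cmult) measurable
      also have "\<dots> = (ennreal (i powr \<sigma>) * ennreal (j powr \<tau>)) * (\<integral>\<^sup>+x. \<integral>\<^sup>+y. K x y * ennreal (h y powr \<sigma>) * ennreal (g x powr \<tau>) \<partial>N \<partial>N)"
        by (intro nn_integral_cmult) measurable
      also have "\<dots> \<le> (ennreal (i powr \<sigma>) * ennreal (j powr \<tau>)) * ennreal C"
        by (intro mult_left_mono norm hg0 h1 g1) auto
      also have "\<dots> = ennreal C * epow I \<sigma> * epow J \<tau>" using i j by (simp add: mult_ac)
      finally show ?thesis .
    qed
  qed
qed

lemma ennreal_sum_sum_mult:
  assumes "\<And>s t. 0 \<le> a s t" "\<And>s t. 0 \<le> b s t"
  shows "ennreal (\<Sum>s\<in>S. \<Sum>t\<in>T. a s t * b s t) = (\<Sum>s\<in>S. \<Sum>t\<in>T. ennreal (a s t) * ennreal (b s t))"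
  using assms by (simp add: ennreal_mult[symmetric] sum_nonneg)

text \<open>
  The central inequality. In the index \<open>s\<close> the exponent \<open>\<sigma> + \<tau> - 1\<close> is the critical one: the bounds on a
  single \<open>k s t\<close> do not decay in \<open>s\<close>, and the sum over \<open>s\<close> converges only because the level parts of a
  normalized function have integrals that are summable in \<open>s\<close>. In the index \<open>t\<close> there is a geometric
  series, which converges because \<open>r > \<sigma>\<close>.
\<close>

lemma HLS_bound_dyadic_sum:
  fixes N :: "'a measure"
  assumes N: "sigma_finite_measure N"
    and \<sigma>: "0 < \<sigma>" "\<sigma> < 1" and \<tau>: "0 < \<tau>" "\<tau> < 1" "1 < \<sigma> + \<tau>" and r: "\<sigma> < r" and A: "0 \<le> A"
  obtains C where "0 < C"
    "\<And>m (k :: nat \<Rightarrow> nat \<Rightarrow> 'a \<Rightarrow> 'a \<Rightarrow> real).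
      \<lbrakk>\<And>s t. (\<lambda>(x, y). k s t x y) \<in> borel_measurable (N \<Otimes>\<^sub>M N); \<And>s t x y. 0 \<le> k s t x y;
       \<And>s t y. (\<integral>\<^sup>+x. ennreal (k s t x y) \<partial>N) \<le> ennreal (A * 2 ^ t);
       \<And>s t x. (\<integral>\<^sup>+y. ennreal (k s t x y) \<partial>N) \<le> ennreal A;
       \<And>s t x y. k s t x y \<le> A * 2 ^ (s + t)\<rbrakk> \<Longrightarrow>
      HLS_bound N (\<lambda>x y. ennreal (\<Sum>s<m. \<Sum>t<m. 2 powr (- (\<sigma> + \<tau> - 1) * real s) * 2 powr (- r * real t) * k s t x y))
        \<sigma> \<tau> (ennreal C)"
proof -
  \<comment> \<open>Small enough for all the side conditions on the level parts and for
    \<open>\<sigma> + \<epsilon> < r\<close>, which makes the ratio \<open>\<rho>\<close> of the series in \<open>t\<close> less than 1.\<close>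
  define \<epsilon> where "\<epsilon> = Min {\<sigma> / 2, \<tau> / 2, 1 - \<sigma>, 1 - \<tau>, (\<sigma> + \<tau> - 1) / 2, (r - \<sigma>) / 2}"
  have \<epsilon>0: "0 < \<epsilon>"
    unfolding \<epsilon>_def by (subst Min_gr_iff) (use \<sigma> \<tau> r in auto)
  have "\<epsilon> \<le> \<sigma> / 2" "\<epsilon> \<le> \<tau> / 2" "\<epsilon> \<le> 1 - \<sigma>" "\<epsilon> \<le> 1 - \<tau>" "\<epsilon> \<le> (\<sigma> + \<tau> - 1) / 2" "\<epsilon> \<le> (r - \<sigma>) / 2"
    unfolding \<epsilon>_def by (rule Min_le; simp)+
  then have \<epsilon>: "0 < \<epsilon>" "\<epsilon> < \<sigma>" "\<epsilon> < \<tau>" "\<sigma> + \<epsilon> \<le> 1" "\<tau> + \<epsilon> \<le> 1" "1 \<le> \<sigma> + \<tau> - 2 * \<epsilon>" "\<sigma> + \<epsilon> < r"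
    using \<epsilon>0 \<sigma> \<tau> r by auto
  \<comment> \<open>The constant of \<open>sum_level_part_le\<close>.\<close>
  define D where "D = (\<lambda>\<sigma>::real. 2 / (1 - 2 powr (- (\<epsilon> / (\<sigma> + \<epsilon>)))))"
  have D: "0 < D \<rho>" if "0 < \<rho>" for \<rho>
    using that \<epsilon>0 by (auto simp: D_def intro!: divide_pos_pos powr_less_one)
  define \<rho> where "\<rho> = 2 powr (\<sigma> + \<epsilon> - r)"
  have \<rho>: "0 < \<rho>" "\<rho> < 1" using \<epsilon> by (auto simp: \<rho>_def powr_less_one)
  define C where "C = 1 + A / (1 - \<rho>) * (D \<sigma> + D \<tau> * D \<sigma> + D \<tau>)"
  have D0: "0 < D \<sigma>" "0 < D \<tau>" using D \<sigma> \<tau> by auto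
  have C: "0 < C" unfolding C_def using A \<rho> D0 by (intro add_pos_nonneg mult_nonneg_nonneg) auto
  show thesis
  proof (rule that[OF C])
    fix m and k :: "nat \<Rightarrow> nat \<Rightarrow> 'a \<Rightarrow> 'a \<Rightarrow> real"
    assume k: "\<And>s t. (\<lambda>(x, y). k s t x y) \<in> borel_measurable (N \<Otimes>\<^sub>M N)" "\<And>s t x y. 0 \<le> k s t x y"
      "\<And>s t y. (\<integral>\<^sup>+x. ennreal (k s t x y) \<partial>N) \<le> ennreal (A * 2 ^ t)"
      "\<And>s t x. (\<integral>\<^sup>+y. ennreal (k s t x y) \<partial>N) \<le> ennreal A"
      "\<And>s t x y. k s t x y \<le> A * 2 ^ (s + t)"
    have k' [measurable]: "(\<lambda>p. k s t (fst p) (snd p)) \<in> borel_measurable (N \<Otimes>\<^sub>M N)" for s t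
      using k(1) by (simp add: case_prod_beta)
    have kx' [measurable]: "k s t x \<in> borel_measurable N" if "x \<in> space N" for s t x
      using measurable_compose[OF measurable_Pair1'[OF that] k(1)] by simp
    interpret sigma_finite_measure N by fact
    show "HLS_bound N (\<lambda>x y. ennreal (\<Sum>s<m. \<Sum>t<m. 2 powr (- (\<sigma> + \<tau> - 1) * real s) * 2 powr (- r * real t) * k s t x y))
        \<sigma> \<tau> (ennreal C)"
    proof (rule HLS_bound_of_normalized[OF _ N C])
      show "(\<lambda>(x, y). ennreal (\<Sum>s<m. \<Sum>t<m. 2 powr (- (\<sigma> + \<tau> - 1) * real s) * 2 powr (- r * real t) * k s t x y))
         \<in> borel_measurable (N \<Otimes>\<^sub>M N)"
        unfolding case_prod_beta by measurable
    next
      fix h g :: "'a \<Rightarrow> real"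
      assume [measurable]: "h \<in> borel_measurable N" "g \<in> borel_measurable N" and hg0: "\<And>y. 0 \<le> h y" "\<And>y. 0 \<le> g y"
        and h1: "(\<integral>\<^sup>+y. ennreal (h y) \<partial>N) = 1" and g1: "(\<integral>\<^sup>+y. ennreal (g y) \<partial>N) = 1"
      define U where "U s = (\<integral>\<^sup>+y. ennreal (level_part \<sigma> \<epsilon> s (h y)) \<partial>N)" for s
      define W where "W s = (\<integral>\<^sup>+x. ennreal (level_part \<tau> \<epsilon> s (g x)) \<partial>N)" for s
      have sums: "(\<Sum>s<m. (\<integral>\<^sup>+y. ennreal (level_part \<rho> \<epsilon> s (f y)) \<partial>N)) \<le> ennreal (D \<rho>)"
        if "f \<in> borel_measurable N" "\<And>y. 0 \<le> f y" "(\<integral>\<^sup>+y. ennreal (f y) \<partial>N) = 1" "\<epsilon> < \<rho>" for f \<rho> m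
      proof -
        note [measurable] = that(1)
        have "(\<Sum>s<m. (\<integral>\<^sup>+y. ennreal (level_part \<rho> \<epsilon> s (f y)) \<partial>N)) = (\<integral>\<^sup>+y. ennreal (\<Sum>s<m. level_part \<rho> \<epsilon> s (f y)) \<partial>N)"
          by (subst nn_integral_sum[symmetric]) (auto simp: sum_ennreal)
        also have "\<dots> \<le> (\<integral>\<^sup>+y. ennreal (D \<rho>) * ennreal (f y) \<partial>N)"
          using that \<epsilon>0 sum_level_part_le[OF \<epsilon>0 that(4)] D[of \<rho>]
          by (intro nn_integral_mono) (auto simp: ennreal_mult[symmetric] D_def intro!: ennreal_leI)
        also have "\<dots> = ennreal (D \<rho>)" using that by (simp add: nn_integral_cmult)
        finally show ?thesis .
      qed
      have Us: "(\<Sum>s<m. U s) \<le> ennreal (D \<sigma>)" and Ws: "(\<Sum>s<m. W s) \<le> ennreal (D \<tau>)"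
        unfolding U_def W_def using hg0 h1 g1 \<epsilon> by (auto intro!: sums)
      \<comment> \<open>The integrals are summable, hence bounded; this handles the product \<open>U s * W s\<close>.\<close>
      have W1: "W s \<le> ennreal (D \<tau>)" for s
      proof -
        have "W s \<le> (\<Sum>s<Suc s. W s)" by simp
        also have "\<dots> \<le> ennreal (D \<tau>)" unfolding W_def using hg0 g1 \<epsilon> by (intro sums) auto
        finally show ?thesis .
      qed
      have "(\<integral>\<^sup>+x. \<integral>\<^sup>+y. ennreal (\<Sum>s<m. \<Sum>t<m. 2 powr (- (\<sigma> + \<tau> - 1) * real s) * 2 powr (- r * real t) * k s t x y)
            * ennreal (h y powr \<sigma>) * ennreal (g x powr \<tau>) \<partial>N \<partial>N)
         = (\<integral>\<^sup>+x. \<integral>\<^sup>+y. (\<Sum>s<m. \<Sum>t<m. ennreal (2 powr (- r * real t)) *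
            ennreal (2 powr (- (\<sigma> + \<tau> - 1) * real s) * k s t x y * (h y powr \<sigma> * g x powr \<tau>))) \<partial>N \<partial>N)"
      proof (intro nn_integral_cong)
        fix x y
        let ?S = "\<Sum>s<m. \<Sum>t<m. 2 powr (- (\<sigma> + \<tau> - 1) * real s) * 2 powr (- r * real t) * k s t x y"
        have "0 \<le> ?S" using k(2) by (intro sum_nonneg mult_nonneg_nonneg) auto
        then have "ennreal ?S * ennreal (h y powr \<sigma>) * ennreal (g x powr \<tau>) = ennreal (?S * (h y powr \<sigma> * g x powr \<tau>))"
          by (simp add: ennreal_mult mult.assoc)
        also have "?S * (h y powr \<sigma> * g x powr \<tau>) = (\<Sum>s<m. \<Sum>t<m. 2 powr (- r * real t) *
            (2 powr (- (\<sigma> + \<tau> - 1) * real s) * k s t x y * (h y powr \<sigma> * g x powr \<tau>)))"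
          unfolding sum_distrib_right by (intro sum.cong refl) (simp only: mult_ac)
        also have "ennreal \<dots> = (\<Sum>s<m. \<Sum>t<m. ennreal (2 powr (- r * real t)) *
            ennreal (2 powr (- (\<sigma> + \<tau> - 1) * real s) * k s t x y * (h y powr \<sigma> * g x powr \<tau>)))"
          by (rule ennreal_sum_sum_mult) (use k(2) in auto)
        finally show "ennreal ?S * ennreal (h y powr \<sigma>) * ennreal (g x powr \<tau>) = (\<Sum>s<m. \<Sum>t<m. ennreal (2 powr (- r * real t)) *
            ennreal (2 powr (- (\<sigma> + \<tau> - 1) * real s) * k s t x y * (h y powr \<sigma> * g x powr \<tau>)))" .
      qed
      also have "\<dots> = (\<Sum>s<m. \<Sum>t<m. ennreal (2 powr (- r * real t)) * (\<integral>\<^sup>+x. \<integral>\<^sup>+y.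
            ennreal (2 powr (- (\<sigma> + \<tau> - 1) * real s) * k s t x y * (h y powr \<sigma> * g x powr \<tau>)) \<partial>N \<partial>N))"
      proof -
        define Q where "Q s t x y = ennreal (2 powr (- (\<sigma> + \<tau> - 1) * real s) * k s t x y * (h y powr \<sigma> * g x powr \<tau>))" for s t x y
        define c where "c t = ennreal (2 powr (- r * real t))" for t :: nat
        have Q2: "(\<lambda>(x, y). Q s t x y) \<in> borel_measurable (N \<Otimes>\<^sub>M N)" for s t
          unfolding Q_def case_prod_beta by measurable
        have Q1: "(\<lambda>y. Q s t x y) \<in> borel_measurable N" if "x \<in> space N" for s t x
          using measurable_compose[OF measurable_Pair1'[OF that] Q2] by simp
        have Qx: "(\<lambda>x. \<integral>\<^sup>+y. Q s t x y \<partial>N) \<in> borel_measurable N" for s t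
          by (rule borel_measurable_nn_integral[OF Q2])
        have "(\<integral>\<^sup>+x. \<integral>\<^sup>+y. (\<Sum>s<m. \<Sum>t<m. c t * Q s t x y) \<partial>N \<partial>N) = (\<integral>\<^sup>+x. (\<Sum>s<m. \<Sum>t<m. c t * (\<integral>\<^sup>+y. Q s t x y \<partial>N)) \<partial>N)"
        proof (intro nn_integral_cong)
          fix x assume x: "x \<in> space N"
          have m1: "(\<lambda>y. c t * Q s t x y) \<in> borel_measurable N" for s t
            using Q1[OF x] by (rule borel_measurable_times_ennreal[OF borel_measurable_const])
          have m2: "(\<lambda>y. \<Sum>t<m. c t * Q s t x y) \<in> borel_measurable N" for s
            by (intro borel_measurable_sum m1)
          have "(\<integral>\<^sup>+y. (\<Sum>s<m. \<Sum>t<m. c t * Q s t x y) \<partial>N) = (\<Sum>s<m. \<integral>\<^sup>+y. (\<Sum>t<m. c t * Q s t x y) \<partial>N)"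
            by (rule nn_integral_sum) (rule m2)
          also have "\<dots> = (\<Sum>s<m. \<Sum>t<m. \<integral>\<^sup>+y. c t * Q s t x y \<partial>N)"
            by (rule sum.cong[OF refl], rule nn_integral_sum) (rule m1)
          also have "\<dots> = (\<Sum>s<m. \<Sum>t<m. c t * (\<integral>\<^sup>+y. Q s t x y \<partial>N))"
            by (intro sum.cong refl nn_integral_cmult Q1 x)
          finally show "(\<integral>\<^sup>+y. (\<Sum>s<m. \<Sum>t<m. c t * Q s t x y) \<partial>N) = (\<Sum>s<m. \<Sum>t<m. c t * (\<integral>\<^sup>+y. Q s t x y \<partial>N))" .
        qed
        also have "\<dots> = (\<Sum>s<m. \<Sum>t<m. c t * (\<integral>\<^sup>+x. \<integral>\<^sup>+y. Q s t x y \<partial>N \<partial>N))"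
        proof -
          have m1: "(\<lambda>x. c t * (\<integral>\<^sup>+y. Q s t x y \<partial>N)) \<in> borel_measurable N" for s t
            using Qx by (rule borel_measurable_times_ennreal[OF borel_measurable_const])
          have m2: "(\<lambda>x. \<Sum>t<m. c t * (\<integral>\<^sup>+y. Q s t x y \<partial>N)) \<in> borel_measurable N" for s
            by (intro borel_measurable_sum m1)
          have "(\<integral>\<^sup>+x. (\<Sum>s<m. \<Sum>t<m. c t * (\<integral>\<^sup>+y. Q s t x y \<partial>N)) \<partial>N) = (\<Sum>s<m. \<integral>\<^sup>+x. (\<Sum>t<m. c t * (\<integral>\<^sup>+y. Q s t x y \<partial>N)) \<partial>N)"
            by (rule nn_integral_sum) (rule m2)
          also have "\<dots> = (\<Sum>s<m. \<Sum>t<m. \<integral>\<^sup>+x. c t * (\<integral>\<^sup>+y. Q s t x y \<partial>N) \<partial>N)"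
            by (rule sum.cong[OF refl], rule nn_integral_sum) (rule m1)
          also have "\<dots> = (\<Sum>s<m. \<Sum>t<m. c t * (\<integral>\<^sup>+x. \<integral>\<^sup>+y. Q s t x y \<partial>N \<partial>N))"
            by (intro sum.cong refl nn_integral_cmult Qx)
          finally show ?thesis .
        qed
        finally show ?thesis unfolding Q_def c_def .
      qed
      also have "\<dots> \<le> (\<Sum>s<m. \<Sum>t<m. ennreal (2 powr (- r * real t)) *
            (ennreal (2 powr ((\<sigma> + \<epsilon>) * real t) * A) * (U s + W s + U s * W s)))"
        unfolding U_def W_def
        by (intro sum_mono mult_left_mono level_part_kernel_bound[OF N]) (use \<epsilon> A k hg0 in auto)
      also have "\<dots> = (\<Sum>t<m. ennreal (A * \<rho> ^ t)) * (\<Sum>s<m. U s + W s + U s * W s)"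
      proof -
        have "ennreal (2 powr (- r * real t)) * (ennreal (2 powr ((\<sigma> + \<epsilon>) * real t) * A) * X)
            = ennreal (A * \<rho> ^ t) * X" for t X
          using A by (simp add: mult.assoc[symmetric] ennreal_mult[symmetric] \<rho>_def powr_realpow[symmetric] powr_powr
              powr_add[symmetric] algebra_simps)
        then have "(\<Sum>s<m. \<Sum>t<m. ennreal (2 powr (- r * real t)) *
            (ennreal (2 powr ((\<sigma> + \<epsilon>) * real t) * A) * (U s + W s + U s * W s)))
          = (\<Sum>s<m. \<Sum>t<m. ennreal (A * \<rho> ^ t) * (U s + W s + U s * W s))"
          by (intro sum.cong refl)
        also have "\<dots> = (\<Sum>t<m. \<Sum>s<m. ennreal (A * \<rho> ^ t) * (U s + W s + U s * W s))"
          by (rule sum.swap)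
        finally show ?thesis unfolding sum_product .
      qed
      also have "\<dots> \<le> ennreal (A / (1 - \<rho>)) * (ennreal (D \<sigma>) + ennreal (D \<tau>) + ennreal (D \<sigma>) * ennreal (D \<tau>))"
      proof (rule mult_mono)
        have "(\<Sum>t<m. \<rho> ^ t) \<le> (\<Sum>t. \<rho> ^ t)" using \<rho> by (intro sum_le_suminf summable_geometric) auto
        also have "\<dots> = 1 / (1 - \<rho>)" using \<rho> by (intro suminf_geometric) auto
        finally have "A * (\<Sum>t<m. \<rho> ^ t) \<le> A / (1 - \<rho>)" using A by (auto dest: mult_left_mono)
        then show "(\<Sum>t<m. ennreal (A * \<rho> ^ t)) \<le> ennreal (A / (1 - \<rho>))"
          using A \<rho> by (simp add: sum_ennreal sum_distrib_left ennreal_leI)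
        have "(\<Sum>s<m. U s * W s) \<le> (\<Sum>s<m. U s * ennreal (D \<tau>))" by (intro sum_mono mult_left_mono W1) auto
        also have "\<dots> = (\<Sum>s<m. U s) * ennreal (D \<tau>)" by (simp add: sum_distrib_right)
        also have "\<dots> \<le> ennreal (D \<sigma>) * ennreal (D \<tau>)" by (intro mult_right_mono Us) auto
        finally show "(\<Sum>s<m. U s + W s + U s * W s) \<le> ennreal (D \<sigma>) + ennreal (D \<tau>) + ennreal (D \<sigma>) * ennreal (D \<tau>)"
          using Us Ws by (simp add: sum.distrib add_mono)
      qed auto
      also have "\<dots> = ennreal (A / (1 - \<rho>) * (D \<sigma> + D \<tau> * D \<sigma> + D \<tau>))"
        using A \<rho> D0 by (subst ennreal_mult) (auto simp: ennreal_mult ennreal_plus ac_simps)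
      also have "\<dots> \<le> ennreal C" by (intro ennreal_leI) (simp add: C_def)
      finally show "(\<integral>\<^sup>+x. \<integral>\<^sup>+y. ennreal (\<Sum>s<m. \<Sum>t<m. 2 powr (- (\<sigma> + \<tau> - 1) * real s) * 2 powr (- r * real t) * k s t x y)
            * ennreal (h y powr \<sigma>) * ennreal (g x powr \<tau>) \<partial>N \<partial>N) \<le> ennreal C" .
    qed
  qed
qed

lemma nn_integral_bilinear_cmult:
  assumes N: "sigma_finite_measure N" and K: "(\<lambda>(x, y). K x y) \<in> borel_measurable (N \<Otimes>\<^sub>M N)"
    and [measurable]: "a \<in> borel_measurable N" "b \<in> borel_measurable N"
  shows "(\<integral>\<^sup>+x. \<integral>\<^sup>+y. K x y * c * a y * b x \<partial>N \<partial>N) = c * (\<integral>\<^sup>+x. \<integral>\<^sup>+y. K x y * a y * b x \<partial>N \<partial>N)"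
proof -
  interpret sigma_finite_measure N by fact
  have K1 [measurable]: "K x \<in> borel_measurable N" if "x \<in> space N" for x
    using measurable_compose[OF measurable_Pair1'[OF that] K] by simp
  have K2 [measurable]: "(\<lambda>p. K (fst p) (snd p)) \<in> borel_measurable (N \<Otimes>\<^sub>M N)"
    using K by (simp add: case_prod_beta)
  have "(\<integral>\<^sup>+x. \<integral>\<^sup>+y. K x y * c * a y * b x \<partial>N \<partial>N) = (\<integral>\<^sup>+x. c * (\<integral>\<^sup>+y. K x y * a y * b x \<partial>N) \<partial>N)"
  proof (intro nn_integral_cong)
    fix x assume x: "x \<in> space N"
    note K1[OF x, measurable]
    have "(\<integral>\<^sup>+y. K x y * c * a y * b x \<partial>N) = (\<integral>\<^sup>+y. c * (K x y * a y * b x) \<partial>N)"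
      by (intro nn_integral_cong) (simp add: mult_ac)
    then show "(\<integral>\<^sup>+y. K x y * c * a y * b x \<partial>N) = c * (\<integral>\<^sup>+y. K x y * a y * b x \<partial>N)"
      by (simp add: nn_integral_cmult)
  qed
  also have "\<dots> = c * (\<integral>\<^sup>+x. \<integral>\<^sup>+y. K x y * a y * b x \<partial>N \<partial>N)"
    by (intro nn_integral_cmult borel_measurable_nn_integral) (simp add: case_prod_beta)
  finally show ?thesis .
qed

text \<open>
  Integrating one pair of coordinates out with the one-dimensional inequality replaces \<open>H\<close> and \<open>G\<close> by
  their marginals \<open>H'\<close> and \<open>G'\<close>, again raised to the powers \<open>\<sigma>\<close> and \<open>\<tau>\<close>, so that the induction hypothesis
  applies. No summation over tensor blocks takes place, and this is why the constant depends on
  the number of coordinates only.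
\<close>

lemma HLS_bound_PiM:
  fixes N :: "'a measure" and I :: "'i set"
  assumes N: "sigma_finite_measure N"
    and K [measurable]: "(\<lambda>(x, y). K x y) \<in> borel_measurable (N \<Otimes>\<^sub>M N)"
    and B: "HLS_bound N K \<sigma> \<tau> C"
    and I: "finite I"
  shows "HLS_bound (Pi\<^sub>M I (\<lambda>_. N)) (\<lambda>x y. \<Prod>i\<in>I. K (x i) (y i)) \<sigma> \<tau> (C ^ card I)"
  using I
proof (induction I rule: finite_induct)
  case empty
  then show ?case by (simp add: HLS_bound_def PiM_empty nn_integral_count_space_finite)
next
  case (insert i I)
  interpret N: sigma_finite_measure N by fact
  interpret product_sigma_finite "\<lambda>_::'i. N" by (intro product_sigma_finite.intro N)
  interpret I: finite_product_sigma_finite "\<lambda>_::'i. N" I using insert by unfold_locales auto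
  let ?P = "Pi\<^sub>M I (\<lambda>_::'i. N)" and ?PI = "Pi\<^sub>M (insert i I) (\<lambda>_::'i. N)"
  interpret PI: finite_product_sigma_finite "\<lambda>_::'i. N" "insert i I" using insert by unfold_locales auto
  interpret NP: pair_sigma_finite N ?P ..
  have K2 [measurable]: "(\<lambda>p. K (fst p) (snd p)) \<in> borel_measurable (N \<Otimes>\<^sub>M N)"
    using K by (simp add: case_prod_beta)
  have K3 [measurable]: "f \<in> M \<rightarrow>\<^sub>M N \<Longrightarrow> g \<in> M \<rightarrow>\<^sub>M N \<Longrightarrow> (\<lambda>x. K (f x) (g x)) \<in> borel_measurable M" for f g and M :: "'z measure"
    using measurable_compose[OF measurable_Pair K2, of f M g] by simp
  show ?case
    unfolding HLS_bound_def
  proof (intro allI impI)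
    fix H G :: "('i \<Rightarrow> 'a) \<Rightarrow> ennreal"
    assume H [measurable]: "H \<in> borel_measurable (Pi\<^sub>M (insert i I) (\<lambda>_. N))"
      and G [measurable]: "G \<in> borel_measurable (Pi\<^sub>M (insert i I) (\<lambda>_. N))"
    let ?K = "\<lambda>x y. \<Prod>j\<in>I. K (x j) (y j)"
    have upd: "(\<Prod>j\<in>insert i I. K ((x(i := \<xi>)) j) ((y(i := \<eta>)) j)) = K \<xi> \<eta> * ?K x y" for x y \<xi> \<eta>
    proof -
      have "(\<Prod>j\<in>I. K ((x(i := \<xi>)) j) ((y(i := \<eta>)) j)) = ?K x y"
        using insert by (intro prod.cong) auto
      then show ?thesis using insert by simp
    qed
    have mH [measurable]: "(\<lambda>p. H ((fst p)(i := snd p))) \<in> borel_measurable (?P \<Otimes>\<^sub>M N)"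
      and mG [measurable]: "(\<lambda>p. G ((fst p)(i := snd p))) \<in> borel_measurable (?P \<Otimes>\<^sub>M N)"
      using measurable_compose[OF measurable_add_dim H]
            measurable_compose[OF measurable_add_dim G]
      by (simp_all add: case_prod_beta)
    have mH' [measurable]: "f \<in> M \<rightarrow>\<^sub>M ?P \<Longrightarrow> g \<in> M \<rightarrow>\<^sub>M N \<Longrightarrow> (\<lambda>x. H ((f x)(i := g x))) \<in> borel_measurable M"
      and mG' [measurable]: "f \<in> M \<rightarrow>\<^sub>M ?P \<Longrightarrow> g \<in> M \<rightarrow>\<^sub>M N \<Longrightarrow> (\<lambda>x. G ((f x)(i := g x))) \<in> borel_measurable M"
      for f g and M :: "'z measure"
      using measurable_compose[OF measurable_Pair mH, of f M g] measurable_compose[OF measurable_Pair mG, of f M g] by simp_all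
    have Hy: "(\<lambda>\<eta>. H (y(i := \<eta>))) \<in> borel_measurable N" if "y \<in> space ?P" for y
      using measurable_compose[OF measurable_Pair1'[OF that] mH] by simp
    have Gx: "(\<lambda>\<xi>. G (x(i := \<xi>))) \<in> borel_measurable N" if "x \<in> space ?P" for x
      using measurable_compose[OF measurable_Pair1'[OF that] mG] by simp
    define H' where "H' y = (\<integral>\<^sup>+\<eta>. H (y(i := \<eta>)) \<partial>N)" for y
    define G' where "G' x = (\<integral>\<^sup>+\<xi>. G (x(i := \<xi>)) \<partial>N)" for x
    have [measurable]: "H' \<in> borel_measurable ?P" "G' \<in> borel_measurable ?P"
      unfolding H'_def G'_def by measurable
    let ?F = "\<lambda>x y. (\<Prod>j\<in>insert i I. K (x j) (y j)) * epow (H y) \<sigma> * epow (G x) \<tau>"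
    have mF [measurable]: "(\<lambda>p. ?F (fst p) (snd p)) \<in> borel_measurable (?PI \<Otimes>\<^sub>M ?PI)"
      by measurable
    have "(\<integral>\<^sup>+x. \<integral>\<^sup>+y. (\<Prod>j\<in>insert i I. K (x j) (y j)) * epow (H y) \<sigma> * epow (G x) \<tau> \<partial>Pi\<^sub>M (insert i I) (\<lambda>_. N) \<partial>Pi\<^sub>M (insert i I) (\<lambda>_. N))
        = (\<integral>\<^sup>+x. \<integral>\<^sup>+\<xi>. \<integral>\<^sup>+y. \<integral>\<^sup>+\<eta>. K \<xi> \<eta> * ?K x y * epow (H (y(i := \<eta>))) \<sigma> * epow (G (x(i := \<xi>))) \<tau> \<partial>N \<partial>?P \<partial>N \<partial>?P)"
    proof -
      have mF1: "(\<lambda>y. ?F x y) \<in> borel_measurable ?PI" if "x \<in> space ?PI" for x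
        using measurable_compose[OF measurable_Pair1'[OF that] mF] by simp
      have sp: "x(i := \<xi>) \<in> space ?PI" if "x \<in> space ?P" "\<xi> \<in> space N" for x \<xi>
        using that by (auto simp: space_PiM PiE_def Pi_def extensional_def)
      have "(\<integral>\<^sup>+x. \<integral>\<^sup>+y. ?F x y \<partial>?PI \<partial>?PI) = (\<integral>\<^sup>+x. \<integral>\<^sup>+\<xi>. \<integral>\<^sup>+y. ?F (x(i := \<xi>)) y \<partial>?PI \<partial>N \<partial>?P)"
        using insert by (intro product_nn_integral_insert) auto
      also have "\<dots> = (\<integral>\<^sup>+x. \<integral>\<^sup>+\<xi>. \<integral>\<^sup>+y. \<integral>\<^sup>+\<eta>. ?F (x(i := \<xi>)) (y(i := \<eta>)) \<partial>N \<partial>?P \<partial>N \<partial>?P)"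
        using insert by (intro nn_integral_cong product_nn_integral_insert mF1 sp) auto
      finally show ?thesis unfolding upd .
    qed
    also have "\<dots> = (\<integral>\<^sup>+x. \<integral>\<^sup>+y. \<integral>\<^sup>+\<xi>. \<integral>\<^sup>+\<eta>. K \<xi> \<eta> * ?K x y * epow (H (y(i := \<eta>))) \<sigma> * epow (G (x(i := \<xi>))) \<tau> \<partial>N \<partial>N \<partial>?P \<partial>?P)"
    proof (intro nn_integral_cong NP.Fubini'[symmetric])
      fix x assume x: "x \<in> space ?P"
      have m1: "(\<lambda>p. x(i := fst (fst p))) \<in> (N \<Otimes>\<^sub>M ?P) \<Otimes>\<^sub>M N \<rightarrow>\<^sub>M ?PI"
        using measurable_compose[OF measurable_Pair[OF measurable_const[OF x] measurable_compose[OF measurable_fst measurable_fst]] measurable_add_dim]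
        by simp
      have m2: "(\<lambda>p. (snd (fst p))(i := snd p)) \<in> (N \<Otimes>\<^sub>M ?P) \<Otimes>\<^sub>M N \<rightarrow>\<^sub>M ?PI"
        using measurable_compose[OF measurable_Pair[OF measurable_compose[OF measurable_fst measurable_snd] measurable_snd] measurable_add_dim]
        by simp
      have "(\<lambda>p. ?F (x(i := fst (fst p))) ((snd (fst p))(i := snd p))) \<in> borel_measurable ((N \<Otimes>\<^sub>M ?P) \<Otimes>\<^sub>M N)"
        using measurable_compose[OF measurable_Pair[OF m1 m2] mF] by simp
      then show "(\<lambda>(\<xi>, y). \<integral>\<^sup>+\<eta>. K \<xi> \<eta> * ?K x y * epow (H (y(i := \<eta>))) \<sigma> * epow (G (x(i := \<xi>))) \<tau> \<partial>N) \<in> borel_measurable (N \<Otimes>\<^sub>M ?P)"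
        unfolding upd case_prod_beta by (intro N.borel_measurable_nn_integral) (simp add: case_prod_beta)
    qed
    also have "\<dots> = (\<integral>\<^sup>+x. \<integral>\<^sup>+y. ?K x y * (\<integral>\<^sup>+\<xi>. \<integral>\<^sup>+\<eta>. K \<xi> \<eta> * epow (H (y(i := \<eta>))) \<sigma> * epow (G (x(i := \<xi>))) \<tau> \<partial>N \<partial>N) \<partial>?P \<partial>?P)"
    proof (intro nn_integral_cong)
      fix x y assume [measurable]: "x \<in> space ?P" "y \<in> space ?P"
      show "(\<integral>\<^sup>+\<xi>. \<integral>\<^sup>+\<eta>. K \<xi> \<eta> * ?K x y * epow (H (y(i := \<eta>))) \<sigma> * epow (G (x(i := \<xi>))) \<tau> \<partial>N \<partial>N)
         = ?K x y * (\<integral>\<^sup>+\<xi>. \<integral>\<^sup>+\<eta>. K \<xi> \<eta> * epow (H (y(i := \<eta>))) \<sigma> * epow (G (x(i := \<xi>))) \<tau> \<partial>N \<partial>N)"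
        by (rule nn_integral_bilinear_cmult[OF N K, of "\<lambda>\<eta>. epow (H (y(i := \<eta>))) \<sigma>" "\<lambda>\<xi>. epow (G (x(i := \<xi>))) \<tau>"]) (simp_all only: epow_measurable Hy Gx \<open>x \<in> space ?P\<close> \<open>y \<in> space ?P\<close>)
    qed
    also have "\<dots> \<le> (\<integral>\<^sup>+x. \<integral>\<^sup>+y. ?K x y * (C * epow (H' y) \<sigma> * epow (G' x) \<tau>) \<partial>?P \<partial>?P)"
    proof (intro nn_integral_mono mult_left_mono)
      fix x y assume [measurable]: "x \<in> space ?P" "y \<in> space ?P"
      show "(\<integral>\<^sup>+\<xi>. \<integral>\<^sup>+\<eta>. K \<xi> \<eta> * epow (H (y(i := \<eta>))) \<sigma> * epow (G (x(i := \<xi>))) \<tau> \<partial>N \<partial>N) \<le> C * epow (H' y) \<sigma> * epow (G' x) \<tau>"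
        unfolding H'_def G'_def by (rule B[unfolded HLS_bound_def, rule_format, OF Hy Gx]) fact+
    qed simp
    also have "\<dots> = C * (\<integral>\<^sup>+x. \<integral>\<^sup>+y. ?K x y * epow (H' y) \<sigma> * epow (G' x) \<tau> \<partial>?P \<partial>?P)"
    proof -
      have KP: "(\<lambda>(x, y). ?K x y) \<in> borel_measurable (?P \<Otimes>\<^sub>M ?P)"
        unfolding case_prod_beta by measurable
      show ?thesis
        using nn_integral_bilinear_cmult[OF I.sigma_finite_measure_axioms KP, of "\<lambda>y. epow (H' y) \<sigma>" "\<lambda>x. epow (G' x) \<tau>" C]
        by (simp only: mult.assoc epow_measurable \<open>H' \<in> borel_measurable ?P\<close> \<open>G' \<in> borel_measurable ?P\<close>)
    qed
    also have "\<dots> \<le> C * (C ^ card I * epow (\<integral>\<^sup>+y. H' y \<partial>?P) \<sigma> * epow (\<integral>\<^sup>+x. G' x \<partial>?P) \<tau>)"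
      by (intro mult_left_mono insert.IH[unfolded HLS_bound_def, rule_format]) auto
    also have "(\<integral>\<^sup>+y. H' y \<partial>?P) = (\<integral>\<^sup>+y. H y \<partial>Pi\<^sub>M (insert i I) (\<lambda>_. N))"
      unfolding H'_def using insert by (simp add: product_nn_integral_insert)
    also have "(\<integral>\<^sup>+x. G' x \<partial>?P) = (\<integral>\<^sup>+x. G x \<partial>Pi\<^sub>M (insert i I) (\<lambda>_. N))"
      unfolding G'_def using insert by (simp add: product_nn_integral_insert)
    finally show "(\<integral>\<^sup>+x. \<integral>\<^sup>+y. (\<Prod>j\<in>insert i I. K (x j) (y j)) * epow (H y) \<sigma> * epow (G x) \<tau> \<partial>Pi\<^sub>M (insert i I) (\<lambda>_. N) \<partial>Pi\<^sub>M (insert i I) (\<lambda>_. N))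
       \<le> C ^ card (insert i I) * epow (\<integral>\<^sup>+y. H y \<partial>Pi\<^sub>M (insert i I) (\<lambda>_. N)) \<sigma> * epow (\<integral>\<^sup>+x. G x \<partial>Pi\<^sub>M (insert i I) (\<lambda>_. N)) \<tau>"
      using insert by (simp add: mult_ac)
  qed
qed

section \<open>Trigonometric polynomials with small discrete averages\<close>

definition ee :: "real \<Rightarrow> complex" where
  "ee t = cis (2 * pi * t)"

lemma ee_0 [simp]: "ee 0 = 1"
  by (simp add: ee_def)

lemma ee_add: "ee (a + b) = ee a * ee b"
  by (simp add: ee_def cis_mult algebra_simps)

lemma norm_ee [simp]: "norm (ee t) = 1"
  by (simp add: ee_def)

lemma cnj_ee: "cnj (ee t) = ee (- t)"
  by (simp add: ee_def cis_cnj)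

lemma ee_of_int [simp]: "ee (of_int n) = 1"
  unfolding ee_def by (rule cis_multiple_2pi) simp

lemma ee_power: "ee t ^ n = ee (real n * t)"
  by (induction n) (simp_all add: ee_add[symmetric] algebra_simps)

lemma ee_eq_1_iff: "ee t = 1 \<longleftrightarrow> t \<in> \<int>"
proof
  assume "ee t = 1"
  then have "cos (2 * pi * t) = 1" by (simp add: ee_def complex_eq_iff)
  then obtain n where "2 * pi * t = real_of_int n * 2 * pi" by (auto simp: cos_one_2pi_int)
  then show "t \<in> \<int>" by (auto simp: Ints_def)
qed (auto elim!: Ints_cases)

lemma continuous_on_ee [continuous_intros]:
  "continuous_on S f \<Longrightarrow> continuous_on S (\<lambda>x. ee (f x))"
  unfolding ee_def by (intro continuous_intros)

lemma sum_ee_roots: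
  assumes N: "0 < N"
  shows "(\<Sum>l<N. ee (of_int j * (x + real l / real N))) = (if int N dvd j then of_nat N * ee (of_int j * x) else 0)"
proof -
  define w where "w = ee (of_int j / real N)"
  have "ee (of_int j * (x + real l / real N)) = ee (of_int j * x) * w ^ l" for l
    by (simp add: w_def ee_power ee_add[symmetric] algebra_simps)
  then have eq: "(\<Sum>l<N. ee (of_int j * (x + real l / real N))) = ee (of_int j * x) * (\<Sum>l<N. w ^ l)"
    by (simp add: sum_distrib_left)
  have wN: "w ^ N = 1" using N by (simp add: w_def ee_power)
  show ?thesis
  proof (cases "int N dvd j")
    case True
    then obtain m where "j = int N * m" by blast
    then have "of_int j / real N = of_int m" using N by simp
    then have "w = 1" by (simp add: w_def)
    then show ?thesis using True eq by simp
  next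
    case False
    have "w \<noteq> 1"
    proof
      assume "w = 1"
      then obtain m where "of_int j / real N = of_int m" by (auto simp: w_def ee_eq_1_iff elim!: Ints_cases)
      then have "real_of_int j = of_int (int N * m)" using N by (simp add: field_simps)
      then have "j = int N * m" by (simp only: of_int_eq_iff)
      with False show False by simp
    qed
    then have "(\<Sum>l<N. w ^ l) = 0" using geometric_sum[of w N] wN by simp
    then show ?thesis using False eq by simp
  qed
qed

definition trig :: "int set \<Rightarrow> (int \<Rightarrow> complex) \<Rightarrow> real \<Rightarrow> complex" where
  "trig A c x = (\<Sum>k\<in>A. c k * ee (of_int k * x))"

lemma trig_add_of_int [simp]: "trig A c (x + of_int n) = trig A c x"
  unfolding trig_def
proof (rule sum.cong[OF refl])
  fix k
  have "ee (of_int k * (x + of_int n)) = ee (of_int k * x) * ee (of_int (k * n))"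
    by (simp add: ee_add[symmetric] algebra_simps)
  then show "c k * ee (of_int k * (x + of_int n)) = c k * ee (of_int k * x)"
    by (simp only: ee_of_int mult_1_right)
qed

text \<open>
  The frequencies of a window of length \<open>N\<close> are pairwise incongruent modulo \<open>N\<close>, so the exponentials are
  orthogonal on \<open>N\<close> equidistant nodes.
\<close>

lemma discrete_Parseval:
  assumes N: "0 < N"
  shows "(\<Sum>l<N. (norm (trig {a<..a + int N} c (x + real l / real N)))\<^sup>2) = real N * (\<Sum>k\<in>{a<..a + int N}. (norm (c k))\<^sup>2)"
proof -
  let ?A = "{a<..a + int N}" and ?x = "\<lambda>l. x + real l / real N"
  have "complex_of_real (\<Sum>l<N. (norm (trig ?A c (?x l)))\<^sup>2)
      = (\<Sum>l<N. \<Sum>k\<in>?A. \<Sum>j\<in>?A. c k * cnj (c j) * ee (of_int (k - j) * ?x l))"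
  proof -
    have "complex_of_real ((norm (trig ?A c (?x l)))\<^sup>2) = (\<Sum>k\<in>?A. \<Sum>j\<in>?A. c k * cnj (c j) * ee (of_int (k - j) * ?x l))" for l
    proof -
      have "complex_of_real ((norm (trig ?A c (?x l)))\<^sup>2) = trig ?A c (?x l) * cnj (trig ?A c (?x l))"
        by (rule complex_norm_square)
      also have "\<dots> = (\<Sum>k\<in>?A. \<Sum>j\<in>?A. (c k * ee (of_int k * ?x l)) * (cnj (c j) * ee (- (of_int j * ?x l))))"
        by (simp add: trig_def sum_product cnj_ee)
      also have "\<dots> = (\<Sum>k\<in>?A. \<Sum>j\<in>?A. c k * cnj (c j) * ee (of_int (k - j) * ?x l))"
      proof (intro sum.cong refl)
        fix k j
        have "ee (of_int (k - j) * ?x l) = ee (of_int k * ?x l) * ee (- (of_int j * ?x l))"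
          by (simp only: ee_add[symmetric]) (simp add: left_diff_distrib)
        then show "(c k * ee (of_int k * ?x l)) * (cnj (c j) * ee (- (of_int j * ?x l))) = c k * cnj (c j) * ee (of_int (k - j) * ?x l)"
          by (simp only: mult_ac)
      qed
      finally show ?thesis .
    qed
    then show ?thesis by simp
  qed
  also have "\<dots> = (\<Sum>k\<in>?A. \<Sum>j\<in>?A. c k * cnj (c j) * (\<Sum>l<N. ee (of_int (k - j) * ?x l)))"
    unfolding sum_distrib_left by (subst sum.swap, rule sum.cong[OF refl], rule sum.swap)
  also have "\<dots> = (\<Sum>k\<in>?A. \<Sum>j\<in>?A. if j = k then of_nat N * (c k * cnj (c k)) else 0)"
  proof (intro sum.cong refl)
    fix k j assume kj: "k \<in> ?A" "j \<in> ?A"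
    have "int N dvd (k - j) \<longleftrightarrow> j = k"
    proof
      assume "int N dvd (k - j)"
      then have "k mod int N = j mod int N" by (simp add: mod_eq_dvd_iff)
      moreover have "\<bar>k - j\<bar> < int N" using kj by auto
      ultimately show "j = k" by (metis \<open>int N dvd k - j\<close> dvd_imp_le_int eq_iff_diff_eq_0 linorder_not_le abs_of_nat)
    qed simp
    then show "c k * cnj (c j) * (\<Sum>l<N. ee (of_int (k - j) * ?x l)) = (if j = k then of_nat N * (c k * cnj (c k)) else 0)"
      unfolding sum_ee_roots[OF N] by simp
  qed
  also have "\<dots> = complex_of_real (real N * (\<Sum>k\<in>?A. (norm (c k))\<^sup>2))"
    unfolding of_real_mult of_real_sum complex_norm_square sum_distrib_left by simp
  finally show ?thesis by (simp only: of_real_eq_iff)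
qed

text \<open>
  Shifting the nodes by whole steps permutes them modulo 1. This brings the first node into the
  first cell, after which the distances of the nodes to the integers are known.
\<close>

lemma sum_shift_periodic:
  fixes f :: "real \<Rightarrow> 'a::comm_monoid_add"
  assumes N: "0 < N" and per: "\<And>x n. f (x + of_int n) = f x"
  obtains \<delta> where "0 \<le> \<delta>" "\<delta> < 1 / real N" "(\<Sum>l<N. f (x + real l / real N)) = (\<Sum>l<N. f (\<delta> + real l / real N))"
proof -
  define m where "m = \<lfloor>x * real N\<rfloor>"
  define \<delta> where "\<delta> = x - of_int m / real N"
  have "of_int m \<le> x * real N" "x * real N < of_int m + 1" unfolding m_def by linarith+
  moreover have "\<delta> = (x * real N - of_int m) / real N" using N by (simp add: \<delta>_def field_simps)
  ultimately have \<delta>: "0 \<le> \<delta>" "\<delta> < 1 / real N" using N by (auto intro!: divide_strict_right_mono)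
  let ?r = "\<lambda>l. nat ((m + int l) mod int N)"
  have "f (x + real l / real N) = f (\<delta> + real (?r l) / real N)" for l
  proof -
    have r: "real (?r l) = of_int ((m + int l) mod int N)" using N by simp
    have "of_int (m + int l) = real_of_int ((m + int l) mod int N) + real N * of_int ((m + int l) div int N)"
      by (metis mod_mult_div_eq of_int_add of_int_mult of_int_of_nat_eq)
    then have "x + real l / real N = \<delta> + real (?r l) / real N + of_int ((m + int l) div int N)"
    proof -
      assume "of_int (m + int l) = real_of_int ((m + int l) mod int N) + real N * of_int ((m + int l) div int N)"
      then have "(real_of_int m + real l) / real N = (real_of_int ((m + int l) mod int N) + real N * of_int ((m + int l) div int N)) / real N"
        by simp
      then show ?thesis unfolding r \<delta>_def using N by (simp add: add_divide_distrib)
    qed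
    then show ?thesis using per by simp
  qed
  then have "(\<Sum>l<N. f (x + real l / real N)) = (\<Sum>l<N. f (\<delta> + real (?r l) / real N))" by simp
  also have "\<dots> = (\<Sum>l<N. f (\<delta> + real l / real N))"
  proof (rule sum.reindex_bij_betw[of ?r "{..<N}" "{..<N}" "\<lambda>l. f (\<delta> + real l / real N)"])
    have "inj_on ?r {..<N}"
    proof (rule inj_onI)
      fix k l assume "k \<in> {..<N}" "l \<in> {..<N}" "?r k = ?r l"
      then have "(m + int k) mod int N = (m + int l) mod int N" using N by (simp add: eq_nat_nat_iff)
      then have "int k mod int N = int l mod int N" by (metis add_diff_cancel_left' mod_diff_left_eq)
      then show "k = l" using \<open>k \<in> {..<N}\<close> \<open>l \<in> {..<N}\<close> by simp
    qed
    moreover have "?r ` {..<N} \<subseteq> {..<N}" using N by (auto simp: nat_less_iff)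
    ultimately show "bij_betw ?r {..<N} {..<N}"
      by (metis bij_betw_def card_image card_subset_eq finite_lessThan)
  qed
  finally show thesis using that \<delta> by blast
qed

text \<open>
  Concavity of the sine on \<open>[0, pi]\<close>, and symmetry about \<open>1 / 2\<close>.
\<close>

lemma sin_pi_ge:
  assumes "0 \<le> t" "t \<le> 1"
  shows "2 * min t (1 - t) \<le> sin (pi * t)"
proof -
  have conv: "convex_on {0..pi} (\<lambda>x. - sin x)"
    by (rule f''_ge0_imp_convex[where f' = "\<lambda>x. - cos x" and f'' = sin])
       (auto intro!: derivative_eq_intros sin_ge_zero)
  have half: "2 * t \<le> sin (pi * t)" if "0 \<le> t" "t \<le> 1 / 2" for t
  proof -
    have "- sin ((1 - 2 * t) *\<^sub>R 0 + (2 * t) *\<^sub>R (pi / 2)) \<le> (1 - 2 * t) * (- sin 0) + (2 * t) * (- sin (pi / 2))"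
      using that by (intro convex_onD[OF conv]) auto
    then show ?thesis by (simp add: mult.commute)
  qed
  show ?thesis
  proof (cases "t \<le> 1 / 2")
    case True
    then show ?thesis using half[of t] assms by (simp add: min_def)
  next
    case False
    have "sin (pi * (1 - t)) = sin (pi * t)" by (simp add: right_diff_distrib sin_diff)
    then show ?thesis using half[of "1 - t"] assms False by (simp add: min_def)
  qed
qed

lemma norm_ee_minus_1: "norm (ee t - 1) = 2 * \<bar>sin (pi * t)\<bar>"
proof -
  have "(norm (ee t - 1))\<^sup>2 = (cos (2 * (pi * t)) - 1)\<^sup>2 + (sin (2 * (pi * t)))\<^sup>2"
    by (simp add: ee_def cmod_power2 mult.assoc)
  also have "\<dots> = 2 - 2 * cos (2 * (pi * t))"
    using sin_cos_squared_add[of "2 * (pi * t)"] by (simp add: power2_eq_square algebra_simps)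
  also have "\<dots> = (2 * \<bar>sin (pi * t)\<bar>)\<^sup>2"
    unfolding cos_double_sin by (simp add: power_mult_distrib)
  finally show ?thesis by (rule power2_eq_imp_eq) auto
qed

text \<open>
  The \<open>l\<close>-th node has distance at least \<open>min l (N - 1 - l) / N\<close> to the integers, so the sum is
  dominated by two copies of \<open>\<Sum>l. 1 / (1 + l\<^sup>2)\<close>, each of which is at most 3.
\<close>

lemma sum_inverse_weight_le:
  assumes N: "0 < N"
  shows "(\<Sum>l<N. 1 / (1 + (real N)\<^sup>2 * (norm (ee (x + real l / real N) - 1))\<^sup>2)) \<le> 6"
proof -
  have per: "ee (y + of_int n) = ee y" for y n by (simp add: ee_add)
  obtain \<delta> where \<delta>: "0 \<le> \<delta>" "\<delta> < 1 / real N"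
    and eq: "(\<Sum>l<N. 1 / (1 + (real N)\<^sup>2 * (norm (ee (x + real l / real N) - 1))\<^sup>2))
        = (\<Sum>l<N. 1 / (1 + (real N)\<^sup>2 * (norm (ee (\<delta> + real l / real N) - 1))\<^sup>2))"
    using sum_shift_periodic[OF N, of "\<lambda>y. 1 / (1 + (real N)\<^sup>2 * (norm (ee y - 1))\<^sup>2)" x] per by auto
  have tail: "(\<Sum>l<n. 1 / (1 + (real l)\<^sup>2)) \<le> 3" for n
  proof -
    have "(\<Sum>l<Suc m. 1 / (1 + (real l)\<^sup>2)) \<le> 3 - 2 / real (Suc m)" for m
    proof (induction m)
      case (Suc m)
      have "1 / (1 + (real (Suc m))\<^sup>2) \<le> 2 / real (Suc m) - 2 / real (Suc (Suc m))"
        by (simp add: divide_simps power2_eq_square) (simp add: algebra_simps)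
      with Suc show ?case by simp
    qed simp
    then have "(\<Sum>l<Suc n. 1 / (1 + (real l)\<^sup>2)) \<le> 3" by (rule order_trans) simp
    moreover have "(\<Sum>l<n. 1 / (1 + (real l)\<^sup>2)) \<le> (\<Sum>l<Suc n. 1 / (1 + (real l)\<^sup>2))" by simp
    ultimately show ?thesis by linarith
  qed
  have "(\<Sum>l<N. 1 / (1 + (real N)\<^sup>2 * (norm (ee (\<delta> + real l / real N) - 1))\<^sup>2))
     \<le> (\<Sum>l<N. 1 / (1 + (real l)\<^sup>2) + 1 / (1 + (real (N - 1 - l))\<^sup>2))"
  proof (rule sum_mono)
    fix l assume l: "l \<in> {..<N}"
    define t where "t = \<delta> + real l / real N"
    have "real l + 1 \<le> real N" using l by (simp flip: of_nat_Suc add: Suc_le_eq)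
    then have t: "0 \<le> t" "t \<le> 1" "real l \<le> real N * t" "real (N - 1 - l) \<le> real N * (1 - t)"
      using \<delta> N l by (auto simp: t_def field_simps of_nat_diff)
    define m where "m = min l (N - 1 - l)"
    have "real m \<le> real N * min t (1 - t)" using t N by (auto simp: m_def min_def)
    also have "\<dots> \<le> real N * (sin (pi * t) / 2)" using sin_pi_ge[OF t(1,2)] by (intro mult_left_mono) auto
    also have "\<dots> \<le> real N * norm (ee t - 1)"
      unfolding norm_ee_minus_1 by (intro mult_left_mono) (use abs_ge_self[of "sin (pi * t)"] in auto)
    finally have "(real m)\<^sup>2 \<le> (real N * norm (ee t - 1))\<^sup>2" by (intro power_mono) auto
    then have "1 / (1 + (real N)\<^sup>2 * (norm (ee t - 1))\<^sup>2) \<le> 1 / (1 + (real m)\<^sup>2)"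
      by (intro divide_left_mono) (auto simp: power_mult_distrib intro!: mult_pos_pos add_pos_nonneg)
    also have "\<dots> \<le> 1 / (1 + (real l)\<^sup>2) + 1 / (1 + (real (N - 1 - l))\<^sup>2)"
      unfolding m_def min_def by (simp del: of_nat_diff)
    finally show "1 / (1 + (real N)\<^sup>2 * (norm (ee (\<delta> + real l / real N) - 1))\<^sup>2)
       \<le> 1 / (1 + (real l)\<^sup>2) + 1 / (1 + (real (N - 1 - l))\<^sup>2)" by (simp add: t_def)
  qed
  also have "\<dots> = (\<Sum>l<N. 1 / (1 + (real l)\<^sup>2)) + (\<Sum>l<N. 1 / (1 + (real l)\<^sup>2))"
    unfolding sum.distrib by (subst (2) sum.nat_diff_reindex[symmetric]) simp
  also have "\<dots> \<le> 6" using tail[of N] by simp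
  finally show ?thesis using eq by simp
qed

text \<open>
  Cauchy-Schwarz with the weight \<open>w = 1 + N\<^sup>2 * \<bar>ee - 1\<bar>\<^sup>2\<close>. Multiplying the polynomial by \<open>ee - 1\<close> takes
  differences of its coefficients, so by Parseval the weighted square sum is controlled by the bounds
  on the coefficients and on their differences, while the sum of \<open>1 / w\<close> is bounded.
\<close>

lemma discrete_L1_bound:
  assumes N: "0 < N" and supp: "\<And>k. k \<le> a \<or> a + int N \<le> k \<Longrightarrow> c k = 0"
    and L: "\<And>k. norm (c k) \<le> L" and b: "\<And>k. norm (c k - c (k - 1)) \<le> b * L / real N"
  shows "(\<Sum>l<N. norm (trig {a<..<a + int N} c (x + real l / real N))) \<le> real N * L * sqrt (6 * (1 + b\<^sup>2))"
proof -
  let ?A = "{a<..a + int N}"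
  have L0: "0 \<le> L" using L[of 0] norm_ge_zero order_trans by blast
  define g where "g = trig ?A c"
  define x' where "x' l = x + real l / real N" for l
  define w where "w l = 1 + (real N)\<^sup>2 * (norm (ee (x' l) - 1))\<^sup>2" for l
  have w: "0 < w l" for l unfolding w_def by (intro add_pos_nonneg) auto
  have g_eq: "trig {a<..<a + int N} c y = g y" for y
    unfolding g_def trig_def using supp by (intro sum.mono_neutral_left) auto
  have diff: "(ee y - 1) * g y = trig ?A (\<lambda>k. c (k - 1) - c k) y" for y
  proof -
    have "ee y * g y = (\<Sum>k\<in>?A. c k * ee (of_int (k + 1) * y))"
      unfolding g_def trig_def sum_distrib_left
    proof (rule sum.cong[OF refl])
      fix k
      have "ee (of_int (k + 1) * y) = ee y * ee (of_int k * y)"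
        by (simp only: ee_add[symmetric]) (simp add: algebra_simps)
      then show "ee y * (c k * ee (of_int k * y)) = c k * ee (of_int (k + 1) * y)" by (simp only: mult_ac)
    qed
    also have "\<dots> = (\<Sum>k\<in>(\<lambda>k. k + 1) ` ?A. c (k - 1) * ee (of_int k * y))"
      by (subst sum.reindex) (auto simp: inj_on_def)
    also have "\<dots> = (\<Sum>k\<in>{a + 1<..a + int N}. c (k - 1) * ee (of_int k * y))"
    proof (intro sum.mono_neutral_right)
      show "{a + 1<..a + int N} \<subseteq> (\<lambda>k. k + 1) ` ?A"
      proof
        fix k assume "k \<in> {a + 1<..a + int N}"
        then have "k = (k - 1) + 1" "k - 1 \<in> ?A" by auto
        then show "k \<in> (\<lambda>k. k + 1) ` ?A" by (rule image_eqI)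
      qed
    qed (use supp in auto)
    also have "\<dots> = (\<Sum>k\<in>?A. c (k - 1) * ee (of_int k * y))"
      using supp by (intro sum.mono_neutral_left) auto
    finally show ?thesis by (simp add: trig_def g_def algebra_simps sum_subtractf)
  qed
  have s1: "(\<Sum>l<N. (norm (g (x' l)))\<^sup>2) \<le> (real N * L)\<^sup>2"
  proof -
    have "(\<Sum>l<N. (norm (g (x' l)))\<^sup>2) = real N * (\<Sum>k\<in>?A. (norm (c k))\<^sup>2)"
      unfolding g_def x'_def by (rule discrete_Parseval[OF N])
    also have "\<dots> \<le> real N * (\<Sum>k\<in>?A. L\<^sup>2)" by (intro mult_left_mono sum_mono power_mono L) auto
    also have "\<dots> = (real N * L)\<^sup>2" by (simp add: power2_eq_square)
    finally show ?thesis .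
  qed
  have s2: "(\<Sum>l<N. (norm ((ee (x' l) - 1) * g (x' l)))\<^sup>2) \<le> (b * L)\<^sup>2"
  proof -
    have "(\<Sum>l<N. (norm ((ee (x' l) - 1) * g (x' l)))\<^sup>2) = real N * (\<Sum>k\<in>?A. (norm (c (k - 1) - c k))\<^sup>2)"
      unfolding diff x'_def by (rule discrete_Parseval[OF N])
    also have "\<dots> \<le> real N * (\<Sum>k\<in>?A. (b * L / real N)\<^sup>2)"
      by (intro mult_left_mono sum_mono power_mono) (auto simp: norm_minus_commute b)
    also have "\<dots> = (b * L)\<^sup>2" using N by (simp add: power2_eq_square field_simps)
    finally show ?thesis .
  qed
  have gw: "(\<Sum>l<N. (norm (g (x' l)) * sqrt (w l))\<^sup>2) \<le> (real N * L)\<^sup>2 * (1 + b\<^sup>2)"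
  proof -
    have "(\<Sum>l<N. (norm (g (x' l)) * sqrt (w l))\<^sup>2)
       = (\<Sum>l<N. (norm (g (x' l)))\<^sup>2) + (real N)\<^sup>2 * (\<Sum>l<N. (norm ((ee (x' l) - 1) * g (x' l)))\<^sup>2)"
      unfolding sum_distrib_left sum.distrib[symmetric]
    proof (rule sum.cong[OF refl])
      fix l
      have "(norm (g (x' l)) * sqrt (w l))\<^sup>2 = (norm (g (x' l)))\<^sup>2 * w l"
        using w[of l] by (simp add: power_mult_distrib)
      then show "(norm (g (x' l)) * sqrt (w l))\<^sup>2 = (norm (g (x' l)))\<^sup>2 + (real N)\<^sup>2 * (norm ((ee (x' l) - 1) * g (x' l)))\<^sup>2"
        unfolding w_def norm_mult power_mult_distrib by (simp add: algebra_simps)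
    qed
    also have "\<dots> \<le> (real N * L)\<^sup>2 + (real N)\<^sup>2 * (b * L)\<^sup>2"
      by (intro add_mono mult_left_mono s1 s2) auto
    finally show ?thesis by (simp add: power_mult_distrib algebra_simps)
  qed
  have "(\<Sum>l<N. norm (g (x' l)))\<^sup>2 = (\<Sum>l<N. (norm (g (x' l)) * sqrt (w l)) * (1 / sqrt (w l)))\<^sup>2"
    using w by (simp add: less_imp_neq[OF w, symmetric])
  also have "\<dots> \<le> (\<Sum>l<N. (norm (g (x' l)) * sqrt (w l))\<^sup>2) * (\<Sum>l<N. (1 / sqrt (w l))\<^sup>2)"
    by (rule Cauchy_Schwarz_ineq_sum)
  also have "(\<Sum>l<N. (1 / sqrt (w l))\<^sup>2) = (\<Sum>l<N. 1 / w l)"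
    using w by (intro sum.cong refl) (simp add: power_divide less_imp_le)
  also have "(\<Sum>l<N. (norm (g (x' l)) * sqrt (w l))\<^sup>2) * (\<Sum>l<N. 1 / w l) \<le> (real N * L)\<^sup>2 * (1 + b\<^sup>2) * 6"
    using gw sum_inverse_weight_le[OF N, of x]
    by (intro mult_mono) (auto simp: w_def x'_def intro!: sum_nonneg)
  also have "\<dots> = (real N * L * sqrt (6 * (1 + b\<^sup>2)))\<^sup>2"
    by (simp add: power_mult_distrib)
  finally show ?thesis unfolding g_eq x'_def[symmetric]
    by (rule power2_le_imp_le) (use L0 in auto)
qed

text \<open>
  The trapezoid in \<open>k\<close> that is 1 for \<open>2 * \<bar>k\<bar> \<le> 2 ^ M\<close>, 0 for \<open>\<bar>k\<bar> \<ge> 2 ^ M\<close> and linear in between: the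
  multiplier of a de la Vallee Poussin kernel.
\<close>

definition hat :: "nat \<Rightarrow> int \<Rightarrow> real" where
  "hat M k = max 0 (min 1 (2 - 2 * \<bar>of_int k\<bar> / 2 ^ M))"

lemma hat_bounds: "0 \<le> hat M k" "hat M k \<le> 1"
  by (auto simp: hat_def)

lemma hat_eq_1: "2 * \<bar>k\<bar> \<le> 2 ^ M \<Longrightarrow> hat M k = 1"
proof -
  assume "2 * \<bar>k\<bar> \<le> 2 ^ M"
  then have "real_of_int (2 * \<bar>k\<bar>) \<le> real_of_int (2 ^ M)" by (simp only: of_int_le_iff)
  then have "2 * \<bar>real_of_int k\<bar> / 2 ^ M \<le> 1" by (simp add: divide_le_eq_1)
  then show ?thesis unfolding hat_def by linarith
qed

lemma hat_eq_0: "2 ^ M \<le> \<bar>k\<bar> \<Longrightarrow> hat M k = 0"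
proof -
  assume "2 ^ M \<le> \<bar>k\<bar>"
  then have "real_of_int (2 ^ M) \<le> real_of_int \<bar>k\<bar>" by (simp only: of_int_le_iff)
  then have "2 \<le> 2 * \<bar>real_of_int k\<bar> / 2 ^ M" by (simp add: le_divide_eq)
  then show ?thesis unfolding hat_def by linarith
qed

lemma hat_diff: "\<bar>hat M k - hat M (k - 1)\<bar> \<le> 2 / 2 ^ M"
proof -
  have clip: "\<bar>max 0 (min 1 x) - max 0 (min 1 y)\<bar> \<le> \<bar>x - y\<bar>" for x y :: real by (auto simp: min_def max_def)
  have "\<bar>hat M k - hat M (k - 1)\<bar> \<le> \<bar>(2 - 2 * \<bar>of_int k\<bar> / 2 ^ M) - (2 - 2 * \<bar>of_int (k - 1)\<bar> / 2 ^ M)\<bar>"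
    unfolding hat_def by (rule clip)
  also have "\<dots> = \<bar>2 * (\<bar>of_int (k - 1)\<bar> - \<bar>of_int k\<bar>) / 2 ^ M\<bar>"
    by (simp add: diff_divide_distrib right_diff_distrib)
  also have "\<dots> = 2 * \<bar>\<bar>of_int (k - 1)\<bar> - \<bar>of_int k\<bar>\<bar> / 2 ^ M"
    by (simp only: abs_divide abs_mult abs_numeral power_abs)
  also have "\<dots> \<le> 2 * 1 / 2 ^ M" by (intro divide_right_mono mult_left_mono) auto
  finally show ?thesis by simp
qed

lemma hat_mono: "hat M k \<le> hat (Suc M) k"
proof -
  have "2 - 2 * \<bar>of_int k\<bar> / 2 ^ M \<le> (2 - 2 * \<bar>of_int k\<bar> / 2 ^ Suc M :: real)"
    by (simp add: field_simps)
  then show ?thesis unfolding hat_def by (intro max.mono min.mono) auto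
qed

text \<open>
  A smooth dyadic piece of the sequence \<open>k powr \<rho>\<close>, living on \<open>2 ^ (i - 1) < k < 2 ^ (i + 1)\<close>. Only positive
  frequencies are kept; where negative ones are wanted they are added by complex conjugation.
\<close>

definition block_coeff :: "nat \<Rightarrow> real \<Rightarrow> int \<Rightarrow> real" where
  "block_coeff i \<rho> k = (if 0 < k then (hat (Suc i) k - hat i k) * of_int k powr \<rho> else 0)"

lemma block_coeff_eq_0: "k \<le> 0 \<or> 2 * k \<le> 2 ^ i \<or> 2 ^ Suc i \<le> k \<Longrightarrow> block_coeff i \<rho> k = 0"
  using hat_eq_1[of k i] hat_eq_1[of k "Suc i"] hat_eq_0[of i k] hat_eq_0[of "Suc i" k]
  by (auto simp: block_coeff_def)

lemma powr_Lipschitz_half_two: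
  fixes x y \<rho> :: real
  assumes "x \<in> {1/2..2}" "y \<in> {1/2..2}"
  shows "\<bar>x powr \<rho> - y powr \<rho>\<bar> \<le> \<bar>\<rho>\<bar> * 2 powr (\<bar>\<rho>\<bar> + 1) * \<bar>x - y\<bar>" "x powr \<rho> \<le> 2 powr \<bar>\<rho>\<bar>"
proof -
  have le: "z powr \<gamma> \<le> 2 powr \<bar>\<gamma>\<bar>" if "z \<in> {1/2..2}" for z \<gamma> :: real
  proof (cases "0 \<le> \<gamma>")
    case True
    then show ?thesis using that by (auto intro: powr_mono2)
  next
    case False
    have "z powr \<gamma> \<le> (1/2) powr \<gamma>" using that False by (intro powr_mono2') auto
    also have "\<dots> = 2 powr \<bar>\<gamma>\<bar>" using False by (simp add: powr_divide powr_minus_divide)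
    finally show ?thesis .
  qed
  show "x powr \<rho> \<le> 2 powr \<bar>\<rho>\<bar>" using le assms by blast
  have "norm (x powr \<rho> - y powr \<rho>) \<le> (\<bar>\<rho>\<bar> * 2 powr (\<bar>\<rho>\<bar> + 1)) * norm (x - y)"
  proof (rule field_differentiable_bound[where S = "{1/2..2}" and f' = "\<lambda>z. \<rho> * z powr (\<rho> - 1)"])
    fix z :: real assume z: "z \<in> {1/2..2}"
    then show "((\<lambda>z. z powr \<rho>) has_field_derivative \<rho> * z powr (\<rho> - 1)) (at z within {1/2..2})"
      by (intro DERIV_subset[OF has_real_derivative_powr]) auto
    have "z powr (\<rho> - 1) \<le> 2 powr \<bar>\<rho> - 1\<bar>" by (rule le[OF z])
    also have "\<dots> \<le> 2 powr (\<bar>\<rho>\<bar> + 1)" by (intro powr_mono) auto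
    finally show "norm (\<rho> * z powr (\<rho> - 1)) \<le> \<bar>\<rho>\<bar> * 2 powr (\<bar>\<rho>\<bar> + 1)"
      by (simp add: abs_mult mult_left_mono)
  qed (use assms in auto)
  then show "\<bar>x powr \<rho> - y powr \<rho>\<bar> \<le> \<bar>\<rho>\<bar> * 2 powr (\<bar>\<rho>\<bar> + 1) * \<bar>x - y\<bar>" by simp
qed

text \<open>
  Up to the factor \<open>2 powr (\<rho> * i)\<close> the coefficient is the product of a trapezoid difference and of
  \<open>(k / 2 ^ i) powr \<rho>\<close>. Both are Lipschitz functions of \<open>k / 2 ^ i\<close> on the interval \<open>[1/2, 2]\<close>.
\<close>

lemma block_coeff_bounds:
  fixes \<rho> :: real
  defines "L \<equiv> (\<lambda>i. 2 powr \<bar>\<rho>\<bar> * 2 powr (\<rho> * real i))"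
  shows "\<bar>block_coeff i \<rho> k\<bar> \<le> L i"
    and "\<bar>block_coeff i \<rho> k - block_coeff i \<rho> (k - 1)\<bar> \<le> (3 + 2 * \<bar>\<rho>\<bar>) * L i / 2 ^ i"
proof -
  \<comment> \<open>Clipping to \<open>[1/2, 2]\<close> changes nothing where the coefficient is nonzero.\<close>
  define z where "z k = max (1/2) (min 2 (real_of_int k / 2 ^ i))" for k
  define \<beta> where "\<beta> k = (if 0 < k then hat (Suc i) k - hat i k else 0)" for k
  have z: "z k \<in> {1/2..2}" for k by (auto simp: z_def)
  have rep: "block_coeff i \<rho> k = 2 powr (\<rho> * real i) * (\<beta> k * z k powr \<rho>)" for k
  proof (cases "k \<le> 0 \<or> 2 * k \<le> 2 ^ i \<or> 2 ^ Suc i \<le> k")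
    case True
    then have "block_coeff i \<rho> k = 0" by (rule block_coeff_eq_0)
    moreover from this have "\<beta> k = 0" by (auto simp: block_coeff_def \<beta>_def)
    ultimately show ?thesis by simp
  next
    case False
    then have k: "0 < k" "2 ^ i < 2 * k" "k < 2 ^ Suc i" by auto
    have "real_of_int (2 ^ i) < real_of_int (2 * k)" "real_of_int k < real_of_int (2 ^ Suc i)"
      using k by (simp_all only: of_int_less_iff)
    then have "z k = real_of_int k / 2 ^ i" by (simp add: z_def field_simps min_def max_def)
    moreover have "((2::real) ^ i) powr \<rho> = 2 powr (\<rho> * real i)"
      by (simp add: powr_realpow[symmetric] powr_powr mult.commute)
    ultimately show ?thesis using k by (simp add: block_coeff_def \<beta>_def powr_divide)
  qed
  have \<beta>: "0 \<le> \<beta> k" "\<beta> k \<le> 1" for k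
    using hat_mono[of i k] hat_bounds[of "Suc i" k] hat_bounds[of i k] by (auto simp: \<beta>_def)
  have d\<beta>: "\<bar>\<beta> k - \<beta> (k - 1)\<bar> \<le> 3 / 2 ^ i"
  proof (cases "k \<le> 0")
    case True
    then show ?thesis by (simp add: \<beta>_def)
  next
    case False
    have h0: "hat j 0 = 1" for j by (simp add: hat_eq_1)
    have eq: "\<beta> k = hat (Suc i) k - hat i k" "\<beta> (k - 1) = hat (Suc i) (k - 1) - hat i (k - 1)"
    proof -
      show "\<beta> k = hat (Suc i) k - hat i k" using False by (simp add: \<beta>_def)
      show "\<beta> (k - 1) = hat (Suc i) (k - 1) - hat i (k - 1)"
      proof (cases "k = 1")
        case True
        then show ?thesis by (simp add: \<beta>_def h0)
      qed (use False in \<open>simp add: \<beta>_def\<close>)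
    qed
    have "\<bar>\<beta> k - \<beta> (k - 1)\<bar> \<le> \<bar>hat (Suc i) k - hat (Suc i) (k - 1)\<bar> + \<bar>hat i k - hat i (k - 1)\<bar>"
      unfolding eq by linarith
    also have "\<dots> \<le> 2 / 2 ^ Suc i + 2 / 2 ^ i" by (intro add_mono hat_diff)
    also have "\<dots> = 3 / 2 ^ i" by simp
    finally show ?thesis .
  qed
  have zz: "\<bar>z k - z (k - 1)\<bar> \<le> 1 / 2 ^ i"
  proof -
    have "\<bar>max (1/2) (min 2 x) - max (1/2) (min 2 y)\<bar> \<le> \<bar>x - y\<bar>" for x y :: real by (auto simp: min_def max_def)
    then have "\<bar>z k - z (k - 1)\<bar> \<le> \<bar>real_of_int k / 2 ^ i - real_of_int (k - 1) / 2 ^ i\<bar>" unfolding z_def .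
    also have "\<dots> = 1 / 2 ^ i" by (simp add: diff_divide_distrib)
    finally show ?thesis .
  qed
  show "\<bar>block_coeff i \<rho> k\<bar> \<le> L i"
    using \<beta>[of k] mult_mono[OF \<beta>(2)[of k] powr_Lipschitz_half_two(2)[OF z[of k] z[of k], of \<rho>]]
    by (simp add: rep L_def abs_mult mult.commute mult_right_mono)
  have "\<bar>\<beta> k * z k powr \<rho> - \<beta> (k - 1) * z (k - 1) powr \<rho>\<bar>
      = \<bar>(\<beta> k - \<beta> (k - 1)) * z k powr \<rho> + \<beta> (k - 1) * (z k powr \<rho> - z (k - 1) powr \<rho>)\<bar>"
    by (simp add: algebra_simps)
  also have "\<dots> \<le> \<bar>\<beta> k - \<beta> (k - 1)\<bar> * z k powr \<rho> + \<beta> (k - 1) * \<bar>z k powr \<rho> - z (k - 1) powr \<rho>\<bar>"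
    using \<beta>[of "k - 1"] by (intro order_trans[OF abs_triangle_ineq]) (simp add: abs_mult)
  also have "\<dots> \<le> 3 / 2 ^ i * 2 powr \<bar>\<rho>\<bar> + 1 * (\<bar>\<rho>\<bar> * 2 powr (\<bar>\<rho>\<bar> + 1) * (1 / 2 ^ i))"
  proof (intro add_mono mult_mono)
    have "\<bar>z k powr \<rho> - z (k - 1) powr \<rho>\<bar> \<le> \<bar>\<rho>\<bar> * 2 powr (\<bar>\<rho>\<bar> + 1) * \<bar>z k - z (k - 1)\<bar>"
      by (rule powr_Lipschitz_half_two(1)[OF z z])
    also have "\<dots> \<le> \<bar>\<rho>\<bar> * 2 powr (\<bar>\<rho>\<bar> + 1) * (1 / 2 ^ i)" by (intro mult_left_mono zz) auto
    finally show "\<bar>z k powr \<rho> - z (k - 1) powr \<rho>\<bar> \<le> \<bar>\<rho>\<bar> * 2 powr (\<bar>\<rho>\<bar> + 1) * (1 / 2 ^ i)" .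
    show "z k powr \<rho> \<le> 2 powr \<bar>\<rho>\<bar>" by (rule powr_Lipschitz_half_two(2)[OF z z])
  qed (use \<beta> d\<beta> in auto)
  also have "\<dots> = (3 + 2 * \<bar>\<rho>\<bar>) * 2 powr \<bar>\<rho>\<bar> / 2 ^ i"
    by (simp add: powr_add field_simps)
  finally have main: "\<bar>\<beta> k * z k powr \<rho> - \<beta> (k - 1) * z (k - 1) powr \<rho>\<bar> \<le> (3 + 2 * \<bar>\<rho>\<bar>) * 2 powr \<bar>\<rho>\<bar> / 2 ^ i" .
  have "\<bar>block_coeff i \<rho> k - block_coeff i \<rho> (k - 1)\<bar>
      = 2 powr (\<rho> * real i) * \<bar>\<beta> k * z k powr \<rho> - \<beta> (k - 1) * z (k - 1) powr \<rho>\<bar>"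
    by (simp add: rep right_diff_distrib[symmetric] abs_mult)
  also have "\<dots> \<le> 2 powr (\<rho> * real i) * ((3 + 2 * \<bar>\<rho>\<bar>) * 2 powr \<bar>\<rho>\<bar> / 2 ^ i)" by (intro mult_left_mono main) auto
  finally show "\<bar>block_coeff i \<rho> k - block_coeff i \<rho> (k - 1)\<bar> \<le> (3 + 2 * \<bar>\<rho>\<bar>) * L i / 2 ^ i"
    by (simp add: L_def mult_ac)
qed

definition block :: "nat \<Rightarrow> real \<Rightarrow> real \<Rightarrow> complex" where
  "block i \<rho> x = trig {0<..<2 ^ Suc i} (\<lambda>k. of_real (block_coeff i \<rho> k)) x"

text \<open>
  The constant of \<open>discrete_L1_bound\<close> for \<open>N = 2 ^ (i + 3)\<close>, for which the difference bound
  \<open>(3 + 2 * \<bar>\<rho>\<bar>) / 2 ^ i\<close> reads \<open>8 * (3 + 2 * \<bar>\<rho>\<bar>) / N\<close>.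
\<close>

definition block_const :: "real \<Rightarrow> real" where
  "block_const \<rho> = 2 powr \<bar>\<rho>\<bar> * sqrt (6 * (1 + (8 * (3 + 2 * \<bar>\<rho>\<bar>))\<^sup>2))"

lemma block_const_pos: "0 < block_const \<rho>"
  unfolding block_const_def by (intro mult_pos_pos real_sqrt_gt_zero add_pos_nonneg) auto

lemma block_discrete_L1:
  "(\<Sum>l<2 ^ (i + 3). norm (block i \<rho> (x + real l / 2 ^ (i + 3)))) \<le> 2 ^ (i + 3) * (block_const \<rho> * 2 powr (\<rho> * real i))"
proof -
  let ?N = "2 ^ (i + 3) :: nat" and ?L = "2 powr \<bar>\<rho>\<bar> * 2 powr (\<rho> * real i)"
  have "trig {0<..<2 ^ Suc i} (\<lambda>k. of_real (block_coeff i \<rho> k)) y = trig {0<..<0 + int ?N} (\<lambda>k. complex_of_real (block_coeff i \<rho> k)) y" for y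
    unfolding trig_def
  proof (rule sum.mono_neutral_left)
    have "(2::int) ^ Suc i \<le> 2 ^ (i + 3)" by (intro power_increasing) auto
    then show "{0<..<2 ^ Suc i} \<subseteq> {0<..<0 + int ?N}" by auto
  qed (auto simp: block_coeff_eq_0)
  then have "(\<Sum>l<?N. norm (block i \<rho> (x + real l / real ?N)))
      = (\<Sum>l<?N. norm (trig {0<..<0 + int ?N} (\<lambda>k. complex_of_real (block_coeff i \<rho> k)) (x + real l / real ?N)))"
    by (simp add: block_def)
  also have "\<dots> \<le> real ?N * ?L * sqrt (6 * (1 + (8 * (3 + 2 * \<bar>\<rho>\<bar>))\<^sup>2))"
  proof (rule discrete_L1_bound)
    fix k :: int assume k: "k \<le> 0 \<or> 0 + int ?N \<le> k"
    have "(2::int) ^ Suc i \<le> 2 ^ (i + 3)" by (intro power_increasing) auto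
    with k have "k \<le> 0 \<or> 2 ^ Suc i \<le> k" by auto
    then show "complex_of_real (block_coeff i \<rho> k) = 0" using block_coeff_eq_0 by auto
  next
    fix k :: int
    show "norm (complex_of_real (block_coeff i \<rho> k)) \<le> ?L" using block_coeff_bounds(1) by simp
    have "norm (complex_of_real (block_coeff i \<rho> k) - complex_of_real (block_coeff i \<rho> (k - 1)))
        = \<bar>block_coeff i \<rho> k - block_coeff i \<rho> (k - 1)\<bar>"
      by (simp only: of_real_diff[symmetric] norm_of_real)
    also have "\<dots> \<le> (3 + 2 * \<bar>\<rho>\<bar>) * ?L / 2 ^ i" by (rule block_coeff_bounds(2))
    also have "\<dots> = 8 * (3 + 2 * \<bar>\<rho>\<bar>) * ?L / real ?N" by (simp add: power_add divide_simps)
    finally show "norm (complex_of_real (block_coeff i \<rho> k) - complex_of_real (block_coeff i \<rho> (k - 1)))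
        \<le> 8 * (3 + 2 * \<bar>\<rho>\<bar>) * ?L / real ?N" .
  qed simp
  finally show ?thesis by (simp add: block_const_def mult_ac)
qed

lemma norm_block_le: "norm (block i \<rho> x) \<le> 2 * block_const \<rho> * 2 powr (\<rho> * real i + real i)"
proof -
  have "norm (block i \<rho> x) \<le> (\<Sum>k\<in>{0<..<2 ^ Suc i :: int}. \<bar>block_coeff i \<rho> k\<bar>)"
    unfolding block_def trig_def by (rule order_trans[OF norm_sum]) (simp add: norm_mult)
  also have "\<dots> \<le> (\<Sum>k\<in>{0<..<2 ^ Suc i :: int}. 2 powr \<bar>\<rho>\<bar> * 2 powr (\<rho> * real i))"
    by (intro sum_mono block_coeff_bounds)
  also have "\<dots> \<le> (2 * 2 ^ i) * (2 powr \<bar>\<rho>\<bar> * 2 powr (\<rho> * real i))"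
    by (simp add: of_nat_diff mult_right_mono)
  also have "\<dots> = 2 * 2 powr \<bar>\<rho>\<bar> * 2 powr (\<rho> * real i + real i)"
    by (simp add: powr_add powr_realpow)
  also have "\<dots> \<le> 2 * block_const \<rho> * 2 powr (\<rho> * real i + real i)"
  proof (intro mult_right_mono mult_left_mono)
    have "1 \<le> sqrt (6 * (1 + (8 * (3 + 2 * \<bar>\<rho>\<bar>))\<^sup>2))" by (simp add: real_le_rsqrt)
    then show "2 powr \<bar>\<rho>\<bar> \<le> block_const \<rho>"
      unfolding block_const_def by (subst mult_le_cancel_left1) auto
  qed auto
  finally show ?thesis .
qed

lemma block_minus: "block i \<rho> (- x) = cnj (block i \<rho> x)"
  by (simp add: block_def trig_def cnj_ee)

lemma continuous_on_trig [continuous_intros]: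
  "continuous_on S f \<Longrightarrow> continuous_on S (\<lambda>x. trig A c (f x))"
  unfolding trig_def by (intro continuous_intros)

lemma continuous_on_block [continuous_intros]:
  "continuous_on S f \<Longrightarrow> continuous_on S (\<lambda>x. block i \<rho> (f x))"
  unfolding block_def by (intro continuous_intros)

section \<open>Integration over the unit cube\<close>

definition unit_M :: "real measure" where
  "unit_M = restrict_space lborel {0..1}"

definition cube_M :: "(real ^ 'd) measure" where
  "cube_M = restrict_space lborel (cbox 0 1)"

lemma space_unit_M [simp]: "space unit_M = {0..1}"
  by (simp add: unit_M_def space_restrict_space)

lemma space_cube_M [simp]: "space cube_M = cbox 0 1"
  by (simp add: cube_M_def space_restrict_space)

lemma measurable_unit_M: "f \<in> borel_measurable borel \<Longrightarrow> f \<in> borel_measurable unit_M"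
  by (simp add: unit_M_def measurable_restrict_space1)

lemma measurable_cube_M:
  fixes f :: "real ^ 'd \<Rightarrow> 'b::topological_space"
  shows "f \<in> borel_measurable borel \<Longrightarrow> f \<in> borel_measurable cube_M"
  by (simp add: cube_M_def measurable_restrict_space1)

lemma emeasure_unit_M: "emeasure unit_M {0..1} = 1"
  by (simp add: unit_M_def emeasure_restrict_space)

lemma emeasure_cube_M: "emeasure (cube_M :: (real ^ 'd) measure) (cbox 0 1) = 1"
proof -
  have B: "(0 :: real ^ 'd) \<bullet> b \<le> 1 \<bullet> b" "(1 - 0 :: real ^ 'd) \<bullet> b = 1" if "b \<in> Basis" for b
    using that by (auto simp: Basis_vec_def inner_axis)
  have "emeasure lborel (cbox 0 1 :: (real ^ 'd) set) = ennreal (\<Prod>b\<in>(Basis :: (real ^ 'd) set). (1 - 0) \<bullet> b)"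
    using B(1) by (rule emeasure_lborel_cbox)
  also have "(\<Prod>b\<in>(Basis :: (real ^ 'd) set). (1 - 0 :: real ^ 'd) \<bullet> b) = 1"
    by (rule prod.neutral) (use B(2) in blast)
  finally show ?thesis by (simp add: cube_M_def emeasure_restrict_space)
qed

lemma finite_measure_unit_M: "finite_measure unit_M"
  by (rule finite_measureI) (simp add: emeasure_unit_M)

lemma finite_measure_cube_M: "finite_measure (cube_M :: (real ^ 'd) measure)"
  by (rule finite_measureI) (simp add: emeasure_cube_M)

lemma sigma_finite_unit_M: "sigma_finite_measure unit_M"
  using finite_measure.axioms(1)[OF finite_measure_unit_M] .

lemma sigma_finite_cube_M: "sigma_finite_measure (cube_M :: (real ^ 'd) measure)"
  using finite_measure.axioms(1)[OF finite_measure_cube_M] .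

lemma nn_integral_cube_lborel:
  fixes f :: "real ^ 'd \<Rightarrow> ennreal"
  shows "(\<integral>\<^sup>+x\<in>cbox 0 1. f x \<partial>lborel) = (\<integral>\<^sup>+x. f x \<partial>cube_M)"
  unfolding cube_M_def by (subst nn_integral_restrict_space) auto

lemma set_integral_cube_lborel:
  fixes f :: "real ^ 'd \<Rightarrow> complex"
  shows "(LINT x:cbox 0 1|lborel. f x) = (LINT x|cube_M. f x)"
  unfolding cube_M_def set_lebesgue_integral_def by (subst integral_restrict_space) auto

lemma measurable_vec_lambda_PiM:
  "(vec_lambda :: ('d \<Rightarrow> real) \<Rightarrow> real ^ 'd) \<in> (Pi\<^sub>M UNIV (\<lambda>_. lborel)) \<rightarrow>\<^sub>M borel"
proof (subst borel_measurable_euclidean_space, rule ballI)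
  fix b :: "real ^ 'd" assume "b \<in> Basis"
  then obtain i where b: "b = axis i 1" by (auto simp: Basis_vec_def)
  have eq: "(\<lambda>x. vec_lambda x \<bullet> b) = (\<lambda>x. x i)" unfolding b by (rule ext) (simp add: inner_axis)
  have "(\<lambda>x. x i) \<in> Pi\<^sub>M UNIV (\<lambda>_::'d. lborel :: real measure) \<rightarrow>\<^sub>M lborel"
    by (rule measurable_component_singleton) simp
  then show "(\<lambda>x. vec_lambda x \<bullet> b) \<in> borel_measurable (Pi\<^sub>M UNIV (\<lambda>_. lborel))"
    unfolding eq by (simp only: measurable_lborel1)
qed

lemma prod_Basis_vec: "(\<Prod>b\<in>(Basis :: (real ^ 'd) set). F (x \<bullet> b)) = (\<Prod>i\<in>UNIV. F (x $ i))"
proof -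
  have B: "(Basis :: (real ^ 'd) set) = (\<lambda>i. axis i 1) ` UNIV" by (auto simp: Basis_vec_def)
  show ?thesis unfolding B by (subst prod.reindex) (auto simp: inj_on_def axis_eq_axis inner_axis)
qed

text \<open>
  Lebesgue measure on \<open>real ^ 'd\<close> is a product measure over the standard basis; here the basis is
  replaced by the index type, so that Fubini can be applied coordinate by coordinate.
\<close>

lemma lborel_vec_eq_PiM:
  "(lborel :: (real ^ 'd) measure) = distr (Pi\<^sub>M UNIV (\<lambda>_. lborel)) borel vec_lambda"
proof (rule lborel_eqI)
  interpret product_sigma_finite "\<lambda>_::'d. lborel :: real measure"
    by (intro product_sigma_finite.intro lborel.sigma_finite_measure_axioms)
  fix l u :: "real ^ 'd" assume le: "\<And>b. b \<in> Basis \<Longrightarrow> l \<bullet> b \<le> u \<bullet> b"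
  then have le': "l $ i \<le> u $ i" for i using le[of "axis i 1"] by (auto simp: inner_axis Basis_vec_def)
  have "vec_lambda -` box l u \<inter> space (Pi\<^sub>M UNIV (\<lambda>_::'d. lborel)) = Pi\<^sub>E UNIV (\<lambda>i. {l $ i<..<u $ i})"
    by (auto simp: space_PiM mem_box_cart PiE_iff)
  then have "emeasure (distr (Pi\<^sub>M UNIV (\<lambda>_. lborel)) borel vec_lambda) (box l u)
      = emeasure (Pi\<^sub>M UNIV (\<lambda>_::'d. lborel)) (Pi\<^sub>E UNIV (\<lambda>i. {l $ i<..<u $ i}))"
    by (subst emeasure_distr) (auto intro: measurable_vec_lambda_PiM)
  also have "\<dots> = (\<Prod>i\<in>UNIV. ennreal (u $ i - l $ i))"
    using le' by (subst emeasure_PiM) auto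
  also have "\<dots> = ennreal (\<Prod>i\<in>UNIV. (u - l) $ i)"
    using le' by (simp add: prod_ennreal)
  finally show "emeasure (distr (Pi\<^sub>M UNIV (\<lambda>_. lborel)) borel vec_lambda) (box l u) = ennreal (\<Prod>b\<in>Basis. (u - l) \<bullet> b)"
    using prod_Basis_vec[of "\<lambda>x. x" "u - l"] by simp
qed simp

lemma sets_unit_M: "A \<in> sets unit_M \<longleftrightarrow> A \<in> sets borel \<and> A \<subseteq> {0..1}"
  by (auto simp: unit_M_def sets_restrict_space_iff)

lemma measurable_vec_nth_cube: "vec_nth \<in> (cube_M :: (real ^ 'd) measure) \<rightarrow>\<^sub>M Pi\<^sub>M UNIV (\<lambda>_. unit_M)"
proof (rule measurable_PiM_single')
  fix i :: 'd
  have "(\<lambda>x :: real ^ 'd. x $ i) \<in> borel_measurable cube_M" by (intro measurable_cube_M) simp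
  then show "(\<lambda>x :: real ^ 'd. x $ i) \<in> cube_M \<rightarrow>\<^sub>M unit_M"
    unfolding unit_M_def by (intro measurable_restrict_space2) (auto simp: mem_box_cart)
qed (auto simp: mem_box_cart)

lemma measurable_vec_lambda_cube: "(vec_lambda :: _ \<Rightarrow> real ^ 'd) \<in> Pi\<^sub>M UNIV (\<lambda>_. unit_M) \<rightarrow>\<^sub>M cube_M"
  unfolding cube_M_def
proof (rule measurable_restrict_space2)
  show "vec_lambda \<in> space (Pi\<^sub>M UNIV (\<lambda>_. unit_M)) \<rightarrow> (cbox 0 1 :: (real ^ 'd) set)"
    by (auto simp: space_PiM mem_box_cart PiE_def Pi_def)
  have "(vec_lambda :: ('d \<Rightarrow> real) \<Rightarrow> real ^ 'd) \<in> Pi\<^sub>M UNIV (\<lambda>_. unit_M) \<rightarrow>\<^sub>M borel"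
  proof (subst borel_measurable_euclidean_space, rule ballI)
    fix b :: "real ^ 'd" assume "b \<in> Basis"
    then obtain i where b: "b = axis i 1" by (auto simp: Basis_vec_def)
    have eq: "(\<lambda>x. vec_lambda x \<bullet> b) = (\<lambda>x. x i)" unfolding b by (rule ext) (simp add: inner_axis)
    have "(\<lambda>x. x i) \<in> Pi\<^sub>M UNIV (\<lambda>_::'d. unit_M) \<rightarrow>\<^sub>M unit_M" by (rule measurable_component_singleton) simp
    moreover have "(\<lambda>x. x) \<in> unit_M \<rightarrow>\<^sub>M borel" unfolding unit_M_def by (intro measurable_restrict_space1) simp
    ultimately show "(\<lambda>x. vec_lambda x \<bullet> b) \<in> borel_measurable (Pi\<^sub>M UNIV (\<lambda>_::'d. unit_M))"
      unfolding eq by (rule measurable_compose)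
  qed
  then show "(vec_lambda :: ('d \<Rightarrow> real) \<Rightarrow> real ^ 'd) \<in> Pi\<^sub>M UNIV (\<lambda>_. unit_M) \<rightarrow>\<^sub>M lborel" by simp
qed

lemma PiM_unit_eq_distr: "distr (cube_M :: (real ^ 'd) measure) (Pi\<^sub>M UNIV (\<lambda>_. unit_M)) vec_nth = Pi\<^sub>M UNIV (\<lambda>_. unit_M)"
proof -
  interpret L: product_sigma_finite "\<lambda>_::'d. lborel :: real measure"
    by (intro product_sigma_finite.intro lborel.sigma_finite_measure_axioms)
  interpret U: product_sigma_finite "\<lambda>_::'d. unit_M"
    by (intro product_sigma_finite.intro sigma_finite_unit_M)
  show ?thesis
  proof (rule U.PiM_eqI)
    fix A :: "'d \<Rightarrow> real set" assume A: "\<And>i. i \<in> UNIV \<Longrightarrow> A i \<in> sets unit_M"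
    then have A': "A i \<in> sets borel" "A i \<subseteq> {0..1}" for i by (auto simp: sets_unit_M)
    let ?B = "{x :: real ^ 'd. \<forall>i. x $ i \<in> A i}"
    have B: "?B \<in> sets borel"
    proof -
      have "?B = (\<Inter>i. (\<lambda>x. x $ i) -` A i \<inter> space borel)" by auto
      also have "\<dots> \<in> sets borel"
        using A' by (intro sets.finite_INT measurable_sets[of _ borel borel]) auto
      finally show ?thesis .
    qed
    have Bc: "?B \<subseteq> cbox 0 1" using A'(2) by (auto simp: mem_box_cart subset_eq) 
    have "emeasure (distr cube_M (Pi\<^sub>M UNIV (\<lambda>_. unit_M)) vec_nth) (Pi\<^sub>E UNIV A) = emeasure (cube_M :: (real ^ 'd) measure) (vec_nth -` (Pi\<^sub>E UNIV A) \<inter> space cube_M)"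
      using A by (intro emeasure_distr measurable_vec_nth_cube sets_PiM_I_finite) auto
    also have "vec_nth -` (Pi\<^sub>E UNIV A) \<inter> space cube_M = ?B" using Bc by (auto simp: PiE_def Pi_def)
    also have "emeasure cube_M ?B = emeasure lborel ?B"
      unfolding cube_M_def using Bc by (intro emeasure_restrict_space) auto
    also have "\<dots> = emeasure (Pi\<^sub>M UNIV (\<lambda>_::'d. lborel)) (vec_lambda -` ?B \<inter> space (Pi\<^sub>M UNIV (\<lambda>_::'d. lborel)))"
      by (subst lborel_vec_eq_PiM, rule emeasure_distr) (use B measurable_vec_lambda_PiM in auto)
    also have "vec_lambda -` ?B \<inter> space (Pi\<^sub>M UNIV (\<lambda>_::'d. lborel)) = Pi\<^sub>E UNIV A"
      by (auto simp: space_PiM)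
    also have "emeasure (Pi\<^sub>M UNIV (\<lambda>_::'d. lborel)) (Pi\<^sub>E UNIV A) = (\<Prod>i\<in>UNIV. emeasure lborel (A i))"
      using A' by (intro L.emeasure_PiM) auto
    also have "\<dots> = (\<Prod>i\<in>UNIV. emeasure unit_M (A i))"
      using A' by (intro prod.cong refl) (simp add: unit_M_def emeasure_restrict_space)
    finally show "emeasure (distr cube_M (Pi\<^sub>M UNIV (\<lambda>_. unit_M)) vec_nth) (Pi\<^sub>E UNIV A) = (\<Prod>i\<in>UNIV. emeasure unit_M (A i))" .
  qed auto
qed

lemma nn_integral_cube_PiM:
  fixes F :: "real ^ 'd \<Rightarrow> ennreal"
  assumes F: "F \<in> borel_measurable cube_M"
  shows "(\<integral>\<^sup>+x. F x \<partial>cube_M) = (\<integral>\<^sup>+g. F (vec_lambda g) \<partial>Pi\<^sub>M UNIV (\<lambda>_. unit_M))"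
  by (subst PiM_unit_eq_distr[symmetric], subst nn_integral_distr)
     (auto intro: measurable_vec_nth_cube measurable_compose[OF measurable_vec_lambda_cube F])

lemma nn_integral_cube_prod:
  fixes f :: "'d::finite \<Rightarrow> real \<Rightarrow> ennreal"
  assumes f: "\<And>i. f i \<in> borel_measurable unit_M"
  shows "(\<integral>\<^sup>+x. (\<Prod>i\<in>UNIV. f i (x $ i)) \<partial>cube_M) = (\<Prod>i\<in>UNIV. \<integral>\<^sup>+t. f i t \<partial>unit_M)"
proof -
  interpret U: product_sigma_finite "\<lambda>_::'d. unit_M"
    by (intro product_sigma_finite.intro sigma_finite_unit_M)
  have m: "(\<lambda>g. \<Prod>i\<in>UNIV. f i (g i)) \<in> borel_measurable (Pi\<^sub>M UNIV (\<lambda>_::'d. unit_M))"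
  proof (intro borel_measurable_prod_ennreal)
    fix i :: 'd
    have "(\<lambda>g. g i) \<in> Pi\<^sub>M UNIV (\<lambda>_::'d. unit_M) \<rightarrow>\<^sub>M unit_M" by (rule measurable_component_singleton) simp
    then show "(\<lambda>g. f i (g i)) \<in> borel_measurable (Pi\<^sub>M UNIV (\<lambda>_::'d. unit_M))" by (rule measurable_compose[OF _ f])
  qed
  have "(\<Prod>i\<in>UNIV. \<integral>\<^sup>+t. f i t \<partial>unit_M) = (\<integral>\<^sup>+g. (\<Prod>i\<in>UNIV. f i (g i)) \<partial>Pi\<^sub>M UNIV (\<lambda>_. unit_M))"
    using f by (intro U.product_nn_integral_prod[symmetric]) auto
  also have "\<dots> = (\<integral>\<^sup>+x. (\<Prod>i\<in>UNIV. f i (x $ i)) \<partial>cube_M)"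
    by (subst PiM_unit_eq_distr[symmetric], subst nn_integral_distr) (use m measurable_vec_nth_cube in auto)
  finally show ?thesis by simp
qed

lemma
  fixes f :: "'d::finite \<Rightarrow> real \<Rightarrow> complex"
  assumes f: "\<And>i. integrable unit_M (f i)"
  shows integral_cube_prod: "(LINT x|cube_M. (\<Prod>i\<in>UNIV. f i (x $ i))) = (\<Prod>i\<in>UNIV. LINT t|unit_M. f i t)"
    and integrable_cube_prod: "integrable cube_M (\<lambda>x. \<Prod>i\<in>UNIV. f i (x $ i))"
proof -
  interpret U: product_sigma_finite "\<lambda>_::'d. unit_M"
    by (intro product_sigma_finite.intro sigma_finite_unit_M)
  let ?P = "Pi\<^sub>M UNIV (\<lambda>_::'d. unit_M)"
  have m: "(\<lambda>g. \<Prod>i\<in>UNIV. f i (g i)) \<in> borel_measurable ?P"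
  proof (intro borel_measurable_prod)
    fix i :: 'd
    have "(\<lambda>g. g i) \<in> ?P \<rightarrow>\<^sub>M unit_M" by (rule measurable_component_singleton) simp
    then show "(\<lambda>g. f i (g i)) \<in> borel_measurable ?P" by (rule measurable_compose[OF _ borel_measurable_integrable[OF f]])
  qed
  have "(\<Prod>i\<in>UNIV. LINT t|unit_M. f i t) = (LINT g|?P. (\<Prod>i\<in>UNIV. f i (g i)))"
    using f by (intro U.product_integral_prod[symmetric]) auto
  also have "\<dots> = (LINT g|distr (cube_M :: (real ^ 'd) measure) ?P vec_nth. (\<Prod>i\<in>UNIV. f i (g i)))"
    by (simp only: PiM_unit_eq_distr)
  also have "\<dots> = (LINT x|cube_M. (\<Prod>i\<in>UNIV. f i (x $ i)))"
    by (rule integral_distr[OF measurable_vec_nth_cube m])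
  finally show "(LINT x|cube_M. (\<Prod>i\<in>UNIV. f i (x $ i))) = (\<Prod>i\<in>UNIV. LINT t|unit_M. f i t)" by simp
  have "integrable ?P (\<lambda>g. \<Prod>i\<in>UNIV. f i (g i))"
    using f by (intro U.product_integrable_prod) auto
  then have "integrable (distr (cube_M :: (real ^ 'd) measure) ?P vec_nth) (\<lambda>g. \<Prod>i\<in>UNIV. f i (g i))"
    by (simp only: PiM_unit_eq_distr)
  then show "integrable cube_M (\<lambda>x. \<Prod>i\<in>UNIV. f i (x $ i))"
    by (subst (asm) integrable_distr_eq[OF measurable_vec_nth_cube m])
qed

text \<open>
  The tensor product inequality, moved from functions on the index type to vectors.
\<close>

lemma HLS_bound_cube:
  assumes K: "(\<lambda>(x, y). K x y) \<in> borel_measurable (unit_M \<Otimes>\<^sub>M unit_M)"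
    and B: "HLS_bound unit_M K \<sigma> \<tau> C"
  shows "HLS_bound (cube_M :: (real ^ 'd) measure) (\<lambda>x y. \<Prod>i\<in>UNIV. K (x $ i) (y $ i)) \<sigma> \<tau> (C ^ CARD('d))"
  unfolding HLS_bound_def
proof (intro allI impI)
  fix H G :: "real ^ 'd \<Rightarrow> ennreal"
  assume H: "H \<in> borel_measurable cube_M" and G: "G \<in> borel_measurable cube_M"
  let ?P = "Pi\<^sub>M UNIV (\<lambda>_::'d. unit_M)"
  interpret cube: sigma_finite_measure "cube_M :: (real ^ 'd) measure" by (rule sigma_finite_cube_M)
  let ?F = "\<lambda>x y. (\<Prod>i\<in>UNIV. K (x $ i) (y $ i)) * epow (H y) \<sigma> * epow (G x) \<tau>"
  have nth: "(\<lambda>x :: real ^ 'd. x $ i) \<in> cube_M \<rightarrow>\<^sub>M unit_M" for i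
    using measurable_compose[OF measurable_vec_nth_cube measurable_component_singleton[of i UNIV "\<lambda>_. unit_M"]] by simp
  have Kp: "(\<lambda>p. K (fst p $ i) (snd p $ i)) \<in> borel_measurable ((cube_M :: (real ^ 'd) measure) \<Otimes>\<^sub>M cube_M)" for i
    using measurable_compose[OF measurable_Pair[OF measurable_compose[OF measurable_fst nth] measurable_compose[OF measurable_snd nth]] K] by simp
  have F2: "(\<lambda>(x, y). ?F x y) \<in> borel_measurable (cube_M \<Otimes>\<^sub>M cube_M)"
    unfolding case_prod_beta
    by (intro borel_measurable_times_ennreal borel_measurable_prod_ennreal Kp epow_measurable
        measurable_compose[OF measurable_fst G] measurable_compose[OF measurable_snd H])
  have F1: "?F x \<in> borel_measurable cube_M" if "x \<in> cbox 0 1" for x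
    using measurable_compose[OF measurable_Pair1' F2, of x] that by simp
  have "(\<integral>\<^sup>+x. \<integral>\<^sup>+y. ?F x y \<partial>cube_M \<partial>cube_M) = (\<integral>\<^sup>+g. \<integral>\<^sup>+y. ?F (vec_lambda g) y \<partial>cube_M \<partial>?P)"
    by (intro nn_integral_cube_PiM cube.borel_measurable_nn_integral F2)
  also have "\<dots> = (\<integral>\<^sup>+g. \<integral>\<^sup>+h. ?F (vec_lambda g) (vec_lambda h) \<partial>?P \<partial>?P)"
  proof (intro nn_integral_cong nn_integral_cube_PiM F1)
    fix g assume "g \<in> space ?P"
    then show "vec_lambda g \<in> cbox 0 1" using measurable_space[OF measurable_vec_lambda_cube] by auto
  qed
  also have "\<dots> \<le> C ^ card (UNIV :: 'd set) * epow (\<integral>\<^sup>+h. H (vec_lambda h) \<partial>?P) \<sigma> * epow (\<integral>\<^sup>+g. G (vec_lambda g) \<partial>?P) \<tau>"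
    using HLS_bound_PiM[OF sigma_finite_unit_M K B, of "UNIV :: 'd set", unfolded HLS_bound_def, rule_format,
        OF _ measurable_compose[OF measurable_vec_lambda_cube H] measurable_compose[OF measurable_vec_lambda_cube G]]
    by simp
  finally show "(\<integral>\<^sup>+x. \<integral>\<^sup>+y. ?F x y \<partial>cube_M \<partial>cube_M) \<le> C ^ CARD('d) * epow (\<integral>\<^sup>+y. H y \<partial>cube_M) \<sigma> * epow (\<integral>\<^sup>+x. G x \<partial>cube_M) \<tau>"
    by (simp add: nn_integral_cube_PiM[OF H] nn_integral_cube_PiM[OF G])
qed

lemma Lp_norm_cube:
  fixes f :: "real ^ 'd \<Rightarrow> complex"
  shows "Lp_norm p f = epow (\<integral>\<^sup>+x. ennreal (norm (f x) powr p) \<partial>cube_M) (1 / p)"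
  by (simp add: Lp_norm_def epow_def nn_integral_cube_lborel Let_def)

lemma epow_mono: "x \<le> y \<Longrightarrow> 0 \<le> a \<Longrightarrow> epow x a \<le> epow y a"
  by (cases x; cases y) (auto simp: epow_def top_unique intro!: ennreal_leI powr_mono2)

lemma epow_epow: "0 < a \<Longrightarrow> epow (epow x a) b = epow x (a * b)"
  by (cases x) (auto simp: epow_def powr_powr)

lemma epow_1 [simp]: "epow x 1 = x"
  by (cases x) (auto simp: epow_def)

lemma epow_add: "0 < a \<Longrightarrow> 0 < b \<Longrightarrow> epow x (a + b) = epow x a * epow x b"
  by (cases x) (auto simp: epow_def powr_add ennreal_mult ennreal_mult_eq_top_iff)

text \<open>
  The bilinear inequality is tested with \<open>H = \<bar>\<phi>\<bar> powr p\<close> and \<open>G = \<bar>e\<bar> powr q\<close>. It bounds the integral of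
  \<open>\<bar>e\<bar> powr q\<close> by its own power \<open>1 - 1 / q\<close>, and the finiteness assumption allows to divide by that power.
\<close>

lemma HLS_operator:
  fixes e \<phi> :: "real ^ 'd \<Rightarrow> complex" and K :: "real ^ 'd \<Rightarrow> real ^ 'd \<Rightarrow> ennreal"
  assumes p: "1 < p" and q: "1 < q"
    and B: "HLS_bound (cube_M :: (real ^ 'd) measure) K (1 / p) (1 - 1 / q) C"
    and K: "(\<lambda>(x, y). K x y) \<in> borel_measurable ((cube_M :: (real ^ 'd) measure) \<Otimes>\<^sub>M cube_M)"
    and e [measurable]: "e \<in> borel_measurable cube_M" and \<phi> [measurable]: "\<phi> \<in> borel_measurable cube_M"
    and dom: "\<And>x. x \<in> cbox 0 1 \<Longrightarrow> ennreal (norm (e x)) \<le> \<Lambda> * (\<integral>\<^sup>+y. K x y * ennreal (norm (\<phi> y)) \<partial>cube_M)"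
    and fin: "(\<integral>\<^sup>+x. ennreal (norm (e x) powr q) \<partial>cube_M) < \<infinity>"
  shows "Lp_norm q e \<le> \<Lambda> * C * Lp_norm p \<phi>"
proof -
  define X where "X = (\<integral>\<^sup>+x. ennreal (norm (e x) powr q) \<partial>cube_M)"
  define Y where "Y = (\<integral>\<^sup>+x. ennreal (norm (\<phi> x) powr p) \<partial>cube_M)"
  interpret cube: sigma_finite_measure "cube_M :: (real ^ 'd) measure" by (rule sigma_finite_cube_M)
  have Kx: "K x \<in> borel_measurable cube_M" if "x \<in> cbox 0 1" for x
    using measurable_compose[OF measurable_Pair1' K, of x] that by simp
  have e1: "epow (ennreal (norm (\<phi> y) powr p)) (1 / p) = ennreal (norm (\<phi> y))" for y
    using p by (simp add: powr_powr)
  have e2: "epow (ennreal (norm (e y) powr q)) (1 - 1 / q) = ennreal (norm (e y) powr (q - 1))" for y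
  proof -
    have "q * (1 - 1 / q) = q - 1" using q by (simp add: right_diff_distrib)
    then show ?thesis by (simp add: powr_powr)
  qed
  have e3: "norm (e x) powr q = norm (e x) * norm (e x) powr (q - 1)" for x
    using powr_add[of "norm (e x)" 1 "q - 1"] by (cases "e x = 0") auto
  have "X = (\<integral>\<^sup>+x. ennreal (norm (e x)) * ennreal (norm (e x) powr (q - 1)) \<partial>cube_M)"
    unfolding X_def by (simp add: e3 ennreal_mult)
  also have "\<dots> \<le> (\<integral>\<^sup>+x. \<Lambda> * (\<integral>\<^sup>+y. K x y * ennreal (norm (\<phi> y)) \<partial>cube_M) * ennreal (norm (e x) powr (q - 1)) \<partial>cube_M)"
    by (intro nn_integral_mono mult_right_mono dom) auto
  also have "\<dots> = (\<integral>\<^sup>+x. \<Lambda> * (\<integral>\<^sup>+y. K x y * epow (ennreal (norm (\<phi> y) powr p)) (1 / p) * epow (ennreal (norm (e x) powr q)) (1 - 1 / q) \<partial>cube_M) \<partial>cube_M)"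
    unfolding e1 e2
  proof (intro nn_integral_cong)
    fix x assume "x \<in> space (cube_M :: (real ^ 'd) measure)"
    then have m: "(\<lambda>y. K x y * ennreal (norm (\<phi> y))) \<in> borel_measurable cube_M"
      by (intro borel_measurable_times_ennreal Kx) auto
    show "\<Lambda> * (\<integral>\<^sup>+y. K x y * ennreal (norm (\<phi> y)) \<partial>cube_M) * ennreal (norm (e x) powr (q - 1))
       = \<Lambda> * (\<integral>\<^sup>+y. K x y * ennreal (norm (\<phi> y)) * ennreal (norm (e x) powr (q - 1)) \<partial>cube_M)"
      by (subst nn_integral_multc[OF m]) (simp only: mult.assoc)
  qed
  also have "\<dots> = \<Lambda> * (\<integral>\<^sup>+x. \<integral>\<^sup>+y. K x y * epow (ennreal (norm (\<phi> y) powr p)) (1 / p) * epow (ennreal (norm (e x) powr q)) (1 - 1 / q) \<partial>cube_M \<partial>cube_M)"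
  proof (intro nn_integral_cmult cube.borel_measurable_nn_integral)
    have [measurable]: "(\<lambda>p. K (fst p) (snd p)) \<in> borel_measurable ((cube_M :: (real ^ 'd) measure) \<Otimes>\<^sub>M cube_M)"
      using K by (simp add: case_prod_beta)
    show "(\<lambda>(x, y). K x y * epow (ennreal (norm (\<phi> y) powr p)) (1 / p) * epow (ennreal (norm (e x) powr q)) (1 - 1 / q))
       \<in> borel_measurable (cube_M \<Otimes>\<^sub>M cube_M)"
      unfolding case_prod_beta by measurable
  qed
  also have "\<dots> \<le> \<Lambda> * (C * epow Y (1 / p) * epow X (1 - 1 / q))"
    unfolding X_def Y_def by (intro mult_left_mono B[unfolded HLS_bound_def, rule_format]) auto
  finally have main: "X \<le> \<Lambda> * C * epow Y (1 / p) * epow X (1 - 1 / q)" by (simp add: mult.assoc)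
  have Xfin: "X < \<infinity>" using fin by (simp add: X_def)
  have "epow X (1 / q) \<le> \<Lambda> * C * epow Y (1 / p)"
  proof (cases "X = 0")
    case False
    have split: "X = epow X (1 / q) * epow X (1 - 1 / q)"
      using epow_add[of "1 / q" "1 - 1 / q" X] q by simp
    have c: "epow X (1 - 1 / q) \<noteq> 0" "epow X (1 - 1 / q) < \<infinity>"
      using False Xfin by (simp, simp add: epow_def)
    have iff: "a * epow X (1 - 1 / q) \<le> b * epow X (1 - 1 / q) \<longleftrightarrow> a \<le> b" for a b
      using ennreal_mult_le_mult_iff[of "epow X (1 - 1 / q)"] c by (simp add: mult.commute less_top)
    have "epow X (1 / q) * epow X (1 - 1 / q) \<le> (\<Lambda> * C * epow Y (1 / p)) * epow X (1 - 1 / q)"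
      using main split by simp
    then show ?thesis by (rule iffD1[OF iff])
  qed simp
  then show ?thesis by (simp add: Lp_norm_cube X_def Y_def)
qed

text \<open>
  Young's inequality under the integral, after both integrals have been normalized.
\<close>

lemma nn_integral_Holder:
  fixes H G :: "'a \<Rightarrow> ennreal"
  assumes [measurable]: "H \<in> borel_measurable N" "G \<in> borel_measurable N" and \<sigma>: "0 < \<sigma>" "\<sigma> < 1"
  shows "(\<integral>\<^sup>+x. epow (H x) \<sigma> * epow (G x) (1 - \<sigma>) \<partial>N) \<le> epow (\<integral>\<^sup>+x. H x \<partial>N) \<sigma> * epow (\<integral>\<^sup>+x. G x \<partial>N) (1 - \<sigma>)"
proof -
  define I J where "I = (\<integral>\<^sup>+x. H x \<partial>N)" and "J = (\<integral>\<^sup>+x. G x \<partial>N)"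
  consider "I = 0" | "J = 0" | "I \<noteq> 0" "J \<noteq> 0" "I = \<infinity> \<or> J = \<infinity>" | i j where "I = ennreal i" "0 < i" "J = ennreal j" "0 < j"
    by (cases I; cases J) (auto simp: less_le)
  then show ?thesis
    unfolding I_def[symmetric] J_def[symmetric]
  proof cases
    case 1
    then have "AE x in N. H x = 0" by (simp add: I_def nn_integral_0_iff_AE)
    then have "(\<integral>\<^sup>+x. epow (H x) \<sigma> * epow (G x) (1 - \<sigma>) \<partial>N) = (\<integral>\<^sup>+x. 0 \<partial>N)"
      by (intro nn_integral_cong_AE) auto
    then show "(\<integral>\<^sup>+x. epow (H x) \<sigma> * epow (G x) (1 - \<sigma>) \<partial>N) \<le> epow I \<sigma> * epow J (1 - \<sigma>)" by simp
  next
    case 2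
    then have "AE x in N. G x = 0" by (simp add: J_def nn_integral_0_iff_AE)
    then have "(\<integral>\<^sup>+x. epow (H x) \<sigma> * epow (G x) (1 - \<sigma>) \<partial>N) = (\<integral>\<^sup>+x. 0 \<partial>N)"
      by (intro nn_integral_cong_AE) auto
    then show "(\<integral>\<^sup>+x. epow (H x) \<sigma> * epow (G x) (1 - \<sigma>) \<partial>N) \<le> epow I \<sigma> * epow J (1 - \<sigma>)" by simp
  next
    case 3
    then have "epow I \<sigma> * epow J (1 - \<sigma>) = \<infinity>" by (auto simp: ennreal_mult_eq_top_iff)
    then show "(\<integral>\<^sup>+x. epow (H x) \<sigma> * epow (G x) (1 - \<sigma>) \<partial>N) \<le> epow I \<sigma> * epow J (1 - \<sigma>)" by simp
  next
    case 4
    let ?c = "i powr \<sigma> * j powr (1 - \<sigma>)"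
    have pt: "epow (H x) \<sigma> * epow (G x) (1 - \<sigma>) \<le> ennreal ?c * (ennreal (\<sigma> / i) * H x + ennreal ((1 - \<sigma>) / j) * G x)" for x
    proof (cases "H x = \<infinity> \<or> G x = \<infinity>")
      case True
      then have "ennreal ?c * (ennreal (\<sigma> / i) * H x + ennreal ((1 - \<sigma>) / j) * G x) = \<infinity>"
        using 4 \<sigma> by (auto simp: ennreal_mult_eq_top_iff)
      then show ?thesis by simp
    next
      case False
      then obtain h g where hg: "H x = ennreal h" "0 \<le> h" "G x = ennreal g" "0 \<le> g"
        by (cases "H x"; cases "G x") auto
      have "h powr \<sigma> * g powr (1 - \<sigma>) = ?c * ((h / i) powr \<sigma> * (g / j) powr (1 - \<sigma>))"
        using hg 4 by (simp add: powr_divide)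
      also have "(h / i) powr \<sigma> * (g / j) powr (1 - \<sigma>) \<le> \<sigma> * (h / i) + (1 - \<sigma>) * (g / j)"
      proof (cases "h = 0 \<or> g = 0")
        case True
        then show ?thesis using hg 4 \<sigma> by auto
      next
        case False
        then show ?thesis using hg 4 \<sigma> by (intro Youngs_inequality_0) auto
      qed
      finally have "h powr \<sigma> * g powr (1 - \<sigma>) \<le> ?c * (\<sigma> * (h / i) + (1 - \<sigma>) * (g / j))"
        using 4 by (simp add: mult_left_mono)
      then have "ennreal (h powr \<sigma> * g powr (1 - \<sigma>)) \<le> ennreal (?c * (\<sigma> / i * h + (1 - \<sigma>) / j * g))"
        by (intro ennreal_leI) simp
      also have "\<dots> = ennreal ?c * (ennreal (\<sigma> / i) * ennreal h + ennreal ((1 - \<sigma>) / j) * ennreal g)"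
      proof -
        define a b c where "a = \<sigma> / i" and "b = (1 - \<sigma>) / j" and "c = ?c"
        have "0 \<le> a" "0 \<le> b" "0 \<le> c" using \<sigma> 4 by (auto simp: a_def b_def c_def)
        then show ?thesis unfolding a_def[symmetric] b_def[symmetric] c_def[symmetric]
          using hg by (simp add: ennreal_mult ennreal_plus)
      qed
      finally show ?thesis using hg by (simp add: ennreal_mult)
    qed
    have "(\<integral>\<^sup>+x. epow (H x) \<sigma> * epow (G x) (1 - \<sigma>) \<partial>N) \<le> (\<integral>\<^sup>+x. ennreal ?c * (ennreal (\<sigma> / i) * H x + ennreal ((1 - \<sigma>) / j) * G x) \<partial>N)"
      by (intro nn_integral_mono pt)
    also have "\<dots> = ennreal ?c * (ennreal (\<sigma> / i) * I + ennreal ((1 - \<sigma>) / j) * J)"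
      by (simp add: nn_integral_cmult nn_integral_add I_def J_def)
    also have "ennreal (\<sigma> / i) * I + ennreal ((1 - \<sigma>) / j) * J = 1"
      using 4 \<sigma> by (simp add: ennreal_mult[symmetric] ennreal_plus[symmetric] del: ennreal_plus)
    finally show "(\<integral>\<^sup>+x. epow (H x) \<sigma> * epow (G x) (1 - \<sigma>) \<partial>N) \<le> epow I \<sigma> * epow J (1 - \<sigma>)"
      using 4 by (simp add: ennreal_mult)
  qed
qed

lemma Lp_norm_Holder:
  fixes f g :: "real ^ 'd \<Rightarrow> complex"
  assumes [measurable]: "f \<in> borel_measurable cube_M" "g \<in> borel_measurable cube_M" and p: "1 < p"
  shows "(\<integral>\<^sup>+x. ennreal (norm (f x) * norm (g x)) \<partial>cube_M) \<le> Lp_norm p f * Lp_norm (p / (p - 1)) g"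
proof -
  have \<sigma>: "0 < 1 / p" "1 / p < 1" "1 - 1 / p = 1 / (p / (p - 1))" "p / (p - 1) > 0"
    using p by (auto simp: field_simps)
  have "(\<integral>\<^sup>+x. ennreal (norm (f x) * norm (g x)) \<partial>cube_M)
     = (\<integral>\<^sup>+x. epow (ennreal (norm (f x) powr p)) (1 / p) * epow (ennreal (norm (g x) powr (p / (p - 1)))) (1 - 1 / p) \<partial>cube_M)"
    unfolding \<sigma>(3) using p by (simp add: powr_powr ennreal_mult)
  also have "\<dots> \<le> Lp_norm p f * Lp_norm (p / (p - 1)) g"
    unfolding Lp_norm_cube \<sigma>(3)[symmetric] by (intro nn_integral_Holder \<sigma>) auto
  finally show ?thesis .
qed

text \<open>
  Interpolation: \<open>g powr p\<close> is at most \<open>g\<close> times the power \<open>p - 1\<close> of the supremum.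
\<close>

lemma Lp_of_L1_and_sup:
  fixes g :: "'a \<Rightarrow> real" and c :: real
  assumes m: "(\<lambda>x. ennreal (g x)) \<in> borel_measurable N" and g0: "\<And>x. 0 \<le> g x" and c: "0 < c" and p: "1 \<le> p"
    and sup: "\<And>x. g x \<le> c * 2 powr (\<rho> * i + i)"
    and L1: "(\<integral>\<^sup>+x. ennreal (g x) \<partial>N) \<le> ennreal (c * 2 powr (\<rho> * i))"
  shows "(\<integral>\<^sup>+x. ennreal (g x powr p) \<partial>N) \<le> ennreal ((c * 2 powr ((\<rho> + (1 - 1 / p)) * i)) powr p)"
proof -
  let ?D = "c * 2 powr (\<rho> * i + i)"
  have "(\<integral>\<^sup>+x. ennreal (g x powr p) \<partial>N) \<le> (\<integral>\<^sup>+x. ennreal (?D powr (p - 1)) * ennreal (g x) \<partial>N)"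
  proof (intro nn_integral_mono)
    fix x
    have "g x powr p = g x powr (p - 1) * g x"
      using powr_add[of "g x" "p - 1" 1] g0[of x] by (cases "g x = 0") auto
    also have "\<dots> \<le> ?D powr (p - 1) * g x"
      using p sup[of x] g0[of x] by (intro mult_right_mono powr_mono2) auto
    finally show "ennreal (g x powr p) \<le> ennreal (?D powr (p - 1)) * ennreal (g x)"
      using g0[of x] by (simp add: ennreal_mult[symmetric] ennreal_leI)
  qed
  also have "\<dots> = ennreal (?D powr (p - 1)) * (\<integral>\<^sup>+x. ennreal (g x) \<partial>N)" by (rule nn_integral_cmult[OF m])
  also have "\<dots> \<le> ennreal (?D powr (p - 1)) * ennreal (c * 2 powr (\<rho> * i))"
    by (intro mult_left_mono L1) auto
  also have "\<dots> = ennreal (?D powr (p - 1) * (c * 2 powr (\<rho> * i)))"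
    using c by (simp add: ennreal_mult)
  also have "?D powr (p - 1) * (c * 2 powr (\<rho> * i)) = (c * 2 powr ((\<rho> + (1 - 1 / p)) * i)) powr p"
  proof -
    have "?D powr (p - 1) * (c * 2 powr (\<rho> * i))
        = (c powr (p - 1) * c) * (2 powr ((\<rho> * i + i) * (p - 1)) * 2 powr (\<rho> * i))"
      using c by (simp add: powr_mult powr_powr)
    also have "c powr (p - 1) * c = c powr p"
      using c powr_add[of c "p - 1" 1] by simp
    also have "2 powr ((\<rho> * i + i) * (p - 1)) * 2 powr (\<rho> * i) = 2 powr ((\<rho> + (1 - 1 / p)) * i * p)"
    proof -
      have "(\<rho> * i + i) * (p - 1) + \<rho> * i = (\<rho> + (1 - 1 / p)) * i * p"
        using p by (simp add: algebra_simps)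
      then show ?thesis by (simp only: powr_add[symmetric])
    qed
    finally show ?thesis using c by (simp add: powr_mult powr_powr)
  qed
  finally show ?thesis .
qed

text \<open>
  The integral over the unit interval is the integral over one cell of the sum over \<open>N\<close> shifted nodes.
\<close>

lemma nn_integral_unit_of_discrete:
  fixes g :: "real \<Rightarrow> real"
  assumes g [measurable]: "g \<in> borel_measurable borel" and g0: "\<And>x. 0 \<le> g x" and N: "0 < N"
    and bound: "\<And>x. (\<Sum>l<N. g (x + real l / real N)) \<le> real N * S"
  shows "(\<integral>\<^sup>+x. ennreal (g x) \<partial>unit_M) \<le> ennreal S"
proof -
  have S0: "0 \<le> S"
    using bound[of 0] sum_nonneg[of "{..<N}" "\<lambda>l. g (0 + real l / real N)"] g0 N
    by (metis (no_types, lifting) mult_less_cancel_left_pos mult_zero_right not_le of_nat_0_less_iff order_trans)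
  let ?J = "\<lambda>l. {real l / real N..<(real l + 1) / real N}"
  have cover: "indicator {0..<1::real} x = (\<Sum>l<N. indicator (?J l) x :: ennreal)" for x
  proof (cases "0 \<le> x \<and> x < 1")
    case True
    define k where "k = nat \<lfloor>x * real N\<rfloor>"
    have k: "real k \<le> x * real N" "x * real N < real k + 1"
      using True N by (auto simp: k_def of_nat_nat le_floor_iff zero_le_mult_iff)
    have "x * real N < real N" using True N by simp
    then have kN: "k < N" using k(1) by (metis less_le_trans not_le of_nat_less_iff order_le_less_trans)
    have "x \<in> ?J l \<longleftrightarrow> l = k" for l
    proof
      assume "x \<in> ?J l"
      then have "real l \<le> x * real N" "x * real N < real l + 1" using N by (auto simp: field_simps)
      then have "real l < real k + 1" "real k < real l + 1" using k by auto
      then show "l = k" by linarith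
    qed (use k N in \<open>auto simp: field_simps\<close>)
    then have "(\<Sum>l<N. indicator (?J l) x :: ennreal) = (\<Sum>l<N. if l = k then 1 else 0)"
      by (intro sum.cong refl) (simp add: indicator_def)
    also have "\<dots> = 1" using kN by simp
    finally show ?thesis using True by (simp add: indicator_def)
  next
    case False
    have "x \<notin> ?J l" if "l < N" for l
    proof
      assume x: "x \<in> ?J l"
      have "(real l + 1) / real N \<le> 1" using that N by (simp add: field_simps flip: of_nat_Suc)
      then have "0 \<le> x" "x < 1" using x by (auto intro: order_trans[of 0 "real l / real N"])
      with False show False by simp
    qed
    then have "(\<Sum>l<N. indicator (?J l) x :: ennreal) = 0" by (intro sum.neutral) (simp add: indicator_def)
    with False show ?thesis by (simp add: indicator_def)
  qed
  have "(\<integral>\<^sup>+x. ennreal (g x) \<partial>unit_M) = (\<integral>\<^sup>+x. ennreal (g x) * indicator {0..1} x \<partial>lborel)"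
    unfolding unit_M_def by (subst nn_integral_restrict_space) auto
  also have "\<dots> = (\<integral>\<^sup>+x. ennreal (g x) * indicator {0..<1} x \<partial>lborel)"
    using AE_lborel_singleton[of "1::real"] by (intro nn_integral_cong_AE) (auto simp: indicator_def)
  also have "\<dots> = (\<integral>\<^sup>+x. (\<Sum>l<N. ennreal (g x) * indicator (?J l) x) \<partial>lborel)"
    by (simp only: cover sum_distrib_left)
  also have "\<dots> = (\<Sum>l<N. \<integral>\<^sup>+x. ennreal (g x) * indicator (?J l) x \<partial>lborel)"
    by (rule nn_integral_sum) simp
  also have "\<dots> = (\<Sum>l<N. \<integral>\<^sup>+x. ennreal (g (x + real l / real N)) * indicator {0..<1 / real N} x \<partial>lborel)"
  proof (rule sum.cong[OF refl])
    fix l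
    have i: "indicator (?J l) (real l / real N + 1 * x) = (indicator {0..<1 / real N} x :: ennreal)" for x
      using N by (auto simp: indicator_def add_divide_distrib)
    show "(\<integral>\<^sup>+x. ennreal (g x) * indicator (?J l) x \<partial>lborel) = (\<integral>\<^sup>+x. ennreal (g (x + real l / real N)) * indicator {0..<1 / real N} x \<partial>lborel)"
      by (subst nn_integral_real_affine[of _ 1 "real l / real N"]) (simp_all only: i, simp_all add: add.commute)
  qed
  also have "\<dots> = (\<integral>\<^sup>+x. (\<Sum>l<N. ennreal (g (x + real l / real N)) * indicator {0..<1 / real N} x) \<partial>lborel)"
    by (rule nn_integral_sum[symmetric]) simp
  also have "\<dots> = (\<integral>\<^sup>+x. ennreal (\<Sum>l<N. g (x + real l / real N)) * indicator {0..<1 / real N} x \<partial>lborel)"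
    using g0 by (simp add: sum_distrib_right[symmetric] sum_ennreal)
  also have "\<dots> \<le> (\<integral>\<^sup>+x. ennreal (real N * S) * indicator {0..<1 / real N} x \<partial>lborel)"
    by (intro nn_integral_mono mult_right_mono ennreal_leI bound) auto
  also have "\<dots> = ennreal (real N * S) * ennreal (1 / real N)"
    using N by (subst nn_integral_cmult_indicator) auto
  also have "\<dots> = ennreal S" using N S0 by (simp add: ennreal_mult[symmetric])
  finally show ?thesis .
qed

section \<open>Sampling in one variable\<close>

text \<open>
  The multiplier is 1 on \<open>\<bar>k\<bar> \<le> 2 ^ s\<close>, so convolution with this kernel reproduces such frequencies.
\<close>

definition smooth_kernel :: "nat \<Rightarrow> real \<Rightarrow> complex" where
  "smooth_kernel s x = trig {- (2 ^ Suc s)<..<2 ^ Suc s} (\<lambda>k. of_real (hat (Suc s) k)) x"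

text \<open>
  The constant \<open>sqrt (6 * (1 + b\<^sup>2))\<close> of \<open>discrete_L1_bound\<close> for \<open>b = 4\<close>.
\<close>

definition smooth_const :: real where
  "smooth_const = sqrt 102"

lemma smooth_const_pos: "0 < smooth_const"
  by (simp add: smooth_const_def)

lemma smooth_kernel_discrete_L1:
  "(\<Sum>l<2 ^ (s + 2). norm (smooth_kernel s (x + real l / 2 ^ (s + 2)))) \<le> 2 ^ (s + 2) * smooth_const"
proof -
  let ?N = "2 ^ (s + 2) :: nat" and ?a = "- (2 ^ Suc s) :: int"
  have aN: "?a + int ?N = 2 ^ Suc s" by simp
  have "(\<Sum>l<?N. norm (trig {?a<..<?a + int ?N} (\<lambda>k. complex_of_real (hat (Suc s) k)) (x + real l / real ?N)))
      \<le> real ?N * 1 * sqrt (6 * (1 + 4\<^sup>2))"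
  proof (rule discrete_L1_bound)
    fix k :: int
    show "complex_of_real (hat (Suc s) k) = 0" if "k \<le> ?a \<or> ?a + int ?N \<le> k"
      using that unfolding aN by (subst hat_eq_0) auto
    show "norm (complex_of_real (hat (Suc s) k)) \<le> 1" using hat_bounds[of "Suc s" k] by simp
    have "norm (complex_of_real (hat (Suc s) k) - complex_of_real (hat (Suc s) (k - 1))) = \<bar>hat (Suc s) k - hat (Suc s) (k - 1)\<bar>"
      by (simp only: of_real_diff[symmetric] norm_of_real)
    also have "\<dots> \<le> 2 / 2 ^ Suc s" by (rule hat_diff)
    also have "\<dots> = 4 * 1 / real ?N" by simp
    finally show "norm (complex_of_real (hat (Suc s) k) - complex_of_real (hat (Suc s) (k - 1))) \<le> 4 * 1 / real ?N" .
  qed simp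
  then show ?thesis by (simp add: smooth_kernel_def smooth_const_def aN)
qed

lemma smooth_kernel_minus: "smooth_kernel s (- x) = cnj (smooth_kernel s x)"
  by (simp add: smooth_kernel_def trig_def cnj_ee)

lemma continuous_on_smooth_kernel [continuous_intros]:
  "continuous_on S f \<Longrightarrow> continuous_on S (\<lambda>x. smooth_kernel s (f x))"
  unfolding smooth_kernel_def by (intro continuous_intros)

lemma smooth_kernel_add_of_int [simp]: "smooth_kernel s (x + of_int n) = smooth_kernel s x"
  by (simp add: smooth_kernel_def)

text \<open>
  The number of nodes is chosen so that no two frequencies \<open>\<bar>k\<bar> \<le> 2 ^ s\<close> and \<open>\<bar>j\<bar> < 2 ^ Suc s\<close> are
  congruent modulo this number unless they are equal; the grids are nested.
\<close>

definition grid1 :: "nat \<Rightarrow> real set" where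
  "grid1 s = (\<lambda>l. real l / 2 ^ (s + 2)) ` {..<2 ^ (s + 2)}"

lemma finite_grid1 [simp]: "finite (grid1 s)"
  by (simp add: grid1_def)

lemma card_grid1: "card (grid1 s) = 2 ^ (s + 2)"
  unfolding grid1_def by (subst card_image) (auto simp: inj_on_def)

lemma sum_grid1: "(\<Sum>\<xi>\<in>grid1 s. f \<xi>) = (\<Sum>l<2 ^ (s + 2). f (real l / 2 ^ (s + 2)))"
  unfolding grid1_def by (subst sum.reindex) (auto simp: inj_on_def)

lemma grid1_bounds: "\<xi> \<in> grid1 s \<Longrightarrow> 0 \<le> \<xi> \<and> \<xi> < 1"
proof -
  assume "\<xi> \<in> grid1 s"
  then obtain l where l: "l < 2 ^ (s + 2)" "\<xi> = real l / 2 ^ (s + 2)" by (auto simp: grid1_def)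
  have "real l < real (2 ^ (s + 2))" using l(1) by (simp only: of_nat_less_iff)
  then show ?thesis using l(2) by simp
qed

lemma grid1_mono_Suc: "grid1 s \<subseteq> grid1 (Suc s)"
proof
  fix \<xi> assume "\<xi> \<in> grid1 s"
  then obtain l where l: "l < 2 ^ (s + 2)" "\<xi> = real l / 2 ^ (s + 2)" by (auto simp: grid1_def)
  then show "\<xi> \<in> grid1 (Suc s)" by (auto simp: grid1_def intro!: image_eqI[of _ _ "2 * l"])
qed

lemma grid1_mono: "s \<le> u \<Longrightarrow> grid1 s \<subseteq> grid1 u"
  by (rule lift_Suc_mono_le[of grid1, OF grid1_mono_Suc])

definition interp :: "nat \<Rightarrow> (real \<Rightarrow> complex) \<Rightarrow> real \<Rightarrow> complex" where
  "interp s g x = (\<Sum>\<xi>\<in>grid1 s. g \<xi> * (smooth_kernel s (x - \<xi>) / 2 ^ (s + 2)))"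

text \<open>
  Sampling on the grid could only confuse \<open>k\<close> with a frequency \<open>j\<close> of the kernel that is congruent to it.
  The grid is too fine for that, and at \<open>j = k\<close> the multiplier is 1.
\<close>

lemma interp_ee:
  assumes k: "\<bar>k\<bar> \<le> 2 ^ s"
  shows "interp s (\<lambda>z. ee (of_int k * z)) x = ee (of_int k * x)"
proof -
  let ?N = "2 ^ (s + 2) :: nat" and ?A = "{- (2 ^ Suc s)<..<2 ^ Suc s :: int}"
  have "interp s (\<lambda>z. ee (of_int k * z)) x
    = (\<Sum>l<?N. \<Sum>j\<in>?A. of_real (hat (Suc s) j) * ee (of_int j * x) / 2 ^ (s + 2) * ee (of_int (k - j) * (0 + real l / real ?N)))"
    unfolding interp_def sum_grid1 smooth_kernel_def trig_def sum_distrib_left sum_divide_distrib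
  proof (intro sum.cong refl)
    fix l j
    have "ee (of_int k * (real l / 2 ^ (s + 2))) * ee (of_int j * (x - real l / 2 ^ (s + 2)))
       = ee (of_int j * x) * ee (of_int (k - j) * (0 + real l / real ?N))"
      by (simp only: ee_add[symmetric]) (simp add: algebra_simps diff_divide_distrib)
    then show "ee (of_int k * (real l / 2 ^ (s + 2))) * (of_real (hat (Suc s) j) * ee (of_int j * (x - real l / 2 ^ (s + 2))) / 2 ^ (s + 2))
       = of_real (hat (Suc s) j) * ee (of_int j * x) / 2 ^ (s + 2) * ee (of_int (k - j) * (0 + real l / real ?N))"
      by (simp add: mult_ac)
  qed
  also have "\<dots> = (\<Sum>j\<in>?A. of_real (hat (Suc s) j) * ee (of_int j * x) / 2 ^ (s + 2) * (\<Sum>l<?N. ee (of_int (k - j) * (0 + real l / real ?N))))"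
    unfolding sum_distrib_left by (rule sum.swap)
  also have "\<dots> = (\<Sum>j\<in>?A. if j = k then ee (of_int k * x) else 0)"
  proof (rule sum.cong[OF refl])
    fix j assume j: "j \<in> ?A"
    have N: "int ?N = 4 * 2 ^ s" by simp
    have "int ?N dvd (k - j) \<longleftrightarrow> j = k"
    proof
      assume d: "int ?N dvd (k - j)"
      have "\<bar>k - j\<bar> < int ?N" using j k unfolding N by auto
      with d show "j = k" by (metis dvd_imp_le_int eq_iff_diff_eq_0 linorder_not_le abs_of_nat)
    qed simp
    moreover have "hat (Suc s) k = 1" using k by (intro hat_eq_1) simp
    ultimately show "of_real (hat (Suc s) j) * ee (of_int j * x) / 2 ^ (s + 2) * (\<Sum>l<?N. ee (of_int (k - j) * (0 + real l / real ?N)))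
        = (if j = k then ee (of_int k * x) else 0)"
      by (subst sum_ee_roots) auto
  qed
  also have "\<dots> = ee (of_int k * x)"
  proof -
    have "(0::int) < 2 ^ s" by simp
    then have "k \<in> ?A" using k unfolding greaterThanLessThan_iff power_Suc by linarith
    then show ?thesis by simp
  qed
  finally show ?thesis .
qed

lemma interp_trig:
  assumes "\<And>k. k \<in> A \<Longrightarrow> \<bar>k\<bar> \<le> 2 ^ s"
  shows "interp s (trig A c) x = trig A c x"
proof -
  have "interp s (trig A c) x = (\<Sum>k\<in>A. c k * interp s (\<lambda>z. ee (of_int k * z)) x)"
    unfolding interp_def trig_def sum_distrib_left sum_distrib_right by (subst sum.swap) (simp add: mult_ac)
  then show ?thesis using assms by (simp add: interp_ee trig_def)
qed

text \<open>
  The weights of \<open>interp s - interp (s - 1)\<close>, written on the finer of the two nested grids; at level 0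
  nothing is subtracted.
\<close>

definition detail_weight :: "nat \<Rightarrow> real \<Rightarrow> real \<Rightarrow> complex" where
  "detail_weight s \<xi> x = smooth_kernel s (x - \<xi>) / 2 ^ (s + 2)
     - (if 0 < s \<and> \<xi> \<in> grid1 (s - 1) then smooth_kernel (s - 1) (x - \<xi>) / 2 ^ (s + 1) else 0)"

definition detail :: "nat \<Rightarrow> (real \<Rightarrow> complex) \<Rightarrow> real \<Rightarrow> complex" where
  "detail s g x = (\<Sum>\<xi>\<in>grid1 s. g \<xi> * detail_weight s \<xi> x)"

lemma detail_eq: "detail s g x = interp s g x - (if 0 < s then interp (s - 1) g x else 0)"
proof (cases s)
  case 0
  then show ?thesis by (simp add: detail_def interp_def detail_weight_def)
next
  case (Suc t)
  have "(\<Sum>\<xi>\<in>grid1 (Suc t). g \<xi> * (if \<xi> \<in> grid1 t then smooth_kernel t (x - \<xi>) / 2 ^ (t + 2) else 0)) = interp t g x"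
  proof -
    have "(\<Sum>\<xi>\<in>grid1 (Suc t). g \<xi> * (if \<xi> \<in> grid1 t then smooth_kernel t (x - \<xi>) / 2 ^ (t + 2) else 0))
       = (\<Sum>\<xi>\<in>grid1 (Suc t) \<inter> grid1 t. g \<xi> * (smooth_kernel t (x - \<xi>) / 2 ^ (t + 2)))"
      by (simp add: if_distrib[of "\<lambda>y. g _ * y"] sum.If_cases Int_def cong: if_cong)
    also have "grid1 (Suc t) \<inter> grid1 t = grid1 t" using grid1_mono_Suc by auto
    finally show ?thesis by (simp add: interp_def)
  qed
  moreover have "detail_weight (Suc t) \<xi> x = smooth_kernel (Suc t) (x - \<xi>) / 2 ^ (Suc t + 2)
     - (if \<xi> \<in> grid1 t then smooth_kernel t (x - \<xi>) / 2 ^ (t + 2) else 0)" for \<xi>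
    by (cases "\<xi> \<in> grid1 t") (simp_all add: detail_weight_def)
  ultimately show ?thesis
    by (simp add: Suc detail_def right_diff_distrib sum_subtractf interp_def[of "Suc t"])
qed

lemma sum_detail: "(\<Sum>s\<le>M. detail s g x) = interp M g x"
  by (induction M) (simp_all add: detail_eq)

lemma detail_sum: "detail s (\<lambda>z. \<Sum>u\<in>U. g u z) x = (\<Sum>u\<in>U. detail s (g u) x)"
  unfolding detail_def sum_distrib_right by (rule sum.swap)

lemma smooth_kernel_sum_grid:
  "(\<Sum>\<xi>\<in>grid1 s. norm (smooth_kernel s (x - \<xi>))) \<le> 2 ^ (s + 2) * smooth_const"
proof -
  have "norm (smooth_kernel s (x - \<xi>)) = norm (smooth_kernel s (- x + \<xi>))" for \<xi>
    using smooth_kernel_minus[of s "- x + \<xi>"] by simp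
  then have "(\<Sum>\<xi>\<in>grid1 s. norm (smooth_kernel s (x - \<xi>))) = (\<Sum>l<2 ^ (s + 2). norm (smooth_kernel s (- x + real l / 2 ^ (s + 2))))"
    by (simp only: sum_grid1)
  also have "\<dots> \<le> 2 ^ (s + 2) * smooth_const" by (rule smooth_kernel_discrete_L1)
  finally show ?thesis .
qed

lemma detail_weight_sum: "(\<Sum>\<xi>\<in>grid1 s. norm (detail_weight s \<xi> x)) \<le> 2 * smooth_const"
proof -
  have "(\<Sum>\<xi>\<in>grid1 s. norm (detail_weight s \<xi> x)) \<le> (\<Sum>\<xi>\<in>grid1 s. norm (smooth_kernel s (x - \<xi>)) / 2 ^ (s + 2)
      + (if 0 < s \<and> \<xi> \<in> grid1 (s - 1) then norm (smooth_kernel (s - 1) (x - \<xi>)) / 2 ^ (s + 1) else 0))"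
  proof (rule sum_mono)
    fix \<xi>
    show "norm (detail_weight s \<xi> x) \<le> norm (smooth_kernel s (x - \<xi>)) / 2 ^ (s + 2)
      + (if 0 < s \<and> \<xi> \<in> grid1 (s - 1) then norm (smooth_kernel (s - 1) (x - \<xi>)) / 2 ^ (s + 1) else 0)"
      unfolding detail_weight_def by (rule order_trans[OF norm_triangle_ineq4]) (simp add: norm_divide norm_power)
  qed
  also have "\<dots> = (\<Sum>\<xi>\<in>grid1 s. norm (smooth_kernel s (x - \<xi>))) / 2 ^ (s + 2)
      + (\<Sum>\<xi>\<in>grid1 s. if 0 < s \<and> \<xi> \<in> grid1 (s - 1) then norm (smooth_kernel (s - 1) (x - \<xi>)) / 2 ^ (s + 1) else 0)"
    by (simp add: sum.distrib sum_divide_distrib)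
  also have "\<dots> \<le> smooth_const + smooth_const"
  proof (rule add_mono)
    show "(\<Sum>\<xi>\<in>grid1 s. norm (smooth_kernel s (x - \<xi>))) / 2 ^ (s + 2) \<le> smooth_const"
      using smooth_kernel_sum_grid[of s x] by (simp add: field_simps)
    show "(\<Sum>\<xi>\<in>grid1 s. if 0 < s \<and> \<xi> \<in> grid1 (s - 1) then norm (smooth_kernel (s - 1) (x - \<xi>)) / 2 ^ (s + 1) else 0) \<le> smooth_const"
    proof (cases s)
      case 0
      then show ?thesis using smooth_const_pos by simp
    next
      case (Suc t)
      have "(\<Sum>\<xi>\<in>grid1 s. if 0 < s \<and> \<xi> \<in> grid1 (s - 1) then norm (smooth_kernel (s - 1) (x - \<xi>)) / 2 ^ (s + 1) else 0)
         = (\<Sum>\<xi>\<in>grid1 (Suc t) \<inter> grid1 t. norm (smooth_kernel t (x - \<xi>)) / 2 ^ (t + 2))"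
        using Suc by (simp add: sum.If_cases Int_def)
      also have "grid1 (Suc t) \<inter> grid1 t = grid1 t" using grid1_mono_Suc by auto
      also have "(\<Sum>\<xi>\<in>grid1 t. norm (smooth_kernel t (x - \<xi>)) / 2 ^ (t + 2)) \<le> smooth_const"
        \<comment> \<open>The coarser half of the weight lives on the coarser grid and is normalized there.\<close>
        using smooth_kernel_sum_grid[of t x] by (simp add: sum_divide_distrib[symmetric] field_simps)
      finally show ?thesis .
    qed
  qed
  finally show ?thesis by simp
qed

lemma continuous_on_detail_weight [continuous_intros]:
  "continuous_on S f \<Longrightarrow> continuous_on S (\<lambda>x. detail_weight s \<xi> (f x))"
  unfolding detail_weight_def by (cases "0 < s \<and> \<xi> \<in> grid1 (s - 1)") (auto intro!: continuous_intros)

lemma smooth_kernel_L1: "(\<integral>\<^sup>+x. ennreal (norm (smooth_kernel s (x - \<xi>))) \<partial>unit_M) \<le> ennreal smooth_const"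
proof (rule nn_integral_unit_of_discrete[where N = "2 ^ (s + 2)"])
  show "(\<lambda>x. norm (smooth_kernel s (x - \<xi>))) \<in> borel_measurable borel"
    by (intro borel_measurable_continuous_onI continuous_intros)
  show "(\<Sum>l<2 ^ (s + 2). norm (smooth_kernel s (x + real l / real (2 ^ (s + 2)) - \<xi>))) \<le> real (2 ^ (s + 2)) * smooth_const" for x
    using smooth_kernel_discrete_L1[of s "x - \<xi>"] by (simp add: algebra_simps)
qed auto

lemma detail_weight_L1: "(\<integral>\<^sup>+x. ennreal (norm (detail_weight s \<xi> x)) \<partial>unit_M) \<le> ennreal (smooth_const / 2 ^ s)"
proof -
  have m: "(\<lambda>x. ennreal (norm (smooth_kernel s (x - \<xi>)))) \<in> borel_measurable unit_M" for s
    by (intro measurable_unit_M measurable_compose[OF _ measurable_ennreal] borel_measurable_continuous_onI continuous_intros)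
  have pt: "ennreal (norm (detail_weight s \<xi> x)) \<le> ennreal (1 / 2 ^ (s + 2)) * ennreal (norm (smooth_kernel s (x - \<xi>)))
      + ennreal (1 / 2 ^ (s + 1)) * ennreal (norm (smooth_kernel (s - 1) (x - \<xi>)))" for x
  proof -
    have "norm (detail_weight s \<xi> x) \<le> norm (smooth_kernel s (x - \<xi>)) / 2 ^ (s + 2) + norm (smooth_kernel (s - 1) (x - \<xi>)) / 2 ^ (s + 1)"
      unfolding detail_weight_def by (rule order_trans[OF norm_triangle_ineq4]) (simp add: norm_divide norm_power)
    then show ?thesis by (simp add: ennreal_mult[symmetric] ennreal_plus[symmetric] ennreal_leI del: ennreal_plus)
  qed
  have "(\<integral>\<^sup>+x. ennreal (norm (detail_weight s \<xi> x)) \<partial>unit_M) \<le> (\<integral>\<^sup>+x. ennreal (1 / 2 ^ (s + 2)) * ennreal (norm (smooth_kernel s (x - \<xi>)))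
      + ennreal (1 / 2 ^ (s + 1)) * ennreal (norm (smooth_kernel (s - 1) (x - \<xi>))) \<partial>unit_M)"
    by (rule nn_integral_mono) (rule pt)
  also have "\<dots> = ennreal (1 / 2 ^ (s + 2)) * (\<integral>\<^sup>+x. ennreal (norm (smooth_kernel s (x - \<xi>))) \<partial>unit_M)
      + ennreal (1 / 2 ^ (s + 1)) * (\<integral>\<^sup>+x. ennreal (norm (smooth_kernel (s - 1) (x - \<xi>))) \<partial>unit_M)"
    by (subst nn_integral_add) (auto intro!: m borel_measurable_times_ennreal simp: nn_integral_cmult m)
  also have "\<dots> \<le> ennreal (1 / 2 ^ (s + 2)) * ennreal smooth_const + ennreal (1 / 2 ^ (s + 1)) * ennreal smooth_const"
    by (intro add_mono mult_left_mono smooth_kernel_L1) auto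
  also have "\<dots> = ennreal (smooth_const * (3 / 4) / 2 ^ s)"
    using smooth_const_pos by (simp add: ennreal_mult[symmetric] ennreal_plus[symmetric] field_simps del: ennreal_plus)
  also have "\<dots> \<le> ennreal (smooth_const / 2 ^ s)"
    using smooth_const_pos by (intro ennreal_leI) (simp add: field_simps)
  finally show ?thesis .
qed

text \<open>
  The pieces add up to a smoothed partial sum of \<open>kernel1 r\<close>. The piece \<open>u = 0\<close> is the constant term, and
  \<open>cos (2 * pi * k * x - r * pi / 2)\<close> is the real part of \<open>cis (- (r * pi / 2)) * ee (k * x)\<close>.
\<close>

definition kernel_piece :: "real \<Rightarrow> nat \<Rightarrow> real \<Rightarrow> real" where
  "kernel_piece r u x = (case u of 0 \<Rightarrow> 1 | Suc i \<Rightarrow> 2 * Re (cis (- (r * pi / 2)) * block i (- r) x))"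

definition kernel_const :: "real \<Rightarrow> real" where
  "kernel_const r = 1 + 2 * block_const (- r) * 2 powr r"

lemma kernel_const_ge_1: "1 \<le> kernel_const r"
  using block_const_pos[of "- r"] by (simp add: kernel_const_def)

lemma kernel_piece_le_block: "\<bar>kernel_piece r (Suc i) x\<bar> \<le> 2 * norm (block i (- r) x)"
  using abs_Re_le_cmod[of "cis (- (r * pi / 2)) * block i (- r) x"] by (simp add: kernel_piece_def norm_mult)

lemma continuous_on_kernel_piece [continuous_intros]:
  "continuous_on S f \<Longrightarrow> continuous_on S (\<lambda>x. kernel_piece r u (f x))"
  by (cases u) (auto simp: kernel_piece_def intro!: continuous_intros)

lemma kernel_piece_sup: "\<bar>kernel_piece r u x\<bar> \<le> kernel_const r * 2 powr (- r * real u + real u)"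
proof (cases u)
  case 0
  then show ?thesis using kernel_const_ge_1[of r] by (simp add: kernel_piece_def)
next
  case (Suc i)
  have "\<bar>kernel_piece r u x\<bar> \<le> 2 * (2 * block_const (- r) * 2 powr (- r * real i + real i))"
    unfolding Suc by (rule order_trans[OF kernel_piece_le_block]) (intro mult_left_mono norm_block_le, simp)
  also have "\<dots> = 2 * block_const (- r) * 2 powr r * 2 powr (- r * real u + real u)"
    by (simp add: Suc powr_add[symmetric] algebra_simps powr_diff) (simp add: powr_add)
  also have "\<dots> \<le> kernel_const r * 2 powr (- r * real u + real u)"
    by (intro mult_right_mono) (auto simp: kernel_const_def)
  finally show ?thesis .
qed

lemma kernel_piece_discrete:
  "(\<Sum>l<2 ^ (u + 2). \<bar>kernel_piece r u (x + real l / 2 ^ (u + 2))\<bar>) \<le> 2 ^ (u + 2) * (kernel_const r * 2 powr (- r * real u))"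
proof (cases u)
  case 0
  then show ?thesis using kernel_const_ge_1[of r] by (simp add: kernel_piece_def)
next
  case (Suc i)
  have e: "u + 2 = i + 3" using Suc by simp
  have "(\<Sum>l<2 ^ (u + 2). \<bar>kernel_piece r u (x + real l / 2 ^ (u + 2))\<bar>) \<le> (\<Sum>l<2 ^ (i + 3). 2 * norm (block i (- r) (x + real l / 2 ^ (i + 3))))"
    unfolding e unfolding Suc by (intro sum_mono kernel_piece_le_block)
  also have "\<dots> \<le> 2 * (2 ^ (i + 3) * (block_const (- r) * 2 powr (- r * real i)))"
    unfolding sum_distrib_left[symmetric] by (intro mult_left_mono block_discrete_L1) auto
  also have "\<dots> = 2 ^ (u + 2) * ((2 * block_const (- r) * 2 powr r) * 2 powr (- r * real u))"
    unfolding e by (simp add: Suc powr_add[symmetric] algebra_simps)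
  also have "\<dots> \<le> 2 ^ (u + 2) * (kernel_const r * 2 powr (- r * real u))"
    by (intro mult_left_mono mult_right_mono) (auto simp: kernel_const_def)
  finally show ?thesis .
qed

lemma abs_kernel_piece_reflect:
  "(\<Sum>l<2 ^ (u + 2). \<bar>kernel_piece r u (x - real l / 2 ^ (u + 2))\<bar>) \<le> 2 ^ (u + 2) * (kernel_const r * 2 powr (- r * real u))"
proof (cases u)
  case 0
  then show ?thesis using kernel_const_ge_1[of r] by (simp add: kernel_piece_def)
next
  case (Suc i)
  have e: "u + 2 = i + 3" using Suc by simp
  have sym: "norm (block i (- r) (x - z)) = norm (block i (- r) (- x + z))" for z
    using block_minus[of i "- r" "- x + z"] by simp
  have "(\<Sum>l<2 ^ (u + 2). \<bar>kernel_piece r u (x - real l / 2 ^ (u + 2))\<bar>) \<le> (\<Sum>l<2 ^ (i + 3). 2 * norm (block i (- r) (- x + real l / 2 ^ (i + 3))))"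
    unfolding e unfolding Suc sym[symmetric] by (intro sum_mono kernel_piece_le_block)
  also have "\<dots> \<le> 2 * (2 ^ (i + 3) * (block_const (- r) * 2 powr (- r * real i)))"
    unfolding sum_distrib_left[symmetric] by (intro mult_left_mono block_discrete_L1) auto
  also have "\<dots> = 2 ^ (u + 2) * ((2 * block_const (- r) * 2 powr r) * 2 powr (- r * real u))"
    unfolding e by (simp add: Suc powr_add[symmetric] algebra_simps)
  also have "\<dots> \<le> 2 ^ (u + 2) * (kernel_const r * 2 powr (- r * real u))"
    by (intro mult_left_mono mult_right_mono) (auto simp: kernel_const_def)
  finally show ?thesis .
qed

lemma kernel_piece_L1: "(\<integral>\<^sup>+y. ennreal \<bar>kernel_piece r u (x - y)\<bar> \<partial>unit_M) \<le> ennreal (kernel_const r * 2 powr (- r * real u))"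
proof (rule nn_integral_unit_of_discrete[where N = "2 ^ (u + 2)"])
  show "(\<lambda>y. \<bar>kernel_piece r u (x - y)\<bar>) \<in> borel_measurable borel"
    by (intro borel_measurable_continuous_onI continuous_intros)
  show "(\<Sum>l<2 ^ (u + 2). \<bar>kernel_piece r u (x - (y + real l / real (2 ^ (u + 2))))\<bar>)
      \<le> real (2 ^ (u + 2)) * (kernel_const r * 2 powr (- r * real u))" for y
    using abs_kernel_piece_reflect[of r u "x - y"] by (simp add: algebra_simps)
qed auto

text \<open>
  As a function of \<open>z\<close> the piece has frequencies of modulus less than \<open>2 ^ Suc i\<close>; the second polynomial,
  the conjugate of the first, carries the negative ones.
\<close>

lemma kernel_piece_eq_trig:
  "complex_of_real (kernel_piece r (Suc i) (z - y)) =
     trig {0<..<2 ^ Suc i} (\<lambda>k. cis (- (r * pi / 2)) * of_real (block_coeff i (- r) k) * ee (- (of_int k * y))) z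
   + trig {0<..<2 ^ Suc i} (\<lambda>k. cis (r * pi / 2) * of_real (block_coeff i (- r) k) * ee (of_int k * y)) (- z)"
proof -
  let ?w = "cis (- (r * pi / 2)) * block i (- r) (z - y)"
  have "complex_of_real (kernel_piece r (Suc i) (z - y)) = ?w + cnj ?w"
    by (simp only: kernel_piece_def nat.case complex_add_cnj)
  also have "cnj ?w = cis (r * pi / 2) * block i (- r) (- z + y)"
    using block_minus[of i "- r" "z - y"] by (simp add: cis_cnj)
  also have "?w = trig {0<..<2 ^ Suc i} (\<lambda>k. cis (- (r * pi / 2)) * of_real (block_coeff i (- r) k) * ee (- (of_int k * y))) z"
    unfolding block_def trig_def sum_distrib_left
  proof (rule sum.cong[OF refl])
    fix k
    have "ee (of_int k * (z - y)) = ee (of_int k * z) * ee (- (of_int k * y))"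
      by (simp only: ee_add[symmetric]) (simp add: right_diff_distrib)
    then show "cis (- (r * pi / 2)) * (of_real (block_coeff i (- r) k) * ee (of_int k * (z - y)))
      = cis (- (r * pi / 2)) * of_real (block_coeff i (- r) k) * ee (- (of_int k * y)) * ee (of_int k * z)"
      by (simp only: mult_ac)
  qed
  also have "cis (r * pi / 2) * block i (- r) (- z + y) = trig {0<..<2 ^ Suc i} (\<lambda>k. cis (r * pi / 2) * of_real (block_coeff i (- r) k) * ee (of_int k * y)) (- z)"
    unfolding block_def trig_def sum_distrib_left
  proof (rule sum.cong[OF refl])
    fix k
    have "ee (of_int k * (- z + y)) = ee (of_int k * - z) * ee (of_int k * y)"
      by (simp only: ee_add[symmetric] distrib_left)
    then show "cis (r * pi / 2) * (of_real (block_coeff i (- r) k) * ee (of_int k * (- z + y)))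
      = cis (r * pi / 2) * of_real (block_coeff i (- r) k) * ee (of_int k * y) * ee (of_int k * - z)"
      by (simp only: mult_ac)
  qed
  finally show ?thesis .
qed

lemma nn_integral_sum_cmult:
  assumes "\<And>i. i \<in> I \<Longrightarrow> f i \<in> borel_measurable N"
  shows "(\<integral>\<^sup>+x. (\<Sum>i\<in>I. c i * f i x) \<partial>N) = (\<Sum>i\<in>I. c i * (\<integral>\<^sup>+x. f i x \<partial>N))"
proof -
  have "(\<integral>\<^sup>+x. (\<Sum>i\<in>I. c i * f i x) \<partial>N) = (\<Sum>i\<in>I. \<integral>\<^sup>+x. c i * f i x \<partial>N)"
    by (rule nn_integral_sum) (rule borel_measurable_times_ennreal[OF borel_measurable_const assms])
  also have "\<dots> = (\<Sum>i\<in>I. c i * (\<integral>\<^sup>+x. f i x \<partial>N))"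
    by (intro sum.cong refl nn_integral_cmult assms)
  finally show ?thesis .
qed

lemma interp_cong_sum: "interp s (\<lambda>z. a * f z + b * g z) x = a * interp s f x + b * interp s g x"
  unfolding interp_def sum_distrib_left sum.distrib[symmetric]
  by (intro sum.cong refl) (simp only: distrib_right mult.assoc)

lemma trig_reflect: "trig A c (- z) = trig (uminus ` A) (\<lambda>k. c (- k)) z"
  unfolding trig_def by (subst sum.reindex) (auto simp: inj_on_def)

text \<open>
  The frequencies of the piece \<open>u\<close> are among those that the grid of level \<open>s \<ge> u\<close> reproduces.
\<close>

lemma interp_kernel_piece:
  assumes "u \<le> s"
  shows "interp s (\<lambda>z. complex_of_real (kernel_piece r u (z - y))) x = complex_of_real (kernel_piece r u (x - y))"
proof (cases u)
  case 0
  have "interp s (\<lambda>z. ee (of_int 0 * z)) x = ee (of_int 0 * x)" by (rule interp_ee) simp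
  then show ?thesis using 0 by (simp add: kernel_piece_def)
next
  case (Suc i)
  have le: "(2::int) ^ Suc i \<le> 2 ^ s" using assms Suc by (intro power_increasing) auto
  define c where "c k = cis (- (r * pi / 2)) * of_real (block_coeff i (- r) k) * ee (- (of_int k * y))" for k
  define d where "d k = cis (r * pi / 2) * of_real (block_coeff i (- r) k) * ee (of_int k * y)" for k
  let ?A = "{0<..<2 ^ Suc i :: int}"
  have eq: "complex_of_real (kernel_piece r u (z - y)) = 1 * trig ?A c z + 1 * trig (uminus ` ?A) (\<lambda>k. d (- k)) z" for z
    unfolding Suc kernel_piece_eq_trig trig_reflect c_def d_def by (simp only: mult_1_left)
  have "interp s (trig ?A c) x = trig ?A c x" by (rule interp_trig) (use le in auto)
  moreover have "interp s (trig (uminus ` ?A) (\<lambda>k. d (- k))) x = trig (uminus ` ?A) (\<lambda>k. d (- k)) x"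
    by (rule interp_trig) (use le in auto)
  ultimately show ?thesis unfolding eq interp_cong_sum by simp
qed

section \<open>Kernels of the detail operators\<close>

definition kernel_sum :: "real \<Rightarrow> nat \<Rightarrow> real \<Rightarrow> real" where
  "kernel_sum r M x = (\<Sum>u\<le>M. kernel_piece r u x)"

lemma continuous_on_kernel_sum [continuous_intros]:
  "continuous_on S f \<Longrightarrow> continuous_on S (\<lambda>x. kernel_sum r M (f x))"
  unfolding kernel_sum_def by (intro continuous_intros)

text \<open>
  Both interpolation operators that make up the detail of level \<open>s > u\<close> reproduce the piece.
\<close>

lemma detail_kernel_piece_eq_0:
  assumes "u < s"
  shows "detail s (\<lambda>z. complex_of_real (kernel_piece r u (z - y))) x = 0"
  using assms interp_kernel_piece[of u s r y x] interp_kernel_piece[of u "s - 1" r y x]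
  by (simp add: detail_eq)

lemma detail_kernel_sum:
  "detail s (\<lambda>z. complex_of_real (kernel_sum r M (z - y))) x
     = (\<Sum>u\<le>M. detail s (\<lambda>z. complex_of_real (kernel_piece r u (z - y))) x)"
  unfolding kernel_sum_def of_real_sum by (rule detail_sum)

lemma detail_kernel_sum_eq_0:
  "M < s \<Longrightarrow> detail s (\<lambda>z. complex_of_real (kernel_sum r M (z - y))) x = 0"
  unfolding detail_kernel_sum by (intro sum.neutral ballI detail_kernel_piece_eq_0) auto

lemma sum_detail_kernel_sum:
  "(\<Sum>s\<le>M. detail s (\<lambda>z. complex_of_real (kernel_sum r M (z - y))) x) = complex_of_real (kernel_sum r M (x - y))"
proof -
  have "interp M (\<lambda>z. \<Sum>u\<le>M. complex_of_real (kernel_piece r u (z - y))) x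
      = (\<Sum>u\<le>M. interp M (\<lambda>z. complex_of_real (kernel_piece r u (z - y))) x)"
    unfolding interp_def sum_distrib_right by (rule sum.swap)
  also have "\<dots> = complex_of_real (kernel_sum r M (x - y))"
    by (simp add: kernel_sum_def interp_kernel_piece)
  finally show ?thesis by (simp add: sum_detail kernel_sum_def)
qed

text \<open>
  The detail of level \<open>s\<close> of the piece of level \<open>s + t\<close>, divided by the natural size
  \<open>2 powr (- r * (s + t))\<close> of the piece. Details of pieces with lower level vanish. The three bounds that
  follow are those required by \<open>HLS_bound_dyadic_sum\<close>.
\<close>

definition scaled_detail :: "real \<Rightarrow> nat \<Rightarrow> nat \<Rightarrow> real \<Rightarrow> real \<Rightarrow> real" where
  "scaled_detail r s t x y = 2 powr (r * real (s + t)) * norm (detail s (\<lambda>z. complex_of_real (kernel_piece r (s + t) (z - y))) x)"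

lemma scaled_detail_nonneg [simp]: "0 \<le> scaled_detail r s t x y"
  by (simp add: scaled_detail_def)

definition detail_const :: "real \<Rightarrow> real" where
  "detail_const r = 4 * smooth_const * kernel_const r"

lemma detail_const_pos: "0 < detail_const r"
  using smooth_const_pos kernel_const_ge_1[of r] by (simp add: detail_const_def)

lemma norm_detail_le: "norm (detail s (\<lambda>z. complex_of_real (g z)) x) \<le> (\<Sum>\<xi>\<in>grid1 s. \<bar>g \<xi>\<bar> * norm (detail_weight s \<xi> x))"
  unfolding detail_def by (rule order_trans[OF norm_sum]) (simp add: norm_mult)

lemma scaled_detail_sup: "scaled_detail r s t x y \<le> detail_const r * 2 ^ (s + t)"
proof -
  let ?u = "s + t"
  have "norm (detail s (\<lambda>z. complex_of_real (kernel_piece r ?u (z - y))) x)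
      \<le> (\<Sum>\<xi>\<in>grid1 s. (kernel_const r * 2 powr (- r * real ?u + real ?u)) * norm (detail_weight s \<xi> x))"
    by (rule order_trans[OF norm_detail_le]) (intro sum_mono mult_right_mono kernel_piece_sup norm_ge_zero)
  also have "\<dots> \<le> (kernel_const r * 2 powr (- r * real ?u + real ?u)) * (2 * smooth_const)"
    unfolding sum_distrib_left[symmetric]
    by (intro mult_left_mono detail_weight_sum) (use kernel_const_ge_1[of r] in auto)
  finally have "scaled_detail r s t x y \<le> 2 powr (r * real ?u) * ((kernel_const r * 2 powr (- r * real ?u + real ?u)) * (2 * smooth_const))"
    unfolding scaled_detail_def by (intro mult_left_mono) auto
  also have "\<dots> = 2 * smooth_const * kernel_const r * (2 powr (r * real ?u) * 2 powr (- r * real ?u + real ?u))" by simp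
  also have "2 powr (r * real ?u) * 2 powr (- r * real ?u + real ?u) = 2 ^ ?u"
    by (simp only: powr_add[symmetric]) (simp add: powr_realpow flip: of_nat_add)
  also have "2 * smooth_const * kernel_const r * 2 ^ ?u \<le> detail_const r * 2 ^ ?u"
    unfolding detail_const_def using smooth_const_pos kernel_const_ge_1[of r] by (intro mult_right_mono) auto
  finally show ?thesis .
qed

lemma powr_cancel_scale: "2 powr (r * real u) * (c * 2 powr (- r * real u)) = (c::real)"
  by (simp add: powr_minus)

lemma borel_measurable_scaled_detail:
  "(\<lambda>(x, y). scaled_detail r s t x y) \<in> borel_measurable (unit_M \<Otimes>\<^sub>M unit_M)"
proof -
  have id: "(\<lambda>x::real. x) \<in> borel_measurable unit_M" by (intro measurable_unit_M) simp
  have a: "(\<lambda>p. kernel_piece r (s + t) (\<xi> - snd p)) \<in> borel_measurable (unit_M \<Otimes>\<^sub>M unit_M)" for \<xi>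
  proof (rule measurable_compose[OF measurable_compose[OF measurable_snd id]])
    show "(\<lambda>y. kernel_piece r (s + t) (\<xi> - y)) \<in> borel_measurable borel"
      by (intro borel_measurable_continuous_onI continuous_intros)
  qed
  have b: "(\<lambda>p. detail_weight s \<xi> (fst p)) \<in> borel_measurable (unit_M \<Otimes>\<^sub>M unit_M)" for \<xi>
  proof (rule measurable_compose[OF measurable_compose[OF measurable_fst id]])
    show "(\<lambda>x. detail_weight s \<xi> x) \<in> borel_measurable borel"
      by (intro borel_measurable_continuous_onI continuous_intros)
  qed
  show ?thesis
    unfolding scaled_detail_def detail_def case_prod_beta
  proof (intro borel_measurable_times borel_measurable_const measurable_compose[OF _ borel_measurable_norm] borel_measurable_sum b)
    fix \<xi>
    show "(\<lambda>p. complex_of_real (kernel_piece r (s + t) (\<xi> - snd p))) \<in> borel_measurable (unit_M \<Otimes>\<^sub>M unit_M)"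
      by (rule measurable_compose[OF a[of \<xi>]]) (intro borel_measurable_continuous_onI continuous_intros)
  qed
qed

lemma scaled_detail_int_y: "(\<integral>\<^sup>+y. ennreal (scaled_detail r s t x y) \<partial>unit_M) \<le> ennreal (detail_const r)"
proof -
  let ?u = "s + t" and ?c = "2 powr (r * real (s + t))"
  have m: "(\<lambda>y. ennreal \<bar>kernel_piece r ?u (\<xi> - y)\<bar>) \<in> borel_measurable unit_M" for \<xi>
    by (intro measurable_unit_M measurable_compose[OF _ measurable_ennreal] borel_measurable_continuous_onI continuous_intros)
  have "(\<integral>\<^sup>+y. ennreal (scaled_detail r s t x y) \<partial>unit_M)
      \<le> (\<integral>\<^sup>+y. (\<Sum>\<xi>\<in>grid1 s. ennreal (?c * norm (detail_weight s \<xi> x)) * ennreal \<bar>kernel_piece r ?u (\<xi> - y)\<bar>) \<partial>unit_M)"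
  proof (intro nn_integral_mono)
    fix y
    have "scaled_detail r s t x y \<le> ?c * (\<Sum>\<xi>\<in>grid1 s. \<bar>kernel_piece r ?u (\<xi> - y)\<bar> * norm (detail_weight s \<xi> x))"
      unfolding scaled_detail_def by (intro mult_left_mono norm_detail_le) auto
    also have "\<dots> = (\<Sum>\<xi>\<in>grid1 s. ?c * norm (detail_weight s \<xi> x) * \<bar>kernel_piece r ?u (\<xi> - y)\<bar>)"
      by (simp add: sum_distrib_left mult_ac)
    finally have "ennreal (scaled_detail r s t x y) \<le> ennreal (\<Sum>\<xi>\<in>grid1 s. ?c * norm (detail_weight s \<xi> x) * \<bar>kernel_piece r ?u (\<xi> - y)\<bar>)"
      by (rule ennreal_leI)
    also have "\<dots> = (\<Sum>\<xi>\<in>grid1 s. ennreal (?c * norm (detail_weight s \<xi> x) * \<bar>kernel_piece r ?u (\<xi> - y)\<bar>))"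
      by (rule sum_ennreal[symmetric]) simp
    also have "\<dots> = (\<Sum>\<xi>\<in>grid1 s. ennreal (?c * norm (detail_weight s \<xi> x)) * ennreal \<bar>kernel_piece r ?u (\<xi> - y)\<bar>)"
      by (intro sum.cong refl ennreal_mult) auto
    finally show "ennreal (scaled_detail r s t x y) \<le> (\<Sum>\<xi>\<in>grid1 s. ennreal (?c * norm (detail_weight s \<xi> x)) * ennreal \<bar>kernel_piece r ?u (\<xi> - y)\<bar>)" .
  qed
  also have "\<dots> = (\<Sum>\<xi>\<in>grid1 s. ennreal (?c * norm (detail_weight s \<xi> x)) * (\<integral>\<^sup>+y. ennreal \<bar>kernel_piece r ?u (\<xi> - y)\<bar> \<partial>unit_M))"
    by (rule nn_integral_sum_cmult) (rule m)
  also have "\<dots> \<le> (\<Sum>\<xi>\<in>grid1 s. ennreal (?c * norm (detail_weight s \<xi> x)) * ennreal (kernel_const r * 2 powr (- r * real ?u)))"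
    by (intro sum_mono mult_left_mono kernel_piece_L1) auto
  also have "\<dots> = ennreal ((\<Sum>\<xi>\<in>grid1 s. norm (detail_weight s \<xi> x)) * (?c * (kernel_const r * 2 powr (- r * real ?u))))"
  proof -
    have "(\<Sum>\<xi>\<in>grid1 s. ennreal (?c * norm (detail_weight s \<xi> x)) * ennreal (kernel_const r * 2 powr (- r * real ?u)))
       = (\<Sum>\<xi>\<in>grid1 s. ennreal (?c * norm (detail_weight s \<xi> x) * (kernel_const r * 2 powr (- r * real ?u))))"
      using kernel_const_ge_1[of r] by (intro sum.cong refl ennreal_mult[symmetric]) auto
    also have "\<dots> = ennreal (\<Sum>\<xi>\<in>grid1 s. ?c * norm (detail_weight s \<xi> x) * (kernel_const r * 2 powr (- r * real ?u)))"
      using kernel_const_ge_1[of r] by (intro sum_ennreal) auto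
    finally show ?thesis by (simp only: sum_distrib_left sum_distrib_right mult_ac)
  qed
  also have "\<dots> \<le> ennreal ((2 * smooth_const) * kernel_const r)"
    unfolding powr_cancel_scale using kernel_const_ge_1[of r]
    by (intro ennreal_leI mult_right_mono detail_weight_sum) auto
  also have "\<dots> \<le> ennreal (detail_const r)"
    unfolding detail_const_def using smooth_const_pos kernel_const_ge_1[of r] by (intro ennreal_leI mult_right_mono) auto
  finally show ?thesis .
qed

text \<open>
  Here the piece is summed over the nodes of level \<open>s\<close> only, whereas its discrete average is controlled on
  the grid of its own level \<open>s + t\<close>, which has \<open>2 ^ t\<close> times as many nodes. Enlarging the sum to that
  grid costs the factor \<open>2 ^ t\<close>: this is the aliasing error of sampling, and \<open>r > 1 / p\<close> is what makes
  it summable in \<open>t\<close>.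
\<close>

lemma scaled_detail_int_x: "(\<integral>\<^sup>+x. ennreal (scaled_detail r s t x y) \<partial>unit_M) \<le> ennreal (detail_const r * 2 ^ t)"
proof -
  let ?u = "s + t" and ?c = "2 powr (r * real (s + t))"
  have m: "(\<lambda>x. ennreal (norm (detail_weight s \<xi> x))) \<in> borel_measurable unit_M" for \<xi>
    by (intro measurable_unit_M measurable_compose[OF _ measurable_ennreal] borel_measurable_continuous_onI continuous_intros)
  have "(\<integral>\<^sup>+x. ennreal (scaled_detail r s t x y) \<partial>unit_M)
      \<le> (\<integral>\<^sup>+x. (\<Sum>\<xi>\<in>grid1 s. ennreal (?c * \<bar>kernel_piece r ?u (\<xi> - y)\<bar>) * ennreal (norm (detail_weight s \<xi> x))) \<partial>unit_M)"
  proof (intro nn_integral_mono)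
    fix x
    have "scaled_detail r s t x y \<le> ?c * (\<Sum>\<xi>\<in>grid1 s. \<bar>kernel_piece r ?u (\<xi> - y)\<bar> * norm (detail_weight s \<xi> x))"
      unfolding scaled_detail_def by (intro mult_left_mono norm_detail_le) auto
    also have "\<dots> = (\<Sum>\<xi>\<in>grid1 s. ?c * \<bar>kernel_piece r ?u (\<xi> - y)\<bar> * norm (detail_weight s \<xi> x))"
      by (simp add: sum_distrib_left mult_ac)
    finally have "ennreal (scaled_detail r s t x y) \<le> ennreal (\<Sum>\<xi>\<in>grid1 s. ?c * \<bar>kernel_piece r ?u (\<xi> - y)\<bar> * norm (detail_weight s \<xi> x))"
      by (rule ennreal_leI)
    also have "\<dots> = (\<Sum>\<xi>\<in>grid1 s. ennreal (?c * \<bar>kernel_piece r ?u (\<xi> - y)\<bar> * norm (detail_weight s \<xi> x)))"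
      by (rule sum_ennreal[symmetric]) simp
    also have "\<dots> = (\<Sum>\<xi>\<in>grid1 s. ennreal (?c * \<bar>kernel_piece r ?u (\<xi> - y)\<bar>) * ennreal (norm (detail_weight s \<xi> x)))"
      by (intro sum.cong refl ennreal_mult) auto
    finally show "ennreal (scaled_detail r s t x y) \<le> (\<Sum>\<xi>\<in>grid1 s. ennreal (?c * \<bar>kernel_piece r ?u (\<xi> - y)\<bar>) * ennreal (norm (detail_weight s \<xi> x)))" .
  qed
  also have "\<dots> = (\<Sum>\<xi>\<in>grid1 s. ennreal (?c * \<bar>kernel_piece r ?u (\<xi> - y)\<bar>) * (\<integral>\<^sup>+x. ennreal (norm (detail_weight s \<xi> x)) \<partial>unit_M))"
    by (rule nn_integral_sum_cmult) (rule m)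
  also have "\<dots> \<le> (\<Sum>\<xi>\<in>grid1 s. ennreal (?c * \<bar>kernel_piece r ?u (\<xi> - y)\<bar>) * ennreal (smooth_const / 2 ^ s))"
    by (intro sum_mono mult_left_mono detail_weight_L1) auto
  also have "\<dots> = ennreal ((\<Sum>\<xi>\<in>grid1 s. \<bar>kernel_piece r ?u (\<xi> - y)\<bar>) * (?c * (smooth_const / 2 ^ s)))"
  proof -
    have "(\<Sum>\<xi>\<in>grid1 s. ennreal (?c * \<bar>kernel_piece r ?u (\<xi> - y)\<bar>) * ennreal (smooth_const / 2 ^ s))
       = (\<Sum>\<xi>\<in>grid1 s. ennreal (?c * \<bar>kernel_piece r ?u (\<xi> - y)\<bar> * (smooth_const / 2 ^ s)))"
      using smooth_const_pos by (intro sum.cong refl ennreal_mult[symmetric]) auto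
    also have "\<dots> = ennreal (\<Sum>\<xi>\<in>grid1 s. ?c * \<bar>kernel_piece r ?u (\<xi> - y)\<bar> * (smooth_const / 2 ^ s))"
      using smooth_const_pos by (intro sum_ennreal) auto
    finally show ?thesis by (simp only: sum_distrib_left sum_distrib_right mult_ac)
  qed
  also have "\<dots> \<le> ennreal (2 ^ (?u + 2) * (kernel_const r * 2 powr (- r * real ?u)) * (?c * (smooth_const / 2 ^ s)))"
  proof (intro ennreal_leI mult_right_mono)
    have "(\<Sum>\<xi>\<in>grid1 s. \<bar>kernel_piece r ?u (\<xi> - y)\<bar>) \<le> (\<Sum>\<xi>\<in>grid1 ?u. \<bar>kernel_piece r ?u (\<xi> - y)\<bar>)"
      by (intro sum_mono2 grid1_mono) auto
    also have "\<dots> \<le> 2 ^ (?u + 2) * (kernel_const r * 2 powr (- r * real ?u))"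
      using kernel_piece_discrete[where u = ?u and x = "- y" and r = r] by (simp add: sum_grid1 algebra_simps)
    finally show "(\<Sum>\<xi>\<in>grid1 s. \<bar>kernel_piece r ?u (\<xi> - y)\<bar>) \<le> 2 ^ (?u + 2) * (kernel_const r * 2 powr (- r * real ?u))" .
  qed (use smooth_const_pos in auto)
  also have "2 ^ (?u + 2) * (kernel_const r * 2 powr (- r * real ?u)) * (?c * (smooth_const / 2 ^ s))
     = (2 ^ (?u + 2) * smooth_const / 2 ^ s) * (?c * (kernel_const r * 2 powr (- r * real ?u)))" by simp
  also have "\<dots> = detail_const r * 2 ^ t"
    unfolding powr_cancel_scale by (simp add: detail_const_def power_add)
  finally show ?thesis .
qed

text \<open>
  All details in one variable, weighted by the rate \<open>\<beta>\<close> to be proved. Products of these kernels dominate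
  the error of sampling on a sparse grid.
\<close>

definition detail_kernel :: "real \<Rightarrow> real \<Rightarrow> nat \<Rightarrow> real \<Rightarrow> real \<Rightarrow> real" where
  "detail_kernel r \<beta> M x y = (\<Sum>s\<le>M. 2 powr (\<beta> * real s) * norm (detail s (\<lambda>z. complex_of_real (kernel_sum r M (z - y))) x))"

lemma HLS_bound_mono:
  fixes N :: "'a measure"
  assumes "HLS_bound N K' \<sigma> \<tau> C" and "\<And>x y. K x y \<le> K' x y"
  shows "HLS_bound N K \<sigma> \<tau> C"
  unfolding HLS_bound_def
proof (intro allI impI)
  fix H G :: "'a \<Rightarrow> ennreal" assume m: "H \<in> borel_measurable N" "G \<in> borel_measurable N"
  have "(\<integral>\<^sup>+x. \<integral>\<^sup>+y. K x y * epow (H y) \<sigma> * epow (G x) \<tau> \<partial>N \<partial>N) \<le> (\<integral>\<^sup>+x. \<integral>\<^sup>+y. K' x y * epow (H y) \<sigma> * epow (G x) \<tau> \<partial>N \<partial>N)"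
    by (intro nn_integral_mono mult_right_mono assms(2)) auto
  also have "\<dots> \<le> C * epow (\<integral>\<^sup>+y. H y \<partial>N) \<sigma> * epow (\<integral>\<^sup>+x. G x \<partial>N) \<tau>"
    using assms(1) m by (simp add: HLS_bound_def)
  finally show "(\<integral>\<^sup>+x. \<integral>\<^sup>+y. K x y * epow (H y) \<sigma> * epow (G x) \<tau> \<partial>N \<partial>N) \<le> C * epow (\<integral>\<^sup>+y. H y \<partial>N) \<sigma> * epow (\<integral>\<^sup>+x. G x \<partial>N) \<tau>" .
qed

lemma detail_kernel_HLS:
  assumes \<sigma>: "0 < \<sigma>" "\<sigma> < 1" and \<tau>: "0 < \<tau>" "\<tau> < 1" "1 < \<sigma> + \<tau>" and r: "\<sigma> < r"
  obtains C where "0 < C"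
    "\<And>M. HLS_bound unit_M (\<lambda>x y. ennreal (detail_kernel r (r - (\<sigma> + \<tau> - 1)) M x y)) \<sigma> \<tau> (ennreal C)"
proof -
  obtain C where C: "0 < C" and bound: "\<And>m (k :: nat \<Rightarrow> nat \<Rightarrow> real \<Rightarrow> real \<Rightarrow> real).
      \<lbrakk>\<And>s t. (\<lambda>(x, y). k s t x y) \<in> borel_measurable (unit_M \<Otimes>\<^sub>M unit_M); \<And>s t x y. 0 \<le> k s t x y;
       \<And>s t y. (\<integral>\<^sup>+x. ennreal (k s t x y) \<partial>unit_M) \<le> ennreal (detail_const r * 2 ^ t);
       \<And>s t x. (\<integral>\<^sup>+y. ennreal (k s t x y) \<partial>unit_M) \<le> ennreal (detail_const r);
       \<And>s t x y. k s t x y \<le> detail_const r * 2 ^ (s + t)\<rbrakk> \<Longrightarrow>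
      HLS_bound unit_M (\<lambda>x y. ennreal (\<Sum>s<m. \<Sum>t<m. 2 powr (- (\<sigma> + \<tau> - 1) * real s) * 2 powr (- r * real t) * k s t x y))
        \<sigma> \<tau> (ennreal C)"
    using HLS_bound_dyadic_sum[OF sigma_finite_unit_M \<sigma> \<tau> r less_imp_le[OF detail_const_pos[of r]]] by blast
  have "HLS_bound unit_M (\<lambda>x y. ennreal (detail_kernel r (r - (\<sigma> + \<tau> - 1)) M x y)) \<sigma> \<tau> (ennreal C)" for M
  proof (rule HLS_bound_mono[OF bound[of "scaled_detail r" "Suc M"]])
    fix x y
    let ?D = "\<lambda>u s. norm (detail s (\<lambda>z. complex_of_real (kernel_piece r u (z - y))) x)"
    have "detail_kernel r (r - (\<sigma> + \<tau> - 1)) M x y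
        \<le> (\<Sum>s\<le>M. \<Sum>t\<le>M. 2 powr (- (\<sigma> + \<tau> - 1) * real s) * 2 powr (- r * real t) * scaled_detail r s t x y)"
      unfolding detail_kernel_def
    proof (rule sum_mono)
      fix s assume "s \<in> {..M}"
      have "norm (detail s (\<lambda>z. complex_of_real (kernel_sum r M (z - y))) x) \<le> (\<Sum>u\<le>M. ?D u s)"
        unfolding detail_kernel_sum by (rule norm_sum)
      also have "\<dots> = (\<Sum>u\<in>{s..M}. ?D u s)"
        by (intro sum.mono_neutral_right) (auto simp: detail_kernel_piece_eq_0)
      also have "\<dots> = (\<Sum>t\<in>{..M - s}. ?D (s + t) s)"
        using \<open>s \<in> {..M}\<close> by (intro sum.reindex_bij_witness[of _ "\<lambda>t. s + t" "\<lambda>u. u - s"]) auto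
      also have "\<dots> \<le> (\<Sum>t\<le>M. ?D (s + t) s)" by (intro sum_mono2) auto
      finally have "2 powr ((r - (\<sigma> + \<tau> - 1)) * real s) * norm (detail s (\<lambda>z. complex_of_real (kernel_sum r M (z - y))) x)
         \<le> 2 powr ((r - (\<sigma> + \<tau> - 1)) * real s) * (\<Sum>t\<le>M. ?D (s + t) s)" by (intro mult_left_mono) auto
      also have "\<dots> = (\<Sum>t\<le>M. 2 powr (- (\<sigma> + \<tau> - 1) * real s) * 2 powr (- r * real t) * scaled_detail r s t x y)"
        unfolding sum_distrib_left
      proof (rule sum.cong[OF refl])
        fix t
        have "2 powr ((r - (\<sigma> + \<tau> - 1)) * real s) = 2 powr (- (\<sigma> + \<tau> - 1) * real s) * 2 powr (- r * real t) * 2 powr (r * real (s + t))"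
          by (simp only: powr_add[symmetric]) (simp add: algebra_simps)
        then show "2 powr ((r - (\<sigma> + \<tau> - 1)) * real s) * ?D (s + t) s
           = 2 powr (- (\<sigma> + \<tau> - 1) * real s) * 2 powr (- r * real t) * scaled_detail r s t x y"
          by (simp only: scaled_detail_def mult.assoc)
      qed
      finally show "2 powr ((r - (\<sigma> + \<tau> - 1)) * real s) * norm (detail s (\<lambda>z. complex_of_real (kernel_sum r M (z - y))) x)
         \<le> (\<Sum>t\<le>M. 2 powr (- (\<sigma> + \<tau> - 1) * real s) * 2 powr (- r * real t) * scaled_detail r s t x y)" .
    qed
    then show "ennreal (detail_kernel r (r - (\<sigma> + \<tau> - 1)) M x y)
       \<le> ennreal (\<Sum>s<Suc M. \<Sum>t<Suc M. 2 powr (- (\<sigma> + \<tau> - 1) * real s) * 2 powr (- r * real t) * scaled_detail r s t x y)"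
      by (intro ennreal_leI) (simp add: lessThan_Suc_atMost)
  qed (use borel_measurable_scaled_detail scaled_detail_int_x scaled_detail_int_y scaled_detail_sup in auto)
  with C that show thesis by blast
qed

section \<open>The kernel as a limit of smoothed partial sums\<close>

lemma sum_by_parts:
  fixes a b :: "nat \<Rightarrow> real"
  shows "(\<Sum>k<n. a k * b k) = a n * (\<Sum>k<n. b k) + (\<Sum>k<n. (a k - a (Suc k)) * (\<Sum>j<Suc k. b j))"
  by (induction n) (simp_all add: algebra_simps)

text \<open>
  Summation by parts turns the series into one that is dominated by the telescoping series of the
  differences of \<open>a\<close>.
\<close>

lemma Dirichlet_test:
  fixes a b :: "nat \<Rightarrow> real"
  assumes a: "decseq a" "a \<longlonglongrightarrow> 0" and B: "\<And>n. \<bar>\<Sum>k<n. b k\<bar> \<le> B"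
  shows "summable (\<lambda>k. a k * b k)"
proof -
  have B0: "0 \<le> B" using B[of 0] by simp
  have "summable (\<lambda>k. (a k - a (Suc k)) * B)"
    using telescope_summable'[OF a(2)] by (intro summable_mult2) auto
  then have "summable (\<lambda>k. (a k - a (Suc k)) * (\<Sum>j<Suc k. b j))"
  proof (rule summable_comparison_test'[where N = 0])
    fix k
    show "norm ((a k - a (Suc k)) * (\<Sum>j<Suc k. b j)) \<le> (a k - a (Suc k)) * B"
      using decseqD[OF a(1), of k "Suc k"] B[of "Suc k"] unfolding real_norm_def abs_mult by (intro mult_mono) auto
  qed
  then have "(\<lambda>n. \<Sum>k<n. (a k - a (Suc k)) * (\<Sum>j<Suc k. b j)) \<longlonglongrightarrow> (\<Sum>k. (a k - a (Suc k)) * (\<Sum>j<Suc k. b j))"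
    by (rule summable_LIMSEQ)
  moreover have "(\<lambda>n. a n * (\<Sum>k<n. b k)) \<longlonglongrightarrow> 0"
  proof (rule Lim_null_comparison)
    show "\<forall>\<^sub>F n in sequentially. norm (a n * (\<Sum>k<n. b k)) \<le> \<bar>a n\<bar> * B"
      by (intro always_eventually allI) (simp add: abs_mult mult_left_mono B)
    show "(\<lambda>n. \<bar>a n\<bar> * B) \<longlonglongrightarrow> 0" using tendsto_mult_right[OF tendsto_rabs_zero[OF a(2)], of B] by simp
  qed
  ultimately have "(\<lambda>n. \<Sum>k<n. a k * b k) \<longlonglongrightarrow> 0 + (\<Sum>k. (a k - a (Suc k)) * (\<Sum>j<Suc k. b j))"
    unfolding sum_by_parts[of a b] by (rule tendsto_add[rotated])
  then show ?thesis unfolding summable_iff_convergent convergent_def by blast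
qed

text \<open>
  The real part of a geometric sum with ratio \<open>ee x \<noteq> 1\<close>.
\<close>

lemma bounded_cos_sums:
  assumes "x \<notin> \<int>"
  obtains B where "\<And>n. \<bar>\<Sum>k<n. cos (2 * pi * real (Suc k) * x - c)\<bar> \<le> B"
proof -
  define w where "w = ee x"
  have w: "w \<noteq> 1" "norm w = 1" using assms by (auto simp: w_def ee_eq_1_iff)
  have "\<bar>\<Sum>k<n. cos (2 * pi * real (Suc k) * x - c)\<bar> \<le> 2 / norm (1 - w)" for n
  proof -
    have "cos (2 * pi * real (Suc k) * x - c) = Re (cis (- c) * w * w ^ k)" for k
    proof -
      have "cis (- c) * w * w ^ k = cis (- c) * ee (real (Suc k) * x)"
        using ee_power[of x "Suc k"] by (simp only: mult.assoc power_Suc w_def)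
      also have "\<dots> = cis (2 * pi * real (Suc k) * x - c)"
        unfolding ee_def cis_mult by (simp add: mult.assoc)
      finally show ?thesis by (simp only: cis.simps)
    qed
    then have "(\<Sum>k<n. cos (2 * pi * real (Suc k) * x - c)) = Re (cis (- c) * w * (\<Sum>k<n. w ^ k))"
      by (simp add: sum_distrib_left)
    also have "(\<Sum>k<n. w ^ k) = (w ^ n - 1) / (w - 1)" using w by (intro geometric_sum) auto
    finally have "\<bar>\<Sum>k<n. cos (2 * pi * real (Suc k) * x - c)\<bar> \<le> norm (cis (- c) * w * ((w ^ n - 1) / (w - 1)))"
      by (simp only: abs_Re_le_cmod)
    also have "\<dots> = norm (w ^ n - 1) / norm (1 - w)"
      using w by (simp add: norm_mult norm_divide norm_minus_commute)
    also have "\<dots> \<le> 2 / norm (1 - w)"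
      using norm_triangle_ineq4[of "w ^ n" 1] w by (intro divide_right_mono) (auto simp: norm_power)
    finally show ?thesis .
  qed
  then show thesis by (rule that)
qed

text \<open>
  By parts, the smoothed sum is a convex combination of ordinary partial sums. Its weights are the
  decrements of the trapezoid, which vanish for the first \<open>2 ^ (M - 1) - 1\<close> indices.
\<close>

lemma hat_average_tendsto:
  fixes c :: "nat \<Rightarrow> real"
  assumes c: "summable c"
  shows "(\<lambda>M. \<Sum>k<2 ^ M. hat M (int (Suc k)) * c k) \<longlonglongrightarrow> (\<Sum>k. c k)"
proof (rule LIMSEQ_I)
  fix e :: real assume e: "0 < e"
  define S where "S n = (\<Sum>k<n. c k)" for n
  let ?S = "\<Sum>k. c k"
  have "S \<longlonglongrightarrow> ?S" unfolding S_def by (rule summable_LIMSEQ[OF c])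
  then obtain n0 where n0: "\<And>n. n \<ge> n0 \<Longrightarrow> norm (S n - ?S) < e / 2"
    using LIMSEQ_D[of S ?S "e / 2"] e by auto
  have "norm ((\<Sum>k<2 ^ M. hat M (int (Suc k)) * c k) - ?S) < e" if M: "M \<ge> Suc n0" for M
  proof -
    define h where "h k = hat M (int (Suc k))" for k
    have anti: "h (Suc k) \<le> h k" for k
    proof -
      have "2 - 2 * \<bar>real_of_int (int (Suc (Suc k)))\<bar> / 2 ^ M \<le> 2 - 2 * \<bar>real_of_int (int (Suc k))\<bar> / 2 ^ M"
        by (simp add: divide_right_mono)
      then show ?thesis unfolding h_def hat_def by (intro max.mono min.mono) auto
    qed
    have M': "n0 < 2 ^ (M - 1)" "2 * 2 ^ (M - 1) = (2::nat) ^ M"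
    proof -
      obtain m where m: "M = Suc m" "n0 \<le> m" using M by (cases M) auto
      have "n0 < 2 ^ n0" by (rule less_exp)
      also have "(2::nat) ^ n0 \<le> 2 ^ m" using m by (intro power_increasing) auto
      finally show "n0 < 2 ^ (M - 1)" "2 * 2 ^ (M - 1) = (2::nat) ^ M" using m by simp_all
    qed
    have h0: "h 0 = 1"
    proof -
      have "(2::int) * \<bar>int (Suc 0)\<bar> \<le> 2 ^ M" using M self_le_power[of "2::int" M] by simp
      then show ?thesis unfolding h_def by (rule hat_eq_1)
    qed
    have hN: "h (2 ^ M) = 0" unfolding h_def by (rule hat_eq_0) simp
    have flat: "h k = h (Suc k)" if "Suc k < n0" for k
    proof -
      have "Suc (Suc k) \<le> 2 ^ (M - 1)" using that M' by linarith
      then have "2 * Suc (Suc k) \<le> 2 * 2 ^ (M - 1)" by (rule mult_le_mono2)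
      then have "2 * Suc (Suc k) \<le> 2 ^ M" unfolding M'(2) .
      then have "2 * int (Suc (Suc k)) \<le> 2 ^ M" by (metis of_nat_le_iff of_nat_mult of_nat_numeral of_nat_power)
      then show ?thesis unfolding h_def by (subst (1 2) hat_eq_1) auto
    qed
    have tel: "(\<Sum>k<2 ^ M. h k - h (Suc k)) = 1"
      using sum_lessThan_telescope'[of h "2 ^ M"] h0 hN by simp
    have "(\<Sum>k<2 ^ M. h k * c k) = (\<Sum>k<2 ^ M. (h k - h (Suc k)) * S (Suc k))"
      unfolding sum_by_parts[of h c] S_def using hN by simp
    also have "\<dots> - ?S = (\<Sum>k<2 ^ M. (h k - h (Suc k)) * (S (Suc k) - ?S))"
    proof -
      have "(\<Sum>k<2 ^ M. (h k - h (Suc k)) * (S (Suc k) - ?S)) = (\<Sum>k<2 ^ M. (h k - h (Suc k)) * S (Suc k)) - (\<Sum>k<2 ^ M. h k - h (Suc k)) * ?S"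
        unfolding sum_distrib_right sum_subtractf[symmetric] by (simp only: right_diff_distrib)
      then show ?thesis unfolding tel by simp
    qed
    finally have "norm ((\<Sum>k<2 ^ M. h k * c k) - ?S) \<le> (\<Sum>k<2 ^ M. norm ((h k - h (Suc k)) * (S (Suc k) - ?S)))"
      by (simp only: norm_sum)
    also have "\<dots> \<le> (\<Sum>k<2 ^ M. (h k - h (Suc k)) * (e / 2))"
    proof (rule sum_mono)
      fix k
      show "norm ((h k - h (Suc k)) * (S (Suc k) - ?S)) \<le> (h k - h (Suc k)) * (e / 2)"
      proof (cases "Suc k < n0")
        case True
        then show ?thesis using flat by simp
      next
        case False
        then have "norm (S (Suc k) - ?S) \<le> e / 2" using n0[of "Suc k"] by simp
        from mult_left_mono[OF this, of "h k - h (Suc k)"] anti[of k] show ?thesis by (simp add: abs_mult)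
      qed
    qed
    also have "\<dots> = e / 2" unfolding sum_distrib_right[symmetric] tel by simp
    finally show ?thesis using e by (simp add: h_def)
  qed
  then show "\<exists>no. \<forall>M\<ge>no. norm ((\<Sum>k<2 ^ M. hat M (int (Suc k)) * c k) - ?S) < e" by blast
qed

lemma sum_block:
  "(\<Sum>i<M. block i \<rho> x) = trig {0<..<2 ^ M} (\<lambda>k. of_real (hat M k * of_int k powr \<rho>)) x"
proof -
  let ?A = "{0<..<2 ^ M :: int}"
  have "(\<Sum>i<M. block i \<rho> x) = (\<Sum>i<M. \<Sum>k\<in>?A. of_real (block_coeff i \<rho> k) * ee (of_int k * x))"
  proof (rule sum.cong[OF refl])
    fix i assume "i \<in> {..<M}"
    then have "(2::int) ^ Suc i \<le> 2 ^ M" by (intro power_increasing) auto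
    then show "block i \<rho> x = (\<Sum>k\<in>?A. of_real (block_coeff i \<rho> k) * ee (of_int k * x))"
      unfolding block_def trig_def by (intro sum.mono_neutral_left) (auto simp: block_coeff_eq_0)
  qed
  also have "\<dots> = (\<Sum>k\<in>?A. of_real (\<Sum>i<M. block_coeff i \<rho> k) * ee (of_int k * x))"
    unfolding of_real_sum sum_distrib_right by (rule sum.swap)
  also have "\<dots> = trig ?A (\<lambda>k. of_real (hat M k * of_int k powr \<rho>)) x"
    unfolding trig_def
  proof (rule sum.cong[OF refl])
    fix k assume k: "k \<in> ?A"
    have "(\<Sum>i<M. block_coeff i \<rho> k) = (\<Sum>i<M. hat (Suc i) k - hat i k) * of_int k powr \<rho>"
      using k by (simp add: block_coeff_def sum_distrib_right)
    also have "(\<Sum>i<M. hat (Suc i) k - hat i k) = hat M k"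
      using k by (simp add: sum_lessThan_telescope[of "\<lambda>i. hat i k"] hat_eq_0)
    finally show "complex_of_real (\<Sum>i<M. block_coeff i \<rho> k) * ee (of_int k * x) = complex_of_real (hat M k * of_int k powr \<rho>) * ee (of_int k * x)"
      by simp
  qed
  finally show ?thesis .
qed

lemma kernel_sum_eq_Re:
  "kernel_sum r M x = 1 + 2 * Re (cis (- (r * pi / 2)) * trig {0<..<2 ^ M} (\<lambda>k. of_real (hat M k * of_int k powr (- r))) x)"
proof -
  have "kernel_sum r M x = 1 + (\<Sum>i<M. kernel_piece r (Suc i) x)"
    unfolding kernel_sum_def by (simp add: sum.atMost_shift kernel_piece_def)
  also have "(\<Sum>i<M. kernel_piece r (Suc i) x) = 2 * Re (cis (- (r * pi / 2)) * (\<Sum>i<M. block i (- r) x))"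
    by (simp only: kernel_piece_def nat.case sum_distrib_left Re_sum)
  finally show ?thesis unfolding sum_block .
qed

text \<open>
  For \<open>r \<le> 1\<close> the series of \<open>kernel1 r\<close> converges only conditionally, so Dirichlet's test is used off the
  integers. Smoothing does not change the limit.
\<close>

lemma kernel_sum_tendsto:
  assumes x: "x \<notin> \<int>" and r: "0 < r"
  shows "(\<lambda>M. kernel_sum r M x) \<longlonglongrightarrow> kernel1 r x"
proof -
  define c where "c k = real (Suc k) powr (- r) * cos (2 * pi * real (Suc k) * x - r * pi / 2)" for k
  obtain B where B: "\<And>n. \<bar>\<Sum>k<n. cos (2 * pi * real (Suc k) * x - r * pi / 2)\<bar> \<le> B"
    using bounded_cos_sums[OF x] by blast
  have "summable c"
    unfolding c_def
  proof (rule Dirichlet_test[OF _ _ B])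
    show "decseq (\<lambda>k. real (Suc k) powr (- r))"
      using r by (intro decseq_SucI powr_mono2') auto
    have "(\<lambda>k. real k powr (- r)) \<longlonglongrightarrow> 0"
      using r by (intro tendsto_neg_powr filterlim_real_sequentially) auto
    then show "(\<lambda>k. real (Suc k) powr (- r)) \<longlonglongrightarrow> 0" by (rule LIMSEQ_Suc)
  qed
  then have "(\<lambda>M. 1 + 2 * (\<Sum>k<2 ^ M. hat M (int (Suc k)) * c k)) \<longlonglongrightarrow> 1 + 2 * (\<Sum>k. c k)"
    by (intro tendsto_intros hat_average_tendsto)
  also have "1 + 2 * (\<Sum>k. c k) = kernel1 r x" by (simp add: kernel1_def c_def)
  also have "(\<lambda>M. 1 + 2 * (\<Sum>k<2 ^ M. hat M (int (Suc k)) * c k)) = (\<lambda>M. kernel_sum r M x)"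
  proof (intro ext)
    fix M
    have "Re (cis (- (r * pi / 2)) * trig {0<..<2 ^ M} (\<lambda>k. of_real (hat M k * of_int k powr (- r))) x)
        = (\<Sum>k\<in>{0<..<2 ^ M}. hat M k * (of_int k powr (- r) * cos (2 * pi * of_int k * x - r * pi / 2)))"
      unfolding trig_def sum_distrib_left Re_sum
    proof (rule sum.cong[OF refl])
      fix k :: int
      have "cis (- (r * pi / 2)) * (complex_of_real (hat M k * of_int k powr (- r)) * ee (of_int k * x))
         = complex_of_real (hat M k * of_int k powr (- r)) * cis (2 * pi * of_int k * x - r * pi / 2)"
        by (simp add: ee_def cis_mult algebra_simps)
      then show "Re (cis (- (r * pi / 2)) * (complex_of_real (hat M k * of_int k powr (- r)) * ee (of_int k * x)))
         = hat M k * (of_int k powr (- r) * cos (2 * pi * of_int k * x - r * pi / 2))"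
        by (simp only: times_complex.sel Re_complex_of_real Im_complex_of_real cis.simps)
    qed
    also have "\<dots> = (\<Sum>k\<in>{0<..2 ^ M}. hat M k * (of_int k powr (- r) * cos (2 * pi * of_int k * x - r * pi / 2)))"
      by (rule sum.mono_neutral_left) (auto simp: hat_eq_0)
    also have "\<dots> = (\<Sum>k<2 ^ M. hat M (int (Suc k)) * c k)"
      unfolding c_def
    proof (rule sum.reindex_bij_witness[of _ "\<lambda>k. int (Suc k)" "\<lambda>k. nat k - 1"])
      fix a :: int assume a: "a \<in> {0<..2 ^ M}"
      then have "nat a \<le> 2 ^ M" "0 < nat a" by (simp_all add: nat_le_iff)
      then have "nat a - 1 < 2 ^ M" by linarith
      then show "nat a - 1 \<in> {..<2 ^ M}" by simp
      show "int (Suc (nat a - 1)) = a" using a by simp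
      then show "hat M (int (Suc (nat a - 1))) * (real (Suc (nat a - 1)) powr (- r) * cos (2 * pi * real (Suc (nat a - 1)) * x - r * pi / 2))
         = hat M a * (of_int a powr (- r) * cos (2 * pi * of_int a * x - r * pi / 2))"
        by (metis of_int_of_nat_eq)
    next
      fix b :: nat assume "b \<in> {..<2 ^ M}"
      then have "Suc b \<le> 2 ^ M" by simp
      then have "int (Suc b) \<le> int (2 ^ M)" by (simp only: of_nat_le_iff)
      then show "int (Suc b) \<in> {0<..2 ^ M}" by simp
    qed simp
    finally show "1 + 2 * (\<Sum>k<2 ^ M. hat M (int (Suc k)) * c k) = kernel_sum r M x"
      by (simp only: kernel_sum_eq_Re)
  qed
  finally show ?thesis .
qed

definition kernel_coeff :: "real \<Rightarrow> int \<Rightarrow> complex" where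
  "kernel_coeff r k = (if k = 0 then 1 else of_real (\<bar>of_int k\<bar> powr (- r)) * cis (- (of_int (sgn k) * (r * pi / 2))))"

lemma kernel_coeff_neq_0 [simp]: "kernel_coeff r k \<noteq> 0"
  by (simp add: kernel_coeff_def)

lemma kernel_sum_eq_trig:
  "complex_of_real (kernel_sum r M x) = trig {- (2 ^ M)<..<2 ^ M} (\<lambda>k. of_real (hat M k) * kernel_coeff r k) x"
proof -
  let ?P = "{0<..<2 ^ M :: int}"
  let ?g = "\<lambda>k. of_real (hat M k) * kernel_coeff r k * ee (of_int k * x)"
  define w where "w = cis (- (r * pi / 2)) * trig ?P (\<lambda>k. of_real (hat M k * of_int k powr (- r))) x"
  have w: "w = (\<Sum>k\<in>?P. ?g k)"
    unfolding w_def trig_def sum_distrib_left by (intro sum.cong refl) (simp add: kernel_coeff_def)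
  have "cnj w = (\<Sum>k\<in>?P. ?g (- k))"
    unfolding w cnj_sum
  proof (rule sum.cong[OF refl])
    fix k assume "k \<in> ?P"
    moreover have "hat M (- k) = hat M k" by (simp add: hat_def)
    ultimately show "cnj (?g k) = ?g (- k)" by (simp add: kernel_coeff_def cnj_ee cis_cnj)
  qed
  also have "\<dots> = (\<Sum>k\<in>uminus ` ?P. ?g k)"
  proof -
    have "sum ?g (uminus ` ?P) = sum (?g \<circ> uminus) ?P" by (rule sum.reindex) simp
    then show ?thesis by (simp only: o_def)
  qed
  finally have cw: "cnj w = (\<Sum>k\<in>uminus ` ?P. ?g k)" .
  have g0: "?g 0 = 1" by (simp add: kernel_coeff_def hat_eq_1)
  have "complex_of_real (kernel_sum r M x) = 1 + (w + cnj w)"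
    unfolding kernel_sum_eq_Re w_def[symmetric] complex_add_cnj by simp
  also have "\<dots> = (\<Sum>k\<in>insert 0 (?P \<union> uminus ` ?P). ?g k)"
    unfolding cw unfolding w
    by (subst sum.insert, simp, force, subst sum.union_disjoint) (auto simp: kernel_coeff_def hat_eq_1)
  also have "insert 0 (?P \<union> uminus ` ?P) = {- (2 ^ M)<..<2 ^ M}"
  proof -
    have "uminus ` ?P = {- (2 ^ M)<..<0}" by simp
    then show ?thesis by auto
  qed
  finally show ?thesis by (simp add: trig_def)
qed

text \<open>
  Fatou's lemma, applied to \<open>F M' - F M\<close> as \<open>M'\<close> grows. In this way integrability of the limit and the error of
  the integrals come out of the Cauchy property, without a bound on the limit itself.
\<close>

lemma L1_Cauchy_limit:
  fixes F :: "nat \<Rightarrow> 'a \<Rightarrow> complex" and G :: "'a \<Rightarrow> complex"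
  assumes F: "\<And>M. integrable N (F M)" and G: "G \<in> borel_measurable N"
    and lim: "AE y in N. (\<lambda>M. F M y) \<longlonglongrightarrow> G y"
    and Cauchy: "\<And>M M'. M \<le> M' \<Longrightarrow> (\<integral>\<^sup>+y. ennreal (norm (F M' y - F M y)) \<partial>N) \<le> ennreal (b M)"
    and b0: "\<And>M. 0 \<le> b M"
  shows "integrable N G" "norm ((LINT y|N. F M y) - (LINT y|N. G y)) \<le> b M"
proof -
  have Fm: "F M \<in> borel_measurable N" for M using F by (rule borel_measurable_integrable)
  have bound: "(\<integral>\<^sup>+y. ennreal (norm (G y - F M y)) \<partial>N) \<le> ennreal (b M)" for M
  proof -
    have "(\<integral>\<^sup>+y. ennreal (norm (G y - F M y)) \<partial>N) = (\<integral>\<^sup>+y. liminf (\<lambda>M'. ennreal (norm (F M' y - F M y))) \<partial>N)"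
    proof (rule nn_integral_cong_AE, use lim in eventually_elim)
      fix y assume "(\<lambda>M. F M y) \<longlonglongrightarrow> G y"
      then have "(\<lambda>M'. ennreal (norm (F M' y - F M y))) \<longlonglongrightarrow> ennreal (norm (G y - F M y))"
        by (intro tendsto_ennrealI tendsto_intros)
      then show "ennreal (norm (G y - F M y)) = liminf (\<lambda>M'. ennreal (norm (F M' y - F M y)))"
        by (intro lim_imp_Liminf[symmetric]) auto
    qed
    also have "\<dots> \<le> liminf (\<lambda>M'. \<integral>\<^sup>+y. ennreal (norm (F M' y - F M y)) \<partial>N)"
      using Fm by (intro nn_integral_liminf) auto
    also have "\<dots> \<le> limsup (\<lambda>M'. \<integral>\<^sup>+y. ennreal (norm (F M' y - F M y)) \<partial>N)"
      by (rule Liminf_le_Limsup) simp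
    also have "\<dots> \<le> ennreal (b M)"
      by (rule Limsup_bounded) (auto simp: eventually_sequentially intro!: exI[of _ M] Cauchy)
    finally show ?thesis .
  qed
  have d: "integrable N (\<lambda>y. G y - F M y)" for M
    unfolding integrable_iff_bounded using bound[of M] G Fm by (auto intro: le_less_trans)
  from Bochner_Integration.integrable_add[OF d F, of 0 0] show "integrable N G" by simp
  then have "(LINT y|N. F M y) - (LINT y|N. G y) = - (LINT y|N. G y - F M y)"
    using F by simp
  then have "norm ((LINT y|N. F M y) - (LINT y|N. G y)) \<le> (LINT y|N. norm (G y - F M y))"
    by (simp only: norm_minus_cancel integral_norm_bound)
  also have "\<dots> = enn2real (\<integral>\<^sup>+y. ennreal (norm (G y - F M y)) \<partial>N)"
    using G Fm by (intro integral_eq_nn_integral) auto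
  also have "\<dots> \<le> b M" using bound[of M] b0[of M] enn2real_mono[of _ "ennreal (b M)"] by simp
  finally show "norm ((LINT y|N. F M y) - (LINT y|N. G y)) \<le> b M" .
qed

lemma AE_unit_countable:
  assumes "countable C"
  shows "AE t in unit_M. t \<notin> C"
proof -
  have "AE t in lborel. t \<notin> C"
    by (rule AE_I'[OF countable_imp_null_set_lborel[OF assms]]) auto
  then show ?thesis unfolding unit_M_def by (subst AE_restrict_space_iff) (auto elim: eventually_mono)
qed

lemma AE_cube_component:
  fixes i :: "'d::finite"
  assumes C: "countable C"
  shows "AE y in (cube_M :: (real ^ 'd) measure). y $ i \<notin> C"
proof -
  have Cb: "C \<in> sets borel" by (rule sets.countable[OF _ C]) auto
  let ?f = "\<lambda>j t. if j = i then indicator C t else (1 :: ennreal)"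
  have "(\<integral>\<^sup>+y. indicator C ((y :: real ^ 'd) $ i) \<partial>cube_M) = (\<integral>\<^sup>+y. (\<Prod>j\<in>UNIV. ?f j (y $ j)) \<partial>cube_M)"
    by (intro nn_integral_cong) (simp add: if_distrib prod.delta cong: if_cong)
  also have "\<dots> = (\<Prod>j\<in>UNIV. \<integral>\<^sup>+t. ?f j t \<partial>unit_M)"
    using Cb by (intro nn_integral_cube_prod) (auto intro!: measurable_unit_M)
  also have "\<dots> = 0"
  proof -
    have "(\<integral>\<^sup>+t. ?f i t \<partial>unit_M) = (\<integral>\<^sup>+t. 0 \<partial>unit_M)"
      using AE_unit_countable[OF C] by (intro nn_integral_cong_AE) (auto elim: eventually_mono)
    then have "\<exists>j\<in>UNIV. (\<integral>\<^sup>+t. ?f j t \<partial>unit_M) = 0" by (intro bexI[of _ i]) simp_all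
    then show ?thesis by (intro prod_zero) simp_all
  qed
  finally have "AE y in (cube_M :: (real ^ 'd) measure). indicator C (y $ i) = (0 :: ennreal)"
    using Cb by (subst (asm) nn_integral_0_iff_AE) (auto intro!: measurable_cube_M)
  then show ?thesis by eventually_elim (auto simp: indicator_def split: if_splits)
qed

text \<open>
  Convolution with the tensor product of smoothed partial sums: a trigonometric polynomial in \<open>x\<close>.
\<close>

definition conv_approx :: "real \<Rightarrow> nat \<Rightarrow> (real ^ 'd \<Rightarrow> complex) \<Rightarrow> real ^ 'd \<Rightarrow> complex" where
  "conv_approx r M \<phi> x = (LINT y|cube_M. complex_of_real (\<Prod>i\<in>UNIV. kernel_sum r M (x $ i - y $ i)) * \<phi> y)"

lemma kernel_piece_Lp:
  assumes p: "1 < p"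
  shows "(\<integral>\<^sup>+y. ennreal (\<bar>kernel_piece r u (x - y)\<bar> powr (p / (p - 1))) \<partial>unit_M)
     \<le> ennreal ((kernel_const r * 2 powr (- (r - 1 / p) * real u)) powr (p / (p - 1)))"
proof -
  have "(\<integral>\<^sup>+y. ennreal (\<bar>kernel_piece r u (x - y)\<bar> powr (p / (p - 1))) \<partial>unit_M)
     \<le> ennreal ((kernel_const r * 2 powr ((- r + (1 - 1 / (p / (p - 1)))) * real u)) powr (p / (p - 1)))"
  proof (rule Lp_of_L1_and_sup[OF _ _ _ _ kernel_piece_sup kernel_piece_L1])
    show "(\<lambda>y. ennreal \<bar>kernel_piece r u (x - y)\<bar>) \<in> borel_measurable unit_M"
      by (intro measurable_unit_M measurable_compose[OF _ measurable_ennreal] borel_measurable_continuous_onI continuous_intros)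
    show "0 < kernel_const r" using kernel_const_ge_1[of r] by simp
    show "1 \<le> p / (p - 1)" using p by (simp add: field_simps)
  qed simp
  also have "- r + (1 - 1 / (p / (p - 1))) = - (r - 1 / p)" using p by (simp add: field_simps)
  finally show ?thesis .
qed

lemma continuous_on_prod_component:
  fixes g :: "'d::finite \<Rightarrow> real \<Rightarrow> 'a::real_normed_field"
  assumes "\<And>i. continuous_on UNIV (g i)"
  shows "continuous_on UNIV (\<lambda>x :: real ^ 'd. \<Prod>i\<in>UNIV. g i (x $ i))"
  by (intro continuous_on_prod continuous_on_compose2[OF assms]) (auto intro!: continuous_intros)

lemma epow_root: "0 \<le> c \<Longrightarrow> 0 < q \<Longrightarrow> epow (ennreal (c powr q)) (1 / q) = ennreal c"
  by (simp add: powr_powr)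

lemma kernel_piece_prod_Holder:
  fixes \<phi> :: "real ^ 'd \<Rightarrow> complex" and u :: "'d \<Rightarrow> nat"
  assumes p: "1 < p" and \<phi>: "\<phi> \<in> borel_measurable cube_M"
  shows "(\<integral>\<^sup>+y. ennreal (\<bar>\<Prod>i\<in>UNIV. kernel_piece r (u i) (x $ i - y $ i)\<bar> * norm (\<phi> y)) \<partial>cube_M)
    \<le> ennreal (\<Prod>i\<in>UNIV. kernel_const r * 2 powr (- (r - 1 / p) * real (u i))) * Lp_norm p \<phi>"
proof -
  let ?q = "p / (p - 1)"
  have q: "0 < ?q" using p by simp
  define g where "g y = complex_of_real (\<Prod>i\<in>UNIV. kernel_piece r (u i) (x $ i - y $ i))" for y :: "real ^ 'd"
  have "g \<in> borel_measurable borel" unfolding g_def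
    by (intro borel_measurable_continuous_onI continuous_on_of_real continuous_on_prod_component) (auto intro!: continuous_intros)
  then have gm: "g \<in> borel_measurable cube_M" by (rule measurable_cube_M)
  have "(\<integral>\<^sup>+y. ennreal (\<bar>\<Prod>i\<in>UNIV. kernel_piece r (u i) (x $ i - y $ i)\<bar> * norm (\<phi> y)) \<partial>cube_M)
      = (\<integral>\<^sup>+y. ennreal (norm (\<phi> y) * norm (g y)) \<partial>cube_M)"
    unfolding g_def norm_of_real by (simp only: mult.commute)
  also have "\<dots> \<le> Lp_norm p \<phi> * Lp_norm ?q g" by (rule Lp_norm_Holder[OF \<phi> gm p])
  also have "\<dots> \<le> Lp_norm p \<phi> * ennreal (\<Prod>i\<in>UNIV. kernel_const r * 2 powr (- (r - 1 / p) * real (u i)))"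
  proof (rule mult_left_mono)
    let ?c = "\<lambda>i. kernel_const r * 2 powr (- (r - 1 / p) * real (u i))"
    have c0: "0 \<le> ?c i" for i using kernel_const_ge_1[of r] by simp
    have "(\<integral>\<^sup>+y. ennreal (norm (g y) powr ?q) \<partial>cube_M)
       = (\<integral>\<^sup>+y. (\<Prod>i\<in>UNIV. ennreal (\<bar>kernel_piece r (u i) (x $ i - y $ i)\<bar> powr ?q)) \<partial>cube_M)"
      unfolding g_def norm_of_real abs_prod prod_powr_distrib
      by (intro nn_integral_cong prod_ennreal[symmetric]) simp
    also have "\<dots> = (\<Prod>i\<in>UNIV. \<integral>\<^sup>+t. ennreal (\<bar>kernel_piece r (u i) (x $ i - t)\<bar> powr ?q) \<partial>unit_M)"
    proof (rule nn_integral_cube_prod)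
      fix i
      have [measurable]: "(\<lambda>t. kernel_piece r (u i) (x $ i - t)) \<in> borel_measurable borel"
        by (intro borel_measurable_continuous_onI continuous_intros)
      show "(\<lambda>t. ennreal (\<bar>kernel_piece r (u i) (x $ i - t)\<bar> powr ?q)) \<in> borel_measurable unit_M"
        by (intro measurable_unit_M) measurable
    qed
    also have "\<dots> \<le> (\<Prod>i\<in>UNIV. ennreal (?c i powr ?q))"
      by (intro prod_mono_ennreal kernel_piece_Lp p)
    also have "\<dots> = ennreal ((\<Prod>i\<in>UNIV. ?c i) powr ?q)"
      using c0 by (simp add: prod_ennreal prod_powr_distrib)
    finally have "Lp_norm ?q g \<le> epow (ennreal ((\<Prod>i\<in>UNIV. ?c i) powr ?q)) (1 / ?q)"
      unfolding Lp_norm_cube by (rule epow_mono) (use p in auto)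
    also have "\<dots> = ennreal (\<Prod>i\<in>UNIV. ?c i)"
    proof -
      have "0 \<le> (\<Prod>i\<in>UNIV. ?c i)" using c0 by (intro prod_nonneg) auto
      then show ?thesis using q by (rule epow_root)
    qed
    finally show "Lp_norm ?q g \<le> ennreal (\<Prod>i\<in>UNIV. ?c i)" .
  qed simp
  finally show ?thesis by (simp only: mult.commute)
qed

text \<open>
  A majorant of the \<open>L\<^sub>p\<close>-dual norm of \<open>kernel_sum r M\<close>; its \<open>d\<close>-th power does the same for the tensor
  product. It is a partial sum of a geometric series, convergent for \<open>r > 1 / p\<close>.
\<close>

definition series_partial :: "real \<Rightarrow> real \<Rightarrow> nat \<Rightarrow> real" where
  "series_partial r p M = (\<Sum>u\<le>M. kernel_const r * 2 powr (- (r - 1 / p) * real u))"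

lemma finite_PiE_nat [simp]: "finite (Pi\<^sub>E (UNIV :: 'd::finite set) (\<lambda>_. {..M::nat}))"
  by (intro finite_PiE) auto

lemma kernel_sum_prod_expand:
  "(\<Prod>i\<in>UNIV. kernel_sum r M (z i)) = (\<Sum>u\<in>Pi\<^sub>E (UNIV :: 'd::finite set) (\<lambda>_. {..M}). \<Prod>i\<in>UNIV. kernel_piece r (u i) (z i))"
  unfolding kernel_sum_def by (rule prod_sum_PiE) auto

lemma series_partial_power:
  "series_partial r p M ^ CARD('d::finite) = (\<Sum>u\<in>Pi\<^sub>E (UNIV :: 'd set) (\<lambda>_. {..M}). \<Prod>i\<in>UNIV. kernel_const r * 2 powr (- (r - 1 / p) * real (u i)))"
proof -
  have "series_partial r p M ^ CARD('d) = (\<Prod>i\<in>(UNIV :: 'd set). series_partial r p M)" by simp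
  also have "\<dots> = (\<Sum>u\<in>Pi\<^sub>E (UNIV :: 'd set) (\<lambda>_. {..M}). \<Prod>i\<in>UNIV. kernel_const r * 2 powr (- (r - 1 / p) * real (u i)))"
    unfolding series_partial_def by (rule prod_sum_PiE) auto
  finally show ?thesis .
qed

lemma nn_integral_sum_le:
  assumes "\<And>i. i \<in> I \<Longrightarrow> f i \<in> borel_measurable N" and "\<And>x. F x \<le> (\<Sum>i\<in>I. f i x)"
  shows "(\<integral>\<^sup>+x. F x \<partial>N) \<le> (\<Sum>i\<in>I. \<integral>\<^sup>+x. f i x \<partial>N)"
proof -
  have "(\<integral>\<^sup>+x. F x \<partial>N) \<le> (\<integral>\<^sup>+x. (\<Sum>i\<in>I. f i x) \<partial>N)" by (intro nn_integral_mono assms)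
  also have "\<dots> = (\<Sum>i\<in>I. \<integral>\<^sup>+x. f i x \<partial>N)" by (rule nn_integral_sum[OF assms(1)])
  finally show ?thesis .
qed

text \<open>
  Expanded into pieces, the two products differ by the multi-indices in \<open>{..M'}\<close> that leave \<open>{..M}\<close>. Each
  of them is bounded by Holder's inequality, and the bounds add up to a difference of majorants.
\<close>

lemma kernel_sum_prod_Cauchy:
  fixes \<phi> :: "real ^ 'd \<Rightarrow> complex"
  assumes p: "1 < p" and \<phi>: "\<phi> \<in> borel_measurable cube_M" and MM: "M \<le> M'"
  shows "(\<integral>\<^sup>+y. ennreal (norm (complex_of_real (\<Prod>i\<in>UNIV. kernel_sum r M' (x $ i - y $ i)) * \<phi> y
            - complex_of_real (\<Prod>i\<in>UNIV. kernel_sum r M (x $ i - y $ i)) * \<phi> y)) \<partial>cube_M)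
     \<le> ennreal (series_partial r p M' ^ CARD('d) - series_partial r p M ^ CARD('d)) * Lp_norm p \<phi>"
proof -
  let ?U = "\<lambda>M. Pi\<^sub>E (UNIV :: 'd set) (\<lambda>_. {..M})"
  let ?D = "?U M' - ?U M"
  have sub: "?U M \<subseteq> ?U M'" using MM by (intro PiE_mono) auto
  let ?k = "\<lambda>u y. \<Prod>i\<in>UNIV. kernel_piece r (u i) (x $ i - y $ i)"
  let ?c = "\<lambda>u. \<Prod>i\<in>UNIV. kernel_const r * 2 powr (- (r - 1 / p) * real (u i))"
  have c0: "0 \<le> ?c u" for u :: "'d \<Rightarrow> nat" using kernel_const_ge_1[of r] by (intro prod_nonneg) auto
  have km: "(\<lambda>y :: real ^ 'd. ennreal (\<bar>?k u y\<bar> * norm (\<phi> y))) \<in> borel_measurable cube_M" for u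
  proof -
    have "(\<lambda>y :: real ^ 'd. ?k u y) \<in> borel_measurable borel"
      by (intro borel_measurable_continuous_onI continuous_on_prod_component) (auto intro!: continuous_intros)
    then have [measurable]: "(\<lambda>y :: real ^ 'd. ?k u y) \<in> borel_measurable cube_M" by (rule measurable_cube_M)
    note \<phi>[measurable]
    show ?thesis by measurable
  qed
  have "(\<integral>\<^sup>+y. ennreal (norm (complex_of_real (\<Prod>i\<in>UNIV. kernel_sum r M' (x $ i - y $ i)) * \<phi> y
            - complex_of_real (\<Prod>i\<in>UNIV. kernel_sum r M (x $ i - y $ i)) * \<phi> y)) \<partial>cube_M)
     \<le> (\<Sum>u\<in>?D. \<integral>\<^sup>+y. ennreal (\<bar>?k u y\<bar> * norm (\<phi> y)) \<partial>cube_M)"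
  proof (rule nn_integral_sum_le[OF km])
    fix y :: "real ^ 'd"
    have "complex_of_real (\<Prod>i\<in>UNIV. kernel_sum r M' (x $ i - y $ i)) * \<phi> y - complex_of_real (\<Prod>i\<in>UNIV. kernel_sum r M (x $ i - y $ i)) * \<phi> y
        = complex_of_real (\<Sum>u\<in>?D. ?k u y) * \<phi> y"
      unfolding kernel_sum_prod_expand using sub by (simp add: sum_diff left_diff_distrib del: of_real_sum of_real_prod)
    then have "norm (complex_of_real (\<Prod>i\<in>UNIV. kernel_sum r M' (x $ i - y $ i)) * \<phi> y - complex_of_real (\<Prod>i\<in>UNIV. kernel_sum r M (x $ i - y $ i)) * \<phi> y)
        = \<bar>\<Sum>u\<in>?D. ?k u y\<bar> * norm (\<phi> y)"
      by (simp only: norm_mult norm_of_real)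
    also have "\<dots> \<le> (\<Sum>u\<in>?D. \<bar>?k u y\<bar>) * norm (\<phi> y)" by (intro mult_right_mono sum_abs) auto
    finally have "ennreal (norm (complex_of_real (\<Prod>i\<in>UNIV. kernel_sum r M' (x $ i - y $ i)) * \<phi> y - complex_of_real (\<Prod>i\<in>UNIV. kernel_sum r M (x $ i - y $ i)) * \<phi> y))
        \<le> ennreal (\<Sum>u\<in>?D. \<bar>?k u y\<bar> * norm (\<phi> y))" unfolding sum_distrib_right by (rule ennreal_leI)
    also have "\<dots> = (\<Sum>u\<in>?D. ennreal (\<bar>?k u y\<bar> * norm (\<phi> y)))" by (rule sum_ennreal[symmetric]) simp
    finally show "ennreal (norm (complex_of_real (\<Prod>i\<in>UNIV. kernel_sum r M' (x $ i - y $ i)) * \<phi> y - complex_of_real (\<Prod>i\<in>UNIV. kernel_sum r M (x $ i - y $ i)) * \<phi> y))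
        \<le> (\<Sum>u\<in>?D. ennreal (\<bar>?k u y\<bar> * norm (\<phi> y)))" .
  qed
  also have "\<dots> \<le> (\<Sum>u\<in>?D. ennreal (?c u) * Lp_norm p \<phi>)"
    by (intro sum_mono kernel_piece_prod_Holder p \<phi>)
  also have "\<dots> = ennreal (\<Sum>u\<in>?D. ?c u) * Lp_norm p \<phi>"
    using c0 by (simp only: sum_distrib_right[symmetric] sum_ennreal)
  also have "(\<Sum>u\<in>?D. ?c u) = series_partial r p M' ^ CARD('d) - series_partial r p M ^ CARD('d)"
    unfolding series_partial_power using sub by (simp add: sum_diff)
  finally show ?thesis .
qed

section \<open>Functions in the Sobolev ball\<close>

definition eed :: "('d \<Rightarrow> int) \<Rightarrow> real ^ 'd \<Rightarrow> complex" where
  "eed k x = (\<Prod>i\<in>UNIV. ee (of_int (k i) * x $ i))"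

definition fourier :: "(real ^ 'd \<Rightarrow> complex) \<Rightarrow> ('d \<Rightarrow> int) \<Rightarrow> complex" where
  "fourier \<phi> k = (LINT y|cube_M. cnj (eed k y) * \<phi> y)"

definition multi_coeff :: "real \<Rightarrow> ('d::finite \<Rightarrow> int) \<Rightarrow> complex" where
  "multi_coeff r k = (\<Prod>i\<in>UNIV. kernel_coeff r (k i))"

lemma multi_coeff_neq_0 [simp]: "multi_coeff r k \<noteq> 0"
  by (simp add: multi_coeff_def)

lemma norm_eed [simp]: "norm (eed k x) = 1"
  by (simp add: eed_def prod_norm[symmetric])

lemma continuous_on_eed [continuous_intros]: "continuous_on S (eed k)"
  unfolding eed_def by (intro continuous_on_prod continuous_intros)

lemma borel_measurable_eed [measurable]: "eed k \<in> borel_measurable borel"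
  by (intro borel_measurable_continuous_onI continuous_intros)

lemma periodic_eed:
  fixes k :: "'d::finite \<Rightarrow> int"
  shows "periodic (eed k)"
  unfolding periodic_def
proof (intro allI)
  fix x :: "real ^ 'd" and i
  have "ee (of_int (k j) * (x + axis i 1) $ j) = ee (of_int (k j) * x $ j)" for j
  proof -
    have "ee (of_int (k j) * (x + axis i 1) $ j) = ee (of_int (k j) * x $ j) * ee (of_int (if j = i then k j else 0))"
      by (simp only: ee_add[symmetric]) (simp add: axis_def algebra_simps)
    then show ?thesis by (simp only: ee_of_int mult_1_right)
  qed
  then show "eed k (x + axis i 1) = eed k x" by (simp add: eed_def)
qed

lemma integrable_unit_continuous:
  fixes f :: "real \<Rightarrow> complex"
  assumes "continuous_on UNIV f"
  shows "integrable unit_M f"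
proof -
  have "set_integrable lborel {0..1} f"
    unfolding set_integrable_def by (rule borel_integrable_compact) (auto intro: continuous_on_subset[OF assms])
  then show ?thesis
    unfolding unit_M_def set_integrable_def by (subst integrable_restrict_space) auto
qed

lemma integrable_cube_continuous:
  fixes f :: "real ^ 'd \<Rightarrow> complex"
  assumes "continuous_on UNIV f"
  shows "integrable cube_M f"
proof -
  have "set_integrable lborel (cbox 0 1) f"
    unfolding set_integrable_def by (rule borel_integrable_compact) (auto intro: continuous_on_subset[OF assms])
  then show ?thesis
    unfolding cube_M_def set_integrable_def by (subst integrable_restrict_space) auto
qed

lemma integral_unit_ee: "(LINT t|unit_M. ee (of_int n * t)) = (if n = 0 then 1 else 0)"
proof -
  have eq: "(LINT t|unit_M. ee (of_int n * t)) = (LINT t|lborel. indicator {0..1} t *\<^sub>R ee (of_int n * t))"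
    unfolding unit_M_def by (subst integral_restrict_space) auto
  show ?thesis
  proof (cases "n = 0")
    case True
    have "(LINT t|unit_M. (1::complex)) = 1" by (simp add: measure_def emeasure_unit_M)
    then show ?thesis using True by simp
  next
    case False
    define c :: complex where "c = of_real (2 * pi * of_int n) * \<i>"
    have c: "c \<noteq> 0" using False by (simp add: c_def)
    define F where "F t = ee (of_int n * t) / c" for t
    have ee_exp: "ee (of_int n * t) = exp (c * of_real t)" for t
      by (simp add: ee_def cis_conv_exp c_def mult_ac)
    have "(LINT t|lborel. indicator {0..1} t *\<^sub>R ee (of_int n * t)) = F 1 - F 0"
    proof (rule integral_FTC_atLeastAtMost)
      fix t :: real
      have "((\<lambda>z. exp (c * z) / c) has_field_derivative exp (c * of_real t)) (at (of_real t))"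
        using c by (auto intro!: derivative_eq_intros)
      then have "((\<lambda>z. exp (c * of_real z) / c) has_vector_derivative exp (c * of_real t)) (at t within {0..1})"
        by (rule has_vector_derivative_real_field)
      then show "(F has_vector_derivative ee (of_int n * t)) (at t within {0..1})"
        unfolding F_def ee_exp .
    qed (auto intro!: continuous_intros)
    also have "\<dots> = 0" by (simp add: F_def)
    finally show ?thesis using False eq by simp
  qed
qed

lemma eed_mult_cnj: "cnj (eed k y) * eed l y = (\<Prod>i\<in>UNIV. ee (of_int (l i - k i) * y $ i))"
  unfolding eed_def cnj_prod prod.distrib[symmetric]
  by (intro prod.cong refl) (simp add: cnj_ee ee_add[symmetric] left_diff_distrib)

lemma fourier_eed: "fourier (eed l) k = (if k = l then 1 else 0)"
proof -
  have "fourier (eed l) k = (\<Prod>i\<in>UNIV. LINT t|unit_M. ee (of_int (l i - k i) * t))"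
    unfolding fourier_def eed_mult_cnj
    by (rule integral_cube_prod) (intro integrable_unit_continuous continuous_intros)
  also have "\<dots> = (\<Prod>i\<in>UNIV. if l i = k i then 1 else 0)" unfolding integral_unit_ee by simp
  also have "\<dots> = (if k = l then 1 else 0)"
  proof (cases "k = l")
    case False
    then obtain i where "k i \<noteq> l i" by (auto simp: fun_eq_iff)
    then have "l i \<noteq> k i" by simp
    then have "(\<Prod>i\<in>UNIV. if l i = k i then 1 else (0::complex)) = 0" by (intro prod_zero) auto
    then show ?thesis using False by simp
  qed simp
  finally show ?thesis .
qed

definition trigd :: "('d \<Rightarrow> int) set \<Rightarrow> (('d \<Rightarrow> int) \<Rightarrow> complex) \<Rightarrow> real ^ 'd \<Rightarrow> complex" where
  "trigd K \<gamma> x = (\<Sum>k\<in>K. \<gamma> k * eed k x)"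

lemma continuous_on_trigd [continuous_intros]: "continuous_on S (trigd K \<gamma>)"
  unfolding trigd_def by (intro continuous_intros)

lemma periodic_sum: "(\<And>j. j \<in> J \<Longrightarrow> periodic (f j)) \<Longrightarrow> periodic (\<lambda>x. \<Sum>j\<in>J. c j * f j x)"
  by (simp add: periodic_def)

lemma periodic_trigd: "periodic (trigd K \<gamma>)"
  unfolding trigd_def by (rule periodic_sum) (rule periodic_eed)

lemma trigd_measurable: "trigd K \<gamma> \<in> torus_measurable"
  by (simp add: torus_measurable_def periodic_trigd borel_measurable_continuous_onI continuous_intros)

lemma Lp_norm_continuous_finite:
  fixes f :: "real ^ 'd \<Rightarrow> complex"
  assumes f: "continuous_on UNIV f" and p: "0 < p"
  shows "(\<integral>\<^sup>+x. ennreal (norm (f x) powr p) \<partial>cube_M) < \<infinity>" and "Lp_norm p f < \<infinity>"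
proof -
  have "compact (f ` cbox 0 1)" by (intro compact_continuous_image continuous_on_subset[OF f]) auto
  then obtain B where "\<forall>x\<in>cbox 0 1. norm (f x) \<le> B"
    by (auto dest!: compact_imp_bounded simp: bounded_iff)
  then have B: "\<And>x. x \<in> cbox 0 1 \<Longrightarrow> norm (f x) \<le> B" by simp
  have "(\<integral>\<^sup>+x. ennreal (norm (f x) powr p) \<partial>cube_M) \<le> (\<integral>\<^sup>+x. ennreal (B powr p) \<partial>(cube_M :: (real ^ 'd) measure))"
    using p B by (intro nn_integral_mono ennreal_leI powr_mono2) auto
  also have "\<dots> = ennreal (B powr p)" by (simp add: emeasure_cube_M)
  finally show 1: "(\<integral>\<^sup>+x. ennreal (norm (f x) powr p) \<partial>cube_M) < \<infinity>" by (simp add: le_less_trans)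
  then show "Lp_norm p f < \<infinity>" by (simp add: Lp_norm_cube epow_def)
qed

lemma Lp_integrable:
  fixes \<phi> :: "real ^ 'd \<Rightarrow> complex"
  assumes \<phi>: "\<phi> \<in> borel_measurable cube_M" and p: "1 < p" and fin: "Lp_norm p \<phi> < \<infinity>"
  shows "integrable cube_M \<phi>"
  unfolding integrable_iff_bounded
proof (intro conjI \<phi>)
  have "(\<integral>\<^sup>+x. ennreal (norm (\<phi> x)) \<partial>cube_M) = (\<integral>\<^sup>+x. ennreal (norm (\<phi> x) * norm ((\<lambda>_ :: real ^ 'd. 1 :: complex) x)) \<partial>cube_M)"
    by simp
  also have "\<dots> \<le> Lp_norm p \<phi> * Lp_norm (p / (p - 1)) (\<lambda>_ :: real ^ 'd. 1 :: complex)"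
    by (rule Lp_norm_Holder[OF \<phi> _ p]) simp
  also have "\<dots> < \<infinity>"
    using fin Lp_norm_continuous_finite(2)[of "\<lambda>_ :: real ^ 'd. 1 :: complex" "p / (p - 1)"] p
    by (simp add: ennreal_mult_less_top)
  finally show "(\<integral>\<^sup>+x. ennreal (norm (\<phi> x)) \<partial>cube_M) < \<infinity>" .
qed

lemma integrable_eed_mult:
  fixes \<phi> :: "real ^ 'd \<Rightarrow> complex"
  assumes "integrable cube_M \<phi>"
  shows "integrable cube_M (\<lambda>y. cnj (eed k y) * \<phi> y)"
proof (rule Bochner_Integration.integrable_bound[OF assms])
  have [measurable]: "\<phi> \<in> borel_measurable cube_M" using assms by simp
  have [measurable]: "(\<lambda>y. cnj (eed k y)) \<in> borel_measurable (cube_M :: (real ^ 'd) measure)"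
    by (intro measurable_cube_M borel_measurable_continuous_onI continuous_intros)
  show "(\<lambda>y. cnj (eed k y) * \<phi> y) \<in> borel_measurable cube_M" by measurable
qed (simp add: norm_mult)

lemma fourier_trigd: "finite K \<Longrightarrow> fourier (trigd K \<gamma>) k = (if k \<in> K then \<gamma> k else 0)"
proof -
  assume K: "finite K"
  have "fourier (trigd K \<gamma>) k = (\<Sum>l\<in>K. \<gamma> l * fourier (eed l) k)"
  proof -
    have "fourier (trigd K \<gamma>) k = (LINT y|cube_M. (\<Sum>l\<in>K. \<gamma> l * (cnj (eed k y) * eed l y)))"
      unfolding fourier_def trigd_def sum_distrib_left by (simp only: mult_ac)
    also have "\<dots> = (\<Sum>l\<in>K. LINT y|cube_M. \<gamma> l * (cnj (eed k y) * eed l y))"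
      by (intro Bochner_Integration.integral_sum integrable_mult_right integrable_eed_mult integrable_cube_continuous continuous_intros)
    also have "\<dots> = (\<Sum>l\<in>K. \<gamma> l * fourier (eed l) k)" unfolding fourier_def by simp
    finally show ?thesis .
  qed
  also have "\<dots> = (\<Sum>l\<in>K. if l = k then \<gamma> l else 0)" unfolding fourier_eed by (intro sum.cong refl) auto
  also have "\<dots> = (if k \<in> K then \<gamma> k else 0)" using K by simp
  finally show ?thesis .
qed

definition freqs :: "nat \<Rightarrow> ('d::finite \<Rightarrow> int) set" where
  "freqs M = Pi\<^sub>E UNIV (\<lambda>_. {- (2 ^ M)<..<2 ^ M})"

lemma finite_freqs [simp]: "finite (freqs M)"
  unfolding freqs_def by (intro finite_PiE) auto

lemma mem_freqs: "k \<in> freqs M \<longleftrightarrow> (\<forall>i. \<bar>k i\<bar> < 2 ^ M)"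
proof -
  have "j \<in> {- (2 ^ M)<..<2 ^ M} \<longleftrightarrow> \<bar>j\<bar> < 2 ^ M" for j :: int
    unfolding greaterThanLessThan_iff abs_less_iff by linarith
  then show ?thesis by (simp add: freqs_def PiE_iff)
qed

text \<open>
  The two occurrences of one coordinate separate, so a convolution with this kernel acts on \<open>\<phi>\<close> through
  finitely many Fourier coefficients.
\<close>

lemma prod_trig_expand:
  fixes x y :: "real ^ 'd"
  assumes A: "finite A"
  shows "(\<Prod>i\<in>UNIV. trig A (c i) (x $ i - y $ i)) = (\<Sum>k\<in>Pi\<^sub>E UNIV (\<lambda>_. A). (\<Prod>i\<in>UNIV. c i (k i)) * (eed k x * cnj (eed k y)))"
proof -
  have "(\<Prod>i\<in>UNIV. trig A (c i) (x $ i - y $ i)) = (\<Sum>k\<in>Pi\<^sub>E UNIV (\<lambda>_. A). \<Prod>i\<in>UNIV. c i (k i) * ee (of_int (k i) * (x $ i - y $ i)))"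
    unfolding trig_def by (rule prod_sum_PiE) (use A in auto)
  also have "\<dots> = (\<Sum>k\<in>Pi\<^sub>E UNIV (\<lambda>_. A). (\<Prod>i\<in>UNIV. c i (k i)) * (eed k x * cnj (eed k y)))"
  proof (rule sum.cong[OF refl])
    fix k :: "'d \<Rightarrow> int"
    have "ee (of_int (k i) * (x $ i - y $ i)) = ee (of_int (k i) * x $ i) * cnj (ee (of_int (k i) * y $ i))" for i
      unfolding cnj_ee by (simp only: ee_add[symmetric]) (simp add: right_diff_distrib)
    then show "(\<Prod>i\<in>UNIV. c i (k i) * ee (of_int (k i) * (x $ i - y $ i))) = (\<Prod>i\<in>UNIV. c i (k i)) * (eed k x * cnj (eed k y))"
      unfolding eed_def cnj_prod by (simp only: prod.distrib)
  qed
  finally show ?thesis .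
qed

lemma conv_trig_expand:
  fixes \<phi> :: "real ^ 'd \<Rightarrow> complex"
  assumes A: "finite A" and \<phi>: "integrable cube_M \<phi>"
  shows "(LINT y|cube_M. (\<Prod>i\<in>UNIV. trig A (c i) (x $ i - y $ i)) * \<phi> y)
     = trigd (Pi\<^sub>E UNIV (\<lambda>_. A)) (\<lambda>k. (\<Prod>i\<in>UNIV. c i (k i)) * fourier \<phi> k) x"
    and "integrable cube_M (\<lambda>y. (\<Prod>i\<in>UNIV. trig A (c i) (x $ i - y $ i)) * \<phi> y)"
proof -
  let ?P = "Pi\<^sub>E (UNIV :: 'd set) (\<lambda>_. A)"
  have eq: "(\<Prod>i\<in>UNIV. trig A (c i) (x $ i - y $ i)) * \<phi> y
     = (\<Sum>k\<in>?P. ((\<Prod>i\<in>UNIV. c i (k i)) * eed k x) * (cnj (eed k y) * \<phi> y))" for y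
    unfolding prod_trig_expand[OF A] sum_distrib_right by (intro sum.cong refl) (simp only: mult_ac)
  have i: "integrable cube_M (\<lambda>y. ((\<Prod>i\<in>UNIV. c i (k i)) * eed k x) * (cnj (eed k y) * \<phi> y))" for k
    by (intro integrable_mult_right integrable_eed_mult \<phi>)
  show "integrable cube_M (\<lambda>y. (\<Prod>i\<in>UNIV. trig A (c i) (x $ i - y $ i)) * \<phi> y)"
    unfolding eq by (intro Bochner_Integration.integrable_sum i)
  have "(LINT y|cube_M. (\<Prod>i\<in>UNIV. trig A (c i) (x $ i - y $ i)) * \<phi> y)
      = (\<Sum>k\<in>?P. LINT y|cube_M. ((\<Prod>i\<in>UNIV. c i (k i)) * eed k x) * (cnj (eed k y) * \<phi> y))"
    unfolding eq by (rule Bochner_Integration.integral_sum) (rule i)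
  also have "\<dots> = (\<Sum>k\<in>?P. ((\<Prod>i\<in>UNIV. c i (k i)) * eed k x) * fourier \<phi> k)"
    unfolding fourier_def by simp
  finally show "(LINT y|cube_M. (\<Prod>i\<in>UNIV. trig A (c i) (x $ i - y $ i)) * \<phi> y)
     = trigd ?P (\<lambda>k. (\<Prod>i\<in>UNIV. c i (k i)) * fourier \<phi> k) x"
    unfolding trigd_def by (simp only: mult_ac)
qed

lemma conv_approx_expand:
  fixes \<phi> :: "real ^ 'd \<Rightarrow> complex"
  assumes \<phi>: "integrable cube_M \<phi>"
  shows "conv_approx r M \<phi> x = trigd (freqs M) (\<lambda>k. (\<Prod>i\<in>UNIV. of_real (hat M (k i)) * kernel_coeff r (k i)) * fourier \<phi> k) x"
    and "integrable cube_M (\<lambda>y. complex_of_real (\<Prod>i\<in>UNIV. kernel_sum r M (x $ i - y $ i)) * \<phi> y)"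
  unfolding conv_approx_def of_real_prod kernel_sum_eq_trig freqs_def
  by (rule conv_trig_expand[OF _ \<phi>, of _ "\<lambda>_ k. of_real (hat M k) * kernel_coeff r k"], simp)+

lemma series_partial_limit:
  assumes p: "1 < p" and r: "1 / p < r"
  obtains a where "(\<lambda>M. series_partial r p M ^ n) \<longlonglongrightarrow> a" "\<And>M. series_partial r p M ^ n \<le> a"
proof -
  define \<rho> where "\<rho> = 2 powr (- (r - 1 / p))"
  have \<rho>: "0 < \<rho>" "\<rho> < 1" using r by (auto simp: \<rho>_def powr_less_one)
  have eq: "kernel_const r * 2 powr (- (r - 1 / p) * real u) = kernel_const r * \<rho> ^ u" for u
    by (simp add: \<rho>_def powr_realpow[symmetric] powr_powr)
  have s: "summable (\<lambda>u. kernel_const r * \<rho> ^ u)" using \<rho> by (intro summable_mult summable_geometric) auto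
  have k: "0 \<le> kernel_const r * \<rho> ^ u" for u using kernel_const_ge_1[of r] \<rho> by simp
  define S where "S = (\<Sum>u. kernel_const r * \<rho> ^ u)"
  have lim: "(\<lambda>M. series_partial r p M) \<longlonglongrightarrow> S"
    unfolding series_partial_def eq S_def using summable_LIMSEQ'[OF s] .
  have le: "series_partial r p M \<le> S" for M
    unfolding series_partial_def eq S_def by (rule sum_le_suminf[OF s]) (use k in auto)
  have "0 \<le> series_partial r p M" for M unfolding series_partial_def eq by (intro sum_nonneg k)
  with lim le show thesis by (intro that[of "S ^ n"] tendsto_power power_mono)
qed

lemma kernel1_measurable: "kernel1 r \<in> borel_measurable borel"
  unfolding kernel1_def
proof (intro borel_measurable_add borel_measurable_times borel_measurable_const borel_measurable_suminf)
  fix k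
  show "(\<lambda>x. cos (2 * pi * real (Suc k) * x - r * pi / 2)) \<in> borel_measurable borel"
    by (intro borel_measurable_continuous_onI continuous_intros)
qed

lemma torus_conv_cube: "torus_conv F \<phi> x = (LINT y|cube_M. complex_of_real (F (x - y)) * \<phi> y)"
  unfolding torus_conv_def by (rule set_integral_cube_lborel)

text \<open>
  Uniformity in \<open>x\<close> is the point: the Cauchy bound does not depend on \<open>x\<close>, because the kernel enters only
  through integrals over full periods. The exceptional points, at which the series of the kernel may
  diverge, lie in countably many hyperplanes.
\<close>

lemma conv_approx_uniform:
  fixes \<phi> :: "real ^ 'd \<Rightarrow> complex"
  assumes p: "1 < p" and r: "1 / p < r" and \<phi>: "\<phi> \<in> Lp_space p"
  obtains b where "b \<longlonglongrightarrow> 0" "\<And>M x. norm (conv_approx r M \<phi> x - torus_conv (kernel r) \<phi> x) \<le> b M"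
proof -
  have r0: "0 < r" using r p by (meson less_trans zero_less_divide_1_iff zero_less_one)
  have \<phi>m: "\<phi> \<in> borel_measurable cube_M" and fin: "Lp_norm p \<phi> < \<infinity>"
    using \<phi> by (auto simp: Lp_space_def torus_measurable_def intro: measurable_cube_M)
  then obtain L where L: "Lp_norm p \<phi> = ennreal L" "0 \<le> L" by (cases "Lp_norm p \<phi>") auto
  have \<phi>i: "integrable cube_M \<phi>" by (rule Lp_integrable[OF \<phi>m p fin])
  obtain a where a: "(\<lambda>M. series_partial r p M ^ CARD('d)) \<longlonglongrightarrow> a" "\<And>M. series_partial r p M ^ CARD('d) \<le> a"
    using series_partial_limit[OF p r] by metis
  define b where "b M = (a - series_partial r p M ^ CARD('d)) * L" for M
  have "b \<longlonglongrightarrow> (a - a) * L" unfolding b_def by (intro tendsto_intros a)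
  then have b: "b \<longlonglongrightarrow> 0" by simp
  have "norm (conv_approx r M \<phi> x - torus_conv (kernel r) \<phi> x) \<le> b M" for M x
    unfolding conv_approx_def torus_conv_cube
  proof (rule L1_Cauchy_limit(2))
    show "integrable cube_M (\<lambda>y. complex_of_real (\<Prod>i\<in>UNIV. kernel_sum r M (x $ i - y $ i)) * \<phi> y)" for M
      by (rule conv_approx_expand(2)[OF \<phi>i])
    have k: "(\<lambda>y :: real ^ 'd. kernel1 r (x $ i - y $ i)) \<in> borel_measurable cube_M" for i
    proof (rule measurable_cube_M, rule measurable_compose[OF _ kernel1_measurable])
      show "(\<lambda>y :: real ^ 'd. x $ i - y $ i) \<in> borel_measurable borel"
        by (intro borel_measurable_continuous_onI continuous_intros)
    qed
    show "(\<lambda>y. complex_of_real (kernel r (x - y)) * \<phi> y) \<in> borel_measurable cube_M"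
      unfolding kernel_def vector_minus_component of_real_prod
      by (intro borel_measurable_times borel_measurable_prod \<phi>m measurable_compose[OF k])
         (intro borel_measurable_continuous_onI continuous_intros)
    have ae: "AE y in (cube_M :: (real ^ 'd) measure). \<forall>i\<in>UNIV. y $ i \<notin> (\<lambda>n. x $ i - of_int n) ` UNIV"
      by (intro AE_finite_allI AE_cube_component) auto
    show "AE y in cube_M. (\<lambda>M. complex_of_real (\<Prod>i\<in>UNIV. kernel_sum r M (x $ i - y $ i)) * \<phi> y) \<longlonglongrightarrow> complex_of_real (kernel r (x - y)) * \<phi> y"
      using ae
    proof eventually_elim
      fix y :: "real ^ 'd" assume y: "\<forall>i\<in>UNIV. y $ i \<notin> (\<lambda>n. x $ i - of_int n) ` UNIV"
      have "x $ i - y $ i \<notin> \<int>" for i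
      proof
        assume "x $ i - y $ i \<in> \<int>"
        then obtain n where "x $ i - y $ i = of_int n" by (auto elim: Ints_cases)
        then have "y $ i = x $ i - of_int n" by simp
        then show False using y by auto
      qed
      then show "(\<lambda>M. complex_of_real (\<Prod>i\<in>UNIV. kernel_sum r M (x $ i - y $ i)) * \<phi> y) \<longlonglongrightarrow> complex_of_real (kernel r (x - y)) * \<phi> y"
        unfolding kernel_def vector_minus_component by (intro tendsto_intros kernel_sum_tendsto r0)
    qed
    show "(\<integral>\<^sup>+y. ennreal (norm (complex_of_real (\<Prod>i\<in>UNIV. kernel_sum r M' (x $ i - y $ i)) * \<phi> y
            - complex_of_real (\<Prod>i\<in>UNIV. kernel_sum r M (x $ i - y $ i)) * \<phi> y)) \<partial>cube_M) \<le> ennreal (b M)" if "M \<le> M'" for M M'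
    proof -
      have "(\<integral>\<^sup>+y. ennreal (norm (complex_of_real (\<Prod>i\<in>UNIV. kernel_sum r M' (x $ i - y $ i)) * \<phi> y
            - complex_of_real (\<Prod>i\<in>UNIV. kernel_sum r M (x $ i - y $ i)) * \<phi> y)) \<partial>cube_M)
        \<le> ennreal (series_partial r p M' ^ CARD('d) - series_partial r p M ^ CARD('d)) * ennreal L"
        using kernel_sum_prod_Cauchy[OF p \<phi>m that] unfolding L(1) .
      also have "\<dots> \<le> ennreal (a - series_partial r p M ^ CARD('d)) * ennreal L"
        using a(2)[of M'] by (intro mult_right_mono ennreal_leI) auto
      also have "\<dots> = ennreal (b M)" using a(2)[of M] L by (simp add: b_def ennreal_mult)
      finally show ?thesis .
    qed
    show "0 \<le> b M" for M using a(2)[of M] L by (simp add: b_def)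
  qed
  with b show thesis by (rule that)
qed

text \<open>
  The set where they differ is open, and nonempty open sets have positive measure.
\<close>

lemma continuous_AE_eq:
  fixes f g :: "real ^ 'd \<Rightarrow> complex"
  assumes f: "continuous_on UNIV f" and g: "continuous_on UNIV g" and ae: "AE x in lborel. f x = g x"
  shows "f = g"
proof (rule ext, rule ccontr)
  fix x assume x: "f x \<noteq> g x"
  let ?A = "{x. f x \<noteq> g x}"
  have op: "open ?A" using f g by (rule open_Collect_neq)
  have "emeasure lborel ?A = 0"
    using ae op by (subst (asm) AE_iff_measurable[of ?A]) auto
  moreover have "\<not> negligible ?A" using op x by (intro open_not_negligible) auto
  ultimately show False
    using op by (auto simp: negligible_iff_emeasure0)
qed

text \<open>
  Convolutions with the kernel are uniform limits of continuous functions, so a continuous function of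
  the space equals its convolution everywhere and not only almost everywhere. The norm is an infimum
  over representations, hence the bound 2 in place of 1 for the norm of one of them.
\<close>

lemma sobolev_ball_representation:
  fixes f :: "real ^ 'd \<Rightarrow> complex"
  assumes p: "1 < p" and r: "1 / p < r" and f: "f \<in> sobolev_ball r p"
  obtains \<phi> b where "\<phi> \<in> Lp_space p" "Lp_norm p \<phi> \<le> 2" "b \<longlonglongrightarrow> 0" "\<And>M x. norm (conv_approx r M \<phi> x - f x) \<le> b M"
proof -
  have cont: "continuous_on UNIV f" and "sobolev_norm r p f \<le> 1" using f by (auto simp: sobolev_ball_def)
  then have "(INF \<phi> \<in> sobolev_reps r p f. Lp_norm p \<phi>) < 2" unfolding sobolev_norm_def by (rule_tac le_less_trans) auto
  then obtain \<phi> where \<phi>: "\<phi> \<in> sobolev_reps r p f" "Lp_norm p \<phi> < 2" by (auto simp: INF_less_iff)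
  then have \<phi>L: "\<phi> \<in> Lp_space p" and ae: "AE x in lborel. f x = torus_conv (kernel r) \<phi> x" by (auto simp: sobolev_reps_def)
  obtain b where b: "b \<longlonglongrightarrow> 0" "\<And>M x. norm (conv_approx r M \<phi> x - torus_conv (kernel r) \<phi> x) \<le> b M"
    using conv_approx_uniform[OF p r \<phi>L] by metis
  have \<phi>i: "integrable cube_M \<phi>"
    using \<phi>L by (intro Lp_integrable[OF _ p]) (auto simp: Lp_space_def torus_measurable_def intro: measurable_cube_M)
  have "continuous_on UNIV (torus_conv (kernel r) \<phi>)"
  proof (rule uniform_limit_theorem[where F = sequentially and f = "\<lambda>M. conv_approx r M \<phi>"])
    show "\<forall>\<^sub>F M in sequentially. continuous_on UNIV (conv_approx r M \<phi>)"
      using conv_approx_expand(1)[OF \<phi>i] by (intro always_eventually allI) (simp add: fun_eq_iff[symmetric] continuous_intros cong: continuous_on_cong)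
    show "uniform_limit UNIV (\<lambda>M. conv_approx r M \<phi>) (torus_conv (kernel r) \<phi>) sequentially"
    proof (rule uniform_limitI)
      fix e :: real assume "0 < e"
      then have "\<forall>\<^sub>F M in sequentially. b M < e" using b(1) by (rule order_tendstoD(2)[rotated])
      then show "\<forall>\<^sub>F M in sequentially. \<forall>x\<in>UNIV. dist (conv_approx r M \<phi> x) (torus_conv (kernel r) \<phi> x) < e"
        by eventually_elim (use b(2) in \<open>auto simp: dist_norm intro: le_less_trans\<close>)
    qed
  qed auto
  then have "f = torus_conv (kernel r) \<phi>" using cont ae by (intro continuous_AE_eq)
  then show thesis using b \<phi> \<phi>L by (intro that[of \<phi> b]) auto
qed

text \<open>
  On a finite set of frequencies the smoothing multipliers are eventually 1, so the approximating
  convolutions are eventually equal to the polynomial with coefficients \<open>multi_coeff r k * \<gamma> k\<close>.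
\<close>

lemma trigd_in_sobolev_ball:
  fixes \<gamma> :: "('d::finite \<Rightarrow> int) \<Rightarrow> complex"
  assumes p: "1 < p" and r: "1 / p < r" and K: "finite K" and le: "Lp_norm p (trigd K \<gamma>) \<le> 1"
  shows "trigd K (\<lambda>k. multi_coeff r k * \<gamma> k) \<in> sobolev_ball r p"
proof -
  let ?f = "trigd K (\<lambda>k. multi_coeff r k * \<gamma> k)"
  have L: "trigd K \<gamma> \<in> Lp_space p" for \<gamma> :: "('d \<Rightarrow> int) \<Rightarrow> complex"
    using p Lp_norm_continuous_finite(2)[OF continuous_on_trigd, of p K \<gamma>] by (simp add: Lp_space_def trigd_measurable)
  have i: "integrable cube_M (trigd K \<gamma>)" by (intro integrable_cube_continuous continuous_intros)
  obtain b where b: "b \<longlonglongrightarrow> 0" "\<And>M x. norm (conv_approx r M (trigd K \<gamma>) x - torus_conv (kernel r) (trigd K \<gamma>) x) \<le> b M"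
    using conv_approx_uniform[OF p r L] by metis
  obtain M0 where M0: "\<And>k i. k \<in> K \<Longrightarrow> 2 * \<bar>k i\<bar> < 2 ^ M0"
  proof -
    define S where "S = (\<Sum>k\<in>K. \<Sum>i\<in>UNIV. 2 * nat \<bar>k i\<bar>)"
    have "2 * \<bar>k i\<bar> < 2 ^ S" if "k \<in> K" for k i
    proof -
      have "2 * nat \<bar>k i\<bar> \<le> (\<Sum>i\<in>UNIV. 2 * nat \<bar>k i\<bar>)" by (rule member_le_sum) auto
      also have "\<dots> \<le> S" unfolding S_def using K that by (intro member_le_sum) auto
      also have "S < 2 ^ S" by (rule less_exp)
      finally have "int (2 * nat \<bar>k i\<bar>) < int (2 ^ S)" by (simp only: of_nat_less_iff)
      then show ?thesis by simp
    qed
    then show thesis by (rule that)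
  qed
  have eventual: "conv_approx r M (trigd K \<gamma>) x = ?f x" if M: "M0 \<le> M" for M x
  proof -
    have big: "2 * \<bar>k i\<bar> < 2 ^ M" if "k \<in> K" for k i
    proof -
      have "(2::int) ^ M0 \<le> 2 ^ M" using M by (intro power_increasing) auto
      with M0[OF that, of i] show ?thesis by linarith
    qed
    have "K \<subseteq> freqs M"
    proof
      fix k assume "k \<in> K"
      then have "\<bar>k i\<bar> < 2 ^ M" for i using big[of k i] abs_ge_zero[of "k i"] by linarith
      then show "k \<in> freqs M" by (simp add: mem_freqs)
    qed
    have "conv_approx r M (trigd K \<gamma>) x = (\<Sum>k\<in>freqs M. (\<Prod>i\<in>UNIV. of_real (hat M (k i)) * kernel_coeff r (k i)) * (if k \<in> K then \<gamma> k else 0) * eed k x)"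
      unfolding conv_approx_expand(1)[OF i] fourier_trigd[OF K] trigd_def ..
    also have "\<dots> = (\<Sum>k\<in>K. (\<Prod>i\<in>UNIV. of_real (hat M (k i)) * kernel_coeff r (k i)) * (if k \<in> K then \<gamma> k else 0) * eed k x)"
      using \<open>K \<subseteq> freqs M\<close> by (intro sum.mono_neutral_right) auto
    also have "\<dots> = ?f x"
      unfolding trigd_def multi_coeff_def
      by (intro sum.cong refl) (simp add: hat_eq_1 big less_imp_le)
    finally show ?thesis .
  qed
  have eq: "torus_conv (kernel r) (trigd K \<gamma>) x = ?f x" for x
  proof -
    have "(\<lambda>M. conv_approx r M (trigd K \<gamma>) x) \<longlonglongrightarrow> torus_conv (kernel r) (trigd K \<gamma>) x"
      by (rule LIM_zero_cancel, rule Lim_null_comparison[OF _ b(1)]) (use b(2) in auto)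
    moreover have "(\<lambda>M. conv_approx r M (trigd K \<gamma>) x) \<longlonglongrightarrow> ?f x"
      using eventual by (intro tendsto_eventually) (auto simp: eventually_sequentially)
    ultimately show ?thesis by (rule LIMSEQ_unique)
  qed
  have rep: "trigd K \<gamma> \<in> sobolev_reps r p ?f" using L by (simp add: sobolev_reps_def eq)
  have "sobolev_norm r p ?f \<le> 1"
    unfolding sobolev_norm_def by (rule INF_lower2[where f = "Lp_norm p", OF rep le])
  then show ?thesis using rep L by (auto simp: sobolev_ball_def sobolev_space_def continuous_intros)
qed

section \<open>Sampling on sparse grids\<close>

definition compositions :: "nat \<Rightarrow> ('d::finite \<Rightarrow> nat) set" where
  "compositions l = {s. sum s UNIV = l}"

definition below_level :: "nat \<Rightarrow> ('d::finite \<Rightarrow> nat) set" where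
  "below_level m = {s. sum s UNIV < m}"

lemma component_le_sum:
  fixes s :: "'d::finite \<Rightarrow> nat"
  shows "s i \<le> sum s UNIV"
  by (rule member_le_sum) auto

lemma finite_below_level [simp]: "finite (below_level m :: ('d::finite \<Rightarrow> nat) set)"
proof (rule finite_subset)
  show "below_level m \<subseteq> Pi\<^sub>E (UNIV :: 'd set) (\<lambda>_. {..m})"
    by (auto simp: below_level_def PiE_iff intro: order_trans[OF component_le_sum])
qed simp

lemma compositions_subset: "l < m \<Longrightarrow> compositions l \<subseteq> below_level m"
  by (auto simp: compositions_def below_level_def)

lemma finite_compositions [simp]: "finite (compositions l)"
  using finite_subset[OF compositions_subset[of l "Suc l"]] by simp

text \<open>
  A composition of \<open>l\<close> is determined by all components but one.
\<close>

lemma card_compositions_le: "card (compositions l :: ('d::finite \<Rightarrow> nat) set) \<le> (l + 1) ^ (CARD('d) - 1)"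
proof -
  obtain i0 :: 'd where True by simp
  let ?I = "UNIV - {i0}"
  have "inj_on (\<lambda>s. restrict s ?I) (compositions l)"
  proof (rule inj_onI)
    fix s t :: "'d \<Rightarrow> nat" assume st: "s \<in> compositions l" "t \<in> compositions l" and eq: "restrict s ?I = restrict t ?I"
    have off: "s i = t i" if "i \<noteq> i0" for i using fun_cong[OF eq, of i] that by simp
    have "sum s UNIV = s i0 + sum s ?I" "sum t UNIV = t i0 + sum t ?I" by (simp_all add: sum.remove)
    moreover have "sum s ?I = sum t ?I" using off by (intro sum.cong) auto
    ultimately have "s i0 = t i0" using st by (simp add: compositions_def)
    then show "s = t" using off by (intro ext) metis
  qed
  moreover have "(\<lambda>s. restrict s ?I) ` compositions l \<subseteq> Pi\<^sub>E ?I (\<lambda>_. {..l})"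
  proof (rule image_subsetI)
    fix s :: "'d \<Rightarrow> nat" assume "s \<in> compositions l"
    then have "s i \<le> l" for i using component_le_sum[of s i] by (simp add: compositions_def)
    then show "restrict s ?I \<in> Pi\<^sub>E ?I (\<lambda>_. {..l})" by (simp add: restrict_PiE_iff)
  qed
  ultimately have "card (compositions l :: ('d \<Rightarrow> nat) set) \<le> card (Pi\<^sub>E ?I (\<lambda>_. {..l}))"
    by (intro card_inj_on_le[of "\<lambda>s. restrict s ?I"] finite_PiE) auto
  also have "\<dots> = (l + 1) ^ (CARD('d) - 1)" by (simp add: card_PiE card_Diff_singleton)
  finally show ?thesis .
qed

lemma sum_pow_below_level: "(\<Sum>s\<in>(below_level m :: ('d::finite \<Rightarrow> nat) set). 2 ^ sum s UNIV) \<le> m ^ (CARD('d) - 1) * (2 ^ m :: nat)"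
proof -
  have U: "(below_level m :: ('d \<Rightarrow> nat) set) = (\<Union>l<m. compositions l)"
    by (auto simp: below_level_def compositions_def)
  have "(\<Sum>s\<in>(below_level m :: ('d \<Rightarrow> nat) set). 2 ^ sum s UNIV) = (\<Sum>l<m. \<Sum>s\<in>(compositions l :: ('d \<Rightarrow> nat) set). (2::nat) ^ sum s UNIV)"
    unfolding U
  proof (rule sum.UNION_disjoint)
    show "\<forall>i\<in>{..<m}. \<forall>j\<in>{..<m}. i \<noteq> j \<longrightarrow> (compositions i :: ('d \<Rightarrow> nat) set) \<inter> compositions j = {}"
      by (auto simp: compositions_def)
  qed simp_all
  also have "\<dots> = (\<Sum>l<m. card (compositions l :: ('d \<Rightarrow> nat) set) * 2 ^ l)"
    by (intro sum.cong refl) (simp add: compositions_def)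
  also have "\<dots> \<le> (\<Sum>l<m. m ^ (CARD('d) - 1) * 2 ^ l)"
  proof (intro sum_mono mult_right_mono)
    fix l assume "l \<in> {..<m}"
    then have "(l + 1) ^ (CARD('d) - 1) \<le> m ^ (CARD('d) - 1)" by (intro power_mono) auto
    with card_compositions_le[of l, where 'd = 'd] show "card (compositions l :: ('d \<Rightarrow> nat) set) \<le> m ^ (CARD('d) - 1)" by linarith
  qed auto
  also have "\<dots> = m ^ (CARD('d) - 1) * (\<Sum>l<m. 2 ^ l)" by (simp only: sum_distrib_left)
  also have "\<dots> \<le> m ^ (CARD('d) - 1) * 2 ^ m"
  proof (rule mult_left_mono)
    have "(\<Sum>l<m. (2::nat) ^ l) + 1 = 2 ^ m" by (induction m) auto
    then show "(\<Sum>l<m. (2::nat) ^ l) \<le> 2 ^ m" by linarith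
  qed simp
  finally show ?thesis .
qed

definition vgrid :: "('d::finite \<Rightarrow> nat) \<Rightarrow> (real ^ 'd) set" where
  "vgrid s = {\<xi>. \<forall>i. \<xi> $ i \<in> grid1 (s i)}"

definition sparse_grid :: "nat \<Rightarrow> (real ^ 'd) set" where
  "sparse_grid m = (\<Union>s\<in>below_level m. vgrid s)"

lemma vgrid_eq: "vgrid s = vec_lambda ` Pi\<^sub>E UNIV (\<lambda>i. grid1 (s i))"
proof (intro equalityI subsetI)
  fix \<xi> assume "\<xi> \<in> vgrid s"
  then have "\<xi> = vec_lambda (\<lambda>i. \<xi> $ i)" "(\<lambda>i. \<xi> $ i) \<in> Pi\<^sub>E UNIV (\<lambda>i. grid1 (s i))" by (auto simp: vgrid_def PiE_iff)
  then show "\<xi> \<in> vec_lambda ` Pi\<^sub>E UNIV (\<lambda>i. grid1 (s i))" by (rule image_eqI)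
qed (auto simp: vgrid_def PiE_iff)

lemma inj_vec_lambda: "inj_on vec_lambda S"
  by (rule inj_onI) (simp add: vec_lambda_inject)

lemma finite_vgrid [simp]: "finite (vgrid s)"
  unfolding vgrid_eq by (intro finite_imageI finite_PiE) auto

lemma card_vgrid: "card (vgrid s :: (real ^ 'd) set) = 4 ^ CARD('d) * 2 ^ sum s UNIV"
proof -
  have "card (vgrid s :: (real ^ 'd) set) = card (Pi\<^sub>E UNIV (\<lambda>i. grid1 (s i)))"
    unfolding vgrid_eq by (rule card_image[OF inj_vec_lambda])
  also have "\<dots> = (\<Prod>i\<in>UNIV. 2 ^ (s i + 2))" by (simp add: card_PiE card_grid1)
  also have "\<dots> = (\<Prod>i\<in>UNIV. 4 * 2 ^ s i)" by (intro prod.cong refl) simp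
  also have "\<dots> = 4 ^ CARD('d) * 2 ^ sum s UNIV" by (simp add: prod.distrib power_sum)
  finally show ?thesis .
qed

lemma finite_sparse_grid [simp]: "finite (sparse_grid m)"
  unfolding sparse_grid_def by auto

lemma card_sparse_grid: "card (sparse_grid m :: (real ^ 'd) set) \<le> 4 ^ CARD('d) * (m ^ (CARD('d) - 1) * 2 ^ m)"
proof -
  have "card (sparse_grid m :: (real ^ 'd) set) \<le> (\<Sum>s\<in>(below_level m :: ('d \<Rightarrow> nat) set). card (vgrid s))"
    unfolding sparse_grid_def by (rule card_UN_le) simp
  also have "\<dots> = 4 ^ CARD('d) * (\<Sum>s\<in>(below_level m :: ('d \<Rightarrow> nat) set). 2 ^ sum s UNIV)"
    by (simp add: card_vgrid sum_distrib_left)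
  also have "\<dots> \<le> 4 ^ CARD('d) * (m ^ (CARD('d) - 1) * 2 ^ m)"
    by (intro mult_left_mono sum_pow_below_level) simp
  finally show ?thesis .
qed

lemma sparse_grid_bounds: "\<xi> \<in> sparse_grid m \<Longrightarrow> 0 \<le> \<xi> $ i \<and> \<xi> $ i < 1"
  by (auto simp: sparse_grid_def vgrid_def dest: grid1_bounds)

text \<open>
  The coefficient of \<open>f \<xi>\<close> when the tensor products of detail operators are added over all levels \<open>s\<close>
  with \<open>sum s UNIV < m\<close>. Collecting the terms by nodes makes the operator use every node once.
\<close>

definition sparse_weight :: "nat \<Rightarrow> real ^ 'd \<Rightarrow> real ^ 'd \<Rightarrow> complex" where
  "sparse_weight m \<xi> x = (\<Sum>s\<in>below_level m. if \<xi> \<in> vgrid s then \<Prod>i\<in>UNIV. detail_weight (s i) (\<xi> $ i) (x $ i) else 0)"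

text \<open>
  Smolyak's sampling operator.
\<close>

definition smolyak :: "nat \<Rightarrow> (real ^ 'd \<Rightarrow> complex) \<Rightarrow> real ^ 'd \<Rightarrow> complex" where
  "smolyak m f x = (\<Sum>\<xi>\<in>sparse_grid m. f \<xi> * sparse_weight m \<xi> x)"

lemma continuous_on_sparse_weight: "continuous_on UNIV (sparse_weight m \<xi> :: real ^ 'd \<Rightarrow> complex)"
proof -
  have "continuous_on UNIV (\<lambda>x :: real ^ 'd. if \<xi> \<in> vgrid s then \<Prod>i\<in>UNIV. detail_weight (s i) (\<xi> $ i) (x $ i) else 0)" for s
    by (cases "\<xi> \<in> vgrid s") (auto intro!: continuous_on_prod_component continuous_intros)
  then show ?thesis unfolding sparse_weight_def by (intro continuous_on_sum)
qed

lemma detail_weight_add_of_int: "detail_weight s \<xi> (x + of_int n) = detail_weight s \<xi> x"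
proof -
  have "x + of_int n - \<xi> = (x - \<xi>) + of_int n" by simp
  then show ?thesis unfolding detail_weight_def by (simp only: smooth_kernel_add_of_int)
qed

lemma sparse_weight_measurable: "(sparse_weight m \<xi> :: real ^ 'd \<Rightarrow> complex) \<in> torus_measurable"
proof -
  have "periodic (sparse_weight m \<xi> :: real ^ 'd \<Rightarrow> complex)"
    unfolding periodic_def
  proof (intro allI)
    fix x :: "real ^ 'd" and i
    have "detail_weight t \<eta> ((x + axis i 1) $ j) = detail_weight t \<eta> (x $ j)" for t \<eta> j
    proof -
      have "(x + axis i 1) $ j = x $ j + of_int (if j = i then 1 else 0)" by (simp add: axis_def)
      then show ?thesis by (simp only: detail_weight_add_of_int)
    qed
    note shift = this
    show "sparse_weight m \<xi> (x + axis i 1) = sparse_weight m \<xi> x" unfolding sparse_weight_def shift ..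
  qed
  then show ?thesis
    by (simp add: torus_measurable_def borel_measurable_continuous_onI continuous_on_sparse_weight)
qed

lemma smolyak_tensor:
  fixes g :: "'d::finite \<Rightarrow> real \<Rightarrow> complex"
  shows "smolyak m (\<lambda>\<xi>. \<Prod>i\<in>UNIV. g i (\<xi> $ i)) x = (\<Sum>s\<in>below_level m. \<Prod>i\<in>UNIV. detail (s i) (g i) (x $ i))"
proof -
  let ?w = "\<lambda>s \<xi>. \<Prod>i\<in>UNIV. g i (\<xi> $ i) * detail_weight (s i) (\<xi> $ i) (x $ i)"
  have "smolyak m (\<lambda>\<xi>. \<Prod>i\<in>UNIV. g i (\<xi> $ i)) x = (\<Sum>\<xi>\<in>sparse_grid m. \<Sum>s\<in>below_level m. if \<xi> \<in> vgrid s then ?w s \<xi> else 0)"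
    unfolding smolyak_def sparse_weight_def sum_distrib_left
    by (intro sum.cong refl) (simp add: prod.distrib)
  also have "\<dots> = (\<Sum>s\<in>below_level m. \<Sum>\<xi>\<in>sparse_grid m. if \<xi> \<in> vgrid s then ?w s \<xi> else 0)" by (rule sum.swap)
  also have "\<dots> = (\<Sum>s\<in>below_level m. \<Prod>i\<in>UNIV. detail (s i) (g i) (x $ i))"
  proof (rule sum.cong[OF refl])
    fix s :: "'d \<Rightarrow> nat" assume s: "s \<in> below_level m"
    then have sub: "vgrid s \<subseteq> sparse_grid m" by (auto simp: sparse_grid_def)
    have "(\<Sum>\<xi>\<in>sparse_grid m. if \<xi> \<in> vgrid s then ?w s \<xi> else 0) = (\<Sum>\<xi>\<in>vgrid s. if \<xi> \<in> vgrid s then ?w s \<xi> else 0)"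
      using sub by (intro sum.mono_neutral_right) auto
    also have "\<dots> = (\<Sum>\<xi>\<in>vgrid s. ?w s \<xi>)" by (intro sum.cong refl) simp
    also have "\<dots> = (\<Sum>h\<in>Pi\<^sub>E UNIV (\<lambda>i. grid1 (s i)). \<Prod>i\<in>UNIV. g i (h i) * detail_weight (s i) (h i) (x $ i))"
      unfolding vgrid_eq by (subst sum.reindex[OF inj_vec_lambda]) simp
    also have "\<dots> = (\<Prod>i\<in>UNIV. \<Sum>\<eta>\<in>grid1 (s i). g i \<eta> * detail_weight (s i) \<eta> (x $ i))"
      by (rule prod_sum_PiE[symmetric]) auto
    finally show "(\<Sum>\<xi>\<in>sparse_grid m. if \<xi> \<in> vgrid s then ?w s \<xi> else 0) = (\<Prod>i\<in>UNIV. detail (s i) (g i) (x $ i))"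
      unfolding detail_def .
  qed
  finally show ?thesis .
qed

lemma detail_kernel_nonneg [simp]: "0 \<le> detail_kernel r \<beta> M x y"
  unfolding detail_kernel_def by (intro sum_nonneg mult_nonneg_nonneg) auto

text \<open>
  The full tensor sum of details reproduces the kernel. The error therefore consists of the details with
  \<open>m \<le> sum s UNIV\<close>, for which \<open>1 \<le> 2 powr (- \<beta> * m) * 2 powr (\<beta> * sum s UNIV)\<close>; the second factor
  is distributed over the coordinates. After that the sum may run over all levels again and becomes
  a product of sums.
\<close>

lemma smolyak_kernel_error:
  fixes x y :: "real ^ 'd"
  assumes \<beta>: "0 \<le> \<beta>"
  shows "norm (complex_of_real (\<Prod>i\<in>UNIV. kernel_sum r M (x $ i - y $ i)) - smolyak m (\<lambda>\<xi>. complex_of_real (\<Prod>i\<in>UNIV. kernel_sum r M (\<xi> $ i - y $ i))) x)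
     \<le> 2 powr (- \<beta> * real m) * (\<Prod>i\<in>UNIV. detail_kernel r \<beta> M (x $ i) (y $ i))"
proof -
  define D where "D s = (\<Prod>i\<in>UNIV. detail (s i) (\<lambda>z. complex_of_real (kernel_sum r M (z - y $ i))) (x $ i))" for s :: "'d \<Rightarrow> nat"
  let ?U = "Pi\<^sub>E (UNIV :: 'd set) (\<lambda>_. {..M})"
  have full: "complex_of_real (\<Prod>i\<in>UNIV. kernel_sum r M (x $ i - y $ i)) = (\<Sum>s\<in>?U. D s)"
  proof -
    have "(\<Prod>i\<in>UNIV. complex_of_real (kernel_sum r M (x $ i - y $ i)))
        = (\<Prod>i\<in>UNIV. \<Sum>t\<le>M. detail t (\<lambda>z. complex_of_real (kernel_sum r M (z - y $ i))) (x $ i))"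
      by (intro prod.cong refl) (rule sum_detail_kernel_sum[symmetric])
    also have "\<dots> = (\<Sum>s\<in>?U. D s)" unfolding D_def by (rule prod_sum_PiE) auto
    finally show ?thesis unfolding of_real_prod .
  qed
  have part: "smolyak m (\<lambda>\<xi>. complex_of_real (\<Prod>i\<in>UNIV. kernel_sum r M (\<xi> $ i - y $ i))) x = (\<Sum>s\<in>below_level m. D s)"
    unfolding of_real_prod D_def by (rule smolyak_tensor)
  have zero: "D s = 0" if "s \<notin> ?U" for s
  proof -
    have "\<exists>i. M < s i"
    proof (rule ccontr)
      assume "\<nexists>i. M < s i"
      then have "s \<in> ?U" by (auto simp: PiE_iff not_less)
      with that show False by simp
    qed
    then obtain i where "M < s i" ..
    then have "detail (s i) (\<lambda>z. complex_of_real (kernel_sum r M (z - y $ i))) (x $ i) = 0" by (rule detail_kernel_sum_eq_0)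
    then show ?thesis unfolding D_def by (intro prod_zero) auto
  qed
  have "(\<Sum>s\<in>below_level m. D s) = (\<Sum>s\<in>?U \<inter> below_level m. D s)"
    using zero by (intro sum.mono_neutral_right) auto
  then have "complex_of_real (\<Prod>i\<in>UNIV. kernel_sum r M (x $ i - y $ i)) - smolyak m (\<lambda>\<xi>. complex_of_real (\<Prod>i\<in>UNIV. kernel_sum r M (\<xi> $ i - y $ i))) x
      = (\<Sum>s\<in>?U - below_level m. D s)"
    unfolding full part using sum.Int_Diff[of ?U D "below_level m"] by simp
  also have "norm \<dots> \<le> (\<Sum>s\<in>?U - below_level m. norm (D s))" by (rule norm_sum)
  also have "\<dots> \<le> (\<Sum>s\<in>?U - below_level m. 2 powr (- \<beta> * real m) * (\<Prod>i\<in>UNIV. 2 powr (\<beta> * real (s i)) * norm (detail (s i) (\<lambda>z. complex_of_real (kernel_sum r M (z - y $ i))) (x $ i))))"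
  proof (rule sum_mono)
    fix s assume "s \<in> ?U - below_level m"
    then have "m \<le> sum s UNIV" by (simp add: below_level_def)
    then have "\<beta> * real m \<le> \<beta> * (\<Sum>i\<in>UNIV. real (s i))" using \<beta> by (intro mult_left_mono) (simp_all flip: of_nat_sum)
    then have "1 \<le> 2 powr (- \<beta> * real m) * 2 powr (\<Sum>i\<in>UNIV. \<beta> * real (s i))"
      by (simp add: powr_add[symmetric] sum_distrib_left ge_one_powr_ge_zero)
    then have "1 * norm (D s) \<le> (2 powr (- \<beta> * real m) * 2 powr (\<Sum>i\<in>UNIV. \<beta> * real (s i))) * norm (D s)"
      by (rule mult_right_mono) (rule norm_ge_zero)
    then have "norm (D s) \<le> (2 powr (- \<beta> * real m) * 2 powr (\<Sum>i\<in>UNIV. \<beta> * real (s i))) * norm (D s)"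
      by (simp only: mult_1_left)
    also have "2 powr (\<Sum>i\<in>UNIV. \<beta> * real (s i)) = (\<Prod>i\<in>UNIV. 2 powr (\<beta> * real (s i)))"
      by (rule powr_sum) auto
    finally show "norm (D s) \<le> 2 powr (- \<beta> * real m) * (\<Prod>i\<in>UNIV. 2 powr (\<beta> * real (s i)) * norm (detail (s i) (\<lambda>z. complex_of_real (kernel_sum r M (z - y $ i))) (x $ i)))"
      unfolding D_def prod_norm[symmetric] prod.distrib by (simp only: mult.assoc)
  qed
  also have "\<dots> \<le> (\<Sum>s\<in>?U. 2 powr (- \<beta> * real m) * (\<Prod>i\<in>UNIV. 2 powr (\<beta> * real (s i)) * norm (detail (s i) (\<lambda>z. complex_of_real (kernel_sum r M (z - y $ i))) (x $ i))))"
    by (rule sum_mono2) (auto intro!: mult_nonneg_nonneg prod_nonneg)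
  also have "\<dots> = 2 powr (- \<beta> * real m) * (\<Prod>i\<in>UNIV. detail_kernel r \<beta> M (x $ i) (y $ i))"
    unfolding sum_distrib_left[symmetric] detail_kernel_def
    by (intro arg_cong2[where f = "(*)"] refl prod_sum_PiE[symmetric]) auto
  finally show ?thesis .
qed

lemma detail_kernel_measurable: "(\<lambda>(x, y). ennreal (detail_kernel r \<beta> M x y)) \<in> borel_measurable (unit_M \<Otimes>\<^sub>M unit_M)"
proof -
  have id: "(\<lambda>x::real. x) \<in> borel_measurable unit_M" by (intro measurable_unit_M) simp
  have a: "(\<lambda>p. complex_of_real (kernel_sum r M (\<xi> - snd p))) \<in> borel_measurable (unit_M \<Otimes>\<^sub>M unit_M)" for \<xi>
  proof (rule measurable_compose[OF measurable_compose[OF measurable_snd id]])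
    show "(\<lambda>y. complex_of_real (kernel_sum r M (\<xi> - y))) \<in> borel_measurable borel"
      by (intro borel_measurable_continuous_onI continuous_intros)
  qed
  have b: "(\<lambda>p. detail_weight s \<xi> (fst p)) \<in> borel_measurable (unit_M \<Otimes>\<^sub>M unit_M)" for s \<xi>
  proof (rule measurable_compose[OF measurable_compose[OF measurable_fst id]])
    show "(\<lambda>x. detail_weight s \<xi> x) \<in> borel_measurable borel"
      by (intro borel_measurable_continuous_onI continuous_intros)
  qed
  show ?thesis
    unfolding detail_kernel_def detail_def case_prod_beta
    by (intro measurable_compose[OF _ measurable_ennreal] borel_measurable_sum borel_measurable_times borel_measurable_const
        measurable_compose[OF _ borel_measurable_norm] a b)
qed

lemma prod_kernel_measurable:
  assumes K: "(\<lambda>(x, y). K x y) \<in> borel_measurable (unit_M \<Otimes>\<^sub>M unit_M)"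
  shows "(\<lambda>(x, y). \<Prod>i\<in>UNIV. K (x $ i) (y $ i) :: ennreal) \<in> borel_measurable ((cube_M :: (real ^ 'd) measure) \<Otimes>\<^sub>M cube_M)"
proof -
  have nth: "(\<lambda>x :: real ^ 'd. x $ i) \<in> cube_M \<rightarrow>\<^sub>M unit_M" for i
    using measurable_compose[OF measurable_vec_nth_cube measurable_component_singleton[of i UNIV "\<lambda>_. unit_M"]] by simp
  have Kp: "(\<lambda>p. K (fst p $ i) (snd p $ i)) \<in> borel_measurable ((cube_M :: (real ^ 'd) measure) \<Otimes>\<^sub>M cube_M)" for i
    using measurable_compose[OF measurable_Pair[OF measurable_compose[OF measurable_fst nth] measurable_compose[OF measurable_snd nth]] K] by simp
  show ?thesis unfolding case_prod_beta by (intro borel_measurable_prod_ennreal Kp)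
qed

lemma Lp_norm_le_iff:
  fixes f :: "real ^ 'd \<Rightarrow> complex"
  assumes "0 < p" "0 \<le> B"
  shows "Lp_norm p f \<le> ennreal B \<longleftrightarrow> (\<integral>\<^sup>+x. ennreal (norm (f x) powr p) \<partial>cube_M) \<le> ennreal (B powr p)"
proof
  assume "Lp_norm p f \<le> ennreal B"
  then have "epow (Lp_norm p f) p \<le> epow (ennreal B) p" using assms by (intro epow_mono) auto
  then show "(\<integral>\<^sup>+x. ennreal (norm (f x) powr p) \<partial>cube_M) \<le> ennreal (B powr p)"
    using assms unfolding Lp_norm_cube by (simp add: epow_epow)
next
  assume "(\<integral>\<^sup>+x. ennreal (norm (f x) powr p) \<partial>cube_M) \<le> ennreal (B powr p)"
  then have "Lp_norm p f \<le> epow (ennreal (B powr p)) (1 / p)"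
    unfolding Lp_norm_cube using assms by (intro epow_mono) auto
  then show "Lp_norm p f \<le> ennreal B" using assms by (simp only: epow_root)
qed

lemma Lp_norm_Fatou:
  fixes F :: "nat \<Rightarrow> real ^ 'd \<Rightarrow> complex"
  assumes m: "\<And>M. F M \<in> borel_measurable cube_M" and lim: "\<And>x. (\<lambda>M. F M x) \<longlonglongrightarrow> G x"
    and B: "\<And>M. Lp_norm p (F M) \<le> ennreal B" "0 \<le> B" and p: "0 < p"
  shows "Lp_norm p G \<le> ennreal B"
  unfolding Lp_norm_le_iff[OF p B(2)]
proof -
  have "(\<integral>\<^sup>+x. ennreal (norm (G x) powr p) \<partial>cube_M) = (\<integral>\<^sup>+x. liminf (\<lambda>M. ennreal (norm (F M x) powr p)) \<partial>cube_M)"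
  proof (intro nn_integral_cong)
    fix x
    have "(\<lambda>M. ennreal (norm (F M x) powr p)) \<longlonglongrightarrow> ennreal (norm (G x) powr p)"
      using p by (intro tendsto_ennrealI tendsto_powr' tendsto_norm lim tendsto_const) auto
    then show "ennreal (norm (G x) powr p) = liminf (\<lambda>M. ennreal (norm (F M x) powr p))"
      by (intro lim_imp_Liminf[symmetric]) auto
  qed
  also have "\<dots> \<le> liminf (\<lambda>M. \<integral>\<^sup>+x. ennreal (norm (F M x) powr p) \<partial>cube_M)"
    using m by (intro nn_integral_liminf) measurable
  also have "\<dots> \<le> limsup (\<lambda>M. \<integral>\<^sup>+x. ennreal (norm (F M x) powr p) \<partial>cube_M)" by (rule Liminf_le_Limsup) simp
  also have "\<dots> \<le> ennreal (B powr p)"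
  proof (intro Limsup_bounded always_eventually allI)
    fix M
    show "(\<integral>\<^sup>+x. ennreal (norm (F M x) powr p) \<partial>cube_M) \<le> ennreal (B powr p)"
      using B(1)[of M] unfolding Lp_norm_le_iff[OF p B(2)] .
  qed
  finally show "(\<integral>\<^sup>+x. ennreal (norm (G x) powr p) \<partial>cube_M) \<le> ennreal (B powr p)" .
qed

text \<open>
  A function of the ball is a limit of convolutions, and the Smolyak operator acts on these through
  their kernel. The error is thus dominated by an integral operator with the tensor product of the
  detail kernels, which maps \<open>L\<^sub>p\<close> to \<open>L\<^sub>q\<close> with a norm that does not depend on how far the kernel has
  been truncated; Fatou's lemma removes the truncation. The exponents are matched by
  \<open>\<sigma> = 1 / p\<close> and \<open>\<tau> = 1 - 1 / q\<close>, for which \<open>r - (\<sigma> + \<tau> - 1)\<close> is the rate \<open>r - 1 / p + 1 / q\<close>.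
\<close>

lemma smolyak_error:
  fixes dummy :: "'d::finite itself"
  assumes p: "1 < p" and pq: "p < q" and r: "1 / p < r"
  obtains C where "0 < C"
    "\<And>m (f :: real ^ 'd \<Rightarrow> complex). f \<in> sobolev_ball r p \<Longrightarrow>
       Lp_norm q (\<lambda>x. f x - smolyak m f x) \<le> ennreal (C * 2 powr (- (r - 1 / p + 1 / q) * real m))"
proof -
  define \<beta> where "\<beta> = r - 1 / p + 1 / q"
  have q: "1 < q" "0 < q" using p pq by auto
  have pq': "1 / q < 1 / p" using p pq by (intro divide_strict_left_mono) auto
  have \<beta>: "0 \<le> \<beta>" "r - (1 / p + (1 - 1 / q) - 1) = \<beta>" using r q by (auto simp: \<beta>_def)
  obtain C where C: "0 < C" "\<And>M. HLS_bound unit_M (\<lambda>x y. ennreal (detail_kernel r \<beta> M x y)) (1 / p) (1 - 1 / q) (ennreal C)"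
  proof (rule detail_kernel_HLS[of "1 / p" "1 - 1 / q" r])
    show "0 < 1 / p" "1 / p < 1" "0 < 1 - 1 / q" "1 - 1 / q < 1" "1 < 1 / p + (1 - 1 / q)" "1 / p < r"
      using p q pq' r by auto
  qed (use \<beta>(2) in auto)
  let ?C = "2 * C ^ CARD('d)"
  have "Lp_norm q (\<lambda>x. f x - smolyak m f x) \<le> ennreal (?C * 2 powr (- \<beta> * real m))"
    if f: "f \<in> sobolev_ball r p" for m and f :: "real ^ 'd \<Rightarrow> complex"
  proof -
    obtain \<phi> b where \<phi>: "\<phi> \<in> Lp_space p" "Lp_norm p \<phi> \<le> 2"
      and b: "b \<longlonglongrightarrow> 0" "\<And>M x. norm (conv_approx r M \<phi> x - f x) \<le> b M"
      using sobolev_ball_representation[OF p r f] by metis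
    have \<phi>m: "\<phi> \<in> borel_measurable cube_M" and fin: "Lp_norm p \<phi> < \<infinity>"
      using \<phi> by (auto simp: Lp_space_def torus_measurable_def intro: measurable_cube_M)
    have \<phi>i: "integrable cube_M \<phi>" by (rule Lp_integrable[OF \<phi>m p fin])
    define e where "e M x = conv_approx r M \<phi> x - smolyak m (conv_approx r M \<phi>) x" for M x
    have ec: "continuous_on UNIV (e M)" for M
    proof -
      have "conv_approx r M \<phi> = trigd (freqs M) (\<lambda>k. (\<Prod>i\<in>UNIV. of_real (hat M (k i)) * kernel_coeff r (k i)) * fourier \<phi> k)"
        by (rule ext) (rule conv_approx_expand(1)[OF \<phi>i])
      then have "continuous_on UNIV (conv_approx r M \<phi>)" by (simp add: continuous_intros)
      then show ?thesis unfolding e_def smolyak_def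
        by (intro continuous_on_diff continuous_on_sum continuous_on_mult continuous_on_const continuous_on_sparse_weight)
    qed
    have em: "e M \<in> borel_measurable cube_M" for M
      by (intro measurable_cube_M borel_measurable_continuous_onI ec)
    have eK: "ennreal (norm (e M x)) \<le> ennreal (2 powr (- \<beta> * real m)) * (\<integral>\<^sup>+y. (\<Prod>i\<in>UNIV. ennreal (detail_kernel r \<beta> M (x $ i) (y $ i))) * ennreal (norm (\<phi> y)) \<partial>cube_M)"
      if x: "x \<in> cbox 0 1" for M x
    proof -
      let ?F = "\<lambda>x y :: real ^ 'd. complex_of_real (\<Prod>i\<in>UNIV. kernel_sum r M (x $ i - y $ i))"
      have i: "integrable cube_M (\<lambda>y. ?F x y * \<phi> y)" for x by (rule conv_approx_expand(2)[OF \<phi>i])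
      have sm: "smolyak m (\<lambda>\<xi>. ?F \<xi> y) x * \<phi> y = (\<Sum>\<xi>\<in>sparse_grid m. sparse_weight m \<xi> x * (?F \<xi> y * \<phi> y))" for y
        unfolding smolyak_def sum_distrib_right by (intro sum.cong refl) (simp only: mult_ac)
      have i2: "integrable cube_M (\<lambda>y. smolyak m (\<lambda>\<xi>. ?F \<xi> y) x * \<phi> y)"
        unfolding sm by (intro Bochner_Integration.integrable_sum integrable_mult_right i)
      have "smolyak m (conv_approx r M \<phi>) x = (\<Sum>\<xi>\<in>sparse_grid m. LINT y|cube_M. sparse_weight m \<xi> x * (?F \<xi> y * \<phi> y))"
        unfolding smolyak_def conv_approx_def by (intro sum.cong refl) simp
      also have "\<dots> = (LINT y|cube_M. smolyak m (\<lambda>\<xi>. ?F \<xi> y) x * \<phi> y)"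
        unfolding sm by (rule Bochner_Integration.integral_sum[symmetric]) (intro integrable_mult_right i)
      finally have "e M x = (LINT y|cube_M. ?F x y * \<phi> y - smolyak m (\<lambda>\<xi>. ?F \<xi> y) x * \<phi> y)"
        unfolding e_def using Bochner_Integration.integral_diff[OF i[of x] i2] by (simp add: conv_approx_def)
      then have "ennreal (norm (e M x)) \<le> (\<integral>\<^sup>+y. ennreal (norm (?F x y * \<phi> y - smolyak m (\<lambda>\<xi>. ?F \<xi> y) x * \<phi> y)) \<partial>cube_M)"
        by (simp only: integral_norm_bound_ennreal[OF Bochner_Integration.integrable_diff[OF i i2]])
      also have "\<dots> \<le> (\<integral>\<^sup>+y. ennreal (2 powr (- \<beta> * real m)) * ((\<Prod>i\<in>UNIV. ennreal (detail_kernel r \<beta> M (x $ i) (y $ i))) * ennreal (norm (\<phi> y))) \<partial>cube_M)"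
      proof (intro nn_integral_mono)
        fix y
        have "norm (?F x y * \<phi> y - smolyak m (\<lambda>\<xi>. ?F \<xi> y) x * \<phi> y) = norm (?F x y - smolyak m (\<lambda>\<xi>. ?F \<xi> y) x) * norm (\<phi> y)"
          by (simp only: left_diff_distrib[symmetric] norm_mult)
        also have "\<dots> \<le> (2 powr (- \<beta> * real m) * (\<Prod>i\<in>UNIV. detail_kernel r \<beta> M (x $ i) (y $ i))) * norm (\<phi> y)"
          by (intro mult_right_mono smolyak_kernel_error \<beta>) auto
        finally have "ennreal (norm (?F x y * \<phi> y - smolyak m (\<lambda>\<xi>. ?F \<xi> y) x * \<phi> y)) \<le> ennreal ((2 powr (- \<beta> * real m) * (\<Prod>i\<in>UNIV. detail_kernel r \<beta> M (x $ i) (y $ i))) * norm (\<phi> y))"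
          by (rule ennreal_leI)
        also have "\<dots> = ennreal (2 powr (- \<beta> * real m)) * ((\<Prod>i\<in>UNIV. ennreal (detail_kernel r \<beta> M (x $ i) (y $ i))) * ennreal (norm (\<phi> y)))"
          by (simp add: prod_ennreal ennreal_mult prod_nonneg mult.assoc)
        finally show "ennreal (norm (?F x y * \<phi> y - smolyak m (\<lambda>\<xi>. ?F \<xi> y) x * \<phi> y)) \<le> ennreal (2 powr (- \<beta> * real m)) * ((\<Prod>i\<in>UNIV. ennreal (detail_kernel r \<beta> M (x $ i) (y $ i))) * ennreal (norm (\<phi> y)))" .
      qed
      also have "\<dots> = ennreal (2 powr (- \<beta> * real m)) * (\<integral>\<^sup>+y. (\<Prod>i\<in>UNIV. ennreal (detail_kernel r \<beta> M (x $ i) (y $ i))) * ennreal (norm (\<phi> y)) \<partial>cube_M)"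
      proof (rule nn_integral_cmult, rule borel_measurable_times_ennreal)
        show "(\<lambda>y. \<Prod>i\<in>UNIV. ennreal (detail_kernel r \<beta> M (x $ i) (y $ i))) \<in> borel_measurable cube_M"
          using measurable_compose[OF measurable_Pair1' prod_kernel_measurable[OF detail_kernel_measurable], of x] x by simp
        show "(\<lambda>y. ennreal (norm (\<phi> y))) \<in> borel_measurable cube_M" using \<phi>m by measurable
      qed
      finally show ?thesis .
    qed
    have eB: "Lp_norm q (e M) \<le> ennreal (?C * 2 powr (- \<beta> * real m))" for M
    proof -
      have "Lp_norm q (e M) \<le> ennreal (2 powr (- \<beta> * real m)) * ennreal C ^ CARD('d) * Lp_norm p \<phi>"
        using p q(1) HLS_bound_cube[OF detail_kernel_measurable C(2)] prod_kernel_measurable[OF detail_kernel_measurable] em \<phi>m eK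
          Lp_norm_continuous_finite(1)[OF ec q(2)]
        by (rule HLS_operator)
      also have "\<dots> \<le> ennreal (2 powr (- \<beta> * real m)) * ennreal C ^ CARD('d) * ennreal 2"
        using \<phi>(2) by (intro mult_left_mono) auto
      also have "\<dots> = ennreal (?C * 2 powr (- \<beta> * real m))"
        using C(1) by (simp add: ennreal_power ennreal_mult[symmetric] mult_ac flip: ennreal_numeral)
      finally show ?thesis .
    qed
    \<comment> \<open>Point evaluations at the nodes pass to the limit, because the convergence is everywhere.\<close>
    have elim: "(\<lambda>M. e M x) \<longlonglongrightarrow> f x - smolyak m f x" for x
    proof -
      have "(\<lambda>M. conv_approx r M \<phi> x) \<longlonglongrightarrow> f x" for x
        by (rule LIM_zero_cancel, rule Lim_null_comparison[OF _ b(1)]) (use b(2) in auto)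
      then show ?thesis unfolding e_def smolyak_def
        by (intro tendsto_diff tendsto_sum tendsto_mult tendsto_const)
    qed
    have "0 \<le> ?C * 2 powr (- \<beta> * real m)" using C(1) by simp
    then show ?thesis by (rule Lp_norm_Fatou[OF em elim eB _ q(2)])
  qed
  note main = this
  show thesis
  proof (rule that[of ?C])
    show "0 < ?C" using C(1) by simp
  qed (rule main[unfolded \<beta>_def])
qed

text \<open>
  The remaining nodes may be placed anywhere else and receive the weight zero.
\<close>

lemma sampling_width_le_smolyak:
  fixes F :: "(real ^ 'd \<Rightarrow> complex) set"
  assumes card: "card (sparse_grid m :: (real ^ 'd) set) \<le> n"
    and le: "\<And>f. f \<in> F \<Longrightarrow> Lp_norm q (\<lambda>x. f x - smolyak m f x) \<le> B"
  shows "sampling_width n F q \<le> B"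
proof -
  let ?Q = "{x :: real ^ 'd. \<forall>i. 0 \<le> x $ i \<and> x $ i < 1}"
  let ?S = "sparse_grid m :: (real ^ 'd) set"
  have inf: "infinite ((\<lambda>t :: real. (\<chi> i. t) :: real ^ 'd) ` {0..<1})"
    by (subst finite_image_iff) (auto simp: inj_on_def vec_eq_iff)
  have sub: "(\<lambda>t :: real. (\<chi> i. t) :: real ^ 'd) ` {0..<1} \<subseteq> ?Q" by auto
  have "infinite ?Q" by (rule infinite_super[OF sub inf])
  then have "infinite (?Q - ?S)" by simp
  from infinite_arbitrarily_large[OF this, of "n - card ?S"]
  obtain B' where B': "finite B'" "card B' = n - card ?S" "B' \<subseteq> ?Q - ?S"
    by (elim exE conjE) (rule that)
  define G where "G = ?S \<union> B'"
  have G: "finite G" "card G = n" "?S \<subseteq> G"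
  proof -
    have "?S \<inter> B' = {}" using B'(3) by auto
    then have "card G = card ?S + card B'" unfolding G_def using B'(1) by (intro card_Un_disjoint) simp_all
    then show "card G = n" using B'(2) card by simp
    show "finite G" "?S \<subseteq> G" using B'(1) by (simp_all add: G_def)
  qed
  have GQ: "G \<subseteq> ?Q" using B'(3) sparse_grid_bounds by (auto simp: G_def)
  obtain X where X: "bij_betw X {1..n} G" using ex_bij_betw_nat_finite_1[OF G(1)] G(2) by auto
  define \<Phi> where "\<Phi> j = (if X j \<in> ?S then sparse_weight m (X j) else (\<lambda>_. 0))" for j :: nat
  have XS: "X \<in> sample_points n"
    using X GQ by (auto simp: sample_points_def bij_betw_def)
  have \<Phi>: "\<forall>j\<in>{1..n}. \<Phi> j \<in> torus_measurable"
  proof -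
    have "(\<lambda>_. 0) \<in> (torus_measurable :: (real ^ 'd \<Rightarrow> complex) set)" by (simp add: torus_measurable_def periodic_def)
    then show ?thesis by (simp add: \<Phi>_def sparse_weight_measurable)
  qed
  have op: "sampling_op n X \<Phi> f x = smolyak m f x" for f x
  proof -
    let ?g = "\<lambda>\<xi>. f \<xi> * (if \<xi> \<in> ?S then sparse_weight m \<xi> x else 0)"
    have "sampling_op n X \<Phi> f x = (\<Sum>j\<in>{1..n}. ?g (X j))"
      unfolding sampling_op_def \<Phi>_def by (intro sum.cong refl) simp
    also have "\<dots> = (\<Sum>\<xi>\<in>G. ?g \<xi>)" by (rule sum.reindex_bij_betw[OF X])
    also have "\<dots> = (\<Sum>\<xi>\<in>?S. ?g \<xi>)" using G by (intro sum.mono_neutral_right) auto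
    also have "\<dots> = smolyak m f x" unfolding smolyak_def by (intro sum.cong refl) simp
    finally show ?thesis .
  qed
  have "sampling_width n F q \<le> (SUP f\<in>F. Lp_norm q (\<lambda>t. f t - sampling_op n X \<Phi> f t))"
    unfolding sampling_width_def by (rule INF_lower2[of "(X, \<Phi>)"]) (use XS \<Phi> in auto)
  also have "\<dots> \<le> B" unfolding op by (rule SUP_least) (rule le)
  finally show ?thesis .
qed

section \<open>A Nikolskii inequality for a dyadic layer\<close>

lemma block_L1_x: "(\<integral>\<^sup>+x. ennreal (norm (block i \<rho> (x - y))) \<partial>unit_M) \<le> ennreal (block_const \<rho> * 2 powr (\<rho> * real i))"
proof (rule nn_integral_unit_of_discrete[where N = "2 ^ (i + 3)"])
  show "(\<lambda>x. norm (block i \<rho> (x - y))) \<in> borel_measurable borel"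
    by (intro borel_measurable_continuous_onI continuous_intros)
  show "(\<Sum>l<2 ^ (i + 3). norm (block i \<rho> (x + real l / real (2 ^ (i + 3)) - y))) \<le> real (2 ^ (i + 3)) * (block_const \<rho> * 2 powr (\<rho> * real i))" for x
    using block_discrete_L1[of i \<rho> "x - y"] by (simp add: algebra_simps)
qed auto

lemma block_L1_y: "(\<integral>\<^sup>+y. ennreal (norm (block i \<rho> (x - y))) \<partial>unit_M) \<le> ennreal (block_const \<rho> * 2 powr (\<rho> * real i))"
proof -
  have "norm (block i \<rho> (x - y)) = norm (block i \<rho> (y - x))" for y
    using block_minus[of i \<rho> "y - x"] by simp
  then show ?thesis using block_L1_x[of i \<rho> x] by simp
qed

definition band_kernel :: "real \<Rightarrow> nat \<Rightarrow> real \<Rightarrow> real \<Rightarrow> real" where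
  "band_kernel a M x y = (\<Sum>i<M. 2 powr (- a * real i) * norm (block i 0 (x - y)))"

lemma band_kernel_measurable: "(\<lambda>(x, y). ennreal (band_kernel a M x y)) \<in> borel_measurable (unit_M \<Otimes>\<^sub>M unit_M)"
  and block_measurable2: "(\<lambda>(x, y). norm (block i \<rho> (x - y))) \<in> borel_measurable (unit_M \<Otimes>\<^sub>M unit_M)"
proof -
  have id: "(\<lambda>x::real. x) \<in> borel_measurable unit_M" by (intro measurable_unit_M) simp
  have b: "(\<lambda>p. norm (block i \<rho> (fst p - snd p))) \<in> borel_measurable (unit_M \<Otimes>\<^sub>M unit_M)" for i \<rho>
  proof (rule measurable_compose[of "\<lambda>p. fst p - snd p" _ borel])
    show "(\<lambda>p. fst p - snd p) \<in> borel_measurable (unit_M \<Otimes>\<^sub>M unit_M)"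
      by (intro borel_measurable_diff measurable_compose[OF measurable_fst id] measurable_compose[OF measurable_snd id])
    show "(\<lambda>z. norm (block i \<rho> z)) \<in> borel_measurable borel"
      by (intro borel_measurable_continuous_onI continuous_intros)
  qed
  then show "(\<lambda>(x, y). norm (block i \<rho> (x - y))) \<in> borel_measurable (unit_M \<Otimes>\<^sub>M unit_M)"
    by (simp add: case_prod_beta)
  show "(\<lambda>(x, y). ennreal (band_kernel a M x y)) \<in> borel_measurable (unit_M \<Otimes>\<^sub>M unit_M)"
    unfolding band_kernel_def case_prod_beta
    by (intro measurable_compose[OF _ measurable_ennreal] borel_measurable_sum borel_measurable_times borel_measurable_const b)
qed

lemma band_kernel_nonneg [simp]: "0 \<le> band_kernel a M x y"
  unfolding band_kernel_def by (intro sum_nonneg) auto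

text \<open>
  The case of \<open>HLS_bound_dyadic_sum\<close> in which only the terms with \<open>t = 0\<close> are present; any exponent
  greater than \<open>\<sigma>\<close> may then be used in the index \<open>t\<close>, and 1 is taken.
\<close>

lemma band_kernel_HLS:
  assumes \<sigma>: "0 < \<sigma>" "\<sigma> < 1" and \<tau>: "0 < \<tau>" "\<tau> < 1" "1 < \<sigma> + \<tau>"
  obtains C where "0 < C"
    "\<And>M. HLS_bound unit_M (\<lambda>x y. ennreal (band_kernel (\<sigma> + \<tau> - 1) M x y)) \<sigma> \<tau> (ennreal C)"
proof -
  let ?A = "2 * block_const 0"
  have A0: "0 \<le> ?A" using block_const_pos[of 0] by simp
  obtain C where C: "0 < C" and bound: "\<And>m (k :: nat \<Rightarrow> nat \<Rightarrow> real \<Rightarrow> real \<Rightarrow> real).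
      \<lbrakk>\<And>s t. (\<lambda>(x, y). k s t x y) \<in> borel_measurable (unit_M \<Otimes>\<^sub>M unit_M); \<And>s t x y. 0 \<le> k s t x y;
       \<And>s t y. (\<integral>\<^sup>+x. ennreal (k s t x y) \<partial>unit_M) \<le> ennreal (?A * 2 ^ t);
       \<And>s t x. (\<integral>\<^sup>+y. ennreal (k s t x y) \<partial>unit_M) \<le> ennreal ?A;
       \<And>s t x y. k s t x y \<le> ?A * 2 ^ (s + t)\<rbrakk> \<Longrightarrow>
      HLS_bound unit_M (\<lambda>x y. ennreal (\<Sum>s<m. \<Sum>t<m. 2 powr (- (\<sigma> + \<tau> - 1) * real s) * 2 powr (- 1 * real t) * k s t x y))
        \<sigma> \<tau> (ennreal C)"
    using HLS_bound_dyadic_sum[OF sigma_finite_unit_M \<sigma> \<tau> \<sigma>(2) A0] by blast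
  define k where "k s t x y = (if t = 0 then norm (block s 0 (x - y)) else 0)" for s t :: nat and x y :: real
  have "HLS_bound unit_M (\<lambda>x y. ennreal (band_kernel (\<sigma> + \<tau> - 1) M x y)) \<sigma> \<tau> (ennreal C)" for M
  proof (rule HLS_bound_mono[OF bound[of k M]])
    fix s t :: nat
    show "(\<lambda>(x, y). k s t x y) \<in> borel_measurable (unit_M \<Otimes>\<^sub>M unit_M)"
      unfolding k_def using block_measurable2[of s 0] by (cases "t = 0") auto
    show "0 \<le> k s t x y" for x y by (simp add: k_def)
    have le: "ennreal (block_const 0 * 2 powr (0 * real s)) \<le> ennreal (?A * 2 ^ t)" "ennreal (block_const 0 * 2 powr (0 * real s)) \<le> ennreal ?A"
    proof -
      have "(1::real) \<le> 2 ^ t" by simp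
      then have "(1::real) \<le> 2 * 2 ^ t" by linarith
      then have "1 * block_const 0 \<le> (2 * 2 ^ t) * block_const 0"
        using less_imp_le[OF block_const_pos[of 0]] by (rule mult_right_mono)
      then show "ennreal (block_const 0 * 2 powr (0 * real s)) \<le> ennreal (?A * 2 ^ t)" by (intro ennreal_leI) (simp add: mult_ac)
      show "ennreal (block_const 0 * 2 powr (0 * real s)) \<le> ennreal ?A" using block_const_pos[of 0] by (intro ennreal_leI) simp
    qed
    show "(\<integral>\<^sup>+x. ennreal (k s t x y) \<partial>unit_M) \<le> ennreal (?A * 2 ^ t)" for y
    proof (cases "t = 0")
      case True
      then have "(\<integral>\<^sup>+x. ennreal (k s t x y) \<partial>unit_M) = (\<integral>\<^sup>+x. ennreal (norm (block s 0 (x - y))) \<partial>unit_M)" by (simp add: k_def)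
      with block_L1_x[of s 0 y] le(1) show ?thesis by (simp only: order_trans)
    qed (simp add: k_def)
    show "(\<integral>\<^sup>+y. ennreal (k s t x y) \<partial>unit_M) \<le> ennreal ?A" for x
    proof (cases "t = 0")
      case True
      then have "(\<integral>\<^sup>+y. ennreal (k s t x y) \<partial>unit_M) = (\<integral>\<^sup>+y. ennreal (norm (block s 0 (x - y))) \<partial>unit_M)" by (simp add: k_def)
      with block_L1_y[of s 0 x] le(2) show ?thesis by (simp only: order_trans)
    qed (simp add: k_def)
    show "k s t x y \<le> ?A * 2 ^ (s + t)" for x y
      using norm_block_le[of s 0 "x - y"] A0 by (simp add: k_def powr_realpow)
  next
    fix x y
    show "ennreal (band_kernel (\<sigma> + \<tau> - 1) M x y)
       \<le> ennreal (\<Sum>s<M. \<Sum>t<M. 2 powr (- (\<sigma> + \<tau> - 1) * real s) * 2 powr (- 1 * real t) * k s t x y)"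
      unfolding band_kernel_def
    proof (intro ennreal_leI sum_mono)
      fix s assume s: "s \<in> {..<M}"
      have "(\<Sum>t<M. 2 powr (- (\<sigma> + \<tau> - 1) * real s) * 2 powr (- 1 * real t) * k s t x y)
          = (\<Sum>t\<in>{0}. 2 powr (- (\<sigma> + \<tau> - 1) * real s) * 2 powr (- 1 * real t) * k s t x y)"
        using s by (intro sum.mono_neutral_right) (auto simp: k_def)
      then show "2 powr (- (\<sigma> + \<tau> - 1) * real s) * norm (block s 0 (x - y))
         \<le> (\<Sum>t<M. 2 powr (- (\<sigma> + \<tau> - 1) * real s) * 2 powr (- 1 * real t) * k s t x y)"
        by (simp add: k_def)
    qed
  qed
  with C show thesis by (rule that)
qed

definition dyadic_box :: "('d::finite \<Rightarrow> nat) \<Rightarrow> ('d \<Rightarrow> int) set" where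
  "dyadic_box s = Pi\<^sub>E UNIV (\<lambda>i. {2 ^ s i..<2 ^ Suc (s i)})"

text \<open>
  The level \<open>m\<close> part of a hyperbolic cross, in the octant of positive frequencies.
\<close>

definition layer :: "nat \<Rightarrow> ('d::finite \<Rightarrow> int) set" where
  "layer m = (\<Union>s\<in>compositions m. dyadic_box s)"

lemma mem_dyadic_box: "k \<in> dyadic_box s \<longleftrightarrow> (\<forall>i. 2 ^ s i \<le> k i \<and> k i < 2 ^ Suc (s i))"
  by (auto simp: dyadic_box_def PiE_iff)

lemma finite_dyadic_box [simp]: "finite (dyadic_box s)"
  unfolding dyadic_box_def by (intro finite_PiE) auto

lemma finite_layer [simp]: "finite (layer m)"
  unfolding layer_def by auto

lemma card_dyadic_box: "card (dyadic_box s) = 2 ^ sum s UNIV"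
proof -
  have "card (dyadic_box s) = (\<Prod>i\<in>UNIV. card {2 ^ s i..<2 ^ Suc (s i) :: int})"
    unfolding dyadic_box_def by (rule card_PiE) simp
  also have "\<dots> = (\<Prod>i\<in>UNIV. 2 ^ s i)"
    by (intro prod.cong refl) (simp add: nat_power_eq)
  finally show ?thesis by (simp add: power_sum)
qed

lemma dyadic_box_disjoint: "k \<in> dyadic_box s \<Longrightarrow> k \<in> dyadic_box t \<Longrightarrow> s = t"
proof (rule ext, rule ccontr)
  fix i assume k: "k \<in> dyadic_box s" "k \<in> dyadic_box t" and ne: "s i \<noteq> t i"
  have *: False if "u < v" "k i < 2 ^ Suc u" "2 ^ v \<le> k i" for u v :: nat
  proof -
    have "(2::int) ^ Suc u \<le> 2 ^ v" using that(1) by (intro power_increasing) auto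
    with that show False by linarith
  qed
  have s: "2 ^ s i \<le> k i" "k i < 2 ^ Suc (s i)" and t: "2 ^ t i \<le> k i" "k i < 2 ^ Suc (t i)"
    using k by (simp_all add: mem_dyadic_box)
  from ne consider "s i < t i" | "t i < s i" by linarith
  then show False using *[of "s i" "t i"] *[of "t i" "s i"] s t by cases auto
qed

lemma card_layer: "card (layer m :: ('d::finite \<Rightarrow> int) set) = card (compositions m :: ('d \<Rightarrow> nat) set) * 2 ^ m"
proof -
  have "card (layer m :: ('d \<Rightarrow> int) set) = (\<Sum>s\<in>(compositions m :: ('d \<Rightarrow> nat) set). card (dyadic_box s))"
    unfolding layer_def by (rule card_UN_disjoint) (auto dest: dyadic_box_disjoint)
  also have "\<dots> = (\<Sum>s\<in>(compositions m :: ('d \<Rightarrow> nat) set). 2 ^ m)"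
    by (intro sum.cong refl) (simp add: card_dyadic_box compositions_def)
  finally show ?thesis by simp
qed

lemma block_eq_trig_wide:
  assumes "Suc i \<le> M"
  shows "block i \<rho> x = trig {0<..<2 ^ M} (\<lambda>k. of_real (block_coeff i \<rho> k)) x"
  unfolding block_def trig_def
proof (rule sum.mono_neutral_left)
  have "(2::int) ^ Suc i \<le> 2 ^ M" using assms by (intro power_increasing) auto
  then show "{0<..<2 ^ Suc i} \<subseteq> {0<..<2 ^ M :: int}" by auto
qed (auto simp: block_coeff_eq_0)

text \<open>
  A frequency in \<open>[2 ^ t, 2 ^ (t + 1))\<close> is met by the blocks \<open>t\<close> and \<open>t + 1\<close> only.
\<close>

lemma prod_block_coeff_eq_0:
  assumes k: "k \<in> layer m" and s: "m + CARD('d) < sum s UNIV"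
  shows "(\<Prod>i\<in>(UNIV :: 'd::finite set). complex_of_real (block_coeff (s i) \<rho> (k i))) = 0"
proof -
  obtain t where t: "t \<in> compositions m" "k \<in> dyadic_box t" using k by (auto simp: layer_def)
  have "\<exists>i. t i + 1 < s i"
  proof (rule ccontr)
    assume "\<nexists>i. t i + 1 < s i"
    then have "sum s UNIV \<le> (\<Sum>i\<in>UNIV. t i + 1)" by (intro sum_mono) (simp add: not_less)
    also have "\<dots> = sum t UNIV + (\<Sum>i\<in>(UNIV :: 'd set). 1)" by (rule sum.distrib)
    also have "\<dots> = m + CARD('d)" using t(1) by (simp add: compositions_def)
    finally show False using s by simp
  qed
  then obtain i where i: "t i + 1 < s i" ..
  have "k i < 2 ^ Suc (t i)" using t(2) by (simp add: mem_dyadic_box)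
  also have "(2::int) ^ Suc (t i) \<le> 2 ^ (s i - 1)" using i by (intro power_increasing) auto
  finally have "2 * k i \<le> 2 * 2 ^ (s i - 1)" by simp
  also have "\<dots> = 2 ^ s i" using i by (metis Suc_diff_1 add_lessD1 not_less_zero power_Suc neq0_conv)
  finally have "block_coeff (s i) \<rho> (k i) = 0" by (intro block_coeff_eq_0) simp
  then show ?thesis by (intro prod_zero) auto
qed

text \<open>
  A polynomial with frequencies in the layer is reproduced by convolution with the tensor blocks of
  level at most \<open>m + d\<close>. On these levels the weight \<open>2 powr (- a * sum s UNIV)\<close> with \<open>a = 1 / 2 - 1 / Q\<close>
  can be inserted at the price of \<open>2 powr (a * (m + d))\<close>, and the weighted sum of all blocks is a tensor
  product of kernels that maps \<open>L\<^sub>2\<close> to \<open>L\<^sub>Q\<close>. The number of dyadic boxes in the layer does not enter.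
\<close>

lemma Nikolskii_layer:
  fixes dummy :: "'d::finite itself"
  assumes Q: "2 \<le> Q"
  obtains C where "0 < C"
    "\<And>m K (\<gamma> :: ('d \<Rightarrow> int) \<Rightarrow> complex). K \<subseteq> layer m \<Longrightarrow>
       Lp_norm Q (trigd K \<gamma>) \<le> ennreal (C * 2 powr ((1 / 2 - 1 / Q) * real m)) * Lp_norm 2 (trigd K \<gamma>)"
proof (cases "Q = 2")
  case True
  then show thesis by (intro that[of 1]) auto
next
  case False
  with Q have Q2: "2 < Q" by simp
  define a where "a = 1 / 2 - 1 / Q"
  have a: "0 < a" "1 / 2 + (1 - 1 / Q) - 1 = a" using Q2 by (auto simp: a_def field_simps)
  have Q1: "1 / Q < 1" "0 < 1 / Q" using Q2 by (auto simp: divide_less_eq)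
  obtain C where C: "0 < C" "\<And>M. HLS_bound unit_M (\<lambda>x y. ennreal (band_kernel a M x y)) (1 / 2) (1 - 1 / Q) (ennreal C)"
  proof (rule band_kernel_HLS[of "1 / 2" "1 - 1 / Q"])
    show "1 < 1 / 2 + (1 - 1 / Q)" using a by linarith
  qed (use Q1 a(2) in auto)
  let ?d = "CARD('d)"
  let ?C = "2 powr (a * real ?d) * C ^ ?d"
  have "Lp_norm Q (trigd K \<gamma>) \<le> ennreal (?C * 2 powr (a * real m)) * Lp_norm 2 (trigd K \<gamma>)"
    if K: "K \<subseteq> layer m" for m K and \<gamma> :: "('d \<Rightarrow> int) \<Rightarrow> complex"
  proof -
    let ?M = "m + 2" let ?A = "{0<..<2 ^ ?M :: int}" and ?U = "Pi\<^sub>E (UNIV :: 'd set) (\<lambda>_. {..<?M})"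
    let ?P = "Pi\<^sub>E (UNIV :: 'd set) (\<lambda>_. ?A)"
    have finK: "finite K" by (rule finite_subset[OF K finite_layer])
    define g where "g = trigd K \<gamma>"
    have gc: "continuous_on UNIV g" unfolding g_def by (rule continuous_on_trigd)
    have gi: "integrable cube_M g" by (rule integrable_cube_continuous[OF gc])
    have gm: "g \<in> borel_measurable cube_M" using gi by (rule borel_measurable_integrable)
    have KP: "K \<subseteq> ?P"
    proof
      fix k assume "k \<in> K"
      then obtain t where t: "t \<in> compositions m" "k \<in> dyadic_box t" using K by (auto simp: layer_def)
      have "0 < k i \<and> k i < 2 ^ ?M" for i
      proof -
        have "t i \<le> m" using t(1) component_le_sum[of t i] by (simp add: compositions_def)
        then have "(2::int) ^ Suc (t i) \<le> 2 ^ ?M" by (intro power_increasing) auto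
        moreover have "2 ^ t i \<le> k i" "k i < 2 ^ Suc (t i)" using t(2) by (simp_all add: mem_dyadic_box)
        moreover have "(0::int) < 2 ^ t i" by simp
        ultimately show ?thesis by linarith
      qed
      then show "k \<in> ?P" by (simp add: PiE_iff)
    qed
    have conv: "(LINT y|cube_M. (\<Prod>i\<in>UNIV. block (s i) 0 (x $ i - y $ i)) * g y)
        = (\<Sum>k\<in>K. (\<Prod>i\<in>UNIV. complex_of_real (block_coeff (s i) 0 (k i))) * \<gamma> k * eed k x)"
      "integrable cube_M (\<lambda>y. (\<Prod>i\<in>UNIV. block (s i) 0 (x $ i - y $ i)) * g y)"
      if s: "s \<in> ?U" for s x
    proof -
      have b: "block (s i) 0 z = trig ?A (\<lambda>k. of_real (block_coeff (s i) 0 k)) z" for i z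
      proof (rule block_eq_trig_wide, rule Suc_leI)
        show "s i < ?M" using s by (simp add: PiE_iff)
      qed
      show "integrable cube_M (\<lambda>y. (\<Prod>i\<in>UNIV. block (s i) 0 (x $ i - y $ i)) * g y)"
        unfolding b by (rule conv_trig_expand(2)[OF _ gi]) simp
      have "(LINT y|cube_M. (\<Prod>i\<in>UNIV. block (s i) 0 (x $ i - y $ i)) * g y)
         = trigd ?P (\<lambda>k. (\<Prod>i\<in>UNIV. complex_of_real (block_coeff (s i) 0 (k i))) * fourier g k) x"
        unfolding b by (rule conv_trig_expand(1)[OF _ gi]) simp
      also have "\<dots> = (\<Sum>k\<in>K. (\<Prod>i\<in>UNIV. complex_of_real (block_coeff (s i) 0 (k i))) * fourier g k * eed k x)"
        unfolding trigd_def
        by (rule sum.mono_neutral_right) (use KP in \<open>auto simp: g_def fourier_trigd[OF finK] intro!: finite_PiE\<close>)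
      also have "\<dots> = (\<Sum>k\<in>K. (\<Prod>i\<in>UNIV. complex_of_real (block_coeff (s i) 0 (k i))) * \<gamma> k * eed k x)"
        by (intro sum.cong refl) (simp add: g_def fourier_trigd[OF finK])
      finally show "(LINT y|cube_M. (\<Prod>i\<in>UNIV. block (s i) 0 (x $ i - y $ i)) * g y)
        = (\<Sum>k\<in>K. (\<Prod>i\<in>UNIV. complex_of_real (block_coeff (s i) 0 (k i))) * \<gamma> k * eed k x)" .
    qed
    let ?V = "{s\<in>?U. sum s UNIV \<le> m + ?d}"
    let ?T = "\<lambda>s x. LINT y|cube_M. (\<Prod>i\<in>UNIV. block (s i) 0 (x $ i - y $ i)) * g y"
    have finU: "finite ?U" by (intro finite_PiE) auto
    \<comment> \<open>Blocks of higher level do not meet the layer, and all blocks together form a partition of unity.\<close>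
    have repr: "g x = (\<Sum>s\<in>?V. ?T s x)" for x
    proof -
      have "(\<Sum>s\<in>?V. ?T s x) = (\<Sum>s\<in>?U. ?T s x)"
      proof (rule sum.mono_neutral_left[OF finU])
        show "\<forall>s\<in>?U - ?V. ?T s x = 0"
        proof
          fix s assume s: "s \<in> ?U - ?V"
          then have sU: "s \<in> ?U" and big: "m + ?d < sum s UNIV" by (simp_all add: not_le)
          have z: "(\<Prod>i\<in>UNIV. complex_of_real (block_coeff (s i) 0 (k i))) = 0" if "k \<in> K" for k
            by (rule prod_block_coeff_eq_0[OF subsetD[OF K that] big])
          show "?T s x = 0" unfolding conv(1)[OF sU]
            by (intro sum.neutral ballI) (simp only: z mult_zero_left)
        qed
      qed auto
      also have "\<dots> = (\<Sum>s\<in>?U. \<Sum>k\<in>K. (\<Prod>i\<in>UNIV. complex_of_real (block_coeff (s i) 0 (k i))) * (\<gamma> k * eed k x))"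
        by (intro sum.cong refl) (simp add: conv(1) mult.assoc)
      also have "\<dots> = (\<Sum>k\<in>K. (\<Sum>s\<in>?U. \<Prod>i\<in>UNIV. complex_of_real (block_coeff (s i) 0 (k i))) * (\<gamma> k * eed k x))"
        unfolding sum_distrib_right by (rule sum.swap)
      also have "\<dots> = (\<Sum>k\<in>K. 1 * (\<gamma> k * eed k x))"
      proof (intro sum.cong refl arg_cong2[where f = "(*)"])
        fix k assume "k \<in> K"
        then obtain t where t: "t \<in> compositions m" "k \<in> dyadic_box t" using K by (auto simp: layer_def)
        have one: "(\<Sum>j<?M. block_coeff j 0 (k i)) = 1" for i
        proof -
          have ti: "t i \<le> m" using t(1) component_le_sum[of t i] by (simp add: compositions_def)
          have ki: "2 ^ t i \<le> k i" "k i < 2 ^ Suc (t i)" using t(2) by (simp_all add: mem_dyadic_box)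
          have "(0::int) < 2 ^ t i" by simp
          then have k0: "0 < k i" using ki by linarith
          have "(2::int) ^ Suc (t i) \<le> 2 ^ Suc m" using ti by (intro power_increasing) auto
          then have "k i \<le> 2 ^ Suc m" using ki(2) by linarith
          then have "2 * \<bar>k i\<bar> \<le> 2 * 2 ^ Suc m" using k0 by linarith
          also have "(2::int) * 2 ^ Suc m = 2 ^ ?M" by simp
          finally have "2 * \<bar>k i\<bar> \<le> 2 ^ ?M" .
          then have h: "hat ?M (k i) = 1" by (rule hat_eq_1)
          have h0: "hat 0 (k i) = 0" using k0 by (intro hat_eq_0) simp
          have "(\<Sum>j<?M. block_coeff j 0 (k i)) = (\<Sum>j<?M. hat (Suc j) (k i) - hat j (k i))"
            using k0 by (simp add: block_coeff_def)
          also have "\<dots> = hat ?M (k i) - hat 0 (k i)" by (rule sum_lessThan_telescope)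
          finally show ?thesis using h h0 by simp
        qed
        have "(\<Sum>s\<in>?U. \<Prod>i\<in>UNIV. complex_of_real (block_coeff (s i) 0 (k i))) = (\<Prod>i\<in>UNIV. \<Sum>j<?M. complex_of_real (block_coeff j 0 (k i)))"
          by (rule prod_sum_PiE[symmetric]) auto
        also have "\<dots> = 1" by (simp only: of_real_sum[symmetric] one of_real_1 prod.neutral_const)
        finally show "(\<Sum>s\<in>?U. \<Prod>i\<in>UNIV. complex_of_real (block_coeff (s i) 0 (k i))) = 1" .
      qed
      also have "\<dots> = g x" by (simp add: g_def trigd_def)
      finally show ?thesis by simp
    qed
    let ?c = "2 powr (a * real (m + ?d))"
    have dom: "ennreal (norm (g x)) \<le> ennreal ?c * (\<integral>\<^sup>+y. (\<Prod>i\<in>UNIV. ennreal (band_kernel a ?M (x $ i) (y $ i))) * ennreal (norm (g y)) \<partial>cube_M)"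
      if x: "x \<in> cbox 0 1" for x
    proof -
      have "g x = (LINT y|cube_M. (\<Sum>s\<in>?V. (\<Prod>i\<in>UNIV. block (s i) 0 (x $ i - y $ i)) * g y))"
        by (rule trans[OF repr], rule Bochner_Integration.integral_sum[symmetric], rule conv(2)) simp
      then have "ennreal (norm (g x)) = ennreal (norm (LINT y|cube_M. (\<Sum>s\<in>?V. (\<Prod>i\<in>UNIV. block (s i) 0 (x $ i - y $ i)) * g y)))"
        by (rule arg_cong)
      also have "\<dots> \<le> (\<integral>\<^sup>+y. ennreal (norm (\<Sum>s\<in>?V. (\<Prod>i\<in>UNIV. block (s i) 0 (x $ i - y $ i)) * g y)) \<partial>cube_M)"
        by (rule integral_norm_bound_ennreal, rule Bochner_Integration.integrable_sum, rule conv(2)) simp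
      also have "\<dots> \<le> (\<integral>\<^sup>+y. ennreal ?c * ((\<Prod>i\<in>UNIV. ennreal (band_kernel a ?M (x $ i) (y $ i))) * ennreal (norm (g y))) \<partial>cube_M)"
      proof (intro nn_integral_mono)
        fix y
        have "norm (\<Sum>s\<in>?V. (\<Prod>i\<in>UNIV. block (s i) 0 (x $ i - y $ i)) * g y) \<le> (\<Sum>s\<in>?V. \<Prod>i\<in>UNIV. norm (block (s i) 0 (x $ i - y $ i))) * norm (g y)"
          unfolding sum_distrib_right by (rule order_trans[OF norm_sum]) (simp add: norm_mult prod_norm)
        also have "\<dots> \<le> (\<Sum>s\<in>?V. ?c * (\<Prod>i\<in>UNIV. 2 powr (- a * real (s i)) * norm (block (s i) 0 (x $ i - y $ i)))) * norm (g y)"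
        proof (intro mult_right_mono sum_mono)
          fix s assume "s \<in> ?V"
          then have "sum s UNIV \<le> m + ?d" by simp
          then have "a * (\<Sum>i\<in>UNIV. real (s i)) \<le> a * real (m + ?d)"
            using a(1) by (intro mult_left_mono) (simp_all only: of_nat_sum[symmetric] of_nat_le_iff less_imp_le)
          then have "1 \<le> ?c * 2 powr (\<Sum>i\<in>UNIV. - a * real (s i))"
            by (simp only: powr_add[symmetric] sum_distrib_left[symmetric]) (rule ge_one_powr_ge_zero, simp_all add: sum_distrib_left sum_negf)
          then have "1 * (\<Prod>i\<in>UNIV. norm (block (s i) 0 (x $ i - y $ i))) \<le> (?c * 2 powr (\<Sum>i\<in>UNIV. - a * real (s i))) * (\<Prod>i\<in>UNIV. norm (block (s i) 0 (x $ i - y $ i)))"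
            by (rule mult_right_mono) (intro prod_nonneg, simp)
          also have "2 powr (\<Sum>i\<in>UNIV. - a * real (s i)) = (\<Prod>i\<in>UNIV. 2 powr (- a * real (s i)))" by (rule powr_sum) auto
          finally show "(\<Prod>i\<in>UNIV. norm (block (s i) 0 (x $ i - y $ i))) \<le> ?c * (\<Prod>i\<in>UNIV. 2 powr (- a * real (s i)) * norm (block (s i) 0 (x $ i - y $ i)))"
            by (simp only: mult_1_left prod.distrib mult.assoc)
        qed simp
        also have "\<dots> \<le> (?c * (\<Prod>i\<in>UNIV. band_kernel a ?M (x $ i) (y $ i))) * norm (g y)"
        proof (rule mult_right_mono)
          have "(\<Sum>s\<in>?V. ?c * (\<Prod>i\<in>UNIV. 2 powr (- a * real (s i)) * norm (block (s i) 0 (x $ i - y $ i))))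
             \<le> (\<Sum>s\<in>?U. ?c * (\<Prod>i\<in>UNIV. 2 powr (- a * real (s i)) * norm (block (s i) 0 (x $ i - y $ i))))"
            by (rule sum_mono2[OF finU]) (auto intro!: mult_nonneg_nonneg prod_nonneg)
          also have "\<dots> = ?c * (\<Prod>i\<in>UNIV. band_kernel a ?M (x $ i) (y $ i))"
            unfolding sum_distrib_left[symmetric] band_kernel_def
            by (intro arg_cong2[where f = "(*)"] refl prod_sum_PiE[symmetric]) auto
          finally show "(\<Sum>s\<in>?V. ?c * (\<Prod>i\<in>UNIV. 2 powr (- a * real (s i)) * norm (block (s i) 0 (x $ i - y $ i))))
             \<le> ?c * (\<Prod>i\<in>UNIV. band_kernel a ?M (x $ i) (y $ i))" .
        qed simp
        finally have "ennreal (norm (\<Sum>s\<in>?V. (\<Prod>i\<in>UNIV. block (s i) 0 (x $ i - y $ i)) * g y))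
           \<le> ennreal ((?c * (\<Prod>i\<in>UNIV. band_kernel a ?M (x $ i) (y $ i))) * norm (g y))" by (rule ennreal_leI)
        also have "\<dots> = ennreal ?c * ((\<Prod>i\<in>UNIV. ennreal (band_kernel a ?M (x $ i) (y $ i))) * ennreal (norm (g y)))"
          by (simp add: prod_ennreal ennreal_mult prod_nonneg mult.assoc)
        finally show "ennreal (norm (\<Sum>s\<in>?V. (\<Prod>i\<in>UNIV. block (s i) 0 (x $ i - y $ i)) * g y))
           \<le> ennreal ?c * ((\<Prod>i\<in>UNIV. ennreal (band_kernel a ?M (x $ i) (y $ i))) * ennreal (norm (g y)))" .
      qed
      also have "\<dots> = ennreal ?c * (\<integral>\<^sup>+y. (\<Prod>i\<in>UNIV. ennreal (band_kernel a ?M (x $ i) (y $ i))) * ennreal (norm (g y)) \<partial>cube_M)"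
      proof (rule nn_integral_cmult, rule borel_measurable_times_ennreal)
        show "(\<lambda>y. \<Prod>i\<in>UNIV. ennreal (band_kernel a ?M (x $ i) (y $ i))) \<in> borel_measurable cube_M"
          using measurable_compose[OF measurable_Pair1' prod_kernel_measurable[OF band_kernel_measurable], of x] x by simp
        show "(\<lambda>y. ennreal (norm (g y))) \<in> borel_measurable cube_M" using gm by measurable
      qed
      finally show ?thesis .
    qed
    have "Lp_norm Q g \<le> ennreal ?c * ennreal C ^ ?d * Lp_norm 2 g"
    proof (rule HLS_operator[OF _ _ HLS_bound_cube[OF band_kernel_measurable C(2)] prod_kernel_measurable[OF band_kernel_measurable] gm gm dom])
      show "(\<integral>\<^sup>+x. ennreal (norm (g x) powr Q) \<partial>cube_M) < \<infinity>"
        using Q2 by (intro Lp_norm_continuous_finite(1)[OF gc]) simp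
    qed (use Q2 in auto)
    also have "ennreal ?c * ennreal C ^ ?d = ennreal (?C * 2 powr (a * real m))"
      using C(1) by (simp add: ennreal_power ennreal_mult[symmetric] powr_add distrib_left mult_ac)
    finally show ?thesis by (simp only: g_def)
  qed
  then show thesis using C(1) by (intro that[of ?C]) (simp_all add: a_def)
qed

section \<open>Fooling coefficient vectors\<close>

definition cinner :: "'k set \<Rightarrow> ('k \<Rightarrow> complex) \<Rightarrow> ('k \<Rightarrow> complex) \<Rightarrow> complex" where
  "cinner S u v = (\<Sum>k\<in>S. u k * cnj (v k))"

lemma cinner_diff_left: "cinner S (\<lambda>k. u k - v k) w = cinner S u w - cinner S v w"
  by (simp add: cinner_def left_diff_distrib sum_subtractf)

lemma cinner_diff_right: "cinner S w (\<lambda>k. u k - v k) = cinner S w u - cinner S w v"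
  by (simp add: cinner_def right_diff_distrib sum_subtractf)

lemma cinner_scale_left: "cinner S (\<lambda>k. c * u k) v = c * cinner S u v"
  by (simp add: cinner_def sum_distrib_left mult.assoc)

lemma cinner_scale_right: "cinner S u (\<lambda>k. c * v k) = cnj c * cinner S u v"
  by (simp add: cinner_def sum_distrib_left mult_ac)

lemma cinner_commute: "cinner S v u = cnj (cinner S u v)"
  by (simp add: cinner_def mult.commute)

lemma cinner_self: "cinner S u u = of_real (\<Sum>k\<in>S. (norm (u k))\<^sup>2)"
  unfolding cinner_def of_real_sum complex_norm_square ..

lemma cinner_unit: "finite S \<Longrightarrow> i \<in> S \<Longrightarrow> cinner S u (\<lambda>k. if k = i then 1 else 0) = u i"
  by (simp add: cinner_def if_distrib[of cnj] if_distrib[of "\<lambda>z. _ * z"] cong: if_cong)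

text \<open>
  \<open>P\<close> is the orthogonal projection onto the vectors orthogonal to \<open>b 0, \<dots>, b (n - 1)\<close>, built by
  removing one direction \<open>w = P (b n)\<close> at a time. A direction of nonzero length lowers the trace by
  exactly 1, and a vanishing direction needs no change.
\<close>

lemma annihilating_projection:
  fixes b :: "nat \<Rightarrow> 'k \<Rightarrow> complex"
  assumes S: "finite S"
  shows "\<exists>P. (\<forall>u v. cinner S (P u) v = cinner S u (P v)) \<and> (\<forall>u. P (P u) = P u) \<and>
      (\<forall>u j. j < n \<longrightarrow> cinner S (P u) (b j) = 0) \<and> (\<forall>u v c. P (\<lambda>k. u k - c * v k) = (\<lambda>k. P u k - c * P v k)) \<and>
      real (card S) - real n \<le> Re (\<Sum>i\<in>S. cinner S (P (\<lambda>k. if k = i then 1 else 0)) (\<lambda>k. if k = i then 1 else 0))"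
proof (induction n)
  case 0
  have "(\<Sum>i\<in>S. cinner S (\<lambda>k. if k = i then 1 else 0) (\<lambda>k. if k = i then 1 else 0)) = of_nat (card S)"
    using S by (simp add: cinner_unit)
  then show ?case by (intro exI[of _ "\<lambda>u. u"]) simp
next
  case (Suc n)
  obtain P where sa: "\<And>u v. cinner S (P u) v = cinner S u (P v)" and idem: "\<And>u. P (P u) = P u"
    and ann: "\<And>u j. j < n \<Longrightarrow> cinner S (P u) (b j) = 0"
    and lin: "\<And>u v c. P (\<lambda>k. u k - c * v k) = (\<lambda>k. P u k - c * P v k)"
    and tr: "real (card S) - real n \<le> Re (\<Sum>i\<in>S. cinner S (P (\<lambda>k. if k = i then 1 else 0)) (\<lambda>k. if k = i then 1 else 0))"
    using Suc.IH by (elim exE conjE, intro that; iprover)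
  define w where "w = P (b n)"
  have Pw: "P w = w" by (simp add: w_def idem)
  show ?case
  proof (cases "cinner S w w = 0")
    case True
    then have w0: "w k = 0" if "k \<in> S" for k
    proof -
      have "(\<Sum>k\<in>S. (norm (w k))\<^sup>2) = 0" using True unfolding cinner_self by (simp only: of_real_eq_0_iff)
      then show ?thesis using that S by (simp add: sum_nonneg_eq_0_iff)
    qed
    have "cinner S (P u) (b n) = 0" for u
    proof -
      have "cinner S (P u) (b n) = cinner S (P (P u)) (b n)" by (simp only: idem)
      also have "\<dots> = cinner S (P u) w" by (simp only: sa w_def)
      also have "\<dots> = 0" unfolding cinner_def by (intro sum.neutral ballI) (simp add: w0)
      finally show ?thesis .
    qed
    then have "\<forall>u j. j < Suc n \<longrightarrow> cinner S (P u) (b j) = 0" using ann by (auto simp: less_Suc_eq)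
    moreover have "real (card S) - real (Suc n) \<le> Re (\<Sum>i\<in>S. cinner S (P (\<lambda>k. if k = i then 1 else 0)) (\<lambda>k. if k = i then 1 else 0))"
      using tr by simp
    ultimately show ?thesis using sa idem lin by (intro exI[of _ P]) simp
  next
    case False
    define c where "c = cinner S w w"
    have c: "c \<noteq> 0" "cnj c = c" using False cinner_commute[of S w w] by (auto simp: c_def)
    define R where "R u = (\<lambda>k. P u k - (cinner S u w / c) * w k)" for u
    have Rw: "cinner S (R u) w = 0" for u
    proof -
      have "cinner S (P u) w = cinner S u w" by (simp only: sa Pw)
      then show ?thesis using c unfolding R_def cinner_diff_left cinner_scale_left c_def[symmetric] by simp
    qed
    have PR: "P (R u) = R u" for u unfolding R_def lin idem Pw ..
    have "cinner S (R u) v = cinner S u (R v)" for u v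
    proof -
      have "cnj (cinner S v w / c) * cinner S u w = (cinner S u w / c) * cinner S w v"
        using c cinner_commute[of S v w] by simp
      then show ?thesis unfolding R_def cinner_diff_left cinner_diff_right cinner_scale_left cinner_scale_right sa by simp
    qed
    moreover have "R (R u) = R u" for u
      unfolding R_def[of "R u"] Rw PR by simp
    moreover have "cinner S (R u) (b j) = 0" if "j < Suc n" for u j
    proof (cases "j = n")
      case True
      have "cinner S (R u) (b n) = cinner S (P (R u)) (b n)" by (simp only: PR)
      also have "\<dots> = cinner S (R u) w" by (simp only: sa w_def)
      finally show ?thesis using True Rw by simp
    next
      case False
      then have "cinner S (P (R u)) (b j) = 0" using that by (intro ann) simp
      then show ?thesis by (simp only: PR)
    qed
    moreover have "R (\<lambda>k. u k - d * v k) = (\<lambda>k. R u k - d * R v k)" for u v d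
      unfolding R_def lin cinner_diff_left cinner_scale_left by (rule ext) (simp add: algebra_simps diff_divide_distrib)
    moreover have "real (card S) - real (Suc n) \<le> Re (\<Sum>i\<in>S. cinner S (R (\<lambda>k. if k = i then 1 else 0)) (\<lambda>k. if k = i then 1 else 0))"
    proof -
      let ?e = "\<lambda>i k. if k = i then 1 else (0::complex)"
      have "cinner S (R (?e i)) (?e i) = cinner S (P (?e i)) (?e i) - (w i * cnj (w i)) / c" if "i \<in> S" for i
      proof -
        have "cinner S w (?e i) = w i" using S that by (rule cinner_unit)
        moreover from this have "cinner S (?e i) w = cnj (w i)" using cinner_commute[of S "?e i" w] by simp
        ultimately show ?thesis unfolding R_def cinner_diff_left cinner_scale_left by simp
      qed
      then have "(\<Sum>i\<in>S. cinner S (R (?e i)) (?e i)) = (\<Sum>i\<in>S. cinner S (P (?e i)) (?e i) - (w i * cnj (w i)) / c)"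
        by (intro sum.cong refl)
      also have "\<dots> = (\<Sum>i\<in>S. cinner S (P (?e i)) (?e i)) - (\<Sum>i\<in>S. w i * cnj (w i)) / c"
        by (simp only: sum_subtractf sum_divide_distrib)
      also have "(\<Sum>i\<in>S. w i * cnj (w i)) / c = 1" using c by (simp add: c_def cinner_def)
      finally show ?thesis using tr by simp
    qed
    ultimately show ?thesis by (intro exI[of _ R]) simp
  qed
qed

text \<open>
  Let \<open>P\<close> be the projection onto the annihilating vectors. The hypothesis says \<open>P = P A\<close>, so
  \<open>P\<close> is the projection applied to the columns of \<open>A\<close> and \<open>\<parallel>P\<parallel> \<le> \<parallel>A\<parallel>\<close> for Frobenius norms. The squared
  Frobenius norm of a projection is its trace, and the trace is at least \<open>card S - n\<close>.
\<close>

lemma fooling_Frobenius: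
  fixes A :: "'k \<Rightarrow> 'k \<Rightarrow> complex" and b :: "nat \<Rightarrow> 'k \<Rightarrow> complex"
  assumes S: "finite S"
    and fool: "\<And>a l. (\<And>j. j < n \<Longrightarrow> (\<Sum>k\<in>S. a k * b j k) = 0) \<Longrightarrow> l \<in> S \<Longrightarrow> (\<Sum>k\<in>S. a k * A k l) = a l"
  shows "real (card S) - real n \<le> (\<Sum>k\<in>S. \<Sum>l\<in>S. (norm (A k l))\<^sup>2)"
proof -
  let ?e = "\<lambda>i k. if k = i then 1 else (0::complex)"
  obtain P where sa: "\<And>u v. cinner S (P u) v = cinner S u (P v)" and idem: "\<And>u. P (P u) = P u"
    and ann: "\<And>u j. j < n \<Longrightarrow> cinner S (P u) (\<lambda>k. cnj (b j k)) = 0"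
    and tr: "real (card S) - real n \<le> Re (\<Sum>i\<in>S. cinner S (P (?e i)) (?e i))"
    using annihilating_projection[OF S, of n "\<lambda>j k. cnj (b j k)"] by (elim exE conjE, intro that; iprover)
  have row: "(\<Sum>k\<in>S. P u k * A k l) = P u l" if "l \<in> S" for u l
    using ann that by (intro fool) (auto simp: cinner_def)
  have normP: "cinner S (P u) (P u) = cinner S (P u) u" for u
    by (metis sa idem)
  have contr: "(\<Sum>k\<in>S. (norm (P u k))\<^sup>2) \<le> (\<Sum>k\<in>S. (norm (u k))\<^sup>2)" for u
  proof -
    have "cinner S u (P u) = cinner S (P u) (P u)" by (metis sa idem)
    then have "cinner S (\<lambda>k. u k - P u k) (\<lambda>k. u k - P u k) = cinner S u u - cinner S (P u) (P u)"
      unfolding cinner_diff_left cinner_diff_right using normP[of u] by simp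
    then have "complex_of_real (\<Sum>k\<in>S. (norm (u k - P u k))\<^sup>2) = complex_of_real ((\<Sum>k\<in>S. (norm (u k))\<^sup>2) - (\<Sum>k\<in>S. (norm (P u k))\<^sup>2))"
      unfolding cinner_self by simp
    then have "(\<Sum>k\<in>S. (norm (u k - P u k))\<^sup>2) = (\<Sum>k\<in>S. (norm (u k))\<^sup>2) - (\<Sum>k\<in>S. (norm (P u k))\<^sup>2)"
      by (simp only: of_real_eq_iff)
    moreover have "0 \<le> (\<Sum>k\<in>S. (norm (u k - P u k))\<^sup>2)" by (intro sum_nonneg) auto
    ultimately show ?thesis by linarith
  qed
  have "real (card S) - real n \<le> (\<Sum>i\<in>S. \<Sum>l\<in>S. (norm (P (?e i) l))\<^sup>2)"
  proof -
    have "(\<Sum>i\<in>S. cinner S (P (?e i)) (?e i)) = complex_of_real (\<Sum>i\<in>S. \<Sum>l\<in>S. (norm (P (?e i) l))\<^sup>2)"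
      unfolding normP[symmetric] cinner_self of_real_sum ..
    with tr show ?thesis by (simp only: Re_complex_of_real)
  qed
  also have "\<dots> = (\<Sum>l\<in>S. \<Sum>i\<in>S. (norm (P (?e i) l))\<^sup>2)" by (rule sum.swap)
  also have "\<dots> = (\<Sum>l\<in>S. \<Sum>i\<in>S. (norm (P (\<lambda>k. cnj (A k l)) i))\<^sup>2)"
  proof (intro sum.cong refl)
    fix l i assume l: "l \<in> S" and i: "i \<in> S"
    have "P (?e i) l = cinner S (P (?e i)) (\<lambda>k. cnj (A k l))" using row[OF l, of "?e i"] by (simp add: cinner_def)
    also have "\<dots> = cinner S (?e i) (P (\<lambda>k. cnj (A k l)))" by (rule sa)
    also have "\<dots> = cnj (P (\<lambda>k. cnj (A k l)) i)"
      using cinner_commute[of S "?e i" "P (\<lambda>k. cnj (A k l))"] cinner_unit[OF S i, of "P (\<lambda>k. cnj (A k l))"] by simp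
    finally show "(norm (P (?e i) l))\<^sup>2 = (norm (P (\<lambda>k. cnj (A k l)) i))\<^sup>2" by simp
  qed
  also have "\<dots> \<le> (\<Sum>l\<in>S. \<Sum>k\<in>S. (norm (cnj (A k l)))\<^sup>2)" by (intro sum_mono contr)
  also have "\<dots> = (\<Sum>k\<in>S. \<Sum>l\<in>S. (norm (A k l))\<^sup>2)" unfolding complex_mod_cnj by (rule sum.swap)
  finally show ?thesis .
qed

section \<open>Localized polynomials\<close>

lemma Parseval_trigd:
  fixes \<gamma> :: "('d::finite \<Rightarrow> int) \<Rightarrow> complex"
  assumes K: "finite K"
  shows "(LINT y|cube_M. (norm (trigd K \<gamma> y))\<^sup>2) = (\<Sum>k\<in>K. (norm (\<gamma> k))\<^sup>2)"
    and "integrable cube_M (\<lambda>y. (norm (trigd K \<gamma> y))\<^sup>2)"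
    and "Lp_norm 2 (trigd K \<gamma>) = ennreal (sqrt (\<Sum>k\<in>K. (norm (\<gamma> k))\<^sup>2))"
proof -
  have ic: "integrable cube_M (trigd K \<gamma>)" by (intro integrable_cube_continuous continuous_on_trigd)
  have eq: "complex_of_real ((norm (trigd K \<gamma> y))\<^sup>2) = (\<Sum>k\<in>K. cnj (\<gamma> k) * (cnj (eed k y) * trigd K \<gamma> y))" for y
  proof -
    have "complex_of_real ((norm (trigd K \<gamma> y))\<^sup>2) = trigd K \<gamma> y * cnj (trigd K \<gamma> y)" by (rule complex_norm_square)
    also have "cnj (trigd K \<gamma> y) = (\<Sum>k\<in>K. cnj (\<gamma> k) * cnj (eed k y))" by (simp add: trigd_def)
    finally show ?thesis by (simp only: sum_distrib_left mult_ac)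
  qed
  have ii: "integrable cube_M (\<lambda>y. cnj (\<gamma> k) * (cnj (eed k y) * trigd K \<gamma> y))" for k
    by (intro integrable_mult_right integrable_eed_mult ic)
  have "integrable cube_M (\<lambda>y. complex_of_real ((norm (trigd K \<gamma> y))\<^sup>2))"
    unfolding eq by (intro Bochner_Integration.integrable_sum ii)
  then show int: "integrable cube_M (\<lambda>y. (norm (trigd K \<gamma> y))\<^sup>2)" by (simp only: complex_of_real_integrable_eq)
  have "complex_of_real (LINT y|cube_M. (norm (trigd K \<gamma> y))\<^sup>2) = (LINT y|cube_M. complex_of_real ((norm (trigd K \<gamma> y))\<^sup>2))"
    by (rule integral_complex_of_real[symmetric])
  also have "\<dots> = (\<Sum>k\<in>K. LINT y|cube_M. cnj (\<gamma> k) * (cnj (eed k y) * trigd K \<gamma> y))"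
    unfolding eq by (rule Bochner_Integration.integral_sum) (rule ii)
  also have "\<dots> = (\<Sum>k\<in>K. cnj (\<gamma> k) * fourier (trigd K \<gamma>) k)" unfolding fourier_def by simp
  also have "\<dots> = (\<Sum>k\<in>K. complex_of_real ((norm (\<gamma> k))\<^sup>2))"
    unfolding fourier_trigd[OF K] complex_norm_square by (intro sum.cong refl) (simp add: mult.commute)
  finally show val: "(LINT y|cube_M. (norm (trigd K \<gamma> y))\<^sup>2) = (\<Sum>k\<in>K. (norm (\<gamma> k))\<^sup>2)"
    by (simp only: of_real_sum[symmetric] of_real_eq_iff)
  have "(\<integral>\<^sup>+y. ennreal (norm (trigd K \<gamma> y) powr 2) \<partial>cube_M) = (\<integral>\<^sup>+y. ennreal ((norm (trigd K \<gamma> y))\<^sup>2) \<partial>cube_M)"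
    by simp
  also have "\<dots> = ennreal (\<Sum>k\<in>K. (norm (\<gamma> k))\<^sup>2)"
    unfolding val[symmetric] by (rule nn_integral_eq_integral[OF int]) simp
  finally show "Lp_norm 2 (trigd K \<gamma>) = ennreal (sqrt (\<Sum>k\<in>K. (norm (\<gamma> k))\<^sup>2))"
    unfolding Lp_norm_cube by (simp add: sum_nonneg powr_half_sqrt)
qed

lemma exists_large_value:
  fixes F :: "real ^ 'd \<Rightarrow> real"
  assumes F: "integrable cube_M F" and c: "c \<le> (LINT y|cube_M. F y)" "0 < c"
  obtains y where "c / 2 \<le> F y"
proof -
  have "\<exists>y. c / 2 \<le> F y"
  proof (rule ccontr)
    assume "\<nexists>y. c / 2 \<le> F y"
    then have le: "F y \<le> c / 2" for y by (simp add: not_le less_imp_le)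
    interpret finite_measure "cube_M :: (real ^ 'd) measure" by (rule finite_measure_cube_M)
    have "(LINT y|cube_M. F y) \<le> (LINT y|(cube_M :: (real ^ 'd) measure). c / 2)"
      by (intro integral_mono F le) simp
    also have "\<dots> = c / 2" by (simp add: measure_def emeasure_cube_M)
    finally show False using c by simp
  qed
  then show thesis using that by (elim exE)
qed

text \<open>
  Two neighbouring blocks: for \<open>\<rho> = 0\<close> the coefficient is 1 on the whole interval \<open>[2 ^ i, 2 ^ (i + 1))\<close>.
\<close>

definition wide_coeff :: "nat \<Rightarrow> real \<Rightarrow> int \<Rightarrow> real" where
  "wide_coeff i \<rho> k = block_coeff i \<rho> k + block_coeff (Suc i) \<rho> k"

definition wide :: "nat \<Rightarrow> real \<Rightarrow> real \<Rightarrow> complex" where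
  "wide i \<rho> x = block i \<rho> x + block (Suc i) \<rho> x"

lemma wide_eq_trig:
  assumes "i + 2 \<le> M"
  shows "wide i \<rho> x = trig {0<..<2 ^ M} (\<lambda>k. of_real (wide_coeff i \<rho> k)) x"
  using assms
  by (simp add: wide_def wide_coeff_def block_eq_trig_wide[of i M] block_eq_trig_wide[of "Suc i" M] trig_def sum.distrib distrib_right)

lemma wide_coeff_eq: "0 < k \<Longrightarrow> wide_coeff i \<rho> k = wide_coeff i 0 k * of_int k powr \<rho>"
  by (simp add: wide_coeff_def block_coeff_def algebra_simps)

lemma wide_coeff_eq_1:
  assumes "2 ^ i \<le> k" "k < 2 ^ Suc i"
  shows "wide_coeff i 0 k = 1"
proof -
  have k: "0 < k" using assms(1) zero_less_power[of "2::int" i] by linarith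
  have "hat (Suc (Suc i)) k = 1" by (rule hat_eq_1) (use assms k in simp)
  moreover have "hat i k = 0" by (rule hat_eq_0) (use assms k in simp)
  ultimately show ?thesis using k by (simp add: wide_coeff_def block_coeff_def)
qed

definition wide_const :: "real \<Rightarrow> real" where
  "wide_const \<rho> = 2 * block_const \<rho> * (1 + 2 * 2 powr \<rho>)"

lemma wide_const_pos: "0 < wide_const \<rho>"
  unfolding wide_const_def using block_const_pos[of \<rho>] by (intro mult_pos_pos add_pos_pos) auto

lemma norm_wide_le: "norm (wide i \<rho> x) \<le> wide_const \<rho> * 2 powr (\<rho> * real i + real i)"
proof -
  have "norm (wide i \<rho> x) \<le> norm (block i \<rho> x) + norm (block (Suc i) \<rho> x)"
    unfolding wide_def by (rule norm_triangle_ineq)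
  also have "\<dots> \<le> 2 * block_const \<rho> * 2 powr (\<rho> * real i + real i) + 2 * block_const \<rho> * 2 powr (\<rho> * real (Suc i) + real (Suc i))"
    by (intro add_mono norm_block_le)
  also have "2 powr (\<rho> * real (Suc i) + real (Suc i)) = 2 powr (\<rho> * real i + real i) * (2 powr \<rho> * 2)"
  proof -
    have "\<rho> * real (Suc i) + real (Suc i) = (\<rho> * real i + real i) + (\<rho> + 1)" by (simp add: algebra_simps)
    then show ?thesis by (simp only: powr_add powr_one)
  qed
  finally show ?thesis by (simp add: wide_const_def algebra_simps)
qed

lemma wide_L1: "(\<integral>\<^sup>+x. ennreal (norm (wide i \<rho> (x - y))) \<partial>unit_M) \<le> ennreal (wide_const \<rho> * 2 powr (\<rho> * real i))"
proof -
  have m: "(\<lambda>x. ennreal (norm (block j \<rho> (x - y)))) \<in> borel_measurable unit_M" for j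
    by (intro measurable_unit_M measurable_compose[OF _ measurable_ennreal] borel_measurable_continuous_onI continuous_intros)
  have "(\<integral>\<^sup>+x. ennreal (norm (wide i \<rho> (x - y))) \<partial>unit_M) \<le> (\<integral>\<^sup>+x. ennreal (norm (block i \<rho> (x - y))) + ennreal (norm (block (Suc i) \<rho> (x - y))) \<partial>unit_M)"
    by (intro nn_integral_mono) (simp add: wide_def ennreal_plus[symmetric] norm_triangle_ineq ennreal_leI del: ennreal_plus)
  also have "\<dots> = (\<integral>\<^sup>+x. ennreal (norm (block i \<rho> (x - y))) \<partial>unit_M) + (\<integral>\<^sup>+x. ennreal (norm (block (Suc i) \<rho> (x - y))) \<partial>unit_M)"
    by (rule nn_integral_add[OF m m])
  also have "\<dots> \<le> ennreal (block_const \<rho> * 2 powr (\<rho> * real i)) + ennreal (block_const \<rho> * 2 powr (\<rho> * real (Suc i)))"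
    by (intro add_mono block_L1_x)
  also have "\<dots> = ennreal (block_const \<rho> * (1 + 2 powr \<rho>) * 2 powr (\<rho> * real i))"
    using block_const_pos[of \<rho>] by (simp add: ennreal_plus[symmetric] algebra_simps powr_add del: ennreal_plus)
  also have "\<dots> \<le> ennreal (wide_const \<rho> * 2 powr (\<rho> * real i))"
  proof (intro ennreal_leI mult_right_mono)
    have "block_const \<rho> * (1 + 2 powr \<rho>) \<le> block_const \<rho> * (2 * (1 + 2 * 2 powr \<rho>))"
      using block_const_pos[of \<rho>] by (intro mult_left_mono) auto
    then show "block_const \<rho> * (1 + 2 powr \<rho>) \<le> wide_const \<rho>" by (simp add: wide_const_def mult_ac)
  qed simp
  finally show ?thesis .
qed

lemma wide_Lp:
  assumes p: "1 \<le> p"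
  shows "(\<integral>\<^sup>+x. ennreal (norm (wide i \<rho> (x - y)) powr p) \<partial>unit_M) \<le> ennreal ((wide_const \<rho> * 2 powr ((\<rho> + (1 - 1 / p)) * real i)) powr p)"
proof (rule Lp_of_L1_and_sup[OF _ _ wide_const_pos p norm_wide_le wide_L1])
  show "(\<lambda>x. ennreal (norm (wide i \<rho> (x - y)))) \<in> borel_measurable unit_M"
    unfolding wide_def
    by (intro measurable_unit_M measurable_compose[OF _ measurable_ennreal] borel_measurable_continuous_onI continuous_intros)
qed simp

text \<open>
  A cube of positive frequencies containing the spectra of all bumps of level \<open>m\<close>.
\<close>

definition wide_freqs :: "nat \<Rightarrow> ('d::finite \<Rightarrow> int) set" where
  "wide_freqs m = Pi\<^sub>E UNIV (\<lambda>_. {0<..<2 ^ (m + 2)})"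

lemma finite_wide_freqs [simp]: "finite (wide_freqs m)"
  unfolding wide_freqs_def by (intro finite_PiE) auto

lemma wide_freqs_pos: "k \<in> wide_freqs m \<Longrightarrow> 0 < k i"
  by (simp add: wide_freqs_def PiE_iff)

lemma dyadic_box_subset_wide_freqs:
  assumes "s \<in> compositions m"
  shows "dyadic_box s \<subseteq> wide_freqs m"
proof
  fix k assume k: "k \<in> dyadic_box s"
  have "0 < k i \<and> k i < 2 ^ (m + 2)" for i
  proof -
    have "s i \<le> m" using assms component_le_sum[of s i] by (simp add: compositions_def)
    then have "(2::int) ^ Suc (s i) \<le> 2 ^ (m + 2)" by (intro power_increasing) auto
    moreover have "2 ^ s i \<le> k i" "k i < 2 ^ Suc (s i)" using k by (simp_all add: mem_dyadic_box)
    moreover have "(0::int) < 2 ^ s i" by simp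
    ultimately show ?thesis by linarith
  qed
  then show "k \<in> wide_freqs m" by (simp add: wide_freqs_def PiE_iff)
qed

text \<open>
  Coefficients of a bump at the origin with the spectrum near the dyadic box of \<open>s\<close>, multiplied by
  the power \<open>\<rho>\<close> of each component of the frequency.
\<close>

definition bump_coeff :: "('d::finite \<Rightarrow> nat) \<Rightarrow> real \<Rightarrow> ('d \<Rightarrow> int) \<Rightarrow> real" where
  "bump_coeff s \<rho> k = (\<Prod>i\<in>UNIV. wide_coeff (s i) \<rho> (k i))"

lemma bump_coeff_eq_1: "k \<in> dyadic_box s \<Longrightarrow> bump_coeff s 0 k = 1"
  unfolding bump_coeff_def by (rule prod.neutral) (simp add: wide_coeff_eq_1 mem_dyadic_box)

text \<open>
  The polynomial is a product of one-dimensional bumps centred at the coordinates of \<open>y\<close>. Since it is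
  concentrated on a box of volume \<open>2 powr (- m)\<close>, its norm is of the order of \<open>2 powr (- m / p)\<close> times
  its supremum, which is \<open>O(2 powr ((\<rho> + 1) * m))\<close>.
\<close>

lemma Lp_norm_bump:
  fixes y :: "real ^ 'd"
  assumes s: "s \<in> compositions m" and p: "1 \<le> p"
  shows "Lp_norm p (trigd (wide_freqs m) (\<lambda>k. of_real (bump_coeff s \<rho> k) * cnj (eed k y)))
     \<le> ennreal (wide_const \<rho> ^ CARD('d) * 2 powr ((\<rho> + (1 - 1 / p)) * real m))"
proof -
  define g where "g x = (\<Prod>i\<in>UNIV. wide (s i) \<rho> (x $ i - y $ i))" for x :: "real ^ 'd"
  have "trigd (wide_freqs m) (\<lambda>k. of_real (bump_coeff s \<rho> k) * cnj (eed k y)) x = g x" for x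
  proof -
    have le: "s i + 2 \<le> m + 2" for i using s component_le_sum[of s i] by (simp add: compositions_def)
    have "g x = (\<Prod>i\<in>UNIV. trig {0<..<2 ^ (m + 2)} (\<lambda>k. of_real (wide_coeff (s i) \<rho> k)) (x $ i - y $ i))"
      unfolding g_def by (intro prod.cong refl wide_eq_trig le)
    also have "\<dots> = (\<Sum>k\<in>wide_freqs m. (\<Prod>i\<in>UNIV. of_real (wide_coeff (s i) \<rho> (k i))) * (eed k x * cnj (eed k y)))"
      unfolding wide_freqs_def by (rule prod_trig_expand) simp
    finally show ?thesis unfolding trigd_def bump_coeff_def of_real_prod by (simp only: mult_ac)
  qed
  then have eq: "trigd (wide_freqs m) (\<lambda>k. of_real (bump_coeff s \<rho> k) * cnj (eed k y)) = g" by (rule ext)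
  let ?c = "\<lambda>i. wide_const \<rho> * 2 powr ((\<rho> + (1 - 1 / p)) * real (s i))"
  have c0: "0 \<le> (\<Prod>i\<in>UNIV. ?c i)" using wide_const_pos[of \<rho>] by (intro prod_nonneg) auto
  have "(\<integral>\<^sup>+x. ennreal (norm (g x) powr p) \<partial>cube_M) = (\<integral>\<^sup>+x. (\<Prod>i\<in>UNIV. ennreal (norm (wide (s i) \<rho> (x $ i - y $ i)) powr p)) \<partial>cube_M)"
    unfolding g_def prod_norm[symmetric] prod_powr_distrib
    by (intro nn_integral_cong prod_ennreal[symmetric]) simp
  also have "\<dots> = (\<Prod>i\<in>UNIV. \<integral>\<^sup>+t. ennreal (norm (wide (s i) \<rho> (t - y $ i)) powr p) \<partial>unit_M)"
  proof (rule nn_integral_cube_prod)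
    fix i
    have [measurable]: "(\<lambda>t. wide (s i) \<rho> (t - y $ i)) \<in> borel_measurable borel"
      unfolding wide_def by (intro borel_measurable_continuous_onI continuous_intros)
    show "(\<lambda>t. ennreal (norm (wide (s i) \<rho> (t - y $ i)) powr p)) \<in> borel_measurable unit_M"
      by (intro measurable_unit_M) measurable
  qed
  also have "\<dots> \<le> (\<Prod>i\<in>UNIV. ennreal (?c i powr p))" by (intro prod_mono_ennreal wide_Lp p)
  also have "\<dots> = ennreal ((\<Prod>i\<in>UNIV. ?c i) powr p)" by (simp add: prod_ennreal prod_powr_distrib)
  finally have "Lp_norm p g \<le> ennreal (\<Prod>i\<in>UNIV. ?c i)"
    using p c0 by (subst Lp_norm_le_iff) auto
  also have "(\<Prod>i\<in>UNIV. ?c i) = wide_const \<rho> ^ CARD('d) * 2 powr ((\<rho> + (1 - 1 / p)) * real m)"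
  proof -
    have "(\<Prod>i\<in>UNIV. 2 powr ((\<rho> + (1 - 1 / p)) * real (s i))) = 2 powr (\<Sum>i\<in>UNIV. (\<rho> + (1 - 1 / p)) * real (s i))"
      by (rule powr_sum[symmetric]) auto
    also have "(\<Sum>i\<in>UNIV. (\<rho> + (1 - 1 / p)) * real (s i)) = (\<rho> + (1 - 1 / p)) * real m"
      using s by (simp only: sum_distrib_left[symmetric] of_nat_sum[symmetric] compositions_def mem_Collect_eq)
    finally show ?thesis by (simp add: prod.distrib)
  qed
  finally show ?thesis unfolding eq .
qed

section \<open>A lower bound for the error of recovery\<close>

text \<open>
  The recovery error of an exponential. By linearity it determines the error of every polynomial.
\<close>

definition defect :: "nat \<Rightarrow> (nat \<Rightarrow> real ^ 'd) \<Rightarrow> (nat \<Rightarrow> real ^ 'd \<Rightarrow> complex) \<Rightarrow> ('d::finite \<Rightarrow> int) \<Rightarrow> real ^ 'd \<Rightarrow> complex" where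
  "defect n X \<Phi> k x = eed k x - sampling_op n X \<Phi> (eed k) x"

lemma trigd_defect:
  "trigd K a x - sampling_op n X \<Phi> (trigd K a) x = (\<Sum>k\<in>K. a k * defect n X \<Phi> k x)"
proof -
  have "sampling_op n X \<Phi> (trigd K a) x = (\<Sum>j=1..n. \<Sum>k\<in>K. a k * (eed k (X j) * \<Phi> j x))"
    unfolding sampling_op_def trigd_def by (intro sum.cong refl) (simp only: sum_distrib_right mult.assoc)
  also have "\<dots> = (\<Sum>k\<in>K. \<Sum>j=1..n. a k * (eed k (X j) * \<Phi> j x))" by (rule sum.swap)
  also have "\<dots> = (\<Sum>k\<in>K. a k * sampling_op n X \<Phi> (eed k) x)"
    unfolding sampling_op_def by (simp only: sum_distrib_left)
  finally show ?thesis
    unfolding defect_def by (simp only: trigd_def right_diff_distrib sum_subtractf)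
qed

lemma Lp_norm_const_1:
  fixes f :: "real ^ 'd \<Rightarrow> complex"
  assumes "0 < p" "\<And>x. norm (f x) = 1"
  shows "Lp_norm p f \<le> 1"
proof -
  have "(\<integral>\<^sup>+x. ennreal (norm (f x) powr p) \<partial>cube_M) = (\<integral>\<^sup>+x. 1 \<partial>(cube_M :: (real ^ 'd) measure))"
    by (simp only: assms(2) powr_one_eq_one ennreal_1)
  also have "\<dots> = 1" by (simp add: emeasure_cube_M)
  finally have "(\<integral>\<^sup>+x. ennreal (norm (f x) powr p) \<partial>cube_M) \<le> ennreal (1 powr p)" by simp
  then have "Lp_norm p f \<le> ennreal 1" using assms(1) by (subst Lp_norm_le_iff) simp_all
  then show ?thesis by simp
qed

text \<open>
  The lower bound is proved for one sampling operator at a time; this collects what is known about it.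
  A real \<open>W\<close> leaves out the operators with infinite error, for which every lower bound is trivial.
\<close>

definition recovers :: "real \<Rightarrow> real \<Rightarrow> real \<Rightarrow> nat \<Rightarrow> (nat \<Rightarrow> real ^ 'd) \<Rightarrow> (nat \<Rightarrow> real ^ 'd \<Rightarrow> complex) \<Rightarrow> real \<Rightarrow> bool" where
  "recovers r p q n X \<Phi> W \<longleftrightarrow> (\<forall>j\<in>{1..n}. \<Phi> j \<in> torus_measurable) \<and> 0 \<le> W \<and>
     (\<forall>f\<in>sobolev_ball r p. Lp_norm q (\<lambda>t. f t - sampling_op n X \<Phi> f t) \<le> ennreal W)"

lemma defect_integrable:
  fixes \<Phi> :: "nat \<Rightarrow> real ^ 'd \<Rightarrow> complex"
  assumes rec: "recovers r p q n X \<Phi> W" and p: "1 < p" "p < q" and r: "1 / p < r"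
  shows "integrable cube_M (defect n X \<Phi> k)"
proof -
  have m: "defect n X \<Phi> k \<in> borel_measurable cube_M"
  proof (rule measurable_cube_M)
    have "\<Phi> j \<in> borel_measurable borel" if "j \<in> {1..n}" for j
      using rec that by (simp add: recovers_def torus_measurable_def)
    then show "defect n X \<Phi> k \<in> borel_measurable borel"
      unfolding defect_def[abs_def] sampling_op_def
      by (intro borel_measurable_diff borel_measurable_eed borel_measurable_sum borel_measurable_times borel_measurable_const)
  qed
  have "Lp_norm p (trigd {k} (\<lambda>_. 1) :: real ^ 'd \<Rightarrow> complex) \<le> 1"
    using p by (intro Lp_norm_const_1) (simp_all add: trigd_def)
  then have "(trigd {k} (\<lambda>k. multi_coeff r k * 1) :: real ^ 'd \<Rightarrow> complex) \<in> sobolev_ball r p"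
    using p r by (intro trigd_in_sobolev_ball) simp_all
  then have "Lp_norm q (\<lambda>x. trigd {k} (\<lambda>k. multi_coeff r k * 1) x - sampling_op n X \<Phi> (trigd {k} (\<lambda>k. multi_coeff r k * 1)) x) \<le> ennreal W"
    using rec by (simp only: recovers_def)
  then have "Lp_norm q (\<lambda>x. multi_coeff r k * defect n X \<Phi> k x) < \<infinity>"
    unfolding trigd_defect by (simp add: le_less_trans)
  then have "integrable cube_M (\<lambda>x. multi_coeff r k * defect n X \<Phi> k x)"
    using p m by (intro Lp_integrable[of _ q] borel_measurable_times borel_measurable_const) simp_all
  then have "integrable cube_M (\<lambda>x. inverse (multi_coeff r k) * (multi_coeff r k * defect n X \<Phi> k x))"
    by (rule integrable_mult_right)
  then show ?thesis by (simp add: mult.assoc[symmetric])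
qed

definition defect_matrix :: "nat \<Rightarrow> (nat \<Rightarrow> real ^ 'd) \<Rightarrow> (nat \<Rightarrow> real ^ 'd \<Rightarrow> complex) \<Rightarrow> ('d::finite \<Rightarrow> int) \<Rightarrow> ('d \<Rightarrow> int) \<Rightarrow> complex" where
  "defect_matrix n X \<Phi> k l = fourier (defect n X \<Phi> k) l"

text \<open>
  The sum is \<open>N\<close> times the pairing of the error, at the function of the ball with coefficients
  \<open>multi_coeff r k * \<gamma> k / N\<close>, with the polynomial of coefficients \<open>\<delta>\<close>; Holder's inequality bounds the pairing.
\<close>

lemma defect_matrix_duality:
  fixes \<Phi> :: "nat \<Rightarrow> real ^ 'd \<Rightarrow> complex"
  assumes rec: "recovers r p q n X \<Phi> W" and p: "1 < p" "p < q" and r: "1 / p < r"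
    and K: "finite K" "finite L"
    and N: "Lp_norm p (trigd K \<gamma> :: real ^ 'd \<Rightarrow> complex) \<le> ennreal N" "0 < N"
    and D: "Lp_norm (q / (q - 1)) (trigd L \<delta> :: real ^ 'd \<Rightarrow> complex) \<le> ennreal D" "0 \<le> D"
  shows "norm (\<Sum>k\<in>K. \<Sum>l\<in>L. multi_coeff r k * \<gamma> k * defect_matrix n X \<Phi> k l * cnj (\<delta> l)) \<le> W * N * D"
proof -
  let ?a = "\<lambda>k. multi_coeff r k * (\<gamma> k / of_real N)"
  let ?f = "trigd K ?a :: real ^ 'd \<Rightarrow> complex"
  let ?g = "trigd L \<delta> :: real ^ 'd \<Rightarrow> complex"
  let ?e = "\<lambda>x. ?f x - sampling_op n X \<Phi> ?f x"
  let ?E = "defect n X \<Phi>"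
  have q: "1 < q" using p by simp
  have "Lp_norm p (trigd K (\<lambda>k. \<gamma> k / of_real N) :: real ^ 'd \<Rightarrow> complex) \<le> 1"
  proof -
    have "trigd K (\<lambda>k. \<gamma> k / of_real N) x = trigd K \<gamma> x / of_real N" for x :: "real ^ 'd"
      by (simp add: trigd_def sum_divide_distrib)
    then have "ennreal (norm (trigd K (\<lambda>k. \<gamma> k / of_real N) x) powr p) = ennreal (1 / N powr p) * ennreal (norm (trigd K \<gamma> x) powr p)" for x :: "real ^ 'd"
      using N(2) by (simp add: norm_divide powr_divide ennreal_mult[symmetric])
    then have "(\<integral>\<^sup>+x. ennreal (norm (trigd K (\<lambda>k. \<gamma> k / of_real N) x) powr p) \<partial>(cube_M :: (real ^ 'd) measure))
        = ennreal (1 / N powr p) * (\<integral>\<^sup>+x. ennreal (norm (trigd K \<gamma> x) powr p) \<partial>cube_M)"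
    proof (simp only:, intro nn_integral_cmult)
      have "(trigd K \<gamma> :: real ^ 'd \<Rightarrow> complex) \<in> borel_measurable cube_M"
        using trigd_measurable[of K \<gamma>] by (intro measurable_cube_M) (simp add: torus_measurable_def)
      then show "(\<lambda>x :: real ^ 'd. ennreal (norm (trigd K \<gamma> x) powr p)) \<in> borel_measurable cube_M" by measurable
    qed
    also have "\<dots> \<le> ennreal (1 / N powr p) * ennreal (N powr p)"
      using N p Lp_norm_le_iff[of p N "trigd K \<gamma> :: real ^ 'd \<Rightarrow> complex"] by (intro mult_left_mono) auto
    also have "\<dots> = ennreal (1 powr p)" using N(2) by (simp add: ennreal_mult[symmetric])
    finally have "Lp_norm p (trigd K (\<lambda>k. \<gamma> k / of_real N) :: real ^ 'd \<Rightarrow> complex) \<le> ennreal 1"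
      using p by (subst Lp_norm_le_iff) simp_all
    then show ?thesis by simp
  qed
  then have "?f \<in> sobolev_ball r p" using p(1) r K(1) by (intro trigd_in_sobolev_ball)
  then have eW: "Lp_norm q ?e \<le> ennreal W" using rec by (simp only: recovers_def)
  have eeq: "?e x = (\<Sum>k\<in>K. ?a k * ?E k x)" for x by (rule trigd_defect)
  have Ei: "integrable cube_M (?E k)" for k by (rule defect_integrable[OF rec p r])
  have ei: "integrable cube_M ?e" unfolding eeq by (intro Bochner_Integration.integrable_sum integrable_mult_right Ei)
  have gi: "integrable cube_M ?g" by (intro integrable_cube_continuous continuous_on_trigd)
  have prod: "?e x * cnj (?g x) = (\<Sum>k\<in>K. \<Sum>l\<in>L. ?a k * cnj (\<delta> l) * (cnj (eed l x) * ?E k x))" for x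
    unfolding eeq unfolding trigd_def cnj_sum complex_cnj_mult sum_product by (intro sum.cong refl) (simp only: mult_ac)
  have ii: "integrable cube_M (\<lambda>x. ?a k * cnj (\<delta> l) * (cnj (eed l x) * ?E k x))" for k l
    by (intro integrable_mult_right integrable_eed_mult Ei)
  have "(LINT x|cube_M. ?e x * cnj (?g x)) = (\<Sum>k\<in>K. LINT x|cube_M. (\<Sum>l\<in>L. ?a k * cnj (\<delta> l) * (cnj (eed l x) * ?E k x)))"
    unfolding prod by (rule Bochner_Integration.integral_sum) (intro Bochner_Integration.integrable_sum ii)
  also have "\<dots> = (\<Sum>k\<in>K. \<Sum>l\<in>L. LINT x|cube_M. ?a k * cnj (\<delta> l) * (cnj (eed l x) * ?E k x))"
    by (intro sum.cong refl Bochner_Integration.integral_sum ii)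
  also have "\<dots> = (\<Sum>k\<in>K. \<Sum>l\<in>L. ?a k * cnj (\<delta> l) * defect_matrix n X \<Phi> k l)"
    unfolding defect_matrix_def fourier_def by (intro sum.cong refl integral_mult_right_zero)
  also have "\<dots> = (\<Sum>k\<in>K. \<Sum>l\<in>L. multi_coeff r k * \<gamma> k * defect_matrix n X \<Phi> k l * cnj (\<delta> l)) / of_real N"
    unfolding sum_divide_distrib by (intro sum.cong refl) simp
  finally have val: "(LINT x|cube_M. ?e x * cnj (?g x)) = (\<Sum>k\<in>K. \<Sum>l\<in>L. multi_coeff r k * \<gamma> k * defect_matrix n X \<Phi> k l * cnj (\<delta> l)) / of_real N" .
  have "ennreal (norm (LINT x|cube_M. ?e x * cnj (?g x))) \<le> (\<integral>\<^sup>+x. ennreal (norm (?e x * cnj (?g x))) \<partial>cube_M)"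
    unfolding prod by (rule integral_norm_bound_ennreal) (intro Bochner_Integration.integrable_sum ii)
  also have "\<dots> = (\<integral>\<^sup>+x. ennreal (norm (?e x) * norm (?g x)) \<partial>cube_M)" by (simp only: norm_mult complex_mod_cnj)
  also have "\<dots> \<le> Lp_norm q ?e * Lp_norm (q / (q - 1)) ?g"
    by (rule Lp_norm_Holder[OF borel_measurable_integrable[OF ei] borel_measurable_integrable[OF gi] q])
  also have "\<dots> \<le> ennreal W * ennreal D" by (intro mult_mono eW D(1)) auto
  also have "\<dots> = ennreal (W * D)" using D(2) rec by (simp add: ennreal_mult recovers_def)
  finally have "norm (LINT x|cube_M. ?e x * cnj (?g x)) \<le> W * D"
    using D(2) rec by (simp add: recovers_def)
  then have "norm (\<Sum>k\<in>K. \<Sum>l\<in>L. multi_coeff r k * \<gamma> k * defect_matrix n X \<Phi> k l * cnj (\<delta> l)) / N \<le> W * D"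
    using N(2) unfolding val by (simp add: norm_divide)
  then show ?thesis using N(2) by (simp add: divide_le_eq mult_ac)
qed

text \<open>
  A polynomial vanishing at all the nodes is its own error, so the defect matrix acts as the identity on
  its coefficients.
\<close>

lemma defect_matrix_Frobenius:
  fixes \<Phi> :: "nat \<Rightarrow> real ^ 'd \<Rightarrow> complex"
  assumes rec: "recovers r p q n X \<Phi> W" and p: "1 < p" "p < q" and r: "1 / p < r" and S: "finite S"
  shows "real (card S) - real n \<le> (\<Sum>k\<in>S. \<Sum>l\<in>S. (norm (defect_matrix n X \<Phi> k l))\<^sup>2)"
proof (rule fooling_Frobenius[OF S, where b = "\<lambda>j k. eed k (X (Suc j))"])
  fix a and l
  assume z: "\<And>j. j < n \<Longrightarrow> (\<Sum>k\<in>S. a k * eed k (X (Suc j))) = 0" and l: "l \<in> S"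
  have Ei: "integrable cube_M (\<lambda>x. a k * (cnj (eed l x) * defect n X \<Phi> k x))" for k
    by (intro integrable_mult_right integrable_eed_mult defect_integrable[OF rec p r])
  have "trigd S a (X j) = 0" if "j \<in> {1..n}" for j
    using z[of "j - 1"] that by (cases j) (simp_all add: trigd_def)
  then have "sampling_op n X \<Phi> (trigd S a) x = 0" for x
    unfolding sampling_op_def by (intro sum.neutral) simp
  then have eq: "trigd S a x = (\<Sum>k\<in>S. a k * defect n X \<Phi> k x)" for x
    using trigd_defect[of S a x n X \<Phi>] by simp
  have "(\<Sum>k\<in>S. a k * defect_matrix n X \<Phi> k l) = (\<Sum>k\<in>S. LINT x|cube_M. a k * (cnj (eed l x) * defect n X \<Phi> k x))"
    unfolding defect_matrix_def fourier_def by (intro sum.cong refl integral_mult_right_zero[symmetric])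
  also have "\<dots> = (LINT x|cube_M. (\<Sum>k\<in>S. a k * (cnj (eed l x) * defect n X \<Phi> k x)))"
    by (rule Bochner_Integration.integral_sum[symmetric]) (rule Ei)
  also have "\<dots> = (LINT x|cube_M. cnj (eed l x) * (\<Sum>k\<in>S. a k * defect n X \<Phi> k x))"
    by (simp only: sum_distrib_left mult.left_commute)
  also have "\<dots> = fourier (trigd S a) l" unfolding fourier_def eq ..
  also have "\<dots> = a l" using l by (simp add: fourier_trigd[OF S])
  finally show "(\<Sum>k\<in>S. a k * defect_matrix n X \<Phi> k l) = a l" .
qed

lemma compositions_nonempty: "compositions m \<noteq> ({} :: ('d::finite \<Rightarrow> nat) set)"
proof -
  have "(\<lambda>i. if i = undefined then m else 0) \<in> (compositions m :: ('d \<Rightarrow> nat) set)"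
    by (simp add: compositions_def)
  then show ?thesis by (rule ex_in_conv[THEN iffD1, OF exI])
qed

lemma exists_heavy_box:
  fixes h :: "('d::finite \<Rightarrow> int) \<Rightarrow> real"
  assumes "real (card (compositions m :: ('d \<Rightarrow> nat) set)) * 2 ^ m / 2 \<le> (\<Sum>k\<in>layer m. h k)"
  obtains s where "s \<in> compositions m" "2 ^ m / 2 \<le> (\<Sum>k\<in>dyadic_box s. h k)"
proof -
  have "\<exists>s\<in>compositions m. 2 ^ m / 2 \<le> (\<Sum>k\<in>dyadic_box s. h k)"
  proof (rule ccontr)
    assume "\<not> (\<exists>s\<in>compositions m. 2 ^ m / 2 \<le> (\<Sum>k\<in>dyadic_box s. h k))"
    then have less: "(\<Sum>k\<in>dyadic_box s. h k) < 2 ^ m / 2" if "s \<in> compositions m" for s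
      using that by (simp add: not_le)
    have "(\<Sum>k\<in>layer m. h k) = (\<Sum>s\<in>compositions m. \<Sum>k\<in>dyadic_box s. h k)"
      unfolding layer_def by (rule sum.UNION_disjoint) (auto dest: dyadic_box_disjoint)
    also have "\<dots> < (\<Sum>s\<in>(compositions m :: ('d \<Rightarrow> nat) set). 2 ^ m / 2)"
      by (rule sum_strict_mono[OF finite_compositions compositions_nonempty less])
    also have "\<dots> = real (card (compositions m :: ('d \<Rightarrow> nat) set)) * 2 ^ m / 2" by simp
    finally show False using assms by simp
  qed
  then show thesis using that by (elim bexE)
qed

text \<open>
  For fixed \<open>l\<close> the integral over \<open>y\<close> of the squared polynomial is the squared norm of its coefficients,
  by Parseval. The bump has coefficient 1 on the box, so the mean over \<open>y\<close> is at least the mass of the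
  box, and some \<open>y\<close> attains at least half of it.
\<close>

lemma exists_large_bump_point:
  fixes A :: "'i \<Rightarrow> ('d::finite \<Rightarrow> int) \<Rightarrow> complex"
  assumes S: "finite S" and s: "s \<in> compositions m"
    and le: "2 ^ m / 2 \<le> (\<Sum>k\<in>dyadic_box s. \<Sum>l\<in>S. (norm (A l k))\<^sup>2)"
  obtains y :: "real ^ 'd" where
    "2 ^ m / 4 \<le> (\<Sum>l\<in>S. (norm (trigd (wide_freqs m) (\<lambda>k. of_real (bump_coeff s 0 k) * A l k) y))\<^sup>2)"
proof -
  let ?B = "\<lambda>l k. of_real (bump_coeff s 0 k) * A l k"
  let ?F = "\<lambda>y :: real ^ 'd. \<Sum>l\<in>S. (norm (trigd (wide_freqs m) (?B l) y))\<^sup>2"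
  have fin: "finite (wide_freqs m :: ('d \<Rightarrow> int) set)" by simp
  have int: "integrable cube_M ?F" by (intro Bochner_Integration.integrable_sum Parseval_trigd(2) fin)
  have "(\<Sum>k\<in>dyadic_box s. \<Sum>l\<in>S. (norm (A l k))\<^sup>2) = (\<Sum>l\<in>S. \<Sum>k\<in>dyadic_box s. (norm (A l k))\<^sup>2)" by (rule sum.swap)
  also have "\<dots> = (\<Sum>l\<in>S. \<Sum>k\<in>dyadic_box s. (norm (?B l k))\<^sup>2)"
    by (intro sum.cong refl) (simp add: bump_coeff_eq_1)
  also have "\<dots> \<le> (\<Sum>l\<in>S. \<Sum>k\<in>wide_freqs m. (norm (?B l k))\<^sup>2)"
    by (intro sum_mono sum_mono2 fin dyadic_box_subset_wide_freqs s) simp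
  also have "\<dots> = (LINT y|cube_M. ?F y)"
    by (subst Bochner_Integration.integral_sum) (simp_all add: Parseval_trigd fin)
  finally have "2 ^ m / 2 \<le> (LINT y|cube_M. ?F y)" using le by linarith
  from exists_large_value[OF int this] obtain y where "2 ^ m / 2 / 2 \<le> ?F y" by auto
  then have "2 ^ m / 4 \<le> ?F y" by simp
  then show thesis by (rule that)
qed

text \<open>
  All frequencies are positive. Therefore the phases of the kernel coefficients are all the same, and
  their moduli cancel the power \<open>k powr r\<close> of the bump.
\<close>

lemma multi_coeff_bump:
  fixes k :: "'d::finite \<Rightarrow> int"
  assumes k: "k \<in> wide_freqs m"
  shows "multi_coeff r k * of_real (bump_coeff s r k) = cis (- (r * pi / 2)) ^ CARD('d) * of_real (bump_coeff s 0 k)"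
proof -
  have "kernel_coeff r (k i) * of_real (wide_coeff (s i) r (k i)) = cis (- (r * pi / 2)) * of_real (wide_coeff (s i) 0 (k i))" for i
  proof -
    have k0: "0 < k i" using k by (rule wide_freqs_pos)
    then have "(\<bar>of_int (k i)\<bar> powr (- r) :: real) * (of_int (k i)) powr r = 1"
      by (simp add: powr_add[symmetric])
    then have "complex_of_real (\<bar>of_int (k i)\<bar> powr (- r)) * complex_of_real ((of_int (k i)) powr r) = 1"
      by (simp only: of_real_mult[symmetric] of_real_1)
    then show ?thesis using k0 wide_coeff_eq[OF k0, of "s i" r]
      by (simp add: kernel_coeff_def)
  qed
  then show ?thesis
    unfolding multi_coeff_def bump_coeff_def of_real_prod prod.distrib[symmetric] by (simp add: prod.distrib)
qed

lemma norm_inverse_multi_coeff_le: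
  fixes k :: "'d::finite \<Rightarrow> int"
  assumes k: "k \<in> layer m" and r: "0 \<le> r"
  shows "norm (inverse (multi_coeff r k)) \<le> 2 powr (r * real (m + CARD('d)))"
proof -
  obtain s where s: "s \<in> compositions m" "k \<in> dyadic_box s" using k by (auto simp: layer_def)
  have "norm (inverse (multi_coeff r k)) = (\<Prod>i\<in>UNIV. inverse (norm (kernel_coeff r (k i))))"
    unfolding multi_coeff_def by (simp add: norm_inverse prod_norm[symmetric] prod_inversef[symmetric])
  also have "\<dots> \<le> (\<Prod>i\<in>UNIV. 2 powr (r * real (Suc (s i))))"
  proof (rule prod_mono, intro conjI)
    fix i
    have k: "2 ^ s i \<le> k i" "k i < 2 ^ Suc (s i)" using s(2) by (simp_all add: mem_dyadic_box)
    moreover have "(0::int) < 2 ^ s i" by simp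
    ultimately have k0: "0 < k i" by linarith
    have "real_of_int (k i) \<le> real_of_int (2 ^ Suc (s i))" using k(2) by (simp only: of_int_le_iff less_imp_le)
    also have "\<dots> = 2 powr real (Suc (s i))" by (simp add: powr_realpow[symmetric] del: power_Suc of_nat_Suc)
    finally have "real_of_int (k i) powr r \<le> (2 powr real (Suc (s i))) powr r" using k0 r by (intro powr_mono2) auto
    also have "\<dots> = 2 powr (r * real (Suc (s i)))" by (simp add: powr_powr mult.commute)
    finally show "inverse (norm (kernel_coeff r (k i))) \<le> 2 powr (r * real (Suc (s i)))"
      using k0 by (simp add: kernel_coeff_def norm_mult powr_minus norm_inverse)
  qed simp
  also have "\<dots> = 2 powr (\<Sum>i\<in>UNIV. r * real (Suc (s i)))" by (rule powr_sum[symmetric]) auto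
  also have "(\<Sum>i\<in>UNIV. r * real (Suc (s i))) = r * real (m + CARD('d))"
  proof -
    have "(\<Sum>i\<in>UNIV. Suc (s i)) = m + CARD('d)" using s(1) by (simp add: compositions_def sum_Suc)
    then show ?thesis by (simp only: sum_distrib_left[symmetric] of_nat_sum[symmetric])
  qed
  finally show ?thesis .
qed

lemma sqrt_layer_mass:
  assumes "2 ^ m / 4 \<le> G"
  shows "2 powr (real m / 2) / 2 \<le> sqrt G" "0 < sqrt G"
proof -
  have "(2 powr (real m / 2) / 2)\<^sup>2 = 2 ^ m / 4"
    by (simp add: power_divide power2_eq_square powr_add[symmetric] powr_realpow)
  then have "2 powr (real m / 2) / 2 = sqrt (2 ^ m / 4)" by (metis divide_nonneg_pos powr_ge_zero real_sqrt_unique zero_less_numeral)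
  with assms show *: "2 powr (real m / 2) / 2 \<le> sqrt G" by simp
  have "0 < (2 :: real) powr (real m / 2) / 2" by simp
  with * show "0 < sqrt G" by linarith
qed

text \<open>
  The mass of the defect matrix on the layer is at least half the number of its frequencies, so one
  dyadic box of rows (or of columns) carries at least \<open>2 ^ m / 2\<close>. Summing the rows of the box against
  the coefficients of a bump at a suitable point gives a vector \<open>c\<close> on the layer with
  \<open>\<parallel>c\<parallel>\<^sup>2 \<ge> 2 ^ m / 4\<close>, and pairing with \<open>c\<close> itself makes the left side of \<open>defect_matrix_duality\<close> equal
  to \<open>\<parallel>c\<parallel>\<^sup>2\<close>. One of the two polynomials is then a bump and the other one has coefficients of size \<open>c\<close> on the
  layer. The norm of the latter is controlled by \<open>\<parallel>c\<parallel>\<close> through the Nikolskii inequality, which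
  starts from \<open>L\<^sub>2\<close> and hence needs an exponent at least 2: for \<open>q \<le> 2\<close> this is the exponent dual to \<open>q\<close>, and the bump is
  recovered; for \<open>p \<ge> 2\<close> it is \<open>p\<close>, and the bump is the test function.
\<close>

lemma recovery_error_ge:
  fixes dummy :: "'d::finite itself"
  assumes cases: "(1 < p \<and> p < q \<and> q \<le> 2) \<or> (2 \<le> p \<and> p < q)" and r: "1 / p < r"
  obtains c where "0 < c"
    "\<And>n m W (X :: nat \<Rightarrow> real ^ 'd) \<Phi>. \<lbrakk>recovers r p q n X \<Phi> W; 2 * n \<le> card (compositions m :: ('d \<Rightarrow> nat) set) * 2 ^ m\<rbrakk>
       \<Longrightarrow> c * 2 powr (- (r - 1 / p + 1 / q) * real m) \<le> W"
proof -
  have p: "1 < p" "p < q" using cases by auto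
  have r0: "0 < r" using r p by (meson less_trans zero_less_divide_1_iff zero_less_one)
  let ?d = "CARD('d)"
  let ?q = "q / (q - 1)"
  have q': "1 / ?q = 1 - 1 / q" using p by (simp add: field_simps)
  have q1: "1 \<le> ?q" using p by (simp add: field_simps)
  have mass: "real (card (compositions m :: ('d \<Rightarrow> nat) set)) * 2 ^ m / 2
      \<le> (\<Sum>k\<in>layer m. \<Sum>l\<in>layer m. (norm (defect_matrix n X \<Phi> k l))\<^sup>2)"
    if rec: "recovers r p q n X \<Phi> W" and n: "2 * n \<le> card (compositions m :: ('d \<Rightarrow> nat) set) * 2 ^ m"
    for n m W and X :: "nat \<Rightarrow> real ^ 'd" and \<Phi>
  proof -
    have "real (2 * n) \<le> real (card (compositions m :: ('d \<Rightarrow> nat) set) * 2 ^ m)" using n by (simp only: of_nat_le_iff)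
    then have "2 * real n \<le> real (card (compositions m :: ('d \<Rightarrow> nat) set)) * 2 ^ m" by simp
    moreover have "real (card (layer m :: ('d \<Rightarrow> int) set)) = real (card (compositions m :: ('d \<Rightarrow> nat) set)) * 2 ^ m"
      by (simp add: card_layer)
    ultimately show ?thesis using defect_matrix_Frobenius[OF rec p r finite_layer, of m] by linarith
  qed
  show thesis
  proof (cases "q \<le> 2")
    case True
    have "2 \<le> ?q" using True p by (simp add: le_divide_eq)
    \<comment> \<open>The bump is recovered, and its error is tested with a polynomial on the layer.\<close>
    from Nikolskii_layer[OF this] obtain C where C: "0 < C" and
      Nik: "\<And>m K (\<gamma> :: ('d \<Rightarrow> int) \<Rightarrow> complex). K \<subseteq> layer m \<Longrightarrow>
       Lp_norm ?q (trigd K \<gamma>) \<le> ennreal (C * 2 powr ((1 / 2 - 1 / ?q) * real m)) * Lp_norm 2 (trigd K \<gamma>)"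
      by blast
    let ?A = "wide_const r ^ ?d * C"
    have A: "0 < ?A" using C wide_const_pos[of r] by simp
    have "1 / (2 * ?A) * 2 powr (- (r - 1 / p + 1 / q) * real m) \<le> W"
      if rec: "recovers r p q n X \<Phi> W" and n: "2 * n \<le> card (compositions m :: ('d \<Rightarrow> nat) set) * 2 ^ m"
      for n m W and X :: "nat \<Rightarrow> real ^ 'd" and \<Phi>
    proof -
      let ?M = "defect_matrix n X \<Phi>" and ?S = "layer m :: ('d \<Rightarrow> int) set" and ?P = "wide_freqs m :: ('d \<Rightarrow> int) set"
      obtain s where s: "s \<in> compositions m" "2 ^ m / 2 \<le> (\<Sum>k\<in>dyadic_box s. \<Sum>l\<in>?S. (norm (?M k l))\<^sup>2)"
        using exists_heavy_box[OF mass[OF rec n]] .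
      have "2 ^ m / 2 \<le> (\<Sum>k\<in>dyadic_box s. \<Sum>l\<in>?S. (norm (cnj (?M k l)))\<^sup>2)" using s(2) by simp
      from exists_large_bump_point[OF finite_layer s(1) this] obtain y :: "real ^ 'd" where
        y: "2 ^ m / 4 \<le> (\<Sum>l\<in>?S. (norm (trigd ?P (\<lambda>k. of_real (bump_coeff s 0 k) * cnj (?M k l)) y))\<^sup>2)" .
      define c where "c l = cnj (trigd ?P (\<lambda>k. of_real (bump_coeff s 0 k) * cnj (?M k l)) y)" for l
      have c: "c l = (\<Sum>k\<in>?P. of_real (bump_coeff s 0 k) * cnj (eed k y) * ?M k l)" for l
        by (simp add: c_def trigd_def mult_ac)
      let ?G = "\<Sum>l\<in>?S. (norm (c l))\<^sup>2"
      have G: "2 ^ m / 4 \<le> ?G" using y by (simp add: c_def)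
      let ?w = "cis (- (r * pi / 2)) ^ ?d"
      let ?N = "wide_const r ^ ?d * 2 powr ((r + (1 - 1 / p)) * real m)"
      let ?D = "C * 2 powr ((1 / 2 - 1 / ?q) * real m) * sqrt ?G"
      have "norm (\<Sum>k\<in>?P. \<Sum>l\<in>?S. multi_coeff r k * (of_real (bump_coeff s r k) * cnj (eed k y)) * ?M k l * cnj (c l)) \<le> W * ?N * ?D"
      proof (rule defect_matrix_duality[OF rec p r])
        show "Lp_norm p (trigd ?P (\<lambda>k. of_real (bump_coeff s r k) * cnj (eed k y)) :: real ^ 'd \<Rightarrow> complex) \<le> ennreal ?N"
          using s(1) p by (intro Lp_norm_bump) simp_all
        show "0 < ?N" using wide_const_pos[of r] by simp
        have "Lp_norm ?q (trigd ?S c :: real ^ 'd \<Rightarrow> complex) \<le> ennreal (C * 2 powr ((1 / 2 - 1 / ?q) * real m)) * ennreal (sqrt ?G)"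
          using Nik[of ?S m c] by (simp only: Parseval_trigd(3)[OF finite_layer] order_refl)
        also have "\<dots> = ennreal ?D" using C by (simp add: ennreal_mult sum_nonneg)
        finally show "Lp_norm ?q (trigd ?S c :: real ^ 'd \<Rightarrow> complex) \<le> ennreal ?D" .
        show "0 \<le> ?D" using C by (simp add: sum_nonneg)
      qed simp_all
      also have "(\<Sum>k\<in>?P. \<Sum>l\<in>?S. multi_coeff r k * (of_real (bump_coeff s r k) * cnj (eed k y)) * ?M k l * cnj (c l))
          = (\<Sum>k\<in>?P. \<Sum>l\<in>?S. ?w * ((of_real (bump_coeff s 0 k) * cnj (eed k y) * ?M k l) * cnj (c l)))"
      proof (intro sum.cong refl)
        fix k l assume "k \<in> ?P"
        then have "multi_coeff r k * of_real (bump_coeff s r k) * (cnj (eed k y) * (?M k l * cnj (c l)))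
           = (?w * of_real (bump_coeff s 0 k)) * (cnj (eed k y) * (?M k l * cnj (c l)))" by (simp only: multi_coeff_bump)
        then show "multi_coeff r k * (of_real (bump_coeff s r k) * cnj (eed k y)) * ?M k l * cnj (c l)
           = ?w * ((of_real (bump_coeff s 0 k) * cnj (eed k y) * ?M k l) * cnj (c l))" by (simp only: mult.assoc)
      qed
      also have "\<dots> = (\<Sum>l\<in>?S. \<Sum>k\<in>?P. ?w * ((of_real (bump_coeff s 0 k) * cnj (eed k y) * ?M k l) * cnj (c l)))" by (rule sum.swap)
      also have "\<dots> = ?w * (\<Sum>l\<in>?S. c l * cnj (c l))"
        unfolding c[of l for l] sum_distrib_left sum_distrib_right ..
      also have "(\<Sum>l\<in>?S. c l * cnj (c l)) = of_real ?G" by (simp only: of_real_sum complex_norm_square)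
      finally have "norm (?w * of_real ?G) \<le> W * ?N * ?D" .
      moreover have "norm (?w * of_real ?G) = sqrt ?G * sqrt ?G"
        by (simp only: norm_mult norm_power norm_cis power_one mult_1_left norm_of_real real_sqrt_mult_self)
      ultimately have "sqrt ?G * sqrt ?G \<le> (W * ?N * (C * 2 powr ((1 / 2 - 1 / ?q) * real m))) * sqrt ?G" by (simp only: mult.assoc)
      then have "sqrt ?G \<le> W * ?N * (C * 2 powr ((1 / 2 - 1 / ?q) * real m))"
        using sqrt_layer_mass(2)[OF G] by (simp only: mult_le_cancel_right_pos)
      with sqrt_layer_mass(1)[OF G] have "2 powr (real m / 2) / 2 \<le> W * ?N * (C * 2 powr ((1 / 2 - 1 / ?q) * real m))" by linarith
      also have "\<dots> = W * ?A * 2 powr ((r + (1 - 1 / p)) * real m + (1 / 2 - 1 / ?q) * real m)" by (simp add: powr_add mult_ac)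
      finally have "2 powr (real m / 2) / 2 \<le> W * ?A * 2 powr ((r + (1 - 1 / p)) * real m + (1 / 2 - 1 / ?q) * real m)" .
      then have "2 powr (real m / 2) / 2 / 2 powr ((r + (1 - 1 / p)) * real m + (1 / 2 - 1 / ?q) * real m) \<le> W * ?A"
        by (simp only: pos_divide_le_eq powr_gt_zero)
      then have "2 powr (real m / 2) / 2 powr ((r + (1 - 1 / p)) * real m + (1 / 2 - 1 / ?q) * real m) \<le> W * ?A * 2" by simp
      also have "2 powr (real m / 2) / 2 powr ((r + (1 - 1 / p)) * real m + (1 / 2 - 1 / ?q) * real m)
         = 2 powr (- (r - 1 / p + 1 / q) * real m)"
        unfolding powr_diff[symmetric] q' by (rule arg_cong[where f = "\<lambda>x. 2 powr x"]) (simp add: algebra_simps)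
      finally show ?thesis using A by (simp add: divide_le_eq mult_ac)
    qed
    then show thesis using A by (intro that[of "1 / (2 * ?A)"]) simp_all
  next
    case False
    then have p2: "2 \<le> p" using cases by auto
    \<comment> \<open>A polynomial on the layer is recovered, and its error is tested with the bump.\<close>
    from Nikolskii_layer[OF p2] obtain C where C: "0 < C" and
      Nik: "\<And>m K (\<gamma> :: ('d \<Rightarrow> int) \<Rightarrow> complex). K \<subseteq> layer m \<Longrightarrow>
       Lp_norm p (trigd K \<gamma>) \<le> ennreal (C * 2 powr ((1 / 2 - 1 / p) * real m)) * Lp_norm 2 (trigd K \<gamma>)"
      by blast
    let ?A = "wide_const 0 ^ ?d * C * 2 powr (r * real ?d)"
    have A: "0 < ?A" using C wide_const_pos[of 0] by simp
    have "1 / (2 * ?A) * 2 powr (- (r - 1 / p + 1 / q) * real m) \<le> W"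
      if rec: "recovers r p q n X \<Phi> W" and n: "2 * n \<le> card (compositions m :: ('d \<Rightarrow> nat) set) * 2 ^ m"
      for n m W and X :: "nat \<Rightarrow> real ^ 'd" and \<Phi>
    proof -
      let ?M = "defect_matrix n X \<Phi>" and ?S = "layer m :: ('d \<Rightarrow> int) set" and ?P = "wide_freqs m :: ('d \<Rightarrow> int) set"
      have "real (card (compositions m :: ('d \<Rightarrow> nat) set)) * 2 ^ m / 2 \<le> (\<Sum>l\<in>?S. \<Sum>k\<in>?S. (norm (?M k l))\<^sup>2)"
        using mass[OF rec n] by (subst sum.swap)
      from exists_heavy_box[OF this]
      obtain s where s: "s \<in> compositions m" "2 ^ m / 2 \<le> (\<Sum>l\<in>dyadic_box s. \<Sum>k\<in>?S. (norm (?M k l))\<^sup>2)" .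
      from exists_large_bump_point[OF finite_layer s] obtain y :: "real ^ 'd" where
        y: "2 ^ m / 4 \<le> (\<Sum>k\<in>?S. (norm (trigd ?P (\<lambda>l. of_real (bump_coeff s 0 l) * ?M k l) y))\<^sup>2)" .
      define c where "c k = trigd ?P (\<lambda>l. of_real (bump_coeff s 0 l) * ?M k l) y" for k
      have c: "c k = (\<Sum>l\<in>?P. ?M k l * cnj (of_real (bump_coeff s 0 l) * cnj (eed l y)))" for k
        by (simp add: c_def trigd_def mult_ac)
      let ?G = "\<Sum>k\<in>?S. (norm (c k))\<^sup>2"
      have G: "2 ^ m / 4 \<le> ?G" using y by (simp add: c_def)
      \<comment> \<open>Dividing by the coefficients of the kernel costs at most \<open>?R\<close> on the layer.\<close>
      let ?\<gamma> = "\<lambda>k. inverse (multi_coeff r k) * cnj (c k)"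
      let ?R = "2 powr (r * real (m + ?d))"
      let ?N = "C * 2 powr ((1 / 2 - 1 / p) * real m) * (?R * sqrt ?G)"
      let ?D = "wide_const 0 ^ ?d * 2 powr ((0 + (1 - 1 / ?q)) * real m)"
      have "norm (\<Sum>k\<in>?S. \<Sum>l\<in>?P. multi_coeff r k * ?\<gamma> k * ?M k l * cnj (of_real (bump_coeff s 0 l) * cnj (eed l y))) \<le> W * ?N * ?D"
      proof (rule defect_matrix_duality[OF rec p r])
        have "(\<Sum>k\<in>?S. (norm (?\<gamma> k))\<^sup>2) \<le> (\<Sum>k\<in>?S. ?R\<^sup>2 * (norm (c k))\<^sup>2)"
        proof (rule sum_mono)
          fix k assume "k \<in> ?S"
          then have "norm (inverse (multi_coeff r k)) \<le> ?R" using r0 by (intro norm_inverse_multi_coeff_le) simp_all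
          then have "norm (inverse (multi_coeff r k)) * norm (c k) \<le> ?R * norm (c k)" by (rule mult_right_mono) simp
          then have "(norm (inverse (multi_coeff r k)) * norm (c k))\<^sup>2 \<le> (?R * norm (c k))\<^sup>2" by (rule power_mono) simp
          then show "(norm (?\<gamma> k))\<^sup>2 \<le> ?R\<^sup>2 * (norm (c k))\<^sup>2" by (simp only: norm_mult complex_mod_cnj power_mult_distrib)
        qed
        then have "sqrt (\<Sum>k\<in>?S. (norm (?\<gamma> k))\<^sup>2) \<le> sqrt (?R\<^sup>2 * ?G)" unfolding sum_distrib_left by (rule real_sqrt_le_mono)
        also have "\<dots> = ?R * sqrt ?G" by (simp add: real_sqrt_mult)
        finally have \<gamma>: "Lp_norm 2 (trigd ?S ?\<gamma> :: real ^ 'd \<Rightarrow> complex) \<le> ennreal (?R * sqrt ?G)"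
          unfolding Parseval_trigd(3)[OF finite_layer] by (rule ennreal_leI)
        have "Lp_norm p (trigd ?S ?\<gamma> :: real ^ 'd \<Rightarrow> complex) \<le> ennreal (C * 2 powr ((1 / 2 - 1 / p) * real m)) * Lp_norm 2 (trigd ?S ?\<gamma> :: real ^ 'd \<Rightarrow> complex)"
          by (rule Nik) simp
        also have "\<dots> \<le> ennreal (C * 2 powr ((1 / 2 - 1 / p) * real m)) * ennreal (?R * sqrt ?G)"
          by (intro mult_left_mono \<gamma>) simp
        also have "\<dots> = ennreal ?N" using C by (simp add: ennreal_mult[symmetric] sum_nonneg)
        finally show "Lp_norm p (trigd ?S ?\<gamma> :: real ^ 'd \<Rightarrow> complex) \<le> ennreal ?N" .
        show "0 < ?N" using C sqrt_layer_mass(2)[OF G] by (intro mult_pos_pos) simp_all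
        show "Lp_norm ?q (trigd ?P (\<lambda>k. of_real (bump_coeff s 0 k) * cnj (eed k y)) :: real ^ 'd \<Rightarrow> complex) \<le> ennreal ?D"
          using s(1) q1 by (rule Lp_norm_bump)
        show "0 \<le> ?D" using wide_const_pos[of 0] by simp
      qed simp_all
      also have "(\<Sum>k\<in>?S. \<Sum>l\<in>?P. multi_coeff r k * ?\<gamma> k * ?M k l * cnj (of_real (bump_coeff s 0 l) * cnj (eed l y)))
          = (\<Sum>k\<in>?S. \<Sum>l\<in>?P. cnj (c k) * (?M k l * cnj (of_real (bump_coeff s 0 l) * cnj (eed l y))))"
      proof (intro sum.cong refl)
        fix k l
        have "multi_coeff r k * ?\<gamma> k = cnj (c k)" by (simp add: mult.assoc[symmetric])
        then show "multi_coeff r k * ?\<gamma> k * ?M k l * cnj (of_real (bump_coeff s 0 l) * cnj (eed l y))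
          = cnj (c k) * (?M k l * cnj (of_real (bump_coeff s 0 l) * cnj (eed l y)))" by (simp only: mult.assoc)
      qed
      also have "\<dots> = (\<Sum>k\<in>?S. cnj (c k) * c k)"
        unfolding c sum_distrib_left ..
      also have "\<dots> = of_real ?G" by (simp only: of_real_sum complex_norm_square mult.commute)
      finally have "norm (complex_of_real ?G) \<le> W * ?N * ?D" .
      moreover have "norm (complex_of_real ?G) = sqrt ?G * sqrt ?G"
        by (simp only: norm_of_real real_sqrt_mult_self)
      moreover have "W * ?N * ?D = (W * (C * 2 powr ((1 / 2 - 1 / p) * real m)) * ?R * ?D) * sqrt ?G" by (simp only: mult_ac)
      ultimately have "sqrt ?G * sqrt ?G \<le> (W * (C * 2 powr ((1 / 2 - 1 / p) * real m)) * ?R * ?D) * sqrt ?G" by (simp only:)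
      then have "sqrt ?G \<le> W * (C * 2 powr ((1 / 2 - 1 / p) * real m)) * ?R * ?D"
        using sqrt_layer_mass(2)[OF G] by (simp only: mult_le_cancel_right_pos)
      with sqrt_layer_mass(1)[OF G] have "2 powr (real m / 2) / 2 \<le> W * (C * 2 powr ((1 / 2 - 1 / p) * real m)) * ?R * ?D" by linarith
      also have "\<dots> = W * ?A * 2 powr ((1 / 2 - 1 / p) * real m + r * real m + (1 - 1 / ?q) * real m)"
        by (simp add: powr_add mult_ac distrib_left)
      finally have "2 powr (real m / 2) / 2 \<le> W * ?A * 2 powr ((1 / 2 - 1 / p) * real m + r * real m + (1 - 1 / ?q) * real m)" .
      then have "2 powr (real m / 2) / 2 / 2 powr ((1 / 2 - 1 / p) * real m + r * real m + (1 - 1 / ?q) * real m) \<le> W * ?A"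
        by (simp only: pos_divide_le_eq powr_gt_zero)
      then have "2 powr (real m / 2) / 2 powr ((1 / 2 - 1 / p) * real m + r * real m + (1 - 1 / ?q) * real m) \<le> W * ?A * 2" by simp
      also have "2 powr (real m / 2) / 2 powr ((1 / 2 - 1 / p) * real m + r * real m + (1 - 1 / ?q) * real m)
         = 2 powr (- (r - 1 / p + 1 / q) * real m)"
        unfolding powr_diff[symmetric] q' by (rule arg_cong[where f = "\<lambda>x. 2 powr x"]) (simp add: algebra_simps)
      finally show ?thesis using A by (simp add: divide_le_eq mult_ac)
    qed
    then show thesis using A by (intro that[of "1 / (2 * ?A)"]) simp_all
  qed
qed

section \<open>The order of the sampling width\<close>

text \<open>
  All components but one can be chosen freely up to \<open>m div d\<close>; the last one makes up for the rest.
\<close>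

lemma card_compositions_ge:
  "(real (m + 1) / real CARD('d::finite)) ^ (CARD('d) - 1) \<le> real (card (compositions m :: ('d \<Rightarrow> nat) set))"
proof -
  let ?d = "CARD('d)"
  define i0 :: 'd where "i0 = undefined"
  let ?I = "UNIV - {i0} :: 'd set"
  have d: "0 < ?d" by simp
  have cI: "card ?I = ?d - 1" by (simp add: card_Diff_singleton)
  let ?A = "Pi\<^sub>E ?I (\<lambda>_. {..m div ?d})"
  let ?f = "\<lambda>g i. if i = i0 then m - sum g ?I else g i :: nat"
  have split: "sum s UNIV = s i0 + sum s ?I" for s :: "'d \<Rightarrow> nat"
    by (rule sum.remove) simp_all
  have sub: "?f ` ?A \<subseteq> compositions m"
  proof
    fix s assume "s \<in> ?f ` ?A"
    then obtain g where g: "g \<in> ?A" "s = ?f g" by (rule imageE)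
    have "sum g ?I \<le> (\<Sum>i\<in>?I. m div ?d)" using g(1) by (intro sum_mono) (auto simp: PiE_iff)
    also have "\<dots> \<le> ?d * (m div ?d)" unfolding sum_constant cI by (intro mult_mono) simp_all
    also have "\<dots> \<le> m" by simp
    finally have le: "sum g ?I \<le> m" .
    have "sum s ?I = sum g ?I" unfolding g(2) by (intro sum.cong refl) simp
    then have "sum s UNIV = (m - sum g ?I) + sum g ?I" unfolding split[of s] by (simp add: g(2))
    with le show "s \<in> compositions m" by (simp add: compositions_def)
  qed
  have inj: "inj_on ?f ?A"
  proof (rule inj_onI)
    fix g h assume gh: "g \<in> ?A" "h \<in> ?A" and eq: "?f g = ?f h"
    have "g i = h i" if "i \<in> ?I" for i using fun_cong[OF eq, of i] that by simp
    then show "g = h" by (rule PiE_ext[OF gh])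
  qed
  have "m + 1 \<le> ?d * (m div ?d + 1)"
  proof -
    have "m mod ?d < ?d" using d by (rule mod_less_divisor)
    moreover have "m = ?d * (m div ?d) + m mod ?d" by simp
    ultimately show ?thesis by (simp only: distrib_left mult_1_right)
  qed
  then have "real (m + 1) \<le> real (?d * (m div ?d + 1))" by (simp only: of_nat_le_iff)
  then have "real (m + 1) / real ?d \<le> real (m div ?d + 1)"
    using d by (simp only: pos_divide_le_eq of_nat_0_less_iff of_nat_mult mult.commute)
  then have "(real (m + 1) / real ?d) ^ (?d - 1) \<le> real (m div ?d + 1) ^ (?d - 1)"
    by (rule power_mono) simp
  also have "\<dots> = real (card ?A)" by (simp add: card_PiE cI)
  also have "card ?A = card (?f ` ?A)" by (rule card_image[OF inj, symmetric])
  also have "real (card (?f ` ?A)) \<le> real (card (compositions m :: ('d \<Rightarrow> nat) set))"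
    by (simp only: of_nat_le_iff) (rule card_mono[OF finite_compositions sub])
  finally show ?thesis .
qed

lemma ln_2_ge_half: "1 / 2 \<le> ln (2 :: real)"
proof -
  have "exp (1 / 2 :: real) \<le> 2"
  proof -
    have "exp (1 / 2 :: real) ^ 2 = exp 1" by (simp add: exp_double[symmetric])
    also have "\<dots> \<le> 2 ^ 2" using exp_le by (simp add: power2_eq_square)
    finally show ?thesis by (rule power2_le_imp_le) simp
  qed
  then show ?thesis by (subst ln_ge_iff) simp_all
qed

text \<open>
  The level is increased until the bound of \<open>card_sparse_grid\<close> for the next level exceeds \<open>n\<close>. The logarithm comes from \<open>2 ^ m \<le> n\<close>, that is \<open>m \<le> 2 * ln n\<close>.
\<close>

lemma sparse_grid_budget:
  assumes n: "2 \<le> n"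
  obtains m where "card (sparse_grid m :: (real ^ 'd) set) \<le> n"
    "2 powr (- real m) \<le> 2 * 4 ^ CARD('d) * 4 ^ (CARD('d) - 1) * (ln (real n) ^ (CARD('d) - 1) / real n)"
proof -
  let ?d = "CARD('d)" and ?e = "CARD('d) - 1"
  define Q where "Q m = 4 ^ ?d * (m ^ ?e * 2 ^ m)" for m :: nat
  have Q_ge: "2 ^ m \<le> Q m" if "1 \<le> m" for m
  proof -
    have "1 * (1 * 2 ^ m) \<le> 4 ^ ?d * (m ^ ?e * 2 ^ m)" using that by (intro mult_mono) simp_all
    then show ?thesis by (simp add: Q_def)
  qed
  have ex: "\<exists>m. n < Q (Suc m)"
  proof
    have "n < 2 ^ n" by (rule less_exp)
    also have "(2::nat) ^ n \<le> 2 ^ Suc n" by (intro power_increasing) simp_all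
    also have "\<dots> \<le> Q (Suc n)" by (rule Q_ge) simp
    finally show "n < Q (Suc n)" .
  qed
  define m where "m = (LEAST m. n < Q (Suc m))"
  have up: "n < Q (Suc m)" unfolding m_def by (rule LeastI_ex[OF ex])
  have ln2: "1 / 2 \<le> ln (real n)"
  proof -
    have "ln 2 \<le> ln (real n)" using n by simp
    with ln_2_ge_half show ?thesis by linarith
  qed
  have main: "card (sparse_grid m :: (real ^ 'd) set) \<le> n \<and> real (Suc m) \<le> 4 * ln (real n)"
  proof (cases m)
    \<comment> \<open>At level 0 the grid is empty, so the budget is respected although the estimate \<open>Q 0\<close> may exceed it.\<close>
    case 0
    have "sparse_grid 0 = ({} :: (real ^ 'd) set)" by (simp add: sparse_grid_def below_level_def)
    with 0 ln2 show ?thesis by simp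
  next
    case (Suc l)
    have "\<not> n < Q (Suc l)" using not_less_Least[of l "\<lambda>m. n < Q (Suc m)"] Suc unfolding m_def[symmetric] by simp
    then have le: "Q m \<le> n" using Suc by simp
    have "card (sparse_grid m :: (real ^ 'd) set) \<le> Q m" unfolding Q_def by (rule card_sparse_grid)
    with le have card: "card (sparse_grid m :: (real ^ 'd) set) \<le> n" by linarith
    have "2 ^ m \<le> n" using Q_ge[of m] le Suc by simp
    then have "real (2 ^ m) \<le> real n" by (simp only: of_nat_le_iff)
    then have "ln (real (2 ^ m)) \<le> ln (real n)" using n by (subst ln_le_cancel_iff) simp_all
    then have "real m * ln 2 \<le> ln (real n)" by (simp add: ln_realpow)
    moreover have "real m * (1 / 2) \<le> real m * ln 2" by (intro mult_left_mono ln_2_ge_half) simp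
    ultimately have "real m \<le> 2 * ln (real n)" by linarith
    moreover have "real (Suc m) \<le> 2 * real m" using Suc by simp
    ultimately show ?thesis using card by linarith
  qed
  have n0: "0 < real n" using n by simp
  have "real n < real (Q (Suc m))" using up by (simp only: of_nat_less_iff)
  also have "real (Q (Suc m)) = 4 ^ ?d * (real (Suc m) ^ ?e * (2 * 2 ^ m))" by (simp add: Q_def)
  also have "\<dots> \<le> 4 ^ ?d * ((4 * ln (real n)) ^ ?e * (2 * 2 ^ m))"
    using main by (intro mult_left_mono mult_right_mono power_mono) simp_all
  finally have "real n \<le> (2 * 4 ^ ?d * 4 ^ ?e * ln (real n) ^ ?e) * 2 ^ m" by (simp add: power_mult_distrib mult_ac)
  then have "1 / 2 ^ m \<le> 2 * 4 ^ ?d * 4 ^ ?e * ln (real n) ^ ?e / real n"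
    using n0 by (simp add: field_simps)
  then have "2 powr (- real m) \<le> 2 * 4 ^ ?d * 4 ^ ?e * (ln (real n) ^ ?e / real n)"
    by (simp add: powr_minus powr_realpow divide_inverse mult.assoc)
  with main show thesis by (intro that) simp_all
qed

text \<open>
  The smallest layer with at least \<open>2 * n\<close> frequencies is taken; the preceding layer has fewer. Its
  number of boxes is at least \<open>(ln n / d\<^sup>2) ^ (d - 1)\<close>, because \<open>2 * n\<close> frequencies do not fit into layers
  with \<open>m * d < ln n\<close>.
\<close>

lemma layer_budget:
  assumes n: "2 \<le> n"
  obtains m where "2 * n \<le> card (compositions m :: ('d::finite \<Rightarrow> nat) set) * 2 ^ m"
    "1 / (4 * (real CARD('d))\<^sup>2 ^ (CARD('d) - 1)) * (ln (real n) ^ (CARD('d) - 1) / real n) \<le> 2 powr (- real m)"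
proof -
  let ?d = "CARD('d)" and ?e = "CARD('d) - 1"
  let ?c = "\<lambda>m. card (compositions m :: ('d \<Rightarrow> nat) set)"
  have c1: "1 \<le> ?c m" for m
    using compositions_nonempty[where 'd = 'd, of m] by (simp add: Suc_le_eq card_gt_0_iff)
  have ex: "\<exists>m. 2 * n \<le> ?c m * 2 ^ m"
  proof
    have "2 * n \<le> 2 ^ (2 * n)" by (rule less_imp_le[OF less_exp])
    also have "\<dots> = 1 * 2 ^ (2 * n)" by simp
    also have "\<dots> \<le> ?c (2 * n) * 2 ^ (2 * n)" by (intro mult_right_mono c1) simp
    finally show "2 * n \<le> ?c (2 * n) * 2 ^ (2 * n)" .
  qed
  define m where "m = (LEAST m. 2 * n \<le> ?c m * 2 ^ m)"
  have up: "2 * n \<le> ?c m * 2 ^ m" unfolding m_def by (rule LeastI_ex[OF ex])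
  have "m \<noteq> 0"
  proof
    assume "m = 0"
    with up n card_compositions_le[where 'd = 'd, of 0] show False by simp
  qed
  then obtain l where l: "m = Suc l" by (cases m) simp_all
  have "\<not> 2 * n \<le> ?c l * 2 ^ l"
    using not_less_Least[of l "\<lambda>m. 2 * n \<le> ?c m * 2 ^ m"] l unfolding m_def[symmetric] by simp
  then have low: "?c l * 2 ^ m < 4 * n" using l by simp
  have n0: "0 < real n" using n by simp
  have lnm: "ln (real n) \<le> real m * real ?d"
  proof -
    have "n \<le> 2 * n" by simp
    also note up
    \<comment> \<open>A crude count suffices, since only the logarithm is used.\<close>
    also have "?c m * 2 ^ m \<le> (2 ^ m) ^ ?e * 2 ^ m"
    proof (rule mult_right_mono)
      have "m + 1 \<le> 2 ^ m" using less_exp[of m] by (simp only: Suc_eq_plus1[symmetric] Suc_leI)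
      then have "(m + 1) ^ ?e \<le> (2 ^ m) ^ ?e" by (rule power_mono) simp
      then show "?c m \<le> (2 ^ m) ^ ?e" using card_compositions_le[where 'd = 'd, of m] by linarith
    qed simp
    also have "\<dots> = (2 ^ m) ^ ?d" by (metis Suc_diff_1 power_Suc2 zero_less_card_finite)
    also have "\<dots> = 2 ^ (m * ?d)" by (rule power_mult[symmetric])
    finally have "real n \<le> real (2 ^ (m * ?d))" by (simp only: of_nat_le_iff)
    then have "ln (real n) \<le> ln (real (2 ^ (m * ?d)))" using n0 by (subst ln_le_cancel_iff) simp_all
    also have "\<dots> = real (m * ?d) * ln 2" by (simp add: ln_realpow)
    also have "\<dots> \<le> real (m * ?d) * 1" by (intro mult_left_mono) (simp_all add: ln_2_less_1 less_imp_le)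
    finally show ?thesis by simp
  qed
  have d0: "0 < real ?d" by simp
  have "(ln (real n) / (real ?d)\<^sup>2) ^ ?e \<le> (real m / real ?d) ^ ?e"
  proof (rule power_mono)
    have "ln (real n) / (real ?d)\<^sup>2 \<le> real m * real ?d / (real ?d)\<^sup>2" by (rule divide_right_mono[OF lnm]) simp
    then show "ln (real n) / (real ?d)\<^sup>2 \<le> real m / real ?d" by (simp add: power2_eq_square)
    show "0 \<le> ln (real n) / (real ?d)\<^sup>2" using n by simp
  qed
  also have "\<dots> \<le> real (?c l)" using card_compositions_ge[where 'd = 'd, of l] l by simp
  finally have cl: "(ln (real n) / (real ?d)\<^sup>2) ^ ?e \<le> real (?c l)" .
  have "real (?c l * 2 ^ m) \<le> real (4 * n)" using low by (simp only: of_nat_le_iff less_imp_le)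
  then have "real (?c l) * 2 ^ m \<le> 4 * real n" by simp
  moreover have "(ln (real n) / (real ?d)\<^sup>2) ^ ?e * 2 ^ m \<le> real (?c l) * 2 ^ m" using cl by (rule mult_right_mono) simp
  ultimately have "(ln (real n) / (real ?d)\<^sup>2) ^ ?e * 2 ^ m \<le> 4 * real n" by linarith
  then have "(ln (real n) / (real ?d)\<^sup>2) ^ ?e / (4 * real n) \<le> 1 / 2 ^ m" using n0 by (simp add: field_simps)
  moreover have "(ln (real n) / (real ?d)\<^sup>2) ^ ?e / (4 * real n) = 1 / (4 * (real ?d)\<^sup>2 ^ ?e) * (ln (real n) ^ ?e / real n)"
    unfolding power_divide by simp
  moreover have "1 / 2 ^ m = 2 powr (- real m)" by (simp add: powr_minus powr_realpow divide_inverse)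
  ultimately have "1 / (4 * (real ?d)\<^sup>2 ^ ?e) * (ln (real n) ^ ?e / real n) \<le> 2 powr (- real m)"
    by (simp only:)
  with up show thesis by (rule that)
qed

text \<open>
  An operator whose supremum is infinite satisfies every lower bound; for the others the supremum is a
  real number \<open>W\<close>.
\<close>

lemma sampling_width_ge:
  assumes le: "\<And>(X :: nat \<Rightarrow> real ^ 'd::finite) \<Phi> W. recovers r p q n X \<Phi> W \<Longrightarrow> B \<le> W"
  shows "ennreal B \<le> sampling_width n (sobolev_ball r p :: (real ^ 'd \<Rightarrow> complex) set) q"
proof -
  have "ennreal B \<le> (SUP f\<in>sobolev_ball r p. Lp_norm q (\<lambda>t. f t - sampling_op n X \<Phi> f t))" (is "_ \<le> ?S")
    if \<Phi>: "\<forall>j\<in>{1..n}. \<Phi> j \<in> torus_measurable" for X :: "nat \<Rightarrow> real ^ 'd" and \<Phi>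
  proof (cases "?S = \<infinity>")
    case False
    then obtain W where W: "?S = ennreal W" "0 \<le> W" by (cases ?S) auto
    have "Lp_norm q (\<lambda>t. f t - sampling_op n X \<Phi> f t) \<le> ennreal W" if "f \<in> sobolev_ball r p" for f
      unfolding W(1)[symmetric] using that by (rule SUP_upper)
    with \<Phi> W(2) have "recovers r p q n X \<Phi> W" by (simp add: recovers_def)
    then have "B \<le> W" by (rule le)
    then show ?thesis unfolding W(1) by (rule ennreal_leI)
  next
    case True
    then show ?thesis by (simp only: infinity_ennreal_def top_greatest)
  qed
  then show ?thesis unfolding sampling_width_def by (intro INF_greatest) (simp add: split_paired_all)
qed

theorem corollary4p4:
  fixes p q r :: real
  assumes "(1 < p \<and> p < q \<and> q \<le> 2) \<or> (2 \<le> p \<and> p < q)"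
    and "r > max (1 / p) (1 / 2)"
  shows "\<exists>C C'. 0 < C \<and> 0 < C' \<and>
    (\<forall>n::nat. n \<ge> 2 \<longrightarrow>
      (let rate = (ln (real n) ^ (CARD('d::finite) - 1) / real n) powr (r - 1 / p + 1 / q);
           width = sampling_width n (sobolev_ball r p :: (real ^ 'd \<Rightarrow> complex) set) q
       in ennreal (C * rate) \<le> width \<and> width \<le> ennreal (C' * rate)))"
proof -
  have p: "1 < p" "p < q" using assms(1) by auto
  have r: "1 / p < r" using assms(2) by simp
  let ?\<beta> = "r - 1 / p + 1 / q"
  have \<beta>: "0 < ?\<beta>" using r p by (simp add: add_pos_pos)
  let ?x = "\<lambda>n::nat. ln (real n) ^ (CARD('d) - 1) / real n"
  have x0: "0 \<le> ?x n" if "2 \<le> n" for n using that by simp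
  have pw: "2 powr (- ?\<beta> * real m) = (2 powr (- real m)) powr ?\<beta>" for m :: nat
    unfolding powr_powr by (rule arg_cong[where f = "\<lambda>x. 2 powr x"]) (simp only: mult_minus_left mult.commute)
  obtain C where C: "0 < C" and upper: "\<And>m (f :: real ^ 'd \<Rightarrow> complex). f \<in> sobolev_ball r p \<Longrightarrow>
      Lp_norm q (\<lambda>x. f x - smolyak m f x) \<le> ennreal (C * 2 powr (- ?\<beta> * real m))"
    by (rule smolyak_error[OF p r, where 'd = 'd]) (rule that)
  obtain c where c: "0 < c" and lower: "\<And>n m W (X :: nat \<Rightarrow> real ^ 'd) \<Phi>.
      \<lbrakk>recovers r p q n X \<Phi> W; 2 * n \<le> card (compositions m :: ('d \<Rightarrow> nat) set) * 2 ^ m\<rbrakk>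
       \<Longrightarrow> c * 2 powr (- ?\<beta> * real m) \<le> W"
    by (rule recovery_error_ge[OF assms(1) r, where 'd = 'd]) (rule that)
  let ?K = "2 * 4 ^ CARD('d) * 4 ^ (CARD('d) - 1) :: real"
  let ?k = "1 / (4 * (real CARD('d))\<^sup>2 ^ (CARD('d) - 1))"
  have k0: "0 < ?k" by simp
  show ?thesis unfolding Let_def
  proof (intro exI conjI allI impI)
    show "0 < c * ?k powr ?\<beta>" using c k0 by (intro mult_pos_pos) simp_all
    show "0 < C * ?K powr ?\<beta>" using C by (intro mult_pos_pos) simp_all
    fix n :: nat assume n: "2 \<le> n"
    let ?width = "sampling_width n (sobolev_ball r p :: (real ^ 'd \<Rightarrow> complex) set) q"
    show "ennreal (c * ?k powr ?\<beta> * ?x n powr ?\<beta>) \<le> ?width"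
    proof (rule sampling_width_ge)
      fix X :: "nat \<Rightarrow> real ^ 'd" and \<Phi> W assume rec: "recovers r p q n X \<Phi> W"
      obtain m where m: "2 * n \<le> card (compositions m :: ('d \<Rightarrow> nat) set) * 2 ^ m" "?k * ?x n \<le> 2 powr (- real m)"
        using layer_budget[OF n, where 'd = 'd] .
      have "c * ?k powr ?\<beta> * ?x n powr ?\<beta> = c * (?k * ?x n) powr ?\<beta>"
        using x0[OF n] k0 by (simp only: powr_mult less_imp_le mult.assoc)
      also have "\<dots> \<le> c * 2 powr (- ?\<beta> * real m)"
        unfolding pw using c \<beta> x0[OF n] k0 m(2) by (intro mult_left_mono powr_mono2 mult_nonneg_nonneg) (simp_all only: less_imp_le)
      also have "\<dots> \<le> W" by (rule lower[OF rec m(1)])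
      finally show "c * ?k powr ?\<beta> * ?x n powr ?\<beta> \<le> W" .
    qed
    obtain m where m: "card (sparse_grid m :: (real ^ 'd) set) \<le> n" "2 powr (- real m) \<le> ?K * ?x n"
      using sparse_grid_budget[OF n, where 'd = 'd] .
    have "?width \<le> ennreal (C * 2 powr (- ?\<beta> * real m))"
      by (rule sampling_width_le_smolyak[OF m(1) upper])
    also have "\<dots> \<le> ennreal (C * ?K powr ?\<beta> * ?x n powr ?\<beta>)"
    proof (rule ennreal_leI)
      have "C * 2 powr (- ?\<beta> * real m) \<le> C * (?K * ?x n) powr ?\<beta>"
        unfolding pw using C \<beta> m(2) by (intro mult_left_mono powr_mono2) simp_all
      also have "\<dots> = C * ?K powr ?\<beta> * ?x n powr ?\<beta>"
      proof -
        have "0 \<le> ?K" by simp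
        then show ?thesis using x0[OF n] by (simp only: powr_mult mult.assoc)
      qed
      finally show "C * 2 powr (- ?\<beta> * real m) \<le> C * ?K powr ?\<beta> * ?x n powr ?\<beta>" .
    qed
    finally show "?width \<le> ennreal (C * ?K powr ?\<beta> * ?x n powr ?\<beta>)" .
  qed
qed

end
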